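(* Let $\mathcal{P}$ be an unshaded subfactor planar algebra of index $4$ with principal graph $\tilde{A}_\infty$. Then one of the following two cases holds. (1) (Arrow case) $\mathcal{P}$ has an element $P_1\in\mathcal P_1$ satisfying the arrow relations (i)–(iv) listed in the context. Further, with $Q_1=\overline{P}_1$, the principal graph with its equivalence classes of minimal projections is the two-sided infinite path $$\cdots - Q_1^{\otimes 3} - Q_1^{\otimes 2} - Q_1 - \emptyset - P_1 - P_1^{\otimes 2} - P_1^{\otimes 3} - \cdots.$$ (2) (Color case) $\mathcal{P}$ has elements $P_1,Q_1\in\mathcal P_1$ satisfying the color relations (i)–(iv) listed in the context. Further, writing $P_k=P_1\otimes Q_1\otimes P_1\otimes\cdots$ and $Q_k=Q_1\otimes P_1\otimes Q_1\otimes\cdots$ ($k$ alternating factors each), the principal graph with its equivalence classes of minimal projections is the two-sided infinite path $$\cdots - Q_3 - Q_2 - Q_1 - \emptyset - P_1 - P_2 - P_3 - \cdots.$$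
   Context: Unshaded planar algebras. An unshaded planar algebra is the notion obtained from Jones' planar algebras by dropping the shading: a family of complex vector spaces with a compatible action of unshaded planar tangles (outer box, inner boxes, non-crossing strands, a star at each box; isotopy invariant, compatible with composition of tangles). $\mathcal P_k$ is the space of elements drawn as boxes with $k$ strands on top and $k$ on the bottom and star on the left. $fg$ is $f$ stacked on top of $g$; $\otimes$ is horizontal juxtaposition; $\overline{T}$ is rotation by $\pi$; $\mathrm{tr}=\mathrm{tr}^R$ (resp. $\mathrm{tr}^L$) closes all strands up to the right (resp. left); $\emptyset\in\mathcal P_0$ is the empty diagram; $X\in\mathcal P_1$ is the vertical strand. Unshaded subfactor planar algebra: (1) $\dim\mathcal P_0=1$ (closed diagrams are scalars, $\emptyset=1$); (2) $\mathrm{tr}^L=\mathrm{tr}^R$ on $\mathcal P_1$; (3) there is an antilinear adjoint $*$ on each box space, compatible with reflection of tangles over a horizontal line, such that $\langle f,g\rangle=\mathrm{tr}(f^*g)$ is positive definite. A closed loop is a scalar $\delta>0$; the index is $\delta^2$ (so index $4$ means $\delta=2$). Principal graph. A projection is $p$ with $p=p^2=p^*$. $\mathrm{Hom}(p,q)$ is the space of diagrams $f$ with bottom boundary that of $p$, top boundary that of $q$ and $qfp=f$ (numbers of bottom and top points may differ, identified with box space elements by bending strands). $p$ is minimal if $\dim\mathrm{Hom}(p,p)=1$; $p\cong q$ if there is $f\in\mathrm{Hom}(p,q)$ with $f^*f=p$, $ff^*=q$. The principal graph has as vertices the isomorphism classes of minimal projections in the $\mathcal P_k$, $k\ge0$,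 with $\dim\mathrm{Hom}(p\otimes X,q)$ edges between $p$ and $q$. $\tilde A_\infty$ is the two-sided infinite path. Arrow relations (i)–(iv). Put $Q_1=\overline{P}_1$. A strand oriented upward denotes $P_1$ and oriented downward denotes $Q_1$ (oriented strands up to isotopy). (i) (bubble) closed loops of either orientation equal $1$; (ii) $X=P_1+Q_1$; (iii) $P_1Q_1=0$ and $Q_1P_1=0$; (iv) (saddle) the element of $\mathcal P_2$ consisting of an oriented arc joining the two top points and an oriented arc joining the two bottom points, with orientations at the four boundary points equal to those of $P_1\otimes Q_1$ (resp. $Q_1\otimes P_1$), equals $P_1\otimes Q_1$ (resp. $Q_1\otimes P_1$). Color relations (i)–(iv). Here $\overline{P}_1=P_1$, $\overline{Q}_1=Q_1$; a red strand denotes $P_1$ and a blue strand denotes $Q_1$ (up to isotopy). (i) (bubble) red and blue closed loops equal $1$; (ii) $X=P_1+Q_1$; (iii) $P_1Q_1=Q_1P_1=0$; (iv) (saddle) the element of $\mathcal P_2$ consisting of a red (resp. blue) arc joining the two top points and a red (resp. blue) arc joining the two bottom points equals $P_1\otimes P_1$ (resp. $Q_1\otimes Q_1$). *)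

theory Defs
  imports "HOL-Analysis.Analysis"
begin

section \<open>Unshaded planar tangles\<close>

text \<open>
  Tangles live in the plane \<^typ>\<open>complex\<close>.  A box is a closed topological disc together with a
  marked point (the star) on its boundary; the marked point only matters through the boundary
  interval containing it, since an isotopy may move it inside that interval.  The inner boxes of a
  tangle form a finite set, and they are labelled by functions on boxes, so that no ordering of the
  inner boxes has to be chosen.
\<close>

datatype disc = Disc (region: "complex set") (star: complex)

datatype tangle = Tangle (outer: disc) (inner: "disc set") (strings: "complex set")

definition is_disc :: "disc \<Rightarrow> bool" where
  "is_disc B \<longleftrightarrow> region B homeomorphic cball (0::complex) 1 \<and> star B \<in> frontier (region B)"

definition boxes :: "tangle \<Rightarrow> disc set" where
  "boxes T = insert (outer T) (inner T)"

text \<open>The open region of the plane inside the outer box and outside all inner boxes.\<close>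

definition exterior_region :: "tangle \<Rightarrow> complex set" where
  "exterior_region T = interior (region (outer T)) - (\<Union>B\<in>inner T. region B)"

definition closed_strand :: "tangle \<Rightarrow> complex set \<Rightarrow> bool" where
  "closed_strand T c \<longleftrightarrow>
     (\<exists>g. simple_path g \<and> pathfinish g = pathstart g \<and> c = path_image g \<and> c \<subseteq> exterior_region T)"

definition open_strand :: "tangle \<Rightarrow> complex set \<Rightarrow> bool" where
  "open_strand T c \<longleftrightarrow>
     (\<exists>g. arc g \<and> c = path_image g \<and>
          {pathstart g, pathfinish g} \<subseteq> (\<Union>B\<in>boxes T. frontier (region B)) \<and>
          c - {pathstart g, pathfinish g} \<subseteq> exterior_region T)"

definition boundary_points :: "tangle \<Rightarrow> disc \<Rightarrow> complex set" where
  "boundary_points T B = strings T \<inter> frontier (region B)"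

text \<open>A box with \<open>2 * k\<close> boundary points is to be labelled by an element of the \<open>k\<close>-th box space.\<close>

definition box_index :: "tangle \<Rightarrow> disc \<Rightarrow> nat" where
  "box_index T B = card (boundary_points T B) div 2"

definition planar_tangle :: "tangle \<Rightarrow> bool" where
  "planar_tangle T \<longleftrightarrow>
     is_disc (outer T) \<and> finite (inner T) \<and>
     (\<forall>B\<in>inner T. is_disc B \<and> region B \<subseteq> interior (region (outer T))) \<and>
     (\<forall>B\<in>inner T. \<forall>B'\<in>inner T. B \<noteq> B' \<longrightarrow> region B \<inter> region B' = {}) \<and>
     (\<exists>C. finite C \<and> pairwise disjnt C \<and> strings T = \<Union>C \<and>
          (\<forall>c\<in>C. closed_strand T c \<or> open_strand T c)) \<and>
     (\<forall>B\<in>boxes T. star B \<notin> strings T \<and> even (card (boundary_points T B)))"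

definition disc_image :: "(complex \<Rightarrow> complex) \<Rightarrow> disc \<Rightarrow> disc" where
  "disc_image h B = Disc (h ` region B) (h (star B))"

definition tangle_image :: "(complex \<Rightarrow> complex) \<Rightarrow> tangle \<Rightarrow> tangle" where
  "tangle_image h T = Tangle (disc_image h (outer T)) (disc_image h ` inner T) (h ` strings T)"

definition ambient_isotopy :: "(real \<Rightarrow> complex \<Rightarrow> complex) \<Rightarrow> bool" where
  "ambient_isotopy h \<longleftrightarrow>
     continuous_on ({0..1} \<times> UNIV) (\<lambda>(t, z). h t z) \<and>
     (\<forall>t\<in>{0..1}. \<exists>g. homeomorphism UNIV UNIV (h t) g) \<and>
     (\<forall>z. h 0 z = z)"

text \<open>\<open>U\<close> can be glued into the inner box \<open>B\<close> of \<open>T\<close> if its outer box is \<open>B\<close> (with the same star) and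
  the boundary points match.\<close>

definition composable :: "tangle \<Rightarrow> disc \<Rightarrow> tangle \<Rightarrow> bool" where
  "composable T B U \<longleftrightarrow>
     planar_tangle T \<and> planar_tangle U \<and> B \<in> inner T \<and> outer U = B \<and>
     boundary_points T B = boundary_points U B"

definition compose_tangle :: "tangle \<Rightarrow> disc \<Rightarrow> tangle \<Rightarrow> tangle" where
  "compose_tangle T B U =
     Tangle (outer T) ((inner T - {B}) \<union> inner U) (strings T \<union> strings U)"


section \<open>The standard tangles\<close>

definition rect :: "real \<Rightarrow> real \<Rightarrow> real \<Rightarrow> real \<Rightarrow> complex set" where
  "rect a b c d = cbox (Complex a c) (Complex b d)"

text \<open>Rectangular boxes \<open>[a,b] \<times> [c,d]\<close> with the star on the left, respectively on the right.\<close>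

definition lbox :: "real \<Rightarrow> real \<Rightarrow> real \<Rightarrow> real \<Rightarrow> disc" where
  "lbox a b c d = Disc (rect a b c d) (Complex a ((c + d) / 2))"

definition rbox :: "real \<Rightarrow> real \<Rightarrow> real \<Rightarrow> real \<Rightarrow> disc" where
  "rbox a b c d = Disc (rect a b c d) (Complex b ((c + d) / 2))"

definition vline :: "real \<Rightarrow> real \<Rightarrow> real \<Rightarrow> complex set" where
  "vline x c d = closed_segment (Complex x c) (Complex x d)"

definition hline :: "real \<Rightarrow> real \<Rightarrow> real \<Rightarrow> complex set" where
  "hline a b y = closed_segment (Complex a y) (Complex b y)"

text \<open>\<open>k\<close> vertical strands, without inner box.\<close>

definition strands_tangle :: "nat \<Rightarrow> tangle" where
  "strands_tangle k = Tangle (lbox 0 (real k + 1) 0 1) {} (\<Union>i\<in>{1..k}. vline (real i) 0 1)"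

text \<open>A closed loop.\<close>

definition loop_tangle :: tangle where
  "loop_tangle = Tangle (lbox (-2) 2 (-2) 2) {} (sphere 0 1)"

text \<open>One inner box, whose \<open>k\<close> top and \<open>k\<close> bottom points are joined vertically to the outer box.
  With the star of the inner box on the left this is the identity tangle, with the star on the
  right it is the rotation by \<open>\<pi>\<close>.\<close>

definition cable_tangle :: "nat \<Rightarrow> disc \<Rightarrow> tangle" where
  "cable_tangle k B = Tangle (lbox 0 (real k + 2) 0 3) {B}
     (\<Union>i\<in>{1..k}. vline (real i) 0 1 \<union> vline (real i) 2 3)"

definition identity_box :: "nat \<Rightarrow> disc" where
  "identity_box k = lbox (1/2) (real k + 3/2) 1 2"

definition rotated_box :: "nat \<Rightarrow> disc" where
  "rotated_box k = rbox (1/2) (real k + 3/2) 1 2"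

text \<open>Vertical stacking: the lower box has \<open>k\<close> bottom and \<open>l\<close> top points, the upper box has \<open>l\<close> bottom
  and \<open>m\<close> top points.\<close>

definition stack_lower :: "nat \<Rightarrow> nat \<Rightarrow> nat \<Rightarrow> disc" where
  "stack_lower k l m = lbox (1/2) (real (k + l + m) + 3/2) 1 2"

definition stack_upper :: "nat \<Rightarrow> nat \<Rightarrow> nat \<Rightarrow> disc" where
  "stack_upper k l m = lbox (1/2) (real (k + l + m) + 3/2) 3 4"

definition stack_tangle :: "nat \<Rightarrow> nat \<Rightarrow> nat \<Rightarrow> tangle" where
  "stack_tangle k l m = Tangle (lbox 0 (real (k + l + m) + 2) 0 5)
     {stack_lower k l m, stack_upper k l m}
     ((\<Union>i\<in>{1..k}. vline (real i) 0 1) \<union> (\<Union>i\<in>{1..l}. vline (real i) 2 3) \<union>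
      (\<Union>i\<in>{1..m}. vline (real i) 4 5))"

text \<open>Horizontal juxtaposition: the left box has \<open>k\<close> points on top and on the bottom, the right box
  has \<open>l\<close>.\<close>

definition juxt_left :: "nat \<Rightarrow> nat \<Rightarrow> disc" where
  "juxt_left k l = lbox (1/4) (real k + 3/4) 1 2"

definition juxt_right :: "nat \<Rightarrow> nat \<Rightarrow> disc" where
  "juxt_right k l = lbox (real k + 5/4) (real (k + l) + 7/4) 1 2"

definition juxt_tangle :: "nat \<Rightarrow> nat \<Rightarrow> tangle" where
  "juxt_tangle k l = Tangle (lbox 0 (real (k + l) + 2) 0 3)
     {juxt_left k l, juxt_right k l}
     (\<Union>x \<in> real ` ({1..k} \<union> {k + 2..k + l + 1}). vline x 0 1 \<union> vline x 2 3)"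

text \<open>The strand that joins \<open>(a, 1)\<close> to \<open>(a, -1)\<close> by going around through the vertical line at \<open>b\<close>.\<close>

definition closing_strand :: "real \<Rightarrow> real \<Rightarrow> real \<Rightarrow> complex set" where
  "closing_strand a b j =
     vline a 1 (1 + j) \<union> hline a b (1 + j) \<union> vline b (1 + j) (-1 - j) \<union>
     hline b a (-1 - j) \<union> vline a (-1 - j) (-1)"

definition right_trace_box :: "nat \<Rightarrow> disc" where
  "right_trace_box k = lbox (1/4) (real k + 3/4) (-1) 1"

definition right_trace_tangle :: "nat \<Rightarrow> tangle" where
  "right_trace_tangle k = Tangle (lbox 0 (2 * real k + 2) (- real k - 2) (real k + 2))
     {right_trace_box k}
     (\<Union>j\<in>{1..k}. closing_strand (real k + 1 - real j) (real k + 1 + real j) (real j))"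

definition left_trace_box :: "nat \<Rightarrow> disc" where
  "left_trace_box k = lbox (- real k - 3/4) (- 1/4) (-1) 1"

definition left_trace_tangle :: "nat \<Rightarrow> tangle" where
  "left_trace_tangle k = Tangle (lbox (- 2 * real k - 2) 0 (- real k - 2) (real k + 2))
     {left_trace_box k}
     (\<Union>j\<in>{1..k}. closing_strand (- (real k + 1 - real j)) (- (real k + 1 + real j)) (real j))"

text \<open>An arc joining the two top points and an arc joining the two bottom points, each carrying an
  upright box with one strand on its left leg.\<close>

definition saddle_upper :: disc where
  "saddle_upper = lbox (3/4) (5/4) 2 3"

definition saddle_lower :: disc where
  "saddle_lower = lbox (3/4) (5/4) (-3) (-2)"

definition saddle_tangle :: tangle where
  "saddle_tangle = Tangle (lbox 0 3 (-4) 4) {saddle_upper, saddle_lower}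
     ((vline 1 4 3 \<union> vline 1 2 1 \<union> hline 1 2 1 \<union> vline 2 1 4) \<union>
      (vline 1 (-4) (-3) \<union> vline 1 (-2) (-1) \<union> hline 1 2 (-1) \<union> vline 2 (-1) (-4)))"


section \<open>Unshaded planar algebras\<close>

text \<open>The box spaces are subspaces of one complex vector space \<^typ>\<open>'a\<close>; they are neither assumed to
  be independent nor to span it, so this is no restriction on a family of vector spaces.\<close>

record 'a planar_algebra =
  scale :: "complex \<Rightarrow> 'a \<Rightarrow> 'a"
  box_space :: "nat \<Rightarrow> 'a set"
  act :: "tangle \<Rightarrow> (disc \<Rightarrow> 'a) \<Rightarrow> 'a"
  adj :: "nat \<Rightarrow> 'a \<Rightarrow> 'a"

definition labelling :: "'a planar_algebra \<Rightarrow> tangle \<Rightarrow> (disc \<Rightarrow> 'a) \<Rightarrow> bool" where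
  "labelling \<P> T f \<longleftrightarrow> (\<forall>B\<in>inner T. f B \<in> box_space \<P> (box_index T B))"

definition unshaded_planar_algebra :: "'a::ab_group_add planar_algebra \<Rightarrow> bool" where
  "unshaded_planar_algebra \<P> \<longleftrightarrow>
     vector_space (scale \<P>) \<and>
     (\<forall>k. module.subspace (scale \<P>) (box_space \<P> k)) \<and>
     \<comment> \<open>the action of a tangle is a multilinear map depending on the labels of its inner boxes\<close>
     (\<forall>T f. planar_tangle T \<and> labelling \<P> T f \<longrightarrow>
        act \<P> T f \<in> box_space \<P> (box_index T (outer T))) \<and>
     (\<forall>T f g. planar_tangle T \<and> labelling \<P> T f \<and> (\<forall>B\<in>inner T. f B = g B) \<longrightarrow>
        act \<P> T f = act \<P> T g) \<and>
     (\<forall>T f B x y. planar_tangle T \<and> labelling \<P> T f \<and> B \<in> inner T \<and>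
        x \<in> box_space \<P> (box_index T B) \<and> y \<in> box_space \<P> (box_index T B) \<longrightarrow>
        act \<P> T (f(B := x + y)) = act \<P> T (f(B := x)) + act \<P> T (f(B := y))) \<and>
     (\<forall>T f B c x. planar_tangle T \<and> labelling \<P> T f \<and> B \<in> inner T \<and>
        x \<in> box_space \<P> (box_index T B) \<longrightarrow>
        act \<P> T (f(B := scale \<P> c x)) = scale \<P> c (act \<P> T (f(B := x)))) \<and>
     \<comment> \<open>isotopy invariance\<close>
     (\<forall>T h f. planar_tangle T \<and> ambient_isotopy h \<and> labelling \<P> (tangle_image (h 1) T) f \<longrightarrow>
        act \<P> (tangle_image (h 1) T) f = act \<P> T (\<lambda>B. f (disc_image (h 1) B))) \<and>
     \<comment> \<open>compatibility with composition of tangles\<close>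
     (\<forall>T B U f. composable T B U \<and> labelling \<P> (compose_tangle T B U) f \<longrightarrow>
        act \<P> (compose_tangle T B U) f = act \<P> T (f(B := act \<P> U f))) \<and>
     (\<forall>k f. f \<in> box_space \<P> k \<longrightarrow> act \<P> (cable_tangle k (identity_box k)) (\<lambda>_. f) = f)"


subsection \<open>Diagrammatic operations\<close>

text \<open>\<open>strands \<P> 0\<close> is the empty diagram and \<open>strands \<P> 1\<close> is the single strand \<open>X\<close>.\<close>

definition strands :: "'a planar_algebra \<Rightarrow> nat \<Rightarrow> 'a" where
  "strands \<P> k = act \<P> (strands_tangle k) (\<lambda>_. undefined)"

abbreviation empty_diagram :: "'a planar_algebra \<Rightarrow> 'a" where
  "empty_diagram \<P> \<equiv> strands \<P> 0"

definition stack :: "'a planar_algebra \<Rightarrow> nat \<Rightarrow> nat \<Rightarrow> nat \<Rightarrow> 'a \<Rightarrow> 'a \<Rightarrow> 'a" where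
  "stack \<P> k l m g f = act \<P> (stack_tangle k l m) (\<lambda>B. if B = stack_upper k l m then g else f)"

definition mult :: "'a planar_algebra \<Rightarrow> nat \<Rightarrow> 'a \<Rightarrow> 'a \<Rightarrow> 'a" where
  "mult \<P> k f g = stack \<P> k k k f g"

definition tensor :: "'a planar_algebra \<Rightarrow> nat \<Rightarrow> nat \<Rightarrow> 'a \<Rightarrow> 'a \<Rightarrow> 'a" where
  "tensor \<P> k l f g = act \<P> (juxt_tangle k l) (\<lambda>B. if B = juxt_left k l then f else g)"

definition rotation :: "'a planar_algebra \<Rightarrow> nat \<Rightarrow> 'a \<Rightarrow> 'a" where
  "rotation \<P> k f = act \<P> (cable_tangle k (rotated_box k)) (\<lambda>_. f)"

definition right_trace :: "'a planar_algebra \<Rightarrow> nat \<Rightarrow> 'a \<Rightarrow> 'a" where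
  "right_trace \<P> k f = act \<P> (right_trace_tangle k) (\<lambda>_. f)"

definition left_trace :: "'a planar_algebra \<Rightarrow> nat \<Rightarrow> 'a \<Rightarrow> 'a" where
  "left_trace \<P> k f = act \<P> (left_trace_tangle k) (\<lambda>_. f)"

definition saddle :: "'a planar_algebra \<Rightarrow> 'a \<Rightarrow> 'a \<Rightarrow> 'a" where
  "saddle \<P> f g = act \<P> saddle_tangle (\<lambda>B. if B = saddle_upper then f else g)"

definition closed_loop :: "'a planar_algebra \<Rightarrow> 'a" where
  "closed_loop \<P> = act \<P> loop_tangle (\<lambda>_. undefined)"


subsection \<open>Subfactor planar algebras\<close>

text \<open>The scalar represented by an element of the one-dimensional space of closed diagrams.\<close>

definition scalar_of :: "'a planar_algebra \<Rightarrow> 'a \<Rightarrow> complex" where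
  "scalar_of \<P> x = (THE c. x = scale \<P> c (empty_diagram \<P>))"

definition box_inner :: "'a planar_algebra \<Rightarrow> nat \<Rightarrow> 'a \<Rightarrow> 'a \<Rightarrow> complex" where
  "box_inner \<P> k f g = scalar_of \<P> (right_trace \<P> k (mult \<P> k (adj \<P> k f) g))"

text \<open>Complex conjugation of the plane is the reflection over a horizontal line.\<close>

definition adjoint_structure :: "'a::ab_group_add planar_algebra \<Rightarrow> bool" where
  "adjoint_structure \<P> \<longleftrightarrow>
     (\<forall>k. \<forall>f\<in>box_space \<P> k. adj \<P> k f \<in> box_space \<P> k \<and> adj \<P> k (adj \<P> k f) = f) \<and>
     (\<forall>k. \<forall>f\<in>box_space \<P> k. \<forall>g\<in>box_space \<P> k. adj \<P> k (f + g) = adj \<P> k f + adj \<P> k g) \<and>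
     (\<forall>k c. \<forall>f\<in>box_space \<P> k. adj \<P> k (scale \<P> c f) = scale \<P> (cnj c) (adj \<P> k f)) \<and>
     (\<forall>T f. planar_tangle T \<and> labelling \<P> T f \<longrightarrow>
        adj \<P> (box_index T (outer T)) (act \<P> T f) =
        act \<P> (tangle_image cnj T)
          (\<lambda>B. adj \<P> (box_index (tangle_image cnj T) B) (f (disc_image cnj B))))"

definition unshaded_subfactor_planar_algebra :: "'a::ab_group_add planar_algebra \<Rightarrow> bool" where
  "unshaded_subfactor_planar_algebra \<P> \<longleftrightarrow>
     unshaded_planar_algebra \<P> \<and>
     vector_space.dim (scale \<P>) (box_space \<P> 0) = 1 \<and>
     (\<forall>f\<in>box_space \<P> 1. left_trace \<P> 1 f = right_trace \<P> 1 f) \<and>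
     adjoint_structure \<P> \<and>
     (\<forall>k. \<forall>f\<in>box_space \<P> k. f \<noteq> 0 \<longrightarrow>
        Im (box_inner \<P> k f f) = 0 \<and> 0 < Re (box_inner \<P> k f f))"

definition has_index :: "'a planar_algebra \<Rightarrow> real \<Rightarrow> bool" where
  "has_index \<P> r \<longleftrightarrow>
     (\<exists>\<delta>::real. \<delta> > 0 \<and> closed_loop \<P> = scale \<P> (complex_of_real \<delta>) (empty_diagram \<P>) \<and> r = \<delta>\<^sup>2)"


subsection \<open>The principal graph\<close>

definition is_projection :: "'a planar_algebra \<Rightarrow> nat \<Rightarrow> 'a \<Rightarrow> bool" where
  "is_projection \<P> k p \<longleftrightarrow> p \<in> box_space \<P> k \<and> mult \<P> k p p = p \<and> adj \<P> k p = p"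

text \<open>Pairs \<open>(k, p)\<close> stand for elements \<open>p\<close> of the \<open>k\<close>-th box space.  An element of the box space with
  \<open>k + l\<close> boundary points is drawn with \<open>k\<close> points on the bottom and \<open>l\<close> points on top, the star being
  on the left, so strands are bent on the right.  There are no diagrams with an odd number of
  boundary points.\<close>

definition Hom :: "'a::ab_group_add planar_algebra \<Rightarrow> nat \<times> 'a \<Rightarrow> nat \<times> 'a \<Rightarrow> 'a set" where
  "Hom \<P> = (\<lambda>(k, p) (l, q).
     if even (k + l)
     then {f \<in> box_space \<P> ((k + l) div 2). stack \<P> k l l q (stack \<P> k k l f p) = f}
     else {0})"

definition hom_dim :: "'a::ab_group_add planar_algebra \<Rightarrow> nat \<times> 'a \<Rightarrow> nat \<times> 'a \<Rightarrow> nat" where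
  "hom_dim \<P> x y = vector_space.dim (scale \<P>) (Hom \<P> x y)"

definition minimal_projection :: "'a::ab_group_add planar_algebra \<Rightarrow> nat \<times> 'a \<Rightarrow> bool" where
  "minimal_projection \<P> x \<longleftrightarrow> is_projection \<P> (fst x) (snd x) \<and> hom_dim \<P> x x = 1"

definition iso_projections :: "'a::ab_group_add planar_algebra \<Rightarrow> nat \<times> 'a \<Rightarrow> nat \<times> 'a \<Rightarrow> bool" where
  "iso_projections \<P> = (\<lambda>(k, p) (l, q).
     even (k + l) \<and>
     (\<exists>f \<in> Hom \<P> (k, p) (l, q).
        stack \<P> k l k (adj \<P> ((k + l) div 2) f) f = p \<and>
        stack \<P> l k l f (adj \<P> ((k + l) div 2) f) = q))"

definition iso_class :: "'a::ab_group_add planar_algebra \<Rightarrow> nat \<times> 'a \<Rightarrow> (nat \<times> 'a) set" where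
  "iso_class \<P> x = {y. minimal_projection \<P> y \<and> iso_projections \<P> x y}"

definition pg_vertices :: "'a::ab_group_add planar_algebra \<Rightarrow> (nat \<times> 'a) set set" where
  "pg_vertices \<P> = iso_class \<P> ` {x. minimal_projection \<P> x}"

definition tensor_X :: "'a planar_algebra \<Rightarrow> nat \<times> 'a \<Rightarrow> nat \<times> 'a" where
  "tensor_X \<P> = (\<lambda>(k, p). (k + 1, tensor \<P> k 1 p (strands \<P> 1)))"

text \<open>The number of edges, read off from representatives; it does not depend on their choice.\<close>

definition pg_edges :: "'a::ab_group_add planar_algebra \<Rightarrow> (nat \<times> 'a) set \<Rightarrow> (nat \<times> 'a) set \<Rightarrow> nat" where
  "pg_edges \<P> C D = the_elem ((\<lambda>(x, y). hom_dim \<P> (tensor_X \<P> x) y) ` (C \<times> D))"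

text \<open>\<open>v\<close> enumerates the vertices of a multigraph with vertex set \<open>V\<close> and edge multiplicities \<open>e\<close>
  along a two-sided infinite path.\<close>

definition bi_infinite_path :: "'v set \<Rightarrow> ('v \<Rightarrow> 'v \<Rightarrow> nat) \<Rightarrow> (int \<Rightarrow> 'v) \<Rightarrow> bool" where
  "bi_infinite_path V e v \<longleftrightarrow>
     bij_betw v UNIV V \<and> (\<forall>i j. e (v i) (v j) = (if \<bar>i - j\<bar> = 1 then 1 else 0))"

definition principal_graph_A_tilde_infinity :: "'a::ab_group_add planar_algebra \<Rightarrow> bool" where
  "principal_graph_A_tilde_infinity \<P> \<longleftrightarrow>
     (\<exists>v. bi_infinite_path (pg_vertices \<P>) (pg_edges \<P>) v)"


section \<open>Arrow and color relations\<close>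

text \<open>The clockwise loop is the right closure of the upward strand, the counterclockwise loop is the
  right closure of the downward strand.  In the saddle relations each arc carries one box on its left
  leg, so that the orientations (colors) at the boundary are those of the right-hand side.\<close>

definition arrow_relations :: "'a::ab_group_add planar_algebra \<Rightarrow> 'a \<Rightarrow> bool" where
  "arrow_relations \<P> P \<longleftrightarrow> (let Q = rotation \<P> 1 P in
     right_trace \<P> 1 P = empty_diagram \<P> \<and> right_trace \<P> 1 Q = empty_diagram \<P> \<and>
     strands \<P> 1 = P + Q \<and>
     mult \<P> 1 P Q = 0 \<and> mult \<P> 1 Q P = 0 \<and>
     saddle \<P> P P = tensor \<P> 1 1 P Q \<and> saddle \<P> Q Q = tensor \<P> 1 1 Q P)"

definition color_relations :: "'a::ab_group_add planar_algebra \<Rightarrow> 'a \<Rightarrow> 'a \<Rightarrow> bool" where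
  "color_relations \<P> P Q \<longleftrightarrow>
     rotation \<P> 1 P = P \<and> rotation \<P> 1 Q = Q \<and>
     right_trace \<P> 1 P = empty_diagram \<P> \<and> right_trace \<P> 1 Q = empty_diagram \<P> \<and>
     strands \<P> 1 = P + Q \<and>
     mult \<P> 1 P Q = 0 \<and> mult \<P> 1 Q P = 0 \<and>
     saddle \<P> P P = tensor \<P> 1 1 P P \<and> saddle \<P> Q Q = tensor \<P> 1 1 Q Q"

primrec tensor_power :: "'a planar_algebra \<Rightarrow> 'a \<Rightarrow> nat \<Rightarrow> 'a" where
  "tensor_power \<P> P 0 = empty_diagram \<P>"
| "tensor_power \<P> P (Suc n) = tensor \<P> n 1 (tensor_power \<P> P n) P"

text \<open>\<open>P \<otimes> Q \<otimes> P \<otimes> \<dots>\<close> with \<open>n\<close> factors.\<close>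

fun alternating_tensor :: "'a planar_algebra \<Rightarrow> 'a \<Rightarrow> 'a \<Rightarrow> nat \<Rightarrow> 'a" where
  "alternating_tensor \<P> P Q 0 = empty_diagram \<P>"
| "alternating_tensor \<P> P Q (Suc n) = tensor \<P> 1 n P (alternating_tensor \<P> Q P n)"

text \<open>The vertices \<open>\<dots>, [b 2], [b 1], [\<emptyset>], [a 1], [a 2], \<dots>\<close>, provided \<open>a 0 = \<emptyset>\<close>.\<close>

definition two_sided_vertices ::
  "'a::ab_group_add planar_algebra \<Rightarrow> (nat \<Rightarrow> 'a) \<Rightarrow> (nat \<Rightarrow> 'a) \<Rightarrow> int \<Rightarrow> (nat \<times> 'a) set" where
  "two_sided_vertices \<P> a b i =
     iso_class \<P> (if i \<ge> 0 then (nat i, a (nat i)) else (nat (- i), b (nat (- i))))"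

end

theory Submission imports Defs begin

text \<open>Why the theorem is true.  Let \<open>X\<close> be the vertical strand, of trace 2.  Starting at the empty diagram, the
two halves of the principal graph give two sequences \<open>x 0, x 1, x 2, ...\<close> of minimal projections with \<open>x 0\<close>
empty and \<open>x (n + 1)\<close> below \<open>x n \<otimes> X\<close>, called chains below.  Bending one strand turns \<open>x (n + 1)\<close> into a map from
\<open>x n\<close> to \<open>x (n + 1) \<otimes> X\<close>, so that \<open>x (n + 1) \<otimes> X\<close> contains a projection \<open>r\<close> with the trace of \<open>x n\<close> (lemma
\<open>chain_return\<close>); it is orthogonal to \<open>x (n + 2)\<close>, because \<open>x n\<close> and \<open>x (n + 2)\<close> are different vertices.  Hence
\<open>tr (x n) + tr (x (n + 2)) \<le> 2 tr (x (n + 1))\<close>: along the two-sided path the traces form a positive concave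
function on the integers.  Such a function is constant (\<open>concave_two_sided\<close>), all traces are 1, and what
remains of \<open>x (n + 1) \<otimes> X\<close> after removing \<open>r\<close> and \<open>x (n + 2)\<close> is a projection of trace 0, that is 0.

In particular \<open>X = P + Q\<close> for the first elements \<open>P\<close> and \<open>Q\<close> of the two chains.  Rotation by \<open>\<pi>\<close> is an injective
linear anti-homomorphism of the first box space and commutes with the adjoint, so it permutes \<open>P\<close> and \<open>Q\<close>
(\<open>rotation_cases\<close>).  If it exchanges them this is the arrow case, and if it fixes them it is the colour case.
If \<open>x (n + 1)\<close> ends in the letter \<open>R\<close>, then \<open>r\<close> is \<open>x (n + 1)\<close> followed by the rotated letter, so
\<open>x (n + 2)\<close> is \<open>x (n + 1)\<close> followed by the other one (\<open>chain_letter\<close>): the words repeat one letter in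
the arrow case and alternate in the colour case.  The formula for \<open>r\<close> with \<open>n = 0\<close> is the saddle relation.

Most of the text proves the diagrammatic identities that this uses.  Stacking, juxtaposition, rotation and
trace are given by particular pictures, and an identity needs an ambient isotopy between two of them.
Three kinds of isotopies suffice: homeomorphisms of the plane that map each horizontal line to
itself, those that map each vertical line to itself, both piecewise linear on each line, and one map that changes
angles on a half plane.  Together with the fact that planar tangles compose (\<open>planar_compose\<close>), they show that the
value of a picture does not depend on the sizes chosen in it.  The identity behind everything else
is \<open>beside_bend\<close>: a box slides along a strand around a bend and is turned by \<open>\<pi>\<close>.  It makes the identity strands act as
a unit in every shape of box (\<open>unital_all\<close>), and shows that the trace of a composite does not depend on how the boundary
points of the factors are divided into top and bottom (\<open>trace_shape\<close>); positivity of the trace form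
therefore holds for diagrams with different numbers of points at the bottom and at the top.\<close>

section \<open>Moving tangles by ambient isotopies\<close>

definition isotopic_id :: "(complex => complex) => bool" where "isotopic_id h \<longleftrightarrow> (EX H. ambient_isotopy H & H 1 = h)"

lemma isotopic_id_homeomorphism: assumes "isotopic_id h" obtains g where "homeomorphism UNIV UNIV h g"
 using assms unfolding isotopic_id_def ambient_isotopy_def by force

lemma isotopic_id_compose: assumes "isotopic_id h" "isotopic_id h'" shows "isotopic_id (h' \<circ> h)"
proof -
 obtain H1 H2 where H: "ambient_isotopy H1" "H1 1 = h" "ambient_isotopy H2" "H2 1 = h'" using assms unfolding isotopic_id_def by blast
 have c1: "continuous_on ({0..1} \<times> UNIV) (%(t, z). H1 t z)" and c2: "continuous_on ({0..1} \<times> UNIV) (%(t, z). H2 t z)"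
  using H unfolding ambient_isotopy_def by auto
 have "continuous_on ({0..1} \<times> UNIV) ((%(t, z). H2 t z) \<circ> (%p. (fst p, (%(t, z). H1 t z) p)))"
  by (intro continuous_on_compose continuous_on_Pair continuous_on_fst continuous_on_id c1
    continuous_on_subset[OF c2]) auto
 hence c: "continuous_on ({0..1} \<times> UNIV) (%(t, z). (H2 t \<circ> H1 t) z)" by (simp add: o_def case_prod_unfold)
 have "EX g. homeomorphism UNIV UNIV (H2 t \<circ> H1 t) g" if "t \<in> {0..1}" for t using H that unfolding ambient_isotopy_def by (meson homeomorphism_compose)
 hence "ambient_isotopy (%t. H2 t \<circ> H1 t)" using c H unfolding ambient_isotopy_def by (auto simp: o_def)
 thus ?thesis unfolding isotopic_id_def using H by blast
qed

lemma isotopic_idI: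
 fixes H :: "real => complex => complex" assumes c: "continuous_on ({0..1} \<times> UNIV) (%(t, z). H t z)"
  and inj: "!!t. t \<in> {0..1} ==> inj (H t)" and surj: "!!t. t \<in> {0..1} ==> surj (H t)" and "!!z. H 0 z = z" and "H 1 = h" shows "isotopic_id h"
proof -
 have "EX g. homeomorphism UNIV UNIV (H t) g" if t: "t \<in> {0..1}" for t
 proof -
  have "continuous_on UNIV ((%(t, z). H t z) \<circ> (%z. (t, z)))" by (intro continuous_on_compose continuous_intros continuous_on_subset[OF c]) (use t in auto)
  hence "continuous_on UNIV (H t)" by (simp add: o_def)
  then obtain g where "homeomorphism UNIV (H t ` UNIV) (H t) g" using invariance_of_domain_homeomorphism[of UNIV "H t"] inj[OF t] by auto
  thus ?thesis using surj[OF t] by auto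
 qed
 thus ?thesis using assms unfolding isotopic_id_def ambient_isotopy_def by auto
qed

lemma convex_combination_strict_mono:
 fixes f g :: "real => real" assumes "strict_mono f" "strict_mono g" "0 <= t" "t <= 1" shows "strict_mono (%x. (1 - t) * f x + t * g x)"
proof (rule strict_monoI)
 fix x y :: real assume "x < y"
 hence 1: "f x < f y" "g x < g y" using assms by (auto simp: strict_mono_def)
 show "(1 - t) * f x + t * g x < (1 - t) * f y + t * g y"
 proof (cases "t = 1")
  case True thus ?thesis using 1 by simp
 next
  case False
  hence "(1 - t) * f x < (1 - t) * f y" "t * g x <= t * g y" using 1 assms by (auto intro: mult_left_mono)
  thus ?thesis by linarith
 qed
qed

lemma convex_combination_surj:
 fixes f g :: "real => real" assumes "mono f" "mono g" "0 <= t" "t <= 1" "continuous_on UNIV f" "continuous_on UNIV g" "surj f" "surj g"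
 shows "surj (%x. (1 - t) * f x + t * g x)"
proof -
 have "EX x. (1 - t) * f x + t * g x = y" for y
 proof -
  obtain a b where ab: "f a = y" "g b = y" using assms by (metis surjD)
  have l: "f (min a b) <= y" "g (min a b) <= y" and u: "f (max a b) \<ge> y" "g (max a b) \<ge> y"
   using ab assms(1,2) by (metis mono_def min.cobounded1 min.cobounded2 max.cobounded1 max.cobounded2)+
  have y: "(1 - t) * y + t * y = y" by (simp add: algebra_simps)
  have "(1 - t) * f (min a b) + t * g (min a b) <= (1 - t) * y + t * y" using l assms by (intro add_mono mult_left_mono) auto
  moreover have "(1 - t) * y + t * y <= (1 - t) * f (max a b) + t * g (max a b)" using u assms by (intro add_mono mult_left_mono) auto
  moreover have "continuous_on {min a b..max a b} (%x. (1 - t) * f x + t * g x)" by (intro continuous_on_add continuous_on_mult continuous_on_const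
     continuous_on_subset[OF assms(5)] continuous_on_subset[OF assms(6)]) auto
  ultimately have "\<exists>x\<ge>min a b. x <= max a b & (1 - t) * f x + t * g x = y" unfolding y
   by (rule IVT'[of "%x. (1 - t) * f x + t * g x", OF _ _ min.coboundedI1[OF max.cobounded1]])
  thus ?thesis by blast
 qed
 thus ?thesis unfolding surj_def by metis
qed

text \<open>A family of increasing homeomorphisms of the line, one for each horizontal (or vertical) line
  of the plane, moves the plane by an isotopy: interpolate linearly on each line.\<close>

definition fibre_family :: "(real => real => real) => bool" where
 "fibre_family phi \<longleftrightarrow> continuous_on UNIV (%(y, x). phi y x) & (ALL y. strict_mono (phi y)) & (ALL y. surj (phi y))"

definition hmap :: "(real => real => real) => complex => complex" where "hmap phi z = Complex (phi (Im z) (Re z)) (Im z)"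

definition vmap :: "(real => real => real) => complex => complex" where "vmap psi z = Complex (Re z) (psi (Re z) (Im z))"

lemma continuous_on_Complex [continuous_intros]: "continuous_on S f ==> continuous_on S g ==> continuous_on S (%x. Complex (f x) (g x))"
 unfolding Complex_eq by (intro continuous_intros)

lemma fibre_family_continuous: assumes "fibre_family phi" "continuous_on S f" "continuous_on S g" shows "continuous_on S (%x. phi (f x) (g x))"
proof -
 have "continuous_on S ((%(y, x). phi y x) \<circ> (%x. (f x, g x)))" using assms unfolding fibre_family_def
  by (intro continuous_on_compose continuous_intros) (auto intro: continuous_on_subset)
 thus ?thesis by (simp add: o_def)
qed

lemma fibre_interpolate: assumes "fibre_family phi" "t \<in> {0..1}" shows "strict_mono (%x. (1 - t) * x + t * phi y x)" "surj (%x. (1 - t) * x + t * phi y x)"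
proof -
 have c: "continuous_on UNIV (phi y)" by (rule fibre_family_continuous[OF assms(1)]) (auto intro: continuous_intros)
 have s: "strict_mono (phi y)" "surj (phi y)" using assms unfolding fibre_family_def by auto
 have i: "strict_mono (%x::real. x)" "surj (%x::real. x)" "continuous_on UNIV (%x::real. x)" by (auto simp: strict_mono_def surj_def)
 show "strict_mono (%x. (1 - t) * x + t * phi y x)" using convex_combination_strict_mono[OF i(1) s(1)] assms by auto
 show "surj (%x. (1 - t) * x + t * phi y x)" using convex_combination_surj[OF strict_mono_mono[OF i(1)] strict_mono_mono[OF s(1)] _ _ i(3) c i(2) s(2)] assms by auto
qed

text \<open>Convex combinations of increasing functions are increasing, so the family can be deformed to the identity on every line separately.\<close>

lemma isotopic_id_hmap:  assumes "fibre_family phi" shows "isotopic_id (hmap phi)"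
proof (rule isotopic_idI[where H = "%t. hmap (%y x. (1 - t) * x + t * phi y x)"])
 show "continuous_on ({0..1} \<times> UNIV) (%(t, z). hmap (%y x. (1 - t) * x + t * phi y x) z)" unfolding hmap_def case_prod_unfold
  by (intro continuous_intros fibre_family_continuous[OF assms])
 fix t :: real assume t: "t \<in> {0..1}"
 show "inj (hmap (%y x. (1 - t) * x + t * phi y x))"
 proof (rule injI)
  fix z w assume *: "hmap (%y x. (1 - t) * x + t * phi y x) z = hmap (%y x. (1 - t) * x + t * phi y x) w"
  hence i: "Im z = Im w" by (simp add: hmap_def)
  hence "(1 - t) * Re z + t * phi (Im z) (Re z) = (1 - t) * Re w + t * phi (Im z) (Re w)" using arg_cong[OF *, of Re] by (simp add: hmap_def)
  hence "Re z = Re w" by (rule injD[OF strict_mono_imp_inj_on[OF fibre_interpolate(1)[OF assms t, of "Im z"]]])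
  thus "z = w" using i by (simp add: complex_eq_iff)
 qed
 show "surj (hmap (%y x. (1 - t) * x + t * phi y x))"
 proof -
  have "EX z. hmap (%y x. (1 - t) * x + t * phi y x) z = w" for w
  proof -
   obtain x where "(1 - t) * x + t * phi (Im w) x = Re w" using surjD[OF fibre_interpolate(2)[OF assms t, of "Im w"], of "Re w"] by metis
   hence "hmap (%y x. (1 - t) * x + t * phi y x) (Complex x (Im w)) = w" by (simp add: hmap_def complex_eq_iff)
   thus ?thesis by blast
  qed
  thus ?thesis unfolding surj_def by metis
 qed
qed (auto simp: hmap_def fun_eq_iff complex_eq_iff)

lemma isotopic_id_vmap:  assumes "fibre_family phi" shows "isotopic_id (vmap phi)"
proof (rule isotopic_idI[where H = "%t. vmap (%y x. (1 - t) * x + t * phi y x)"])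
 show "continuous_on ({0..1} \<times> UNIV) (%(t, z). vmap (%y x. (1 - t) * x + t * phi y x) z)" unfolding vmap_def case_prod_unfold
  by (intro continuous_intros fibre_family_continuous[OF assms])
 fix t :: real assume t: "t \<in> {0..1}"
 show "inj (vmap (%y x. (1 - t) * x + t * phi y x))"
 proof (rule injI)
  fix z w assume *: "vmap (%y x. (1 - t) * x + t * phi y x) z = vmap (%y x. (1 - t) * x + t * phi y x) w"
  hence r: "Re z = Re w" by (simp add: vmap_def)
  hence "(1 - t) * Im z + t * phi (Re z) (Im z) = (1 - t) * Im w + t * phi (Re z) (Im w)" using arg_cong[OF *, of Im] by (simp add: vmap_def)
  hence "Im z = Im w" by (rule injD[OF strict_mono_imp_inj_on[OF fibre_interpolate(1)[OF assms t, of "Re z"]]])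
  thus "z = w" using r by (simp add: complex_eq_iff)
 qed
 show "surj (vmap (%y x. (1 - t) * x + t * phi y x))"
 proof -
  have "EX z. vmap (%y x. (1 - t) * x + t * phi y x) z = w" for w
  proof -
   obtain x where "(1 - t) * x + t * phi (Re w) x = Im w" using surjD[OF fibre_interpolate(2)[OF assms t, of "Re w"], of "Im w"] by metis
   hence "vmap (%y x. (1 - t) * x + t * phi y x) (Complex (Re w) x) = w" by (simp add: vmap_def complex_eq_iff)
   thus ?thesis by blast
  qed
  thus ?thesis unfolding surj_def by metis
 qed
qed (auto simp: vmap_def fun_eq_iff complex_eq_iff)

subsection \<open>Piecewise linear functions and their interpolations\<close>

primrec pl_tail :: "real => real => (real \<times> real) list => real => real" where "pl_tail a b [] x = max (x - a) 0"
| "pl_tail a b (n # r) x = (snd n - b) / (fst n - a) * max 0 (min (x - a) (fst n - a)) + pl_tail (fst n) (snd n) r x"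

text \<open>The piecewise linear function through the given nodes, of slope 1 outside of them.\<close>

fun pl :: "(real \<times> real) list => real => real" where "pl [] x = x"
| "pl (n # r) x = snd n + min (x - fst n) 0 + pl_tail (fst n) (snd n) r x"

fun nodes :: "(real \<times> real) list => bool" where "nodes (n # m # r) \<longleftrightarrow> fst n < fst m & snd n < snd m & nodes (m # r)"
| "nodes _ \<longleftrightarrow> True"

lemma nodes_tl: "nodes (n # r) ==> nodes r" by (cases r) auto

lemma pl_tail_zero: "nodes (n # r) ==> x <= fst n ==> pl_tail (fst n) (snd n) r x = 0" by (induction r arbitrary: n) auto

lemma pl_tail_mono: "nodes (n # r) ==> x <= x' ==> pl_tail (fst n) (snd n) r x <= pl_tail (fst n) (snd n) r x'"
proof (induction r arbitrary: n)
 case (Cons m r)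
 hence "pl_tail (fst m) (snd m) r x <= pl_tail (fst m) (snd m) r x'" by auto
 moreover have "(snd m - snd n) / (fst m - fst n) * max 0 (min (x - fst n) (fst m - fst n))
   <= (snd m - snd n) / (fst m - fst n) * max 0 (min (x' - fst n) (fst m - fst n))" using Cons.prems by (intro mult_left_mono) auto
 ultimately show ?case by simp
qed auto

lemma pl_tail_strict: "nodes (n # r) ==> fst n <= x ==> x < x' ==> pl_tail (fst n) (snd n) r x < pl_tail (fst n) (snd n) r x'"
proof (induction r arbitrary: n)
 case (Cons m r)
 have le: "pl_tail (fst m) (snd m) r x <= pl_tail (fst m) (snd m) r x'" using Cons.prems by (intro pl_tail_mono) auto
 show ?case
 proof (cases "fst m <= x")
  case True
  hence "pl_tail (fst m) (snd m) r x < pl_tail (fst m) (snd m) r x'" using Cons by auto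
  thus ?thesis using True Cons.prems by auto
 next
  case False
  have "(snd m - snd n) / (fst m - fst n) * max 0 (min (x - fst n) (fst m - fst n))
   < (snd m - snd n) / (fst m - fst n) * max 0 (min (x' - fst n) (fst m - fst n))" using Cons.prems False by (intro mult_strict_left_mono) auto
  thus ?thesis using le by simp
 qed
qed auto

lemma pl_strict_mono: "nodes ns ==> strict_mono (pl ns)"
proof (rule strict_monoI)
 fix x y :: real assume *: "nodes ns" "x < y"
 show "pl ns x < pl ns y"
 proof (cases ns)
  case Nil thus ?thesis using * by simp
 next
  case (Cons n r)
  hence "pl_tail (fst n) (snd n) r x <= pl_tail (fst n) (snd n) r y" using * by (intro pl_tail_mono) auto
  moreover have "fst n <= x ==> pl_tail (fst n) (snd n) r x < pl_tail (fst n) (snd n) r y" using * Cons by (intro pl_tail_strict) auto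
  ultimately show ?thesis using Cons * by (cases "fst n <= x") (auto simp: min_def)
 qed
qed

lemma pl_left: "nodes (n # r) ==> x <= fst n ==> pl (n # r) x = snd n + (x - fst n)" by (auto simp: pl_tail_zero)

lemma pl_between: "nodes (n # m # r) ==> fst n <= x ==> x <= fst m ==>
  pl (n # m # r) x = snd n + (snd m - snd n) / (fst m - fst n) * (x - fst n)" by (auto simp: pl_tail_zero)

lemma pl_skip: "nodes (n # m # r) ==> fst m <= x ==> pl (n # m # r) x = pl (m # r) x" by (auto simp: field_simps)

lemma pl_right: "fst n <= x ==> pl [n] x = snd n + (x - fst n)" by auto

lemma nodes_fst_le: "nodes (n # r) ==> m \<in> set r ==> fst n < fst m" by (induction r arbitrary: n) force+

lemma pl_node: "nodes ns ==> n \<in> set ns ==> pl ns (fst n) = snd n"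
proof (induction ns)
 case (Cons m r)
 show ?case
 proof (cases "n = m")
  case True thus ?thesis using Cons.prems by (simp add: pl_left del: pl.simps)
 next
  case False
  then obtain m' r' where r: "r = m' # r'" using Cons.prems by (cases r) auto
  have "fst m' <= fst n" using Cons.prems False r nodes_fst_le[of m' r' n] by auto
  hence "pl (m # r) (fst n) = pl r (fst n)" using Cons.prems r pl_skip by blast
  thus ?thesis using Cons False r by (auto dest: nodes_tl simp del: pl.simps)
 qed
qed auto

lemma pl_tail_unbounded: "nodes (n # r) ==> EX x. pl_tail (fst n) (snd n) r x \<ge> M"
proof (induction r arbitrary: n)
 case Nil
 show ?case by (rule exI[of _ "fst n + \<bar>M\<bar>"]) auto
next
 case (Cons m r)
 obtain x where x: "pl_tail (fst m) (snd m) r x \<ge> M" using Cons.IH[of m] Cons.prems by auto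
 moreover have "0 <= (snd m - snd n) / (fst m - fst n) * max 0 (min (x - fst n) (fst m - fst n))" using Cons.prems by (intro mult_nonneg_nonneg) auto
 ultimately show ?case by (intro exI[of _ x]) simp
qed

lemma continuous_on_fst_arg: "continuous_on UNIV f ==> continuous_on S (%p. f (fst p))"
 by (rule continuous_on_compose2[of UNIV f S fst]) (auto intro: continuous_on_fst continuous_on_id)

lemma continuous_on_snd_arg: "continuous_on UNIV f ==> continuous_on S (%p. f (snd p))"
 by (rule continuous_on_compose2[of UNIV f S snd]) (auto intro: continuous_on_snd continuous_on_id)

lemma continuous_pl_tail:
 fixes ns :: "((real => real) \<times> (real => real)) list" assumes "\<forall>n\<in>set ns. continuous_on UNIV (fst n) & continuous_on UNIV (snd n)"
  "continuous_on UNIV a" "continuous_on UNIV b" "!!y. nodes ((a y, b y) # map (%n. (fst n y, snd n y)) ns)"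
 shows "continuous_on UNIV (%(y, x). pl_tail (a y) (b y) (map (%n. (fst n y, snd n y)) ns) x)" using assms
proof (induction ns arbitrary: a b)
 case Nil
 show ?case using Nil by (auto simp: case_prod_unfold intro!: continuous_intros continuous_on_fst_arg)
next
 case (Cons n ns)
 have "continuous_on UNIV (%(y, x). pl_tail (fst n y) (snd n y) (map (%n. (fst n y, snd n y)) ns) x)" using Cons.prems(1,4) by (intro Cons.IH) auto
 moreover have "fst n y ~= a y" for y using Cons.prems(4)[of y] by auto
 ultimately show ?case using Cons.prems by (auto simp: case_prod_unfold intro!: continuous_intros continuous_on_fst_arg)
qed

lemma continuous_pl:
 fixes ns :: "((real => real) \<times> (real => real)) list" assumes "\<forall>n\<in>set ns. continuous_on UNIV (fst n) & continuous_on UNIV (snd n)"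
  "!!y. nodes (map (%n. (fst n y, snd n y)) ns)" shows "continuous_on UNIV (%(y, x). pl (map (%n. (fst n y, snd n y)) ns) x)"
proof (cases ns)
 case Nil thus ?thesis by (auto simp: case_prod_unfold intro!: continuous_intros)
next
 case (Cons n r)
 have "continuous_on UNIV (%(y, x). pl_tail (fst n y) (snd n y) (map (%n. (fst n y, snd n y)) r) x)" using Cons assms by (intro continuous_pl_tail) auto
 thus ?thesis using Cons assms by (auto simp: case_prod_unfold intro!: continuous_intros continuous_on_fst_arg)
qed

lemma pl_continuous: "nodes ns ==> continuous_on UNIV (pl ns)"
proof -
 assume "nodes ns"
 hence "continuous_on UNIV (%(y::real, x). pl (map (%n. (fst n y, snd n y)) (map (%n. (%_. fst n, %_. snd n)) ns)) x)" by (intro continuous_pl) (auto simp: o_def)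
 hence "continuous_on UNIV (%(y::real, x). pl ns x)" by (simp add: o_def)
 hence "continuous_on UNIV ((%(y::real, x). pl ns x) \<circ> (%x. (0, x)))" by (intro continuous_on_compose continuous_intros) (auto intro: continuous_on_subset)
 thus ?thesis by (simp add: o_def)
qed

lemma pl_surj: assumes "nodes ns" shows "surj (pl ns)"
proof -
 have "EX x. pl ns x = y" for y
 proof (cases ns)
  case Nil thus ?thesis by auto
 next
  case (Cons n r)
  obtain x' where x': "pl_tail (fst n) (snd n) r x' \<ge> \<bar>y - snd n\<bar>" using pl_tail_unbounded assms Cons by blast
  define u where "u = max x' (fst n)"
  define l where "l = fst n - \<bar>y - snd n\<bar>"
  have "pl_tail (fst n) (snd n) r u \<ge> \<bar>y - snd n\<bar>" using x' pl_tail_mono[of n r x' u] assms Cons by (auto simp: u_def)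
  hence u: "y <= pl ns u" using Cons by (auto simp: u_def)
  have "pl ns l = snd n + (l - fst n)" using pl_left[of n r l] assms Cons by (auto simp: l_def)
  hence l: "pl ns l <= y" by (auto simp: l_def)
  have "EX x. l <= x & x <= u & pl ns x = y" using l u by (intro IVT') (auto simp: l_def u_def intro: continuous_on_subset[OF pl_continuous[OF assms]])
  thus ?thesis by blast
 qed
 thus ?thesis unfolding surj_def by metis
qed

lemma fibre_family_pl: assumes "\<forall>n\<in>set ns. continuous_on UNIV (fst n) & continuous_on UNIV (snd n)" "!!y. nodes (map (%n. (fst n y, snd n y)) ns)"
 shows "fibre_family (%y. pl (map (%n. (fst n y, snd n y)) ns))" unfolding fibre_family_def using continuous_pl[OF assms] pl_strict_mono pl_surj assms(2)
 by (auto simp: case_prod_unfold)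

text \<open>Interpolation between finitely many functions \<open>F\<close>, attained at increasing parameters.\<close>

primrec interpolate :: "real => (real => real) => (real \<times> (real => real)) list => real => real => real" where "interpolate y0 F [] y = F"
| "interpolate y0 F (n # r) y = (if y <= fst n then (%x. (1 - max 0 ((y - y0) / (fst n - y0))) * F x + max 0 ((y - y0) / (fst n - y0)) * snd n x)
   else interpolate (fst n) (snd n) r y)"

lemma interpolate_le: "sorted_wrt (<) (y0 # map fst r) ==> y <= y0 ==> interpolate y0 F r y = F"
proof (induction r)
 case (Cons n r)
 hence "(y - y0) / (fst n - y0) <= 0" by (auto simp: divide_le_0_iff)
 hence "max 0 ((y - y0) / (fst n - y0)) = 0" by simp
 moreover have "y <= fst n" using Cons.prems by auto
 ultimately show ?case by simp
qed auto

lemma interpolate_const: "F x = v ==> (!!G. G \<in> snd ` set r ==> G x = v) ==> interpolate y0 F r y x = v"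
proof (induction r arbitrary: y0 F)
 case (Cons n r)
 hence "snd n x = v" by auto
 thus ?case using Cons by (auto simp: algebra_simps)
qed auto

definition line_homeo :: "(real => real) => bool" where "line_homeo F \<longleftrightarrow> continuous_on UNIV F & strict_mono F & surj F"

lemma line_homeo_pl: "nodes ns ==> line_homeo (pl ns)" by (auto simp: line_homeo_def pl_continuous pl_strict_mono pl_surj)

lemma interpolate_homeo: "sorted_wrt (<) (y0 # map fst r) ==> line_homeo F ==> (!!G. G \<in> snd ` set r ==> line_homeo G) ==>
  line_homeo (interpolate y0 F r y)"
proof (induction r arbitrary: y0 F)
 case (Cons n r)
 show ?case
 proof (cases "y <= fst n")
  case True
  define t where "t = max 0 ((y - y0) / (fst n - y0))"
  have t: "0 <= t" "t <= 1" using True Cons.prems(1) by (auto simp: t_def)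
  have G: "line_homeo (snd n)" using Cons.prems(3) by auto
  have "line_homeo (%x. (1 - t) * F x + t * snd n x)" using G Cons.prems(2) t unfolding line_homeo_def
   by (intro conjI continuous_on_add continuous_on_mult continuous_on_const
     convex_combination_strict_mono convex_combination_surj) (simp_all add: strict_mono_mono)
  thus ?thesis using True by (simp add: t_def)
 next
  case False
  thus ?thesis using Cons by auto
 qed
qed auto

lemma continuous_interpolate: "sorted_wrt (<) (y0 # map fst r) ==> continuous_on UNIV F ==> (!!G. G \<in> snd ` set r ==> continuous_on UNIV G) ==>
  continuous_on UNIV (%p. interpolate y0 F r (fst p) (snd p))"
proof (induction r arbitrary: y0 F)
 case Nil
 show ?case using Nil(2) by (auto intro: continuous_on_snd_arg)
next
 case (Cons n r)
 have IH: "continuous_on UNIV (%p. interpolate (fst n) (snd n) r (fst p) (snd p))" using Cons.prems by (intro Cons.IH) auto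
 have n: "fst n ~= y0" using Cons.prems(1) by auto
 have "continuous_on UNIV (%p. if fst p <= fst n then (1 - max 0 ((fst p - y0) / (fst n - y0))) * F (snd p) + max 0 ((fst p - y0) / (fst n - y0)) * snd n (snd p)
   else interpolate (fst n) (snd n) r (fst p) (snd p))"
 proof (rule continuous_on_cases_le)
  show "continuous_on {p \<in> UNIV. fst p <= fst n} (%p. (1 - max 0 ((fst p - y0) / (fst n - y0))) * F (snd p) + max 0 ((fst p - y0) / (fst n - y0)) * snd n (snd p))"
   using n Cons.prems(2,3) by (auto intro!: continuous_intros continuous_on_snd_arg)
  show "continuous_on {p \<in> UNIV. fst n <= fst p} (%p. interpolate (fst n) (snd n) r (fst p) (snd p))" using IH by (rule continuous_on_subset) auto
  show "continuous_on UNIV (%p::real \<times> real. fst p)" by (intro continuous_intros)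
  fix p :: "real \<times> real" assume "fst p = fst n"
  moreover have "interpolate (fst n) (snd n) r (fst n) = snd n" using Cons.prems(1) by (intro interpolate_le) auto
  moreover have "max 0 ((fst n - y0) / (fst n - y0)) = 1" using n by simp
  ultimately show "(1 - max 0 ((fst p - y0) / (fst n - y0))) * F (snd p) + max 0 ((fst p - y0) / (fst n - y0)) * snd n (snd p) = interpolate (fst n) (snd n) r (fst p) (snd p)"
   by simp
 qed
 moreover have "(%p. interpolate y0 F (n # r) (fst p) (snd p)) = (%p. if fst p <= fst n then (1 - max 0 ((fst p - y0) / (fst n - y0))) * F (snd p) + max 0 ((fst p - y0) / (fst n - y0)) * snd n (snd p)
   else interpolate (fst n) (snd n) r (fst p) (snd p))" by auto
 ultimately show ?case by metis
qed

lemma fibre_family_interpolate: assumes "sorted_wrt (<) (y0 # map fst r)" "line_homeo F" "!!G. G \<in> snd ` set r ==> line_homeo G"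
 shows "fibre_family (interpolate y0 F r)" unfolding fibre_family_def case_prod_unfold
 using continuous_interpolate[OF assms(1)] interpolate_homeo[OF assms] assms(2,3) by (auto simp: line_homeo_def)

section \<open>Tangles under homeomorphisms and composition\<close>

lemma homeomorphism_plane_simps:
 fixes h g :: "complex => complex" assumes "homeomorphism UNIV UNIV h g"
 shows "g (h x) = x" "h (g x) = x" "inj h" "surj h" "bij h" "continuous_on UNIV h" "continuous_on UNIV g"
 using assms unfolding homeomorphism_def by (auto intro!: injI simp: bij_def) (metis)+

lemma homeomorphism_interior_image:
 fixes h g :: "complex => complex" assumes h: "homeomorphism UNIV UNIV h g" shows "interior (h ` S) = h ` interior S"
proof -
 have sub: "h ` interior S <= interior (h ` S)" if h: "homeomorphism UNIV UNIV h g" for h g :: "complex => complex" and S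
 proof (rule interior_maximal)
  have "h ` interior S = g -` interior S" using homeomorphism_plane_simps(1,2)[OF h] by (auto simp: image_iff) (metis)
  thus "open (h ` interior S)" using open_vimage[OF open_interior homeomorphism_plane_simps(7)[OF h]] by simp
 qed (auto simp: interior_subset image_mono)
 have "g ` interior (h ` S) <= interior (g ` h ` S)" using sub homeomorphism_symD[OF h] by blast
 hence "h ` g ` interior (h ` S) <= h ` interior S" using homeomorphism_plane_simps(1)[OF h] by (auto simp: image_image)
 thus ?thesis using sub[OF h, of S] homeomorphism_plane_simps(2)[OF h] by (auto simp: image_image)
qed

lemma homeomorphism_frontier_image:
 fixes h g :: "complex => complex" assumes h: "homeomorphism UNIV UNIV h g" shows "frontier (h ` S) = h ` frontier S"
proof -
 have b: "bij h" by (rule homeomorphism_plane_simps(5)[OF h])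
 have "closure (h ` S) = h ` closure S" using homeomorphism_interior_image[OF h, of "- S"]
  by (simp add: closure_interior bij_image_Compl_eq[OF b] flip: bij_image_Compl_eq[OF b])
 thus ?thesis using b by (simp add: frontier_def homeomorphism_interior_image[OF h] image_set_diff bij_def)
qed

lemma planar_tangleD: assumes "planar_tangle T" shows "is_disc (outer T)" "finite (inner T)" "!!B. B \<in> inner T ==> is_disc B"
  "!!B. B \<in> boxes T ==> is_disc B" "!!B. B \<in> inner T ==> region B <= interior (region (outer T))"
  "!!B B'. B \<in> inner T ==> B' \<in> inner T ==> B ~= B' ==> region B Int region B' = {}"
  "EX C. finite C & pairwise disjnt C & strings T = \<Union>C & (\<forall>c\<in>C. closed_strand T c | open_strand T c)"
  "!!B. B \<in> boxes T ==> star B \<notin> strings T" "!!B. B \<in> boxes T ==> even (card (boundary_points T B))"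
proof -
 note c = assms[unfolded planar_tangle_def]
 have 1: "is_disc (outer T)" by (rule c[THEN conjunct1])
 have 2: "finite (inner T)" by (rule c[THEN conjunct2, THEN conjunct1])
 have 3: "\<forall>B\<in>inner T. is_disc B & region B <= interior (region (outer T))" by (rule c[THEN conjunct2, THEN conjunct2, THEN conjunct1])
 have 4: "\<forall>B\<in>inner T. \<forall>B'\<in>inner T. B ~= B' --> region B Int region B' = {}"
  by (rule c[THEN conjunct2, THEN conjunct2, THEN conjunct2, THEN conjunct1])
 have 5: "EX C. finite C & pairwise disjnt C & strings T = \<Union>C & (\<forall>c\<in>C. closed_strand T c | open_strand T c)"
  by (rule c[THEN conjunct2, THEN conjunct2, THEN conjunct2, THEN conjunct2, THEN conjunct1])
 have 6: "\<forall>B\<in>boxes T. star B \<notin> strings T & even (card (boundary_points T B))"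
  by (rule c[THEN conjunct2, THEN conjunct2, THEN conjunct2, THEN conjunct2, THEN conjunct2])
 show "is_disc (outer T)" "finite (inner T)" by (rule 1, rule 2)
 show "EX C. finite C & pairwise disjnt C & strings T = \<Union>C & (\<forall>c\<in>C. closed_strand T c | open_strand T c)" by (rule 5)
 fix B
 show "B \<in> inner T ==> is_disc B" "B \<in> inner T ==> region B <= interior (region (outer T))" using 3 by blast+
 show "B \<in> boxes T ==> is_disc B" using 1 3 by (auto simp: boxes_def)
 show "B \<in> boxes T ==> star B \<notin> strings T" "B \<in> boxes T ==> even (card (boundary_points T B))" using 6 by blast+
 show "B \<in> inner T ==> B' \<in> inner T ==> B ~= B' ==> region B Int region B' = {}" for B' using 4 by blast
qed

lemma disc_image_simps [simp]: "region (disc_image h B) = h ` region B" "star (disc_image h B) = h (star B)" by (simp_all add: disc_image_def)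

lemma tangle_image_simps [simp]: "outer (tangle_image h T) = disc_image h (outer T)" "inner (tangle_image h T) = disc_image h ` inner T"
 "strings (tangle_image h T) = h ` strings T" by (simp_all add: tangle_image_def)

lemma compose_tangle_simps [simp]: "outer (compose_tangle T B U) = outer T" "inner (compose_tangle T B U) = (inner T - {B}) Un inner U"
 "strings (compose_tangle T B U) = strings T Un strings U" by (simp_all add: compose_tangle_def)

lemma boxes_tangle_image [simp]: "boxes (tangle_image h T) = disc_image h ` boxes T" by (simp add: boxes_def)

lemma is_disc_image: assumes h: "homeomorphism UNIV UNIV h g" and "is_disc B" shows "is_disc (disc_image h B)"
proof -
 have "homeomorphism (region B) (h ` region B) h g" by (rule homeomorphism_of_subsets[OF h]) auto
 hence 1: "h ` region B homeomorphic region B" using homeomorphism_symD unfolding homeomorphic_def by blast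
 have 2: "region B homeomorphic cball (0::complex) 1" "star B \<in> frontier (region B)" using assms(2) by (simp_all add: is_disc_def)
 show ?thesis using homeomorphic_trans[OF 1 2(1)] 2(2) by (simp add: is_disc_def homeomorphism_frontier_image[OF h])
qed

lemma boundary_points_image: assumes h: "homeomorphism UNIV UNIV h g" shows "boundary_points (tangle_image h T) (disc_image h B) = h ` boundary_points T B"
 using homeomorphism_plane_simps(3)[OF h] by (simp add: boundary_points_def homeomorphism_frontier_image[OF h] image_Int)

lemma box_index_image: assumes h: "homeomorphism UNIV UNIV h g" shows "box_index (tangle_image h T) (disc_image h B) = box_index T B"
 using homeomorphism_plane_simps(3)[OF h] by (simp add: box_index_def boundary_points_image[OF h] card_image[OF inj_on_subset])

lemma exterior_region_image: assumes h: "homeomorphism UNIV UNIV h g" shows "exterior_region (tangle_image h T) = h ` exterior_region T"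
 using homeomorphism_plane_simps(3)[OF h] by (simp add: exterior_region_def homeomorphism_interior_image[OF h] image_set_diff image_UN)

text \<open>Every clause of planarity is topological.\<close>

lemma planar_tangle_image: assumes h: "homeomorphism UNIV UNIV h g" and T: "planar_tangle T" shows "planar_tangle (tangle_image h T)"
proof -
 note H = homeomorphism_plane_simps[OF h]
 let ?T1 = "tangle_image h T"
 have c: "closed_strand ?T1 (h ` c)" if c: "closed_strand T c" for c
 proof -
  obtain gamma where gamma: "simple_path gamma" "pathfinish gamma = pathstart gamma" "c = path_image gamma" "c <= exterior_region T"
   using c unfolding closed_strand_def by blast
  have "simple_path (h \<circ> gamma)" using gamma H by (intro simple_path_continuous_image) (auto intro: continuous_on_subset inj_on_subset)
  thus ?thesis unfolding closed_strand_def using gamma by (intro exI[of _ "h \<circ> gamma"])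
    (auto simp: pathstart_compose pathfinish_compose path_image_compose exterior_region_image[OF h])
 qed
 have o: "open_strand ?T1 (h ` c)" if c: "open_strand T c" for c
 proof -
  obtain gamma where gamma: "arc gamma" "c = path_image gamma" "{pathstart gamma, pathfinish gamma} <= (\<Union>B\<in>boxes T. frontier (region B))"
   "c - {pathstart gamma, pathfinish gamma} <= exterior_region T" using c unfolding open_strand_def by blast
  have "arc (h \<circ> gamma)"
  proof -
   have "simple_path (h \<circ> gamma)" using gamma H by (intro simple_path_continuous_image) (auto intro: continuous_on_subset inj_on_subset arc_imp_simple_path)
   moreover have "pathfinish (h \<circ> gamma) ~= pathstart (h \<circ> gamma)"
    using arc_distinct_ends[OF gamma(1)] injD[OF H(3)] by (metis pathstart_compose pathfinish_compose)
   ultimately show ?thesis using simple_path_eq_arc by blast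
  qed
  moreover have "h ` c - h ` {pathstart gamma, pathfinish gamma} = h ` (c - {pathstart gamma, pathfinish gamma})" using H(3) by (simp add: image_set_diff)
  ultimately show ?thesis unfolding open_strand_def using gamma by (intro exI[of _ "h \<circ> gamma"])
    (auto simp: pathstart_compose pathfinish_compose path_image_compose exterior_region_image[OF h]
     homeomorphism_frontier_image[OF h])
 qed
 obtain C where C: "finite C" "pairwise disjnt C" "strings T = \<Union>C" "\<forall>c\<in>C. closed_strand T c | open_strand T c"
  using planar_tangleD(7)[OF T] by (elim exE conjE)
 have "h ` c Int h ` d = {}" if "c Int d = {}" for c d using that image_Int[OF H(3)] by (metis image_empty)
 hence "pairwise disjnt ((`) h ` C)" using C(2) unfolding pairwise_image pairwise_def disjnt_def by blast
 moreover have "strings ?T1 = \<Union>((`) h ` C)" using C(3) by (simp add: image_Union)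
 ultimately have C': "finite ((`) h ` C)" "pairwise disjnt ((`) h ` C)" "strings ?T1 = \<Union>((`) h ` C)"
  "\<forall>c\<in>(`) h ` C. closed_strand ?T1 c | open_strand ?T1 c" using C(1,4) c o by blast+
 show ?thesis unfolding planar_tangle_def
 proof (intro conjI)
  show "is_disc (outer ?T1)" using planar_tangleD(1)[OF T] is_disc_image[OF h] by simp
  show "finite (inner ?T1)" using planar_tangleD(2)[OF T] by simp
  show "\<forall>B\<in>inner ?T1. is_disc B & region B <= interior (region (outer ?T1))"
   using planar_tangleD(3,5)[OF T] is_disc_image[OF h] by (auto simp: homeomorphism_interior_image[OF h])
  show "\<forall>B\<in>inner ?T1. \<forall>B'\<in>inner ?T1. B ~= B' --> region B Int region B' = {}"
  proof (intro ballI impI)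
   fix B B' assume "B \<in> inner ?T1" "B' \<in> inner ?T1" "B ~= B'"
   then obtain D D' where D: "D \<in> inner T" "D' \<in> inner T" "B = disc_image h D" "B' = disc_image h D'" by auto
   hence "region D Int region D' = {}" using planar_tangleD(6)[OF T] `B ~= B'` by blast
   thus "region B Int region B' = {}" using D image_Int[OF H(3)] by (metis disc_image_simps(1) image_empty)
  qed
  show "EX C. finite C & pairwise disjnt C & strings ?T1 = \<Union>C & (\<forall>c\<in>C. closed_strand ?T1 c | open_strand ?T1 c)" using C' by blast
  have "inj_on h (boundary_points T B)" for B using H(3) inj_on_subset by blast
  thus "\<forall>B\<in>boxes ?T1. star B \<notin> strings ?T1 & even (card (boundary_points ?T1 B))"
   using planar_tangleD(8,9)[OF T] H(3) by (simp add: boundary_points_image[OF h] card_image inj_image_mem_iff)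
 qed
qed

subsection \<open>Gluing strands\<close>

definition arc_between :: "complex set => complex => complex => bool" where
 "arc_between c p q \<longleftrightarrow> (EX g. arc g & path_image g = c & pathstart g = p & pathfinish g = q)"

definition simple_loop :: "complex set => bool" where "simple_loop c \<longleftrightarrow> (EX g. simple_path g & pathfinish g = pathstart g & path_image g = c)"

lemma arc_between_sym: "arc_between c p q ==> arc_between c q p"
 unfolding arc_between_def by (metis arc_reversepath path_image_reversepath pathstart_reversepath pathfinish_reversepath)

lemma arc_between_neq: "arc_between c p q ==> p ~= q" unfolding arc_between_def using arc_distinct_ends by metis

lemma arc_between_ends: "arc_between c p q ==> p \<in> c & q \<in> c" unfolding arc_between_def by auto

lemma arc_between_join: assumes "arc_between a p x" "arc_between b x q" "a Int b <= {x}" shows "arc_between (a Un b) p q"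
proof -
 obtain g1 g2 where g: "arc g1" "path_image g1 = a" "pathstart g1 = p" "pathfinish g1 = x" "arc g2" "path_image g2 = b" "pathstart g2 = x" "pathfinish g2 = q"
  using assms unfolding arc_between_def by blast
 have "arc (g1 +++ g2)" using assms(3) g by (intro arc_join) simp_all
 moreover have "path_image (g1 +++ g2) = a Un b" using g by (simp add: path_image_join)
 moreover have "pathstart (g1 +++ g2) = p" "pathfinish (g1 +++ g2) = q" using g by simp_all
 ultimately show ?thesis unfolding arc_between_def by blast
qed

lemma arc_between_join_loop: assumes "arc_between a p x" "arc_between b x p" "a Int b <= {p, x}" shows "simple_loop (a Un b)"
proof -
 obtain g1 g2 where g: "arc g1" "path_image g1 = a" "pathstart g1 = p" "pathfinish g1 = x" "arc g2" "path_image g2 = b" "pathstart g2 = x" "pathfinish g2 = p"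
  using assms unfolding arc_between_def by blast
 have "simple_path (g1 +++ g2)" using assms(3) g by (intro simple_path_join_loop) simp_all
 moreover have "path_image (g1 +++ g2) = a Un b" using g by (simp add: path_image_join)
 moreover have "pathfinish (g1 +++ g2) = pathstart (g1 +++ g2)" using g by simp
 ultimately show ?thesis unfolding simple_loop_def by (intro exI[of _ "g1 +++ g2"]) simp
qed

text \<open>Strands \<open>C\<close> that may touch at the points of \<open>G\<close>, each of which is an end of exactly two of them;
  \<open>E\<close> is the set of all ends.\<close>

definition strand_system :: "complex set set => complex set => complex set => bool" where "strand_system C E G \<longleftrightarrow> finite C & finite G & G <= E &
   (\<forall>c\<in>C. (EX p q. arc_between c p q & c Int E = {p, q}) | (simple_loop c & c Int E = {})) &
   (\<forall>c\<in>C. \<forall>d\<in>C. c ~= d --> c Int d <= G) &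
   (\<forall>x\<in>G. \<exists>a\<in>C. \<exists>b\<in>C. a ~= b & x \<in> a & x \<in> b & (\<forall>c\<in>C. x \<in> c --> c = a | c = b))"

lemma strand_systemD: assumes "strand_system C E G" shows "finite C" "finite G" "G <= E"
  "!!c. c \<in> C ==> (EX p q. arc_between c p q & c Int E = {p, q}) | (simple_loop c & c Int E = {})" "!!c d. c \<in> C ==> d \<in> C ==> c ~= d ==> c Int d <= G"
  "!!x. x \<in> G ==> \<exists>a\<in>C. \<exists>b\<in>C. a ~= b & x \<in> a & x \<in> b & (\<forall>c\<in>C. x \<in> c --> c = a | c = b)"
proof -
 note c = assms[unfolded strand_system_def]
 show "finite C" "finite G" "G <= E" by (rule c[THEN conjunct1], rule c[THEN conjunct2, THEN conjunct1], rule c[THEN conjunct2, THEN conjunct2, THEN conjunct1])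
 show "(EX p q. arc_between c p q & c Int E = {p, q}) | (simple_loop c & c Int E = {})" if "c \<in> C" for c
  by (rule c[THEN conjunct2, THEN conjunct2, THEN conjunct2, THEN conjunct1, rule_format, OF that])
 show "c Int d <= G" if "c \<in> C" "d \<in> C" "c ~= d" for c d
  by (rule c[THEN conjunct2, THEN conjunct2, THEN conjunct2, THEN conjunct2, THEN conjunct1, rule_format, OF that])
 show "\<exists>a\<in>C. \<exists>b\<in>C. a ~= b & x \<in> a & x \<in> b & (\<forall>c\<in>C. x \<in> c --> c = a | c = b)" if "x \<in> G" for x
  by (rule c[THEN conjunct2, THEN conjunct2, THEN conjunct2, THEN conjunct2, THEN conjunct2, THEN bspec, OF that])
qed

lemma strand_system_arc: assumes "strand_system C E G" "c \<in> C" "x \<in> c" "x \<in> E"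
 obtains p where "arc_between c p x" "c Int E = {p, x}"
proof -
 from strand_systemD(4)[OF assms(1,2)] obtain p q where pq: "arc_between c p q" "c Int E = {p, q}" using assms(3,4) by (elim disjE exE conjE) auto
 have "x = p | x = q" using assms(3,4) pq(2) by blast
 thus ?thesis
 proof
  assume "x = p"
  hence "arc_between c q x" "c Int E = {q, x}" using pq arc_between_sym by (simp_all add: insert_commute)
  thus ?thesis by (rule that)
 next
  assume "x = q"
  thus ?thesis using that[of p] pq by simp
 qed
qed

text \<open>Two strands with a common end in \<open>G\<close> are joined there.  They may have their other ends in common as well, in which
case they form a closed loop; otherwise the result is a longer arc.\<close>

lemma glue_step: assumes S: "strand_system C E G" and "x \<in> G"
 shows "EX C' E' G'. strand_system C' E' G' & \<Union>C' = \<Union>C & E' - G' = E - G & G' \<subset> G"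
proof -
 have fin: "finite C" "finite G" "G <= E" and mem: "!!c. c \<in> C ==> (EX p q. arc_between c p q & c Int E = {p, q}) | (simple_loop c & c Int E = {})"
  and int: "!!c d. c \<in> C ==> d \<in> C ==> c ~= d ==> c Int d <= G"
  and two: "!!y. y \<in> G ==> \<exists>a\<in>C. \<exists>b\<in>C. a ~= b & y \<in> a & y \<in> b & (\<forall>c\<in>C. y \<in> c --> c = a | c = b)"
  by (rule strand_systemD[OF S]; assumption)+
 obtain a b where ab: "a \<in> C" "b \<in> C" "a ~= b" "x \<in> a" "x \<in> b" and only: "!!c. c \<in> C ==> x \<in> c ==> c = a | c = b"
  using two[OF `x \<in> G`] by blast
 have xE: "x \<in> E" using `x \<in> G` fin by blast
 obtain p where p: "arc_between a p x" "a Int E = {p, x}" using strand_system_arc[OF S ab(1,4) xE] .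
 obtain q where q: "arc_between b q x" "b Int E = {q, x}" using strand_system_arc[OF S ab(2,5) xE] .
 have px: "p ~= x" "q ~= x" using p q arc_between_neq by auto
 have pin: "p \<in> a" "q \<in> b" using p q arc_between_ends by auto
 have iab: "a Int b <= {p, x} Int {q, x}" using int[OF ab(1,2,3)] fin(3) p(2) q(2) by blast
 define N where "N = (if p = q then {x, p} else {x})"
 define C' where "C' = insert (a Un b) (C - {a, b})"
 have N: "N <= G" using `x \<in> G` int[OF ab(1,2,3)] pin by (auto simp: N_def)
 have old: "c Int N = {}" if c: "c \<in> C" "c ~= a" "c ~= b" for c
 proof -
  have "x \<notin> c" using only c by blast
  moreover have "p \<notin> c" if "p = q"
  proof -
   have "p \<in> G" using N that by (auto simp: N_def)
   thus ?thesis using two[of p] pin that c ab(1,2,3) by metis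
  qed
  ultimately show ?thesis by (auto simp: N_def)
 qed
 have "strand_system C' (E - N) (G - N)" unfolding strand_system_def
 proof (intro conjI ballI impI)
  show "finite C'" "finite (G - N)" "G - N <= E - N" using fin by (auto simp: C'_def)
 next
  fix c assume "c \<in> C'"
  then consider "c = a Un b" | "c \<in> C" "c ~= a" "c ~= b" by (auto simp: C'_def)
  thus "(EX p q. arc_between c p q & c Int (E - N) = {p, q}) | (simple_loop c & c Int (E - N) = {})"
  proof cases
   case 1
   show ?thesis
   proof (cases "p = q")
    case True
    have "simple_loop c" unfolding 1 using arc_between_join_loop[OF p(1)] arc_between_sym[OF q(1)] iab True by auto
    moreover have "c Int (E - N) = {}" using 1 p(2) q(2) True by (auto simp: N_def)
    ultimately show ?thesis by blast
   next
    case False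
    have "arc_between c p q" unfolding 1 using arc_between_join[OF p(1) arc_between_sym[OF q(1)]] iab False by auto
    moreover have "c Int (E - N) = {p, q}" using 1 p(2) q(2) False px by (auto simp: N_def)
    ultimately show ?thesis by blast
   qed
  next
   case 2
   hence "c Int (E - N) = c Int E" using old by blast
   thus ?thesis using mem 2 by simp
  qed
 next
  have n1: "c Int (a Un b) <= G - N" if "c \<in> C" "c ~= a" "c ~= b" for c using int[OF that(1) ab(1) that(2)] int[OF that(1) ab(2) that(3)] old[OF that] by blast
  have n2: "c Int d <= G - N" if "c \<in> C" "c ~= a" "c ~= b" "d \<in> C" "c ~= d" for c d using int[OF that(1) that(4) that(5)] old[OF that(1,2,3)] by blast
  fix c d assume cd: "c \<in> C'" "d \<in> C'" "c ~= d"
  then consider "c = a Un b" "d \<in> C" "d ~= a" "d ~= b" | "d = a Un b" "c \<in> C" "c ~= a" "c ~= b"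
   | "c \<in> C" "c ~= a" "c ~= b" "d \<in> C" unfolding C'_def by blast
  thus "c Int d <= G - N"
  proof cases
   case 1 thus ?thesis using n1[OF 1(2,3,4)] by (simp only: Int_commute)
  next
   case 2 thus ?thesis using n1[OF 2(2,3,4)] by simp
  next
   case 3 thus ?thesis using n2[OF 3 cd(3)] by simp
  qed
 next
  fix y assume y: "y \<in> G - N"
  then obtain a' b' where ab': "a' \<in> C" "b' \<in> C" "a' ~= b'" "y \<in> a'" "y \<in> b'" "!!c. c \<in> C ==> y \<in> c ==> c = a' | c = b'"
   using two[of y] by blast
  have not_ab: "\<not> (y \<in> a & y \<in> b)" using iab y unfolding N_def by (cases "p = q") auto
  have new: "a Un b ~= c" if "c \<in> C" "c ~= a" "c ~= b" for c using old[OF that] ab unfolding N_def by (cases "p = q") auto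
  show "\<exists>a\<in>C'. \<exists>b\<in>C'. a ~= b & y \<in> a & y \<in> b & (\<forall>c\<in>C'. y \<in> c --> c = a | c = b)"
  proof (cases "y \<in> a | y \<in> b")
   case True
   hence "EX d. d \<in> C & d ~= a & d ~= b & y \<in> d & (\<forall>c\<in>C. y \<in> c --> c = a | c = b | c = d)"
   proof (cases "a' = a | a' = b")
    case True
    hence "b' ~= a" "b' ~= b" using ab'(3,4,5) not_ab by blast+
    moreover have "\<forall>c\<in>C. y \<in> c --> c = a | c = b | c = b'" using ab'(6) True by metis
    ultimately show ?thesis using ab'(2,5) by (intro exI[of _ b']) simp
   next
    case False
    have "b' = a | b' = b" using `y \<in> a | y \<in> b` ab'(6)[OF ab(1)] ab'(6)[OF ab(2)] False by metis
    hence "\<forall>c\<in>C. y \<in> c --> c = a | c = b | c = a'" using ab'(6) by metis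
    thus ?thesis using ab'(1,4) False by (intro exI[of _ a']) simp
   qed
   then obtain d where d: "d \<in> C" "d ~= a" "d ~= b" "y \<in> d" and d5: "\<forall>c\<in>C. y \<in> c --> c = a | c = b | c = d" by (elim exE conjE)
   have u: "c = a Un b | c = d" if "c \<in> C'" "y \<in> c" for c using that d5 unfolding C'_def by blast
   have in': "a Un b \<in> C'" "d \<in> C'" "y \<in> a Un b" using d True by (simp_all add: C'_def)
   show ?thesis by (rule bexI[where x = "a Un b"], rule bexI[where x = d], intro conjI ballI impI) (rule new[OF d(1,2,3)] in' d(4) u; assumption?)+
  next
   case False
   have ne: "a' ~= a" "a' ~= b" "b' ~= a" "b' ~= b" using False ab'(4,5) by auto
   have in': "a' \<in> C'" "b' \<in> C'" using ab'(1,2) ne by (simp_all add: C'_def)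
   have u: "c = a' | c = b'" if "c \<in> C'" "y \<in> c" for c
   proof -
    have "c \<in> C" using that False by (auto simp: C'_def)
    thus ?thesis by (rule ab'(6)) (rule that)
   qed
   show ?thesis by (rule bexI[where x = a'], rule bexI[where x = b'], intro conjI ballI impI) (rule ab'(3,4,5) in' u; assumption?)+
  qed
 qed
 moreover have "\<Union>C' = \<Union>C" using ab by (auto simp: C'_def)
 moreover have "E - N - (G - N) = E - G" using N by blast
 moreover have "G - N \<subset> G" using `x \<in> G` by (auto simp: N_def)
 ultimately show ?thesis by blast
qed

text \<open>Gluing one touching point after the other produces disjoint strands.\<close>

lemma glue_strands: assumes "strand_system C E G" shows "EX C'. strand_system C' (E - G) {} & \<Union>C' = \<Union>C" using assms
proof (induction "card G" arbitrary: C E G rule: less_induct)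
 case less
 show ?case
 proof (cases "G = {}")
  case True thus ?thesis using less.prems by auto
 next
  case False
  then obtain C' E' G' where *: "strand_system C' E' G'" "\<Union>C' = \<Union>C" "E' - G' = E - G" "G' \<subset> G" using glue_step[OF less.prems] by blast
  have "finite G" using strand_systemD(2)[OF less.prems] .
  hence "card G' < card G" using * by (simp add: psubset_card_mono)
  thus ?thesis using less.hyps[OF _ *(1)] * by auto
 qed
qed

definition box_frontiers :: "tangle => complex set" where "box_frontiers T = (\<Union>B\<in>boxes T. frontier (region B))"

lemma planar_tangleI: assumes "is_disc (outer T)" "finite (inner T)" "!!B. B \<in> inner T ==> is_disc B & region B <= interior (region (outer T))"
  "!!B B'. B \<in> inner T ==> B' \<in> inner T ==> B ~= B' ==> region B Int region B' = {}" "strand_system C E G" "strings T = \<Union>C"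
  "strings T - (E - G) <= exterior_region T" "E - G <= box_frontiers T" "!!B. B \<in> boxes T ==> star B \<notin> strings T & even (card (boundary_points T B))"
 shows "planar_tangle T"
proof -
 obtain C' where C': "strand_system C' (E - G) {}" "\<Union>C' = \<Union>C" using glue_strands assms(5) by blast
 have "closed_strand T c | open_strand T c" if c: "c \<in> C'" for c
 proof -
  have cs: "c <= strings T" using c C' assms(6) by blast
  have "(EX p q. arc_between c p q & c Int (E - G) = {p, q}) | (simple_loop c & c Int (E - G) = {})" by (rule strand_systemD(4)[OF C'(1) c])
  thus ?thesis
  proof (elim disjE exE conjE)
   fix p q assume pq: "arc_between c p q" "c Int (E - G) = {p, q}"
   then obtain g where "arc g" "path_image g = c" "pathstart g = p" "pathfinish g = q" unfolding arc_between_def by blast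
   moreover have "{p, q} <= box_frontiers T" using pq assms(8) by blast
   moreover have "c - {p, q} <= exterior_region T" using pq cs assms(7) by blast
   ultimately have "open_strand T c" unfolding open_strand_def box_frontiers_def by blast
   thus ?thesis ..
  next
   assume c0: "simple_loop c" "c Int (E - G) = {}"
   hence "c <= exterior_region T" using cs assms(7) by blast
   thus ?thesis using c0 unfolding simple_loop_def closed_strand_def by blast
  qed
 qed
 hence strand: "\<forall>c\<in>C'. closed_strand T c | open_strand T c" by blast
 have fin: "finite C'" by (rule strand_systemD(1)[OF C'(1)])
 have dis: "pairwise disjnt C'"
 proof (rule pairwiseI)
  fix c d assume "c \<in> C'" "d \<in> C'" "c ~= d"
  thus "disjnt c d" using strand_systemD(5)[OF C'(1)] unfolding disjnt_def by blast
 qed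
 have eq: "strings T = \<Union>C'" using assms(6) C'(2) by simp
 show ?thesis unfolding planar_tangle_def by (intro conjI ballI impI exI[of _ C'] fin dis eq strand assms(1,2)) (blast dest: assms(3,4,9))+
qed

lemma is_disc_closed: "is_disc B ==> closed (region B)" unfolding is_disc_def using homeomorphic_compactness compact_cball compact_imp_closed by blast

lemma frontier_region_subset: "is_disc B ==> frontier (region B) <= region B" by (simp add: is_disc_closed frontier_subset_closed)

lemma exterior_frontier_disjoint: assumes "planar_tangle T" shows "exterior_region T Int box_frontiers T = {}"
proof -
 have "x \<notin> exterior_region T" if x: "x \<in> frontier (region B)" "B \<in> boxes T" for x B
 proof (cases "B = outer T")
  case True thus ?thesis using x by (simp add: exterior_region_def frontier_def)
 next
  case False
  hence "B \<in> inner T" using x by (simp add: boxes_def)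
  thus ?thesis using x(1) frontier_region_subset[OF planar_tangleD(3)[OF assms]] by (auto simp: exterior_region_def)
 qed
 thus ?thesis by (auto simp: box_frontiers_def)
qed

lemma planar_tangle_strands: assumes T: "planar_tangle T"
 obtains C where "strand_system C (strings T Int box_frontiers T) {}" "\<Union>C = strings T" "strings T - box_frontiers T <= exterior_region T"
proof -
 obtain C where C: "finite C" "pairwise disjnt C" "strings T = \<Union>C" "\<forall>c\<in>C. closed_strand T c | open_strand T c"
  using planar_tangleD(7)[OF T] by (elim exE conjE)
 note ex = exterior_frontier_disjoint[OF T]
 have c: "((EX p q. arc_between c p q & c Int (strings T Int box_frontiers T) = {p, q}) |
   (simple_loop c & c Int (strings T Int box_frontiers T) = {})) & c - box_frontiers T <= exterior_region T"
  if c: "c \<in> C" for c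
 proof -
  have cs: "c <= strings T" using c C by blast
  from C(4)[rule_format, OF c] show ?thesis
  proof
   assume "closed_strand T c"
   hence "simple_loop c" "c <= exterior_region T" unfolding closed_strand_def simple_loop_def by blast+
   thus ?thesis using ex by blast
  next
   assume "open_strand T c"
   then obtain g where g: "arc g" "c = path_image g" "{pathstart g, pathfinish g} <= box_frontiers T" "c - {pathstart g, pathfinish g} <= exterior_region T"
    unfolding open_strand_def box_frontiers_def by blast
   have ar: "arc_between c (pathstart g) (pathfinish g)" using g unfolding arc_between_def by blast
   hence "c Int (strings T Int box_frontiers T) = {pathstart g, pathfinish g}" using g ex cs arc_between_ends[OF ar] by blast
   thus ?thesis using ar g by blast
  qed
 qed
 have "strand_system C (strings T Int box_frontiers T) {}" unfolding strand_system_def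
 proof (intro conjI ballI impI)
  fix d assume "d \<in> C"
  thus "(EX p q. arc_between d p q & d Int (strings T Int box_frontiers T) = {p, q}) |
   (simple_loop d & d Int (strings T Int box_frontiers T) = {})" using c[of d] by blast
 next
  fix d d' assume "d \<in> C" "d' \<in> C" "d ~= d'"
  thus "d Int d' <= {}" using C(2) unfolding pairwise_def disjnt_def by blast
 qed (use C(1) in auto)
 moreover have "strings T - box_frontiers T <= exterior_region T" using c C(3) by blast
 ultimately show ?thesis using that C(3) by blast
qed

lemma arc_between_infinite: "arc_between c p q ==> infinite c"
proof
 assume c: "arc_between c p q" "finite c"
 hence "connected c" unfolding arc_between_def using connected_arc_image by blast
 hence "c = {} | (EX a. c = {a})" using c(2) connected_finite_iff_sing by blast
 thus False using arc_between_ends[OF c(1)] arc_between_neq[OF c(1)] by auto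
qed

lemma compose_geometry: assumes "composable T B U" shows "strings T Int region B <= frontier (region B)" "strings U <= region B"
  "strings T Int strings U <= boundary_points T B" "!!B'. B' \<in> boxes T ==> B' ~= B ==> frontier (region B') Int region B = {}"
  "!!B'. B' \<in> inner U ==> region B' <= interior (region B)"
  "!!B'. B' \<in> inner T ==> region B' <= interior (region (outer T)) & frontier (region B') <= region B'"
  "!!B'. B' \<in> inner T ==> B' ~= B ==> region B' Int region B = {}" "!!B'. B' \<in> inner U ==> frontier (region B') <= region B'"
proof -
 have T: "planar_tangle T" and U: "planar_tangle U" and B: "B \<in> inner T" "outer U = B" using assms unfolding composable_def by auto
 have oB: "region B <= interior (region (outer T))" using planar_tangleD(5)[OF T] B by blast
 have dB: "frontier (region B') <= region B'" if "B' \<in> boxes T" for B' using planar_tangleD(4)[OF T that] frontier_region_subset by blast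
 show 4: "frontier (region B') Int region B = {}" if "B' \<in> boxes T" "B' ~= B" for B'
 proof (cases "B' = outer T")
  case True thus ?thesis using oB by (auto simp: frontier_def)
 next
  case False
  hence "B' \<in> inner T" using that by (auto simp: boxes_def)
  thus ?thesis using planar_tangleD(6)[OF T _ B(1) that(2)] dB[OF that(1)] by blast
 qed
 have sT: "strings T <= exterior_region T Un box_frontiers T" using planar_tangle_strands[OF T] by blast
 show 1: "strings T Int region B <= frontier (region B)"
 proof
  fix x assume x: "x \<in> strings T Int region B"
  hence "x \<notin> exterior_region T" using B by (auto simp: exterior_region_def)
  then obtain B' where "B' \<in> boxes T" "x \<in> frontier (region B')" using sT x by (auto simp: box_frontiers_def)
  thus "x \<in> frontier (region B)" using 4[of B'] x by blast
 qed
 have dU: "region B' <= region B" "frontier (region B') <= region B'" if "B' \<in> boxes U" for B'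
  using planar_tangleD(5)[OF U, of B'] B that interior_subset[of "region B"] frontier_region_subset[OF planar_tangleD(4)[OF U that]] by (auto simp: boxes_def)
 have "strings U <= exterior_region U Un box_frontiers U" using planar_tangle_strands[OF U] by blast
 thus 2: "strings U <= region B"
 proof (rule subset_trans, intro Un_least)
  show "exterior_region U <= region B" using B(2) interior_subset by (auto simp: exterior_region_def)
  show "box_frontiers U <= region B" using dU unfolding box_frontiers_def by blast
 qed
 show "strings T Int strings U <= boundary_points T B" using 1 2 by (auto simp: boundary_points_def)
 show "region B' <= interior (region B)" "frontier (region B') <= region B'" if "B' \<in> inner U" for B'
  using planar_tangleD(5)[OF U that] B dU(2) that by (simp_all add: boxes_def)
 show "region B' <= interior (region (outer T)) & frontier (region B') <= region B'" if "B' \<in> inner T" for B'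
  using planar_tangleD(5)[OF T that] dB that by (simp add: boxes_def)
 show "region B' Int region B = {}" if "B' \<in> inner T" "B' ~= B" for B' using planar_tangleD(6)[OF T that(1) B(1) that(2)] .
qed

lemma boundary_points_compose: assumes "composable T B U" shows "B' \<in> boxes T ==> B' ~= B ==> boundary_points (compose_tangle T B U) B' = boundary_points T B'"
  "B' \<in> inner U ==> boundary_points (compose_tangle T B U) B' = boundary_points U B'"
proof -
 note g = compose_geometry[OF assms]
 show "boundary_points (compose_tangle T B U) B' = boundary_points T B'" if "B' \<in> boxes T" "B' ~= B" using g(2) g(4)[OF that] by (auto simp: boundary_points_def)
 show "boundary_points (compose_tangle T B U) B' = boundary_points U B'" if "B' \<in> inner U"
 proof -
  have "frontier (region B') Int strings T = {}" using g(1) g(5)[OF that] g(8)[OF that] interior_subset[of "region B"] unfolding frontier_def[of "region B"] by blast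
  thus ?thesis by (auto simp: boundary_points_def)
 qed
qed

text \<open>The strands of both tangles may touch at the boundary points of the box that is filled, and each of these points
is the end of exactly one strand of either tangle.  Hence the union is a strand system, which can be glued.\<close>

lemma planar_compose: assumes c: "composable T B U" shows "planar_tangle (compose_tangle T B U)"
proof -
 note g = compose_geometry[OF c]
 have T: "planar_tangle T" and U: "planar_tangle U" and B: "B \<in> inner T" "outer U = B" and bd: "boundary_points T B = boundary_points U B"
  using c unfolding composable_def by auto
 define V where "V = compose_tangle T B U"
 define G where "G = boundary_points T B"
 define ET where "ET = strings T Int box_frontiers T"
 define EU where "EU = strings U Int box_frontiers U"
 obtain CT where CT: "strand_system CT ET {}" "\<Union>CT = strings T" "strings T - box_frontiers T <= exterior_region T"
  using planar_tangle_strands[OF T] unfolding ET_def .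
 obtain CU where CU: "strand_system CU EU {}" "\<Union>CU = strings U" "strings U - box_frontiers U <= exterior_region U"
  using planar_tangle_strands[OF U] unfolding EU_def .
 have GT: "G <= ET" using B by (auto simp: G_def ET_def boundary_points_def box_frontiers_def boxes_def)
 have GU: "G <= EU" using B unfolding G_def bd by (auto simp: EU_def boundary_points_def box_frontiers_def boxes_def)
 have TU: "strings T Int strings U = G" using g(3) GT GU by (auto simp: G_def ET_def EU_def)
 have finE: "finite E" if "strand_system C E {}" "\<Union>C = S" "E <= S" for C E S
 proof -
  have "finite (c Int E)" if "c \<in> C" for c using strand_systemD(4)[OF `strand_system C E {}` that] by auto
  hence "finite (\<Union>c\<in>C. c Int E)" using strand_systemD(1)[OF that(1)] by blast
  moreover have "(\<Union>c\<in>C. c Int E) = E" using that by blast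
  ultimately show ?thesis by simp
 qed
 have "finite ET" using finE[OF CT(1,2)] by (auto simp: ET_def)
 hence finG: "finite G" using GT finite_subset by blast
 note CTm = strand_systemD(4)[OF CT(1)] and CTf = strand_systemD(1)[OF CT(1)]
 have CTi: "!!c d. c \<in> CT ==> d \<in> CT ==> c ~= d ==> c Int d = {}" using strand_systemD(5)[OF CT(1)] by blast
 note CUm = strand_systemD(4)[OF CU(1)] and CUf = strand_systemD(1)[OF CU(1)]
 have CUi: "!!c d. c \<in> CU ==> d \<in> CU ==> c ~= d ==> c Int d = {}" using strand_systemD(5)[OF CU(1)] by blast
 have diff: "c \<notin> CU" if "c \<in> CT" for c
 proof
  assume "c \<in> CU"
  hence "c <= G" using that CT(2) CU(2) TU by blast
  hence "finite c" "c <= ET" using finG GT finite_subset by blast+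
  from CTm[OF that] show False
  proof (elim disjE exE conjE)
   fix p q assume "arc_between c p q" thus False using `finite c` arc_between_infinite by blast
  next
   assume "simple_loop c" "c Int ET = {}"
   moreover have "c ~= {}" using `simple_loop c` path_image_nonempty unfolding simple_loop_def by metis
   ultimately show False using `c <= ET` by blast
  qed
 qed
 have sys: "strand_system (CT Un CU) (ET Un EU) G" unfolding strand_system_def
 proof (intro conjI ballI impI)
  show "finite (CT Un CU)" "finite G" "G <= ET Un EU" using CTf CUf finG GT by auto
 next
  fix c assume "c \<in> CT Un CU"
  thus "(EX p q. arc_between c p q & c Int (ET Un EU) = {p, q}) | (simple_loop c & c Int (ET Un EU) = {})"
  proof
   assume a: "c \<in> CT"
   hence "c Int (ET Un EU) = c Int ET" using CT(2) TU GT by (auto simp: EU_def)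
   thus ?thesis using CTm[OF a] by simp
  next
   assume a: "c \<in> CU"
   hence "c Int (ET Un EU) = c Int EU" using CU(2) TU GU by (auto simp: ET_def)
   thus ?thesis using CUm[OF a] by simp
  qed
 next
  fix c d assume "c \<in> CT Un CU" "d \<in> CT Un CU" "c ~= d"
  moreover have "c Int d <= G" if "c \<in> CT" "d \<in> CU" for c d
  proof -
   have "c <= strings T" "d <= strings U" using that CT(2) CU(2) by blast+
   thus ?thesis using TU by blast
  qed
  ultimately show "c Int d <= G" using CTi[of c d] CUi[of c d] by (metis Un_iff Int_commute empty_subsetI)
 next
  fix x assume x: "x \<in> G"
  hence "x \<in> \<Union>CT" "x \<in> \<Union>CU" unfolding CT(2) CU(2) using TU by auto
  then obtain a b where ab: "a \<in> CT" "x \<in> a" "b \<in> CU" "x \<in> b" by blast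
  have ne: "a ~= b" using diff[OF ab(1)] ab(3) by blast
  have u: "c = a | c = b" if "c \<in> CT Un CU" "x \<in> c" for c
  proof (cases "c \<in> CT")
   case True
   hence "c = a" using CTi[OF _ ab(1), of c] that(2) ab(2) by blast
   thus ?thesis ..
  next
   case False
   hence "c = b" using CUi[OF _ ab(3), of c] that ab(4) by blast
   thus ?thesis ..
  qed
  show "\<exists>a\<in>CT Un CU. \<exists>b\<in>CT Un CU. a ~= b & x \<in> a & x \<in> b & (\<forall>c\<in>CT Un CU. x \<in> c --> c = a | c = b)"
   by (rule bexI[where x = a], rule bexI[where x = b], intro conjI ballI impI) (rule ne ab UnI1[OF ab(1)] UnI2[OF ab(3)] u; assumption?)+
 qed
 have oB: "region B <= interior (region (outer T))" using g(6) B by blast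
 have out: "outer T ~= B"
 proof
  assume "outer T = B"
  moreover have "star B \<in> frontier (region B)" using planar_tangleD(3)[OF T B(1)] by (simp add: is_disc_def)
  ultimately show False using oB g(6)[OF B(1)] by (auto simp: frontier_def)
 qed
 show ?thesis
 proof (rule planar_tangleI[of _ "CT Un CU" "ET Un EU" G])
  show "is_disc (outer (compose_tangle T B U))" "finite (inner (compose_tangle T B U))" using planar_tangleD(1,2)[OF T] planar_tangleD(2)[OF U] by simp_all
  show "strand_system (CT Un CU) (ET Un EU) G" by (rule sys)
  show "strings (compose_tangle T B U) = \<Union> (CT Un CU)" using CT CU by auto
 next
  fix B' assume B': "B' \<in> inner (compose_tangle T B U)"
  show "is_disc B' & region B' <= interior (region (outer (compose_tangle T B U)))"
  proof (cases "B' \<in> inner T")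
   case True thus ?thesis using planar_tangleD(3,5)[OF T] by simp
  next
   case False
   hence "B' \<in> inner U" using B' by auto
   thus ?thesis using planar_tangleD(3)[OF U] g(5)[of B'] oB interior_subset[of "region B"] by auto
  qed
 next
  fix B1 B2 assume "B1 \<in> inner (compose_tangle T B U)" "B2 \<in> inner (compose_tangle T B U)" "B1 ~= B2"
  moreover have "region B1 Int region B2 = {}" if "B1 \<in> inner T" "B1 ~= B" "B2 \<in> inner U" for B1 B2
   using g(7)[OF that(1,2)] g(5)[OF that(3)] interior_subset by blast
  ultimately show "region B1 Int region B2 = {}" using planar_tangleD(6)[OF T, of B1 B2] planar_tangleD(6)[OF U, of B1 B2]
   by (simp only: compose_tangle_simps Un_iff Diff_iff singleton_iff) (metis Int_commute)
 next
  show "strings (compose_tangle T B U) - (ET Un EU - G) <= exterior_region (compose_tangle T B U)"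
  proof
   fix x assume x: "x \<in> strings (compose_tangle T B U) - (ET Un EU - G)"
   consider "x \<in> G" | "x \<in> strings T" "x \<notin> ET" | "x \<in> strings U" "x \<notin> EU" "x \<notin> G" using x by auto
   thus "x \<in> exterior_region (compose_tangle T B U)"
   proof cases
    case 1
    hence xB: "x \<in> frontier (region B)" by (auto simp: G_def boundary_points_def)
    hence "x \<in> region B" using g(6) B by blast
    hence "x \<in> interior (region (outer T))" using oB by blast
    moreover have "x \<notin> region B'" if "B' \<in> inner T" "B' ~= B" for B' using g(7)[OF that] `x \<in> region B` by blast
    moreover have "x \<notin> region B'" if "B' \<in> inner U" for B' using g(5)[OF that] xB by (auto simp: frontier_def)
    ultimately show ?thesis by (auto simp: exterior_region_def)
   next
    case 2
    hence "x \<in> exterior_region T" using CT(3) by (auto simp: ET_def)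
    moreover have "x \<notin> region B'" if "B' \<in> inner U" for B'
     using subsetD[OF subset_trans[OF g(5)[OF that] interior_subset]] calculation B(1) by (auto simp: exterior_region_def)
    ultimately show ?thesis by (auto simp: exterior_region_def)
   next
    case 3
    hence xU: "x \<in> exterior_region U" using CU(3) by (auto simp: EU_def)
    hence xB: "x \<in> region B" using B(2) interior_subset[of "region B"] by (auto simp: exterior_region_def)
    moreover have "x \<notin> region B'" if "B' \<in> inner T" "B' ~= B" for B' using g(7)[OF that] xB by blast
    ultimately show ?thesis using oB xU by (auto simp: exterior_region_def)
   qed
  qed
  show "ET Un EU - G <= box_frontiers (compose_tangle T B U)"
  proof
   fix x assume x: "x \<in> ET Un EU - G"
   show "x \<in> box_frontiers (compose_tangle T B U)"
   proof (cases "x \<in> ET")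
    case True
    then obtain B' where B': "B' \<in> boxes T" "x \<in> frontier (region B')" "x \<in> strings T" by (auto simp: ET_def box_frontiers_def)
    hence "B' ~= B" using x by (auto simp: G_def boundary_points_def)
    thus ?thesis using B' by (auto simp: box_frontiers_def boxes_def)
   next
    case False
    hence xU: "x \<in> EU" using x by auto
    then obtain B' where B': "B' \<in> boxes U" "x \<in> frontier (region B')" "x \<in> strings U" by (auto simp: EU_def box_frontiers_def)
    hence "B' ~= B" using x unfolding G_def bd by (auto simp: boundary_points_def)
    thus ?thesis using B' B(2) by (auto simp: box_frontiers_def boxes_def)
   qed
  qed
 next
  fix B' assume "B' \<in> boxes (compose_tangle T B U)"
  then consider "B' \<in> boxes T" "B' ~= B" | "B' \<in> inner U" using out by (auto simp: boxes_def)
  thus "star B' \<notin> strings (compose_tangle T B U) & even (card (boundary_points (compose_tangle T B U) B'))"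
  proof cases
   case 1
   have "is_disc B'" using 1 planar_tangleD(4)[OF T] by blast
   hence "star B' \<notin> region B" using g(4)[OF 1] by (auto simp: is_disc_def)
   hence "star B' \<notin> strings U" using g(2) by blast
   thus ?thesis using planar_tangleD(8,9)[OF T 1(1)] boundary_points_compose(1)[OF c 1] by simp
  next
   case 2
   have "is_disc B'" using 2 planar_tangleD(3)[OF U] by blast
   hence "star B' \<in> interior (region B)" using g(5,8)[OF 2] by (auto simp: is_disc_def)
   hence "star B' \<notin> strings T" using g(1) interior_subset[of "region B"] by (auto simp: frontier_def)
   thus ?thesis using planar_tangleD(8,9)[OF U, of B'] 2 boundary_points_compose(2)[OF c 2] by (simp add: boxes_def)
  qed
 qed
qed

section \<open>Rectangles and vertical strands\<close>

lemma rect_iff: "z \<in> rect a b c d \<longleftrightarrow> a <= Re z & Re z <= b & c <= Im z & Im z <= d" by (auto simp: rect_def in_cbox_complex_iff)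

lemma interior_rect_iff: "z \<in> interior (rect a b c d) \<longleftrightarrow> a < Re z & Re z < b & c < Im z & Im z < d"
 by (auto simp: rect_def interior_cbox in_box_complex_iff)

lemma frontier_rect_iff: "z \<in> frontier (rect a b c d) \<longleftrightarrow>
  a <= Re z & Re z <= b & c <= Im z & Im z <= d & (Re z = a | Re z = b | Im z = c | Im z = d)"
proof -
 have "frontier (rect a b c d) = rect a b c d - interior (rect a b c d)" by (simp add: frontier_def rect_def closure_closed closed_cbox)
 thus ?thesis by (auto simp: rect_iff interior_rect_iff)
qed

lemma rect_homeomorphic_disc: assumes "a < b" "c < d" shows "rect a b c d homeomorphic cball (0::complex) 1"
proof -
 have "Complex ((a + b) / 2) ((c + d) / 2) \<in> interior (rect a b c d)" using assms by (auto simp: interior_rect_iff)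
 thus ?thesis unfolding rect_def by (intro homeomorphic_convex_compact_cball) (auto simp: convex_box compact_cbox)
qed

lemma lbox_simps [simp]: "region (lbox a b c d) = rect a b c d" "star (lbox a b c d) = Complex a ((c + d) / 2)" by (simp_all add: lbox_def)

lemma rbox_simps [simp]: "region (rbox a b c d) = rect a b c d" "star (rbox a b c d) = Complex b ((c + d) / 2)" by (simp_all add: rbox_def)

lemma is_disc_lbox: "a < b ==> c < d ==> is_disc (lbox a b c d)" by (auto simp: is_disc_def rect_homeomorphic_disc frontier_rect_iff)

lemma is_disc_rbox: "a < b ==> c < d ==> is_disc (rbox a b c d)" by (auto simp: is_disc_def rect_homeomorphic_disc frontier_rect_iff)

lemma lbox_neq: "a ~= a' | c + d ~= c' + d' ==> lbox a b c d ~= lbox a' b' c' d'" by (auto simp: lbox_def)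

lemma vline_iff: "z \<in> vline x c d \<longleftrightarrow> Re z = x & min c d <= Im z & Im z <= max c d"
 unfolding vline_def closed_segment_same_Re[of "Complex x c" "Complex x d", simplified] by (auto simp: closed_segment_eq_real_ivl)

lemma hline_iff: "z \<in> hline a b y \<longleftrightarrow> Im z = y & min a b <= Re z & Re z <= max a b"
 unfolding hline_def closed_segment_same_Im[of "Complex a y" "Complex b y", simplified] by (auto simp: closed_segment_eq_real_ivl)

definition stripes :: "(nat => real) => nat => real => real => complex set" where "stripes p k c d = (\<Union>i\<in>{1..k}. vline (p i) c d)"

definition points :: "(nat => real) => nat => real => complex set" where "points p k y = (%i. Complex (p i) y) ` {1..k}"

lemma stripes_iff: "c <= d ==> z \<in> stripes p k c d \<longleftrightarrow> (\<exists>i\<in>{1..k}. Re z = p i) & c <= Im z & Im z <= d"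
 by (auto simp: stripes_def vline_iff)

lemma points_iff: "z \<in> points p k y \<longleftrightarrow> (\<exists>i\<in>{1..k}. Re z = p i) & Im z = y" by (auto simp: points_def complex_eq_iff)

lemma vline_join: "c <= d ==> d <= e ==> vline x c d Un vline x d e = vline x c e" by (auto simp: vline_iff)

lemma stripes_join: "c <= d ==> d <= e ==> stripes p k c d Un stripes p k d e = stripes p k c e" by (auto simp: stripes_iff)

lemma stripes_0 [simp]: "stripes p 0 c d = {}" "points p 0 c = {}" by (auto simp: stripes_def points_def)

definition spread :: "(nat => real) => nat => real => real => bool" where
 "spread p k a b \<longleftrightarrow> (\<forall>i\<in>{1..k}. a < p i & p i < b) & (\<forall>i\<in>{1..k}. \<forall>j\<in>{1..k}. i < j --> p i < p j)"

lemma spread_bounds: "spread p k a b ==> i \<in> {1..k} ==> a < p i & p i < b" by (auto simp: spread_def)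

lemma spread_inj: "spread p k a b ==> inj_on p {1..k}" unfolding spread_def inj_on_def by (metis less_irrefl linorder_neqE_nat)

lemma spread_mono: "spread p k a b ==> a' <= a ==> b <= b' ==> spread p k a' b'" unfolding spread_def by (meson less_le_trans le_less_trans)

lemma card_points: "spread p k a b ==> card (points p k y) = k"
proof -
 assume s: "spread p k a b"
 have "inj_on (%i. Complex (p i) y) {1..k}"
 proof (rule inj_onI)
  fix i j assume ij: "i \<in> {1..k}" "j \<in> {1..k}" "Complex (p i) y = Complex (p j) y"
  hence "p i = p j" by simp
  thus "i = j" by (rule inj_onD[OF spread_inj[OF s] _ ij(1,2)])
 qed
 from card_image[OF this] show ?thesis by (simp add: points_def)
qed

lemma finite_points [simp]: "finite (points p k y)" by (simp add: points_def)

lemma card_points2: "spread p k a b ==> spread q l a' b' ==> y ~= y' ==> card (points p k y Un points q l y') = k + l"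
proof -
 assume s: "spread p k a b" "spread q l a' b'" "y ~= y'"
 hence "points p k y Int points q l y' = {}" by (auto simp: points_iff)
 thus ?thesis by (simp add: card_Un_disjoint card_points[OF s(1)] card_points[OF s(2)])
qed

text \<open>Vertical strands that end at the height of a horizontal side meet the boundary there and nowhere else.\<close>

lemma stripes_frontier: assumes "spread p k a b" "c < d" shows "c' < c ==> c < d' ==> d = d' ==> stripes p k c d Int frontier (rect a b c' d') = points p k d"
  "c = c' ==> d < d' ==> stripes p k c d Int frontier (rect a b c' d') = points p k c"
  "c = c' ==> d = d' ==> stripes p k c d Int frontier (rect a b c' d') = points p k c Un points p k d"
  "d = c' ==> c' < d' ==> stripes p k c d Int frontier (rect a b c' d') = points p k d"
  "c = d' ==> c' < d' ==> stripes p k c d Int frontier (rect a b c' d') = points p k c" "c' < c ==> d < d' ==> stripes p k c d Int frontier (rect a b c' d') = {}"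
proof -
 define Q where "Q x \<longleftrightarrow> (\<exists>i\<in>{1..k}. x = p i)" for x
 have Q: "Q x ==> a < x & x < b" for x using assms by (auto simp: Q_def spread_def)
 have *: "z \<in> stripes p k c d \<longleftrightarrow> Q (Re z) & a < Re z & Re z < b & c <= Im z & Im z <= d" if "c < d" for z c d
  using that Q by (auto simp: stripes_iff Q_def)
 have **: "z \<in> points p k y \<longleftrightarrow> Q (Re z) & a < Re z & Re z < b & Im z = y" for z y using Q by (auto simp: points_iff Q_def)
 show "c' < c ==> c < d' ==> d = d' ==> stripes p k c d Int frontier (rect a b c' d') = points p k d"
  "c = c' ==> d < d' ==> stripes p k c d Int frontier (rect a b c' d') = points p k c"
  "c = c' ==> d = d' ==> stripes p k c d Int frontier (rect a b c' d') = points p k c Un points p k d"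
  "d = c' ==> c' < d' ==> stripes p k c d Int frontier (rect a b c' d') = points p k d"
  "c = d' ==> c' < d' ==> stripes p k c d Int frontier (rect a b c' d') = points p k c" "c' < c ==> d < d' ==> stripes p k c d Int frontier (rect a b c' d') = {}"
  using assms(2) by (auto simp: set_eq_iff * ** frontier_rect_iff)
qed

lemma stripes_frontier_away: assumes "spread p k x y" "c <= d" "d < c' | d' < c | y <= a | b <= x" shows "stripes p k c d Int frontier (rect a b c' d') = {}"
 using assms by (fastforce simp: stripes_iff spread_def frontier_rect_iff)

lemma hmap_rect: assumes f: "fibre_family phi" and e: "!!y. c <= y ==> y <= d ==> phi y a = a' & phi y b = b'" shows "hmap phi ` rect a b c d = rect a' b' c d"
proof -
 have m: "phi y s <= phi y t \<longleftrightarrow> s <= t" for y s t using f by (auto simp: fibre_family_def strict_mono_less_eq)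
 show ?thesis
 proof (intro subset_antisym subsetI)
  fix z assume "z \<in> hmap phi ` rect a b c d"
  then obtain w where "w \<in> rect a b c d" "z = hmap phi w" by auto
  thus "z \<in> rect a' b' c d" using e[of "Im w"] m[of "Im w" a "Re w"] m[of "Im w" "Re w" b] by (auto simp: rect_iff hmap_def)
 next
  fix z assume z: "z \<in> rect a' b' c d"
  obtain x where x: "phi (Im z) x = Re z" using f unfolding fibre_family_def by (metis surjD)
  hence "Complex x (Im z) \<in> rect a b c d" using z e[of "Im z"] m[of "Im z" a x] m[of "Im z" x b] by (auto simp: rect_iff)
  thus "z \<in> hmap phi ` rect a b c d" using x by (intro image_eqI[of _ _ "Complex x (Im z)"]) (auto simp: hmap_def complex_eq_iff)
 qed
qed

lemma vmap_rect: assumes f: "fibre_family phi" and e: "!!x. a <= x ==> x <= b ==> phi x c = c' & phi x d = d'" shows "vmap phi ` rect a b c d = rect a b c' d'"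
proof -
 have m: "phi y s <= phi y t \<longleftrightarrow> s <= t" for y s t using f by (auto simp: fibre_family_def strict_mono_less_eq)
 show ?thesis
 proof (intro subset_antisym subsetI)
  fix z assume "z \<in> vmap phi ` rect a b c d"
  then obtain w where "w \<in> rect a b c d" "z = vmap phi w" by auto
  thus "z \<in> rect a b c' d'" using e[of "Re w"] m[of "Re w" c "Im w"] m[of "Re w" "Im w" d] by (auto simp: rect_iff vmap_def)
 next
  fix z assume z: "z \<in> rect a b c' d'"
  obtain x where x: "phi (Re z) x = Im z" using f unfolding fibre_family_def by (metis surjD)
  hence "Complex (Re z) x \<in> rect a b c d" using z e[of "Re z"] m[of "Re z" c x] m[of "Re z" x d] by (auto simp: rect_iff)
  thus "z \<in> vmap phi ` rect a b c d" using x by (intro image_eqI[of _ _ "Complex (Re z) x"]) (auto simp: vmap_def complex_eq_iff)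
 qed
qed

lemma vline_rect: "c <= d ==> vline x c d = rect x x c d" by (auto simp: vline_iff rect_iff)

lemma hline_rect: "a <= b ==> hline a b y = rect a b y y" by (auto simp: hline_iff rect_iff)

lemma hmap_vline: assumes "fibre_family phi" "!!y. c <= y ==> y <= d ==> phi y x = x'" "c <= d" shows "hmap phi ` vline x c d = vline x' c d"
 using hmap_rect[OF assms(1), of c d x x' x x'] assms(2,3) by (simp add: vline_rect)

lemma vmap_vline: assumes "fibre_family phi" "phi x c = c'" "phi x d = d'" "c <= d" shows "vmap phi ` vline x c d = vline x c' d'"
proof -
 have "c' <= d'" using assms by (metis fibre_family_def strict_mono_less_eq)
 have "vmap phi ` rect x x c d = rect x x c' d'" by (rule vmap_rect[OF assms(1)]) (use assms in auto)
 thus ?thesis using assms(4) `c' <= d'` by (simp add: vline_rect)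
qed

lemma hmap_stripes: assumes "fibre_family phi" "!!i y. i \<in> {1..k} ==> c <= y ==> y <= d ==> phi y (p i) = p' i" "c <= d"
 shows "hmap phi ` stripes p k c d = stripes p' k c d" unfolding stripes_def image_UN by (intro SUP_cong refl hmap_vline[OF assms(1)] assms(2,3))

lemma vmap_stripes: assumes "fibre_family phi" "!!i. i \<in> {1..k} ==> phi (p i) c = c' & phi (p i) d = d'" "c <= d"
 shows "vmap phi ` stripes p k c d = stripes p k c' d'" unfolding stripes_def image_UN using assms by (intro SUP_cong refl vmap_vline) auto

lemma hmap_lbox: assumes f: "fibre_family phi" and e: "!!y. c <= y ==> y <= d ==> phi y a = a' & phi y b = b'" and "c <= d"
 shows "disc_image (hmap phi) (lbox a b c d) = lbox a' b' c d" using hmap_rect[OF f e] e[of "(c + d) / 2"] `c <= d` by (simp add: lbox_def disc_image_def hmap_def)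

lemma hmap_rbox: assumes f: "fibre_family phi" and e: "!!y. c <= y ==> y <= d ==> phi y a = a' & phi y b = b'" and "c <= d"
 shows "disc_image (hmap phi) (rbox a b c d) = rbox a' b' c d" using hmap_rect[OF f e] e[of "(c + d) / 2"] `c <= d` by (simp add: rbox_def disc_image_def hmap_def)

lemma vmap_lbox: assumes f: "fibre_family phi" and e: "!!x. a <= x ==> x <= b ==> phi x c = c' & phi x d = d'" and "phi a ((c + d) / 2) = (c' + d') / 2"
 shows "disc_image (vmap phi) (lbox a b c d) = lbox a b c' d'" using vmap_rect[OF f e] assms(3) by (simp add: lbox_def disc_image_def vmap_def)

lemma vmap_rbox: assumes f: "fibre_family phi" and e: "!!x. a <= x ==> x <= b ==> phi x c = c' & phi x d = d'" and "phi b ((c + d) / 2) = (c' + d') / 2"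
 shows "disc_image (vmap phi) (rbox a b c d) = rbox a b c' d'" using vmap_rect[OF f e] assms(3) by (simp add: rbox_def disc_image_def vmap_def)

lemma interpolate_skip: assumes "sorted_wrt (<) (y0 # map fst (n # r))" "fst n <= y" shows "interpolate y0 F (n # r) y = interpolate (fst n) (snd n) r y"
proof (cases "y = fst n")
 case True
 have "interpolate (fst n) (snd n) r y = snd n" using assms True by (intro interpolate_le) auto
 moreover have "max 0 ((y - y0) / (fst n - y0)) = 1" using assms True by simp
 ultimately show ?thesis using True by simp
qed (use assms in auto)

lemma interpolate_here: assumes "y <= fst n" "F x = v" "snd n x = v" shows "interpolate y0 F (n # r) y x = v" using assms by (simp add: algebra_simps)

lemma nodes_sorted_wrt: "nodes ns \<longleftrightarrow> sorted_wrt (%n m. fst n < fst m & snd n < snd m) ns"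
proof (induction ns rule: nodes.induct)
 case (1 n m r)
 thus ?case by auto
qed auto

definition spread_nodes :: "(real \<times> real) list => (nat => real) => (nat => real) => nat => (real \<times> real) list => (real \<times> real) list" where
 "spread_nodes l p q k r = l @ map (%i. (p i, q i)) [1..<Suc k] @ r"

lemma nodes_spread: assumes "spread p k a b" "spread q k a' b'" "a < b" "a' < b'" "nodes (l @ [(a, a')])" "nodes ((b, b') # r)"
 shows "nodes (spread_nodes (l @ [(a, a')]) p q k ((b, b') # r))"
proof -
 have 1: "sorted_wrt (%n m. fst n < fst m & snd n < snd m) (map (%i. (p i, q i)) [1..<Suc k])" unfolding sorted_wrt_map
  by (rule sorted_wrt_mono_rel[OF _ sorted_wrt_upt]) (use assms(1,2) in "simp add: spread_def del: upt_Suc")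
 have 2: "fst n <= a & snd n <= a'" if "n \<in> set (l @ [(a, a')])" for n using assms(5) that by (auto simp: nodes_sorted_wrt sorted_wrt_append)
 have 3: "b <= fst n & b' <= snd n" if "n \<in> set ((b, b') # r)" for n using assms(6) that by (auto simp: nodes_sorted_wrt)
 have 4: "a < fst n & a' < snd n & fst n < b & snd n < b'" if "n \<in> set (map (%i. (p i, q i)) [1..<Suc k])" for n
  using assms(1,2) that by (auto simp: spread_def simp del: upt_Suc)
 have 5: "fst n < fst m & snd n < snd m" if "n \<in> set (l @ [(a, a')])" "m \<in> set (map (%i. (p i, q i)) [1..<Suc k] @ ((b, b') # r))" for n m
  using 2[OF that(1)] 3[of m] 4[of m] that(2) assms(3,4) by force
 have 6: "fst n < fst m & snd n < snd m" if "n \<in> set (map (%i. (p i, q i)) [1..<Suc k])" "m \<in> set ((b, b') # r)" for n m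
  using 3[OF that(2)] 4[OF that(1)] by linarith
 show ?thesis using assms(5,6) 1 5 6 unfolding spread_nodes_def nodes_sorted_wrt sorted_wrt_append by blast
qed

lemma pl_spread_node: assumes "nodes (spread_nodes l p q k r)" shows "i \<in> {1..k} ==> pl (spread_nodes l p q k r) (p i) = q i"
  "(x, y) \<in> set l Un set r ==> pl (spread_nodes l p q k r) x = y" using pl_node[OF assms, of "(p i, q i)"] pl_node[OF assms, of "(x, y)"]
 by (auto simp: spread_nodes_def simp del: upt_Suc)

subsection \<open>Tangles made of rectangles and vertical strands are planar\<close>

lemma open_strand_vline: assumes "c < d" "Complex x c \<in> box_frontiers T" "Complex x d \<in> box_frontiers T"
  "!!y. c < y ==> y < d ==> Complex x y \<in> exterior_region T" shows "open_strand T (vline x c d)" unfolding open_strand_def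
proof (intro exI[of _ "linepath (Complex x c) (Complex x d)"] conjI)
 show "arc (linepath (Complex x c) (Complex x d))" using assms(1) by (intro arc_linepath) auto
 show "vline x c d - {pathstart (linepath (Complex x c) (Complex x d)), pathfinish (linepath (Complex x c) (Complex x d))} <= exterior_region T"
 proof
  fix z assume "z \<in> vline x c d - {pathstart (linepath (Complex x c) (Complex x d)), pathfinish (linepath (Complex x c) (Complex x d))}"
  hence "Re z = x" "c < Im z" "Im z < d" using assms(1) by (auto simp: vline_iff complex_eq_iff)
  thus "z \<in> exterior_region T" using assms(4)[of "Im z"] by (metis complex_surj)
 qed
qed (use assms in "auto simp: vline_def box_frontiers_def")

lemma planar_tangle_vertical: assumes d: "is_disc (outer T)" "finite (inner T)"
  "!!B. B \<in> inner T ==> is_disc B" "!!B. B \<in> inner T ==> region B <= interior (region (outer T))"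
  "!!B B'. B \<in> inner T ==> B' \<in> inner T ==> B ~= B' ==> region B Int region B' = {}" and V: "finite V" "strings T = (\<Union>(x, c, d)\<in>V. vline x c d)"
  "!!x c d. (x, c, d) \<in> V ==> open_strand T (vline x c d)"
  "!!x c d c' d'. (x, c, d) \<in> V ==> (x, c', d') \<in> V ==> (c, d) ~= (c', d') ==> max c d < min c' d' | max c' d' < min c d"
  and e: "!!B. B \<in> boxes T ==> star B \<notin> strings T" "!!B. B \<in> boxes T ==> even (card (boundary_points T B))" shows "planar_tangle T"
proof -
 define C where "C = (%(x, c, d). vline x c d) ` V"
 have fin: "finite C" using V(1) by (simp add: C_def)
 have dis: "pairwise disjnt C"
 proof (rule pairwiseI)
  fix s t assume st: "s \<in> C" "t \<in> C" "s ~= t"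
  obtain x c d where v: "(x, c, d) \<in> V" "s = vline x c d" using st(1) unfolding C_def by auto
  obtain x' c' d' where v': "(x', c', d') \<in> V" "t = vline x' c' d'" using st(2) unfolding C_def by auto
  note v = v v'
  show "disjnt s t"
  proof (cases "x = x'")
   case True
   hence "(c, d) ~= (c', d')" using st v by auto
   hence "max c d < min c' d' | max c' d' < min c d" using V(4)[OF v(1)] v(3) True by blast
   thus ?thesis unfolding disjnt_def v by (auto simp: vline_iff)
  qed (auto simp: v disjnt_def vline_iff)
 qed
 have eq: "strings T = \<Union>C" using V(2) by (auto simp: C_def)
 have st: "\<forall>c\<in>C. closed_strand T c | open_strand T c" using V(3) by (auto simp: C_def)
 show ?thesis unfolding planar_tangle_def by (intro conjI ballI impI exI[of _ C] fin dis eq st d(1,2)) (blast dest: d(3,4,5) e)+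
qed

section \<open>Evaluating labelled tangles\<close>

locale planar_alg =
 fixes \<P> :: "'a::ab_group_add planar_algebra" assumes upa: "unshaded_planar_algebra \<P>"
begin

lemma vs: "vector_space (scale \<P>)" using upa unfolding unshaded_planar_algebra_def by (elim conjE)

sublocale vector_space "scale \<P>" by (rule vs)

abbreviation "\<B> \<equiv> box_space \<P>"
abbreviation "scl \<equiv> scale \<P>"
abbreviation "stk \<equiv> stack \<P>"
abbreviation "cmp k \<equiv> stack \<P> k k k"
abbreviation "returned n f t \<equiv> scl (complex_of_real (1 / t)) (stk (n + 2) n (n + 2) f f)"
abbreviation "ten \<equiv> tensor \<P>"
abbreviation "str \<equiv> strands \<P>"
abbreviation "wire \<equiv> strands \<P> 1"
abbreviation "rot \<equiv> rotation \<P> 1"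
abbreviation "rtr \<equiv> right_trace \<P>"

lemma subspace_box: "subspace (\<B> k)" using upa unfolding unshaded_planar_algebra_def by (elim conjE) (rule spec)

lemma act_in: "planar_tangle T ==> labelling \<P> T f ==> act \<P> T f \<in> \<B> (box_index T (outer T))"
 using upa unfolding unshaded_planar_algebra_def by (elim conjE) simp

lemma act_cong: "planar_tangle T ==> labelling \<P> T f ==> (!!B. B \<in> inner T ==> f B = g B) ==> act \<P> T f = act \<P> T g"
 using upa unfolding unshaded_planar_algebra_def by (elim conjE) metis

lemma act_add: "planar_tangle T ==> labelling \<P> T f ==> B \<in> inner T ==>
  x \<in> \<B> (box_index T B) ==> y \<in> \<B> (box_index T B) ==>
  act \<P> T (f(B := x + y)) = act \<P> T (f(B := x)) + act \<P> T (f(B := y))" using upa unfolding unshaded_planar_algebra_def by (elim conjE) metis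

lemma act_scale: "planar_tangle T ==> labelling \<P> T f ==> B \<in> inner T ==>
  x \<in> \<B> (box_index T B) ==> act \<P> T (f(B := scl c x)) = scl c (act \<P> T (f(B := x)))"
 using upa unfolding unshaded_planar_algebra_def by (elim conjE) metis

lemma act_isotopy: "planar_tangle T ==> ambient_isotopy h ==> labelling \<P> (tangle_image (h 1) T) f ==>
  act \<P> (tangle_image (h 1) T) f = act \<P> T (%B. f (disc_image (h 1) B))" using upa unfolding unshaded_planar_algebra_def by (elim conjE) metis

lemma act_compose: "composable T B U ==> labelling \<P> (compose_tangle T B U) f ==>
  act \<P> (compose_tangle T B U) f = act \<P> T (f(B := act \<P> U f))" using upa unfolding unshaded_planar_algebra_def by (elim conjE) metis

lemma act_cable: "f \<in> \<B> k ==> act \<P> (cable_tangle k (identity_box k)) (%_. f) = f" using upa unfolding unshaded_planar_algebra_def by (elim conjE) metis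

text \<open>A relation, so that the planarity of the tangle and the correctness of its labels come along with the value.\<close>

definition val :: "tangle => (disc => 'a) => 'a => bool" where "val T f x \<longleftrightarrow> planar_tangle T & labelling \<P> T f & act \<P> T f = x"

lemma valI: "planar_tangle T ==> labelling \<P> T f ==> val T f (act \<P> T f)" by (simp add: val_def)

lemma val_cong: assumes "val T f x" and g: "!!B. B \<in> inner T ==> g B = f B" shows "val T g x"
proof -
 have T: "planar_tangle T" "labelling \<P> T f" "act \<P> T f = x" using assms(1) by (simp_all add: val_def)
 have "act \<P> T f = act \<P> T g" by (rule act_cong[OF T(1,2)]) (simp add: g)
 moreover have "labelling \<P> T g" using T(2) g by (simp add: labelling_def)
 ultimately show ?thesis using T by (simp add: val_def)
qed

lemma val_unique: assumes "val T f x" "val T g y" "!!B. B \<in> inner T ==> f B = g B" shows "x = y"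
proof -
 have "val T g x" by (rule val_cong[OF assms(1)]) (simp add: assms(3))
 thus ?thesis using assms(2) by (simp add: val_def)
qed

lemma val_in: "val T f x ==> box_index T (outer T) = k ==> x \<in> \<B> k" using act_in[of T f] by (auto simp: val_def)

lemma val_iso: assumes v: "val T f x" and h: "isotopic_id h" and f': "!!B. B \<in> inner T ==> f' (disc_image h B) = f B" shows "val (tangle_image h T) f' x"
proof -
 have T: "planar_tangle T" "labelling \<P> T f" using v by (auto simp: val_def)
 obtain g where g: "homeomorphism UNIV UNIV h g" using isotopic_id_homeomorphism[OF h] .
 obtain H where H: "ambient_isotopy H" "H 1 = h" using h unfolding isotopic_id_def by blast
 have l: "labelling \<P> (tangle_image h T) f'" using T(2) f' by (simp add: labelling_def box_index_image[OF g])
 have "act \<P> (tangle_image h T) f' = act \<P> T (%B. f' (disc_image h B))" using act_isotopy[OF T(1) H(1)] l H(2) by simp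
 also have "\<dots> = act \<P> T f" by (rule act_cong[OF T, symmetric]) (simp add: f')
 finally show ?thesis using l planar_tangle_image[OF g T(1)] v by (simp add: val_def)
qed

text \<open>Composition of tangles allows an input to be replaced by a picture that evaluates to it.\<close>

lemma val_insert: assumes T: "val T f x" and U: "val U fU (f B)" and B: "B \<in> inner T" "outer U = B" "boundary_points U B = boundary_points T B"
  and g: "!!B'. B' \<in> inner T ==> B' ~= B ==> g B' = f B'" "!!B'. B' \<in> inner U ==> g B' = fU B'" shows "val (compose_tangle T B U) g x"
proof -
 have pT: "planar_tangle T" "labelling \<P> T f" "act \<P> T f = x"
  and pU: "planar_tangle U" "labelling \<P> U fU" "act \<P> U fU = f B" using T U by (auto simp: val_def)
 have c: "composable T B U" using pT pU B by (simp add: composable_def)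
 have l: "labelling \<P> (compose_tangle T B U) g" unfolding labelling_def
 proof
  fix B' assume B': "B' \<in> inner (compose_tangle T B U)"
  show "g B' \<in> \<B> (box_index (compose_tangle T B U) B')"
  proof (cases "B' \<in> inner U")
   case True
   thus ?thesis using g(2) pU(2) boundary_points_compose(2)[OF c True] by (simp add: labelling_def box_index_def)
  next
   case False
   hence B'': "B' \<in> inner T" "B' ~= B" using B' by auto
   hence "B' \<in> boxes T" by (simp add: boxes_def)
   thus ?thesis using B'' g(1) pT(2) boundary_points_compose(1)[OF c] by (simp add: labelling_def box_index_def)
  qed
 qed
 have lU: "labelling \<P> U g" using pU(2) g(2) by (simp add: labelling_def)
 have "act \<P> U g = f B" unfolding pU(3)[symmetric] by (rule act_cong[OF pU(1) lU]) (rule g(2))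
 hence "act \<P> (compose_tangle T B U) g = act \<P> T (g(B := f B))" using act_compose[OF c l] by simp
 also have "\<dots> = x" unfolding pT(3)[symmetric] by (rule act_cong[OF pT(1,2), symmetric]) (simp add: g(1))
 finally show ?thesis using l planar_compose[OF c] by (simp add: val_def)
qed

end

subsection \<open>Two boxes on top of each other\<close>

definition column where "column k l m p q r A B a1 b1 a2 b2 e0 e1 e2 e3 e4 e5 =
   Tangle (lbox A B e0 e5) {lbox a1 b1 e1 e2, lbox a2 b2 e3 e4} (stripes p k e0 e1 Un stripes q l e2 e3 Un stripes r m e4 e5)"

definition column_ok where "column_ok k l m p q r A B a1 b1 a2 b2 e0 e1 e2 e3 e4 e5 \<longleftrightarrow>
   A < a1 & a1 < b1 & b1 < B & A < a2 & a2 < b2 & b2 < B &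
   e0 < (e1::real) & e1 < e2 & e2 < e3 & e3 < e4 & e4 < e5 &
   spread p k a1 b1 & spread q l a1 b1 & spread q l a2 b2 & spread r m a2 b2"

lemma column_simps [simp]: "outer (column k l m p q r A B a1 b1 a2 b2 e0 e1 e2 e3 e4 e5) = lbox A B e0 e5"
 "inner (column k l m p q r A B a1 b1 a2 b2 e0 e1 e2 e3 e4 e5) = {lbox a1 b1 e1 e2, lbox a2 b2 e3 e4}"
 "strings (column k l m p q r A B a1 b1 a2 b2 e0 e1 e2 e3 e4 e5) =
   stripes p k e0 e1 Un stripes q l e2 e3 Un stripes r m e4 e5" by (simp_all add: column_def)

lemma boundary_points_column: assumes ok: "column_ok k l m p q r A B a1 b1 a2 b2 e0 e1 e2 e3 e4 e5"
 shows "boundary_points (column k l m p q r A B a1 b1 a2 b2 e0 e1 e2 e3 e4 e5) (lbox A B e0 e5) = points p k e0 Un points r m e5"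
  "boundary_points (column k l m p q r A B a1 b1 a2 b2 e0 e1 e2 e3 e4 e5) (lbox a1 b1 e1 e2) = points p k e1 Un points q l e2"
  "boundary_points (column k l m p q r A B a1 b1 a2 b2 e0 e1 e2 e3 e4 e5) (lbox a2 b2 e3 e4) = points q l e3 Un points r m e4"
proof -
 have o: "A < a1" "a1 < b1" "A < a2" "a2 < b2" "e0 < e1" "e1 < e2" "e2 < e3" "e3 < e4" "e4 < e5"
  "spread p k a1 b1" "spread q l a1 b1" "spread q l a2 b2" "spread r m a2 b2" "b1 < B" "b2 < B" using ok by (simp_all add: column_ok_def)
 have s: "spread p k A B" "spread q l A B" "spread r m A B" by (rule spread_mono[OF o(10)] spread_mono[OF o(11)] spread_mono[OF o(13)]; use o in linarith)+
 have e: "e1 < e5" "e0 < e2" "e3 < e5" "e0 < e4" "e2 < e4" "e1 < e3" "e1 < e4" "e2 < e5" using o by linarith+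
 let ?T1 = "column k l m p q r A B a1 b1 a2 b2 e0 e1 e2 e3 e4 e5"
 show "boundary_points ?T1 (lbox A B e0 e5) = points p k e0 Un points r m e5"
  by (simp only: boundary_points_def column_simps lbox_simps Int_Un_distrib2 stripes_frontier(2)[OF s(1) o(5) refl e(1)]
    stripes_frontier(6)[OF s(2) o(7) e(2,3)] stripes_frontier(1)[OF s(3) o(9) e(4) o(9) refl] Un_empty_right)
 show "boundary_points ?T1 (lbox a1 b1 e1 e2) = points p k e1 Un points q l e2"
  by (simp only: boundary_points_def column_simps lbox_simps Int_Un_distrib2 stripes_frontier(4)[OF o(10) o(5) refl o(6)]
    stripes_frontier(5)[OF o(11) o(7) refl o(6)] stripes_frontier_away[OF s(3) less_imp_le[OF o(9)] disjI2[OF disjI1[OF e(5)]]] Un_empty_right)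
 show "boundary_points ?T1 (lbox a2 b2 e3 e4) = points q l e3 Un points r m e4"
  by (simp only: boundary_points_def column_simps lbox_simps Int_Un_distrib2 stripes_frontier(4)[OF o(12) o(7) refl o(8)]
    stripes_frontier(5)[OF o(13) o(9) refl o(8)] stripes_frontier_away[OF s(1) less_imp_le[OF o(5)] disjI1[OF e(6)]] Un_empty_left)
qed

lemma box_index_column: assumes ok: "column_ok k l m p q r A B a1 b1 a2 b2 e0 e1 e2 e3 e4 e5"
 shows "box_index (column k l m p q r A B a1 b1 a2 b2 e0 e1 e2 e3 e4 e5) (lbox A B e0 e5) = (k + m) div 2"
  "box_index (column k l m p q r A B a1 b1 a2 b2 e0 e1 e2 e3 e4 e5) (lbox a1 b1 e1 e2) = (k + l) div 2"
  "box_index (column k l m p q r A B a1 b1 a2 b2 e0 e1 e2 e3 e4 e5) (lbox a2 b2 e3 e4) = (l + m) div 2"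
proof -
 have o: "e0 < e1" "e1 < e2" "e2 < e3" "e3 < e4" "e4 < e5" "spread p k a1 b1" "spread q l a1 b1" "spread q l a2 b2" "spread r m a2 b2"
  using ok by (simp_all add: column_ok_def)
 let ?T1 = "column k l m p q r A B a1 b1 a2 b2 e0 e1 e2 e3 e4 e5"
 show "box_index ?T1 (lbox A B e0 e5) = (k + m) div 2" "box_index ?T1 (lbox a1 b1 e1 e2) = (k + l) div 2" "box_index ?T1 (lbox a2 b2 e3 e4) = (l + m) div 2"
  using o(1-5) card_points2[OF o(6,9), of e0 e5] card_points2[OF o(6,7), of e1 e2] card_points2[OF o(8,9), of e3 e4]
  by (simp_all add: box_index_def boundary_points_column[OF ok])
qed

lemma planar_column: assumes ok: "column_ok k l m p q r A B a1 b1 a2 b2 e0 e1 e2 e3 e4 e5" and ev: "even (k + l)" "even (l + m)"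
 shows "planar_tangle (column k l m p q r A B a1 b1 a2 b2 e0 e1 e2 e3 e4 e5)"
proof -
 define T where "T = column k l m p q r A B a1 b1 a2 b2 e0 e1 e2 e3 e4 e5"
 have o: "A < a1" "a1 < b1" "b1 < B" "A < a2" "a2 < b2" "b2 < B" "e0 < e1" "e1 < e2" "e2 < e3" "e3 < e4" "e4 < e5"
  "spread p k a1 b1" "spread q l a1 b1" "spread q l a2 b2" "spread r m a2 b2" using ok by (simp_all add: column_ok_def)
 have ext: "z \<in> exterior_region T \<longleftrightarrow> A < Re z & Re z < B & e0 < Im z & Im z < e5 &
   \<not> (a1 <= Re z & Re z <= b1 & e1 <= Im z & Im z <= e2) & \<not> (a2 <= Re z & Re z <= b2 & e3 <= Im z & Im z <= e4)" for z
  by (simp add: T_def exterior_region_def interior_rect_iff rect_iff)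
 have fr: "z \<in> box_frontiers T \<longleftrightarrow> z \<in> frontier (rect A B e0 e5) | z \<in> frontier (rect a1 b1 e1 e2) | z \<in> frontier (rect a2 b2 e3 e4)" for z
  by (auto simp: T_def box_frontiers_def boxes_def)
 define V where "V = (%i. (p i, e0, e1)) ` {1..k} Un (%i. (q i, e2, e3)) ` {1..l} Un (%i. (r i, e4, e5)) ` {1..m}"
 have V: "(x, c, d) \<in> V \<longleftrightarrow> (c = e0 & d = e1 & (\<exists>i\<in>{1..k}. x = p i)) | (c = e2 & d = e3 & (\<exists>i\<in>{1..l}. x = q i)) | (c = e4 & d = e5 & (\<exists>i\<in>{1..m}. x = r i))" for x c d
  by (auto simp: V_def)
 have "planar_tangle T"
 proof (rule planar_tangle_vertical)
  show "is_disc (outer T)" "finite (inner T)" using o by (auto simp: T_def intro: is_disc_lbox)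
  show "finite V" "strings T = (\<Union>(x, c, d)\<in>V. vline x c d)" by (auto simp: V_def T_def stripes_def)
 next
  fix B' assume "B' \<in> inner T"
  thus "is_disc B'" "region B' <= interior (region (outer T))" using o by (auto simp: T_def interior_rect_iff rect_iff intro: is_disc_lbox)
 next
  fix B1 B2 assume "B1 \<in> inner T" "B2 \<in> inner T" "B1 ~= B2"
  thus "region B1 Int region B2 = {}" using o by (auto simp: T_def rect_iff)
 next
  fix x c d assume "(x, c, d) \<in> V"
  then consider "c = e0" "d = e1" "a1 < x" "x < b1" | "c = e2" "d = e3" "a1 < x" "x < b1" "a2 < x" "x < b2"
   | "c = e4" "d = e5" "a2 < x" "x < b2" unfolding V using o(12-15) by (auto simp: spread_def)
  thus "open_strand T (vline x c d)"
  proof cases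
   case 1 thus ?thesis using o by (intro open_strand_vline) (auto simp: ext fr frontier_rect_iff)
  next
   case 2 thus ?thesis using o by (intro open_strand_vline) (auto simp: ext fr frontier_rect_iff)
  next
   case 3 thus ?thesis using o by (intro open_strand_vline) (auto simp: ext fr frontier_rect_iff)
  qed
 next
  fix x c d c' d' assume "(x, c, d) \<in> V" "(x, c', d') \<in> V" "(c, d) ~= (c', d')"
  thus "max c d < min c' d' | max c' d' < min c d" unfolding V using o by auto
 next
  fix B' assume B': "B' \<in> boxes T"
  have "z \<in> strings T ==> min a1 a2 < Re z & (Im z <= e1 | (e2 <= Im z & Im z <= e3) | e4 <= Im z)" for z using o by (auto simp: T_def stripes_iff spread_def)
  from this[of "star B'"] show "star B' \<notin> strings T" using B' o by (auto simp: T_def boxes_def)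
  have "k + m = k + l + (l + m) - 2 * l" by simp
  hence "even (k + m)" using ev by presburger
  thus "even (card (boundary_points T B'))" using B' ev o card_points2[OF o(12,15), of e0 e5] card_points2[OF o(12,13), of e1 e2] card_points2[OF o(14,15), of e3 e4]
   by (auto simp: T_def boxes_def boundary_points_column[OF ok])
 qed
 thus ?thesis by (simp add: T_def)
qed

lemma stack_tangle_column: "stack_tangle k l m = column k l m real real real 0 (real (k + l + m) + 2) (1/2) (real (k + l + m) + 3/2)
   (1/2) (real (k + l + m) + 3/2) 0 1 2 3 4 5" by (simp add: stack_tangle_def column_def stack_lower_def stack_upper_def stripes_def)

lemma spread_real: "a < 1 ==> real k < b ==> spread real k a b" by (auto simp: spread_def)

lemma stack_column_ok: "column_ok k l m real real real 0 (real (k + l + m) + 2) (1/2) (real (k + l + m) + 3/2) (1/2) (real (k + l + m) + 3/2) 0 1 2 3 4 5"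
 by (auto simp: column_ok_def intro!: spread_real)

lemma fibre_interpolate_homeo: "sorted_wrt (<) (y0 # map fst r) ==> line_homeo F ==> \<forall>G\<in>snd ` set r. line_homeo G ==> fibre_family (interpolate y0 F r)"
 by (rule fibre_family_interpolate) auto

text \<open>The isotopy first moves the strands horizontally, differently at different heights, and then adjusts
  the heights.  To the left of all inner boxes the heights are scaled linearly, which keeps the star of the
  outer box in the middle of its side.\<close>

lemma column_isotopy: assumes ok: "column_ok k l m p q r A B a1 b1 a2 b2 e0 e1 e2 e3 e4 e5"
 obtains h where "isotopic_id h" "tangle_image h (stack_tangle k l m) = column k l m p q r A B a1 b1 a2 b2 e0 e1 e2 e3 e4 e5"
  "disc_image h (stack_lower k l m) = lbox a1 b1 e1 e2" "disc_image h (stack_upper k l m) = lbox a2 b2 e3 e4"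
proof -
 have o: "A < a1" "a1 < b1" "b1 < B" "A < a2" "a2 < b2" "b2 < B" "e0 < e1" "e1 < e2" "e2 < e3" "e3 < e4" "e4 < e5"
  "spread p k a1 b1" "spread q l a1 b1" "spread q l a2 b2" "spread r m a2 b2" using ok by (simp_all add: column_ok_def)
 define N where "N = real (k + l + m)"
 have N: "real k <= N" "real l <= N" "real m <= N" "0 <= N" by (simp_all add: N_def)
 define F where "F = (%p' n a b. spread_nodes ([(0, A)] @ [(1/2, a)]) real p' n [(N + 3/2, b), (N + 2, B)])"
 have nF: "nodes (F p' n a b)" if "spread p' n a b" "real n <= N" "A < a" "a < b" "b < B" for p' n a b
  unfolding F_def using that by (intro nodes_spread spread_real) auto
 have F: "pl (F p' n a b) 0 = A" "pl (F p' n a b) (1/2) = a" "pl (F p' n a b) (N + 3/2) = b" "pl (F p' n a b) (N + 2) = B"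
  "i \<in> {1..n} ==> pl (F p' n a b) (real i) = p' i"
  if "spread p' n a b" "real n <= N" "A < a" "a < b" "b < B" for p' n a b i using pl_spread_node[OF nF[OF that, unfolded F_def]] by (auto simp: F_def)
 define F0 F1 F2 F3 where "F0 = pl (F p k a1 b1)" and "F1 = pl (F q l a1 b1)" and "F2 = pl (F q l a2 b2)" and "F3 = pl (F r m a2 b2)"
 note FF = F[OF o(12) N(1) o(1,2,3), folded F0_def] F[OF o(13) N(2) o(1,2,3), folded F1_def]
  F[OF o(14) N(2) o(4,5,6), folded F2_def] F[OF o(15) N(3) o(4,5,6), folded F3_def]
 define phi where "phi = interpolate 1 F0 [(2, F1), (3, F2), (4, F3)]"
 have fphi: "fibre_family phi" unfolding phi_def using nF o N by (intro fibre_interpolate_homeo) (auto simp: F0_def F1_def F2_def F3_def intro!: line_homeo_pl)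
 have phi01: "phi y = F0" if "y <= 1" for y unfolding phi_def using that by (intro interpolate_le) auto
 have phi12: "phi y x = v" if "y <= 2" "F0 x = v" "F1 x = v" for x y v unfolding phi_def using that by (intro interpolate_here) auto
 have phi23: "phi y x = v" if "2 <= y" "y <= 3" "F1 x = v" "F2 x = v" for x y v
  unfolding phi_def using that by (subst interpolate_skip) (auto intro: interpolate_here simp del: interpolate.simps)
 have s3: "phi y = interpolate 3 F2 [(4, F3)] y" if "3 <= y" for y
  using interpolate_skip[of 1 "(2, F1)" "[(3, F2), (4, F3)]" y F0] interpolate_skip[of 2 "(3, F2)" "[(4, F3)]" y F1] that
  by (simp add: phi_def del: interpolate.simps)
 have phi34: "phi y x = v" if "3 <= y" "y <= 4" "F2 x = v" "F3 x = v" for x y v unfolding s3[OF that(1)] using that by (intro interpolate_here) auto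
 have phi45: "phi y = F3" if "4 <= y" for y using s3[of y] interpolate_skip[of 3 "(4, F3)" "[]" y F2] that by simp
 have phic: "phi y x = v" if "F0 x = v" "F1 x = v" "F2 x = v" "F3 x = v" for x y v unfolding phi_def using that by (intro interpolate_const) auto
 have img1: "disc_image (hmap phi) (lbox 0 (N + 2) 0 5) = lbox A B 0 5" by (rule hmap_lbox[OF fphi]) (use FF in "auto intro!: phic")
 have img2: "disc_image (hmap phi) (lbox (1/2) (N + 3/2) 1 2) = lbox a1 b1 1 2" by (rule hmap_lbox[OF fphi]) (use FF in "auto intro!: phi12")
 have img3: "disc_image (hmap phi) (lbox (1/2) (N + 3/2) 3 4) = lbox a2 b2 3 4" by (rule hmap_lbox[OF fphi]) (use FF in "auto intro!: phi34")
 have img4: "hmap phi ` stripes real k 0 1 = stripes p k 0 1" by (rule hmap_stripes[OF fphi]) (use FF in "auto simp: phi01")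
 have img4': "hmap phi ` stripes real l 2 3 = stripes q l 2 3" by (rule hmap_stripes[OF fphi]) (use FF in "auto intro!: phi23")
 have img4'': "hmap phi ` stripes real m 4 5 = stripes r m 4 5" by (rule hmap_stripes[OF fphi]) (use FF in "auto simp: phi45")
 define G0 G1 where "G0 = pl [(0, e0), (5, e5)]" and "G1 = pl [(0, e0), (1, e1), (2, e2), (3, e3), (4, e4), (5, e5)]"
 define psi where "psi = interpolate A G0 [(min a1 a2, G1)]"
 have fpsi: "fibre_family psi" unfolding psi_def using o by (intro fibre_interpolate_homeo) (auto simp: G0_def G1_def intro!: line_homeo_pl)
 have n0: "nodes [(0, e0), (5, e5)]" and n1: "nodes [(0, e0), (1, e1), (2, e2), (3, e3), (4, e4), (5, e5)]" using o by auto
 have G0: "G0 0 = e0" "G0 5 = e5" "G0 (5/2) = (e0 + e5) / 2" using pl_node[OF n0, of "(0, e0)"] pl_node[OF n0, of "(5, e5)"] pl_between[OF n0, of "5/2"]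
  by (auto simp: G0_def field_simps simp del: pl.simps)
 have G1: "G1 0 = e0" "G1 1 = e1" "G1 2 = e2" "G1 3 = e3" "G1 4 = e4" "G1 5 = e5"
  using pl_node[OF n1, of "(0, e0)"] pl_node[OF n1, of "(1, e1)"] pl_node[OF n1, of "(2, e2)"]
   pl_node[OF n1, of "(3, e3)"] pl_node[OF n1, of "(4, e4)"] pl_node[OF n1, of "(5, e5)"] by (auto simp: G1_def simp del: pl.simps)
 have G1m: "G1 (3/2) = (e1 + e2) / 2" "G1 (7/2) = (e3 + e4) / 2" unfolding G1_def using o by (auto simp: field_simps)
 have psiA: "psi A = G0" unfolding psi_def using o by (intro interpolate_le) auto
 have psi1: "psi x = G1" if "min a1 a2 <= x" for x unfolding psi_def using that o by (subst interpolate_skip) auto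
 have psic: "psi x y = v" if "G0 y = v" "G1 y = v" for x y v unfolding psi_def using that by (intro interpolate_const) auto
 have img5: "disc_image (vmap psi) (lbox A B 0 5) = lbox A B e0 e5" by (rule vmap_lbox[OF fpsi]) (use G0 G1 in "auto intro!: psic simp: psiA")
 have img6: "disc_image (vmap psi) (lbox a1 b1 1 2) = lbox a1 b1 e1 e2" by (rule vmap_lbox[OF fpsi]) (use G1 G1m in "auto simp: psi1")
 have img7: "disc_image (vmap psi) (lbox a2 b2 3 4) = lbox a2 b2 e3 e4" by (rule vmap_lbox[OF fpsi]) (use G1 G1m in "auto simp: psi1")
 have img8: "vmap psi ` stripes p k 0 1 = stripes p k e0 e1" by (rule vmap_stripes[OF fpsi]) (use G1 spread_bounds[OF o(12)] in "force simp: psi1")+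
 have img9: "vmap psi ` stripes q l 2 3 = stripes q l e2 e3" by (rule vmap_stripes[OF fpsi]) (use G1 spread_bounds[OF o(13)] in "force simp: psi1")+
 have img10: "vmap psi ` stripes r m 4 5 = stripes r m e4 e5" by (rule vmap_stripes[OF fpsi]) (use G1 spread_bounds[OF o(15)] in "force simp: psi1")+
 define h where "h = vmap psi \<circ> hmap phi"
 have dh: "disc_image h D = disc_image (vmap psi) (disc_image (hmap phi) D)" for D by (simp add: h_def disc_image_def image_comp)
 have lo: "disc_image h (stack_lower k l m) = lbox a1 b1 e1 e2" by (simp only: stack_lower_def dh N_def[symmetric] img2 img6)
 have up: "disc_image h (stack_upper k l m) = lbox a2 b2 e3 e4" by (simp only: stack_upper_def dh N_def[symmetric] img3 img7)
 have "h ` S = vmap psi ` hmap phi ` S" for S by (simp add: h_def image_comp)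
 hence st: "h ` strings (stack_tangle k l m) = stripes p k e0 e1 Un stripes q l e2 e3 Un stripes r m e4 e5"
  by (simp add: stack_tangle_column image_Un img4 img4' img4'' img8 img9 img10)
 have "outer (stack_tangle k l m) = lbox 0 (N + 2) 0 5" "inner (stack_tangle k l m) = {stack_lower k l m, stack_upper k l m}"
  by (simp_all add: stack_tangle_def N_def)
 hence "tangle_image h (stack_tangle k l m) = column k l m p q r A B a1 b1 a2 b2 e0 e1 e2 e3 e4 e5" unfolding tangle_image_def st column_def
  by (simp only: image_insert image_empty lo up dh[of "lbox 0 (N + 2) 0 5"] img1 img5)
 moreover have "isotopic_id h" unfolding h_def using fphi fpsi by (intro isotopic_id_compose isotopic_id_hmap isotopic_id_vmap)
 ultimately show ?thesis using that lo up by blast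
qed

lemma stack_boxes_neq: "stack_lower k l m ~= stack_upper k l m" unfolding stack_lower_def stack_upper_def by (rule lbox_neq) simp

lemma (in planar_alg) val_column: assumes ok: "column_ok k l m p q r A B a1 b1 a2 b2 e0 e1 e2 e3 e4 e5" and ev: "even (k + l)" "even (l + m)"
  and x: "x \<in> \<B> ((k + l) div 2)" and y: "y \<in> \<B> ((l + m) div 2)" and f: "f (lbox a1 b1 e1 e2) = x" "f (lbox a2 b2 e3 e4) = y"
 shows "val (column k l m p q r A B a1 b1 a2 b2 e0 e1 e2 e3 e4 e5) f (stk k l m y x)"
proof -
 obtain h where h: "isotopic_id h" "tangle_image h (stack_tangle k l m) = column k l m p q r A B a1 b1 a2 b2 e0 e1 e2 e3 e4 e5"
  "disc_image h (stack_lower k l m) = lbox a1 b1 e1 e2" "disc_image h (stack_upper k l m) = lbox a2 b2 e3 e4" using column_isotopy[OF ok] .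
 have "val (stack_tangle k l m) (%B. if B = stack_upper k l m then y else x) (stk k l m y x)" unfolding stack_def
 proof (rule valI)
  show "planar_tangle (stack_tangle k l m)" unfolding stack_tangle_column by (rule planar_column[OF stack_column_ok ev])
  show "labelling \<P> (stack_tangle k l m) (%B. if B = stack_upper k l m then y else x)"
   using x y box_index_column(2,3)[OF stack_column_ok[of k l m]] stack_boxes_neq[of k l m]
   unfolding labelling_def stack_tangle_column by (auto simp: stack_upper_def stack_lower_def)
 qed
 moreover have "f (disc_image h B') = (if B' = stack_upper k l m then y else x)" if "B' \<in> inner (stack_tangle k l m)" for B'
  using that f h(3,4) by (auto simp: stack_tangle_def)
 ultimately have "val (tangle_image h (stack_tangle k l m)) f (stk k l m y x)" by (rule val_iso[OF _ h(1)])
 thus ?thesis by (simp only: h(2))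
qed

subsection \<open>Two boxes next to each other\<close>

definition row where "row k l m n p q s t A B a1 b1 a2 b2 e0 c1 d1 c2 d2 e3 =
   Tangle (lbox A B e0 e3) {lbox a1 b1 c1 d1, lbox a2 b2 c2 d2} (stripes p k e0 c1 Un stripes q l d1 e3 Un stripes s m e0 c2 Un stripes t n d2 e3)"

definition row_ok where "row_ok k l m n p q s t A B a1 b1 a2 b2 e0 c1 d1 c2 d2 e3 \<longleftrightarrow>
   A < a1 & a1 < b1 & b1 < a2 & a2 < b2 & b2 < B &
   e0 < (c1::real) & c1 < d1 & d1 < e3 & e0 < c2 & c2 < d2 & d2 < e3 &
   spread p k a1 b1 & spread q l a1 b1 & spread s m a2 b2 & spread t n a2 b2"

lemma row_okD: assumes "row_ok k l m n p q s t A B a1 b1 a2 b2 e0 c1 d1 c2 d2 e3"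
 shows "A < a1" "a1 < b1" "b1 < a2" "a2 < b2" "b2 < B" "e0 < c1" "c1 < d1" "d1 < e3" "e0 < c2" "c2 < d2" "d2 < e3"
  "spread p k a1 b1" "spread q l a1 b1" "spread s m a2 b2" "spread t n a2 b2" using assms by (simp_all add: row_ok_def)

lemma row_simps [simp]: "outer (row k l m n p q s t A B a1 b1 a2 b2 e0 c1 d1 c2 d2 e3) = lbox A B e0 e3"
 "inner (row k l m n p q s t A B a1 b1 a2 b2 e0 c1 d1 c2 d2 e3) = {lbox a1 b1 c1 d1, lbox a2 b2 c2 d2}"
 "strings (row k l m n p q s t A B a1 b1 a2 b2 e0 c1 d1 c2 d2 e3) =
   stripes p k e0 c1 Un stripes q l d1 e3 Un stripes s m e0 c2 Un stripes t n d2 e3" by (simp_all add: row_def)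

lemma boundary_points_row: assumes ok: "row_ok k l m n p q s t A B a1 b1 a2 b2 e0 c1 d1 c2 d2 e3"
 shows "boundary_points (row k l m n p q s t A B a1 b1 a2 b2 e0 c1 d1 c2 d2 e3) (lbox A B e0 e3) =
   points p k e0 Un points q l e3 Un points s m e0 Un points t n e3"
  "boundary_points (row k l m n p q s t A B a1 b1 a2 b2 e0 c1 d1 c2 d2 e3) (lbox a1 b1 c1 d1) = points p k c1 Un points q l d1"
  "boundary_points (row k l m n p q s t A B a1 b1 a2 b2 e0 c1 d1 c2 d2 e3) (lbox a2 b2 c2 d2) = points s m c2 Un points t n d2"
proof -
 note o = row_okD[OF ok]
 have s: "spread p k A B" "spread q l A B" "spread s m A B" "spread t n A B"
  by (rule spread_mono[OF o(12)] spread_mono[OF o(13)] spread_mono[OF o(14)] spread_mono[OF o(15)]; use o in linarith)+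
 have e: "c1 < e3" "e0 < d1" "c2 < e3" "e0 < d2" using o by linarith+
 let ?T1 = "row k l m n p q s t A B a1 b1 a2 b2 e0 c1 d1 c2 d2 e3"
 show "boundary_points ?T1 (lbox A B e0 e3) =
   points p k e0 Un points q l e3 Un points s m e0 Un points t n e3"
  by (simp only: boundary_points_def row_simps lbox_simps Int_Un_distrib2 stripes_frontier(2)[OF s(1) o(6) refl e(1)]
    stripes_frontier(1)[OF s(2) o(8) e(2) o(8) refl] stripes_frontier(2)[OF s(3) o(9) refl e(3)] stripes_frontier(1)[OF s(4) o(11) e(4) o(11) refl])
 show "boundary_points ?T1 (lbox a1 b1 c1 d1) = points p k c1 Un points q l d1"
  by (simp only: boundary_points_def row_simps lbox_simps Int_Un_distrib2 stripes_frontier(4)[OF o(12) o(6) refl o(7)]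
    stripes_frontier(5)[OF o(13) o(8) refl o(7)] Un_empty_right
    stripes_frontier_away[OF o(14) less_imp_le[OF o(9)] disjI2[OF disjI2[OF disjI2[OF less_imp_le[OF o(3)]]]]]
    stripes_frontier_away[OF o(15) less_imp_le[OF o(11)] disjI2[OF disjI2[OF disjI2[OF less_imp_le[OF o(3)]]]]])
 show "boundary_points ?T1 (lbox a2 b2 c2 d2) = points s m c2 Un points t n d2"
  by (simp only: boundary_points_def row_simps lbox_simps Int_Un_distrib2 stripes_frontier(4)[OF o(14) o(9) refl o(10)]
    stripes_frontier(5)[OF o(15) o(11) refl o(10)] Un_empty_left
    stripes_frontier_away[OF o(12) less_imp_le[OF o(6)] disjI2[OF disjI2[OF disjI1[OF less_imp_le[OF o(3)]]]]]
    stripes_frontier_away[OF o(13) less_imp_le[OF o(8)] disjI2[OF disjI2[OF disjI1[OF less_imp_le[OF o(3)]]]]])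
qed

lemma card_points4: assumes "spread p k a1 b1" "spread q l a1 b1" "spread s m a2 b2" "spread t n a2 b2" "b1 < a2" "y < y'"
 shows "card (points p k y Un points q l y' Un points s m y Un points t n y') = (k + l) + (m + n)"
proof -
 let ?T1 = "points p k y Un points q l y'"
 let ?T2 = "points s m y Un points t n y'"
 have "?T1 Int ?T2 = {}" using assms(1-4,5) by (fastforce simp: points_iff spread_def)
 hence "card (?T1 Un ?T2) = (k + l) + (m + n)" using card_points2[OF assms(1,2), of y y'] card_points2[OF assms(3,4), of y y'] assms(6)
  by (subst card_Un_disjoint) auto
 thus ?thesis by (simp only: Un_assoc)
qed

lemma box_index_row: assumes ok: "row_ok k l m n p q s t A B a1 b1 a2 b2 e0 c1 d1 c2 d2 e3"
 shows "box_index (row k l m n p q s t A B a1 b1 a2 b2 e0 c1 d1 c2 d2 e3) (lbox A B e0 e3) = (k + l + (m + n)) div 2"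
  "box_index (row k l m n p q s t A B a1 b1 a2 b2 e0 c1 d1 c2 d2 e3) (lbox a1 b1 c1 d1) = (k + l) div 2"
  "box_index (row k l m n p q s t A B a1 b1 a2 b2 e0 c1 d1 c2 d2 e3) (lbox a2 b2 c2 d2) = (m + n) div 2"
proof -
 have o: "b1 < a2" "c1 < d1" "c2 < d2" "e0 < e3" "spread p k a1 b1" "spread q l a1 b1" "spread s m a2 b2" "spread t n a2 b2" using ok by (simp_all add: row_ok_def)
 let ?T1 = "row k l m n p q s t A B a1 b1 a2 b2 e0 c1 d1 c2 d2 e3"
 show "box_index ?T1 (lbox A B e0 e3) = (k + l + (m + n)) div 2" by (simp only: box_index_def boundary_points_row[OF ok] card_points4[OF o(5-8,1,4)])
 show "box_index ?T1 (lbox a1 b1 c1 d1) = (k + l) div 2" using card_points2[OF o(5,6), of c1 d1] o(2) by (simp add: box_index_def boundary_points_row[OF ok])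
 show "box_index ?T1 (lbox a2 b2 c2 d2) = (m + n) div 2" using card_points2[OF o(7,8), of c2 d2] o(3) by (simp add: box_index_def boundary_points_row[OF ok])
qed

lemma planar_row: assumes ok: "row_ok k l m n p q s t A B a1 b1 a2 b2 e0 c1 d1 c2 d2 e3" and ev: "even (k + l)" "even (m + n)"
 shows "planar_tangle (row k l m n p q s t A B a1 b1 a2 b2 e0 c1 d1 c2 d2 e3)"
proof -
 define T where "T = row k l m n p q s t A B a1 b1 a2 b2 e0 c1 d1 c2 d2 e3"
 note o = row_okD[OF ok]
 have ext: "z \<in> exterior_region T \<longleftrightarrow> A < Re z & Re z < B & e0 < Im z & Im z < e3 &
   \<not> (a1 <= Re z & Re z <= b1 & c1 <= Im z & Im z <= d1) & \<not> (a2 <= Re z & Re z <= b2 & c2 <= Im z & Im z <= d2)" for z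
  by (simp add: T_def exterior_region_def interior_rect_iff rect_iff)
 have fr: "z \<in> box_frontiers T \<longleftrightarrow> z \<in> frontier (rect A B e0 e3) | z \<in> frontier (rect a1 b1 c1 d1) | z \<in> frontier (rect a2 b2 c2 d2)" for z
  by (auto simp: T_def box_frontiers_def boxes_def)
 define V where "V = (%i. (p i, e0, c1)) ` {1..k} Un (%i. (q i, d1, e3)) ` {1..l} Un (%i. (s i, e0, c2)) ` {1..m} Un (%i. (t i, d2, e3)) ` {1..n}"
 have V: "(c = e0 & d = c1 & a1 < x & x < b1) | (c = d1 & d = e3 & a1 < x & x < b1) |
   (c = e0 & d = c2 & a2 < x & x < b2) | (c = d2 & d = e3 & a2 < x & x < b2)" if "(x, c, d) \<in> V" for x c d using that o(12-15) by (auto simp: V_def spread_def)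
 have "planar_tangle T"
 proof (rule planar_tangle_vertical)
  show "is_disc (outer T)" "finite (inner T)" using o by (auto simp: T_def intro: is_disc_lbox)
  show "finite V" "strings T = (\<Union>(x, c, d)\<in>V. vline x c d)" by (auto simp: V_def T_def stripes_def)
 next
  fix B' assume "B' \<in> inner T"
  thus "is_disc B'" "region B' <= interior (region (outer T))" using o by (auto simp: T_def interior_rect_iff rect_iff intro: is_disc_lbox)
 next
  fix B1 B2 assume "B1 \<in> inner T" "B2 \<in> inner T" "B1 ~= B2"
  thus "region B1 Int region B2 = {}" using o by (auto simp: T_def rect_iff)
 next
  fix x c d assume "(x, c, d) \<in> V"
  from V[OF this] show "open_strand T (vline x c d)"
  proof (elim disjE)
   assume "c = e0 & d = c1 & a1 < x & x < b1"
   thus ?thesis using o by (intro open_strand_vline) (auto simp: ext fr frontier_rect_iff)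
  next
   assume "c = d1 & d = e3 & a1 < x & x < b1"
   thus ?thesis using o by (intro open_strand_vline) (auto simp: ext fr frontier_rect_iff)
  next
   assume "c = e0 & d = c2 & a2 < x & x < b2"
   thus ?thesis using o by (intro open_strand_vline) (auto simp: ext fr frontier_rect_iff)
  next
   assume "c = d2 & d = e3 & a2 < x & x < b2"
   thus ?thesis using o by (intro open_strand_vline) (auto simp: ext fr frontier_rect_iff)
  qed
 next
  fix x c d c' d' assume *: "(x, c, d) \<in> V" "(x, c', d') \<in> V" "(c, d) ~= (c', d')"
  show "max c d < min c' d' | max c' d' < min c d" using V[OF *(1)] V[OF *(2)] *(3) o(1-11) by (elim disjE) simp_all
 next
  fix B' assume B': "B' \<in> boxes T"
  have "z \<in> strings T ==> a1 < Re z & Re z < b1 | a2 < Re z & Re z < b2" for z using o by (auto simp: T_def stripes_iff spread_def)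
  from this[of "star B'"] show "star B' \<notin> strings T" using B' o(1-11) by (auto simp: T_def boxes_def)
  have "e0 < e3" using o by linarith
  thus "even (card (boundary_points T B'))"
   using B' ev o card_points4[OF o(12-15,3), of e0 e3] card_points2[OF o(12,13), of c1 d1] card_points2[OF o(14,15), of c2 d2]
   by (auto simp: T_def boxes_def boundary_points_row[OF ok])
 qed
 thus ?thesis by (simp add: T_def)
qed

lemma row_isotopy: assumes ok: "row_ok k l m n p q s t A B a1 b1 a2 b2 e0 c1 d1 c2 d2 e3" and ok': "row_ok k l m n p' q' s' t' A' B' a1' b1' a2' b2' 0 1 2 1 2 3"
 obtains h where "isotopic_id h" "tangle_image h (row k l m n p' q' s' t' A' B' a1' b1' a2' b2' 0 1 2 1 2 3) = row k l m n p q s t A B a1 b1 a2 b2 e0 c1 d1 c2 d2 e3"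
  "disc_image h (lbox a1' b1' 1 2) = lbox a1 b1 c1 d1" "disc_image h (lbox a2' b2' 1 2) = lbox a2 b2 c2 d2"
proof -
 note o = row_okD[OF ok]
 have o': "A' < a1'" "a1' < b1'" "b1' < a2'" "a2' < b2'" "b2' < B'" "spread p' k a1' b1'" "spread q' l a1' b1'" "spread s' m a2' b2'" "spread t' n a2' b2'"
  using ok' by (simp_all add: row_ok_def)
 define R where "R = (%s' s m. map (%i. (s' i, s i)) [1..<Suc m] @ [(b2', b2), (B', B)])"
 define F where "F = (%p' p k s' s m. spread_nodes ([(A', A)] @ [(a1', a1)]) p' p k ((b1', b1) # (a2', a2) # R s' s m))"
 have nF: "nodes (F p' p k s' s m)"
  if "spread p' k a1' b1'" "spread p k a1 b1" "spread s' m a2' b2'" "spread s m a2 b2" for p' p k s' s m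
 proof -
  have "nodes (spread_nodes ([(b1', b1)] @ [(a2', a2)]) s' s m ((b2', b2) # [(B', B)]))" by (rule nodes_spread[OF that(3,4)]) (use o o' in auto)
  hence "nodes ((b1', b1) # (a2', a2) # R s' s m)" by (simp add: spread_nodes_def R_def del: upt_Suc)
  thus ?thesis unfolding F_def by (intro nodes_spread[OF that(1,2)]) (use o o' in auto)
 qed
 have F: "pl (F p' p k s' s m) A' = A" "pl (F p' p k s' s m) a1' = a1" "pl (F p' p k s' s m) b1' = b1"
   "pl (F p' p k s' s m) a2' = a2" "pl (F p' p k s' s m) b2' = b2" "pl (F p' p k s' s m) B' = B"
   "i \<in> {1..k} ==> pl (F p' p k s' s m) (p' i) = p i" "i \<in> {1..m} ==> pl (F p' p k s' s m) (s' i) = s i"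
  if "spread p' k a1' b1'" "spread p k a1 b1" "spread s' m a2' b2'" "spread s m a2 b2" for p' p k s' s m i
 proof -
  note N = pl_node[OF nF[OF that]]
  show "pl (F p' p k s' s m) A' = A" "pl (F p' p k s' s m) a1' = a1" "pl (F p' p k s' s m) b1' = b1"
   "pl (F p' p k s' s m) a2' = a2" "pl (F p' p k s' s m) b2' = b2" "pl (F p' p k s' s m) B' = B"
   using N[of "(A', A)"] N[of "(a1', a1)"] N[of "(b1', b1)"] N[of "(a2', a2)"] N[of "(b2', b2)"] N[of "(B', B)"]
   by (simp_all add: F_def R_def spread_nodes_def del: upt_Suc pl.simps)
  show "i \<in> {1..k} ==> pl (F p' p k s' s m) (p' i) = p i" "i \<in> {1..m} ==> pl (F p' p k s' s m) (s' i) = s i" using N[of "(p' i, p i)"] N[of "(s' i, s i)"]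
   by (auto simp add: F_def R_def spread_nodes_def simp del: upt_Suc pl.simps)
 qed
 define F0 F1 where "F0 = pl (F p' p k s' s m)" and "F1 = pl (F q' q l t' t n)"
 note FF = F[OF o'(6) o(12) o'(8) o(14), folded F0_def] F[OF o'(7) o(13) o'(9) o(15), folded F1_def]
 define phi where "phi = interpolate 1 F0 [(2, F1)]"
 have fphi: "fibre_family phi" unfolding phi_def by (intro fibre_interpolate_homeo) (auto simp: F0_def F1_def intro!: line_homeo_pl nF o(12-15) o'(6-9))
 have phi1: "phi y = F0" if "y <= 1" for y unfolding phi_def using that by (intro interpolate_le) auto
 have phi2: "phi y = F1" if "2 <= y" for y using interpolate_skip[of 1 "(2, F1)" "[]" y F0] that by (simp add: phi_def)
 have phic: "phi y x = v" if "F0 x = v" "F1 x = v" for x y v unfolding phi_def using that by (intro interpolate_const) auto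
 have img1: "disc_image (hmap phi) (lbox A' B' 0 3) = lbox A B 0 3" by (rule hmap_lbox[OF fphi]) (use FF in "auto intro!: phic")
 have img2: "disc_image (hmap phi) (lbox a1' b1' 1 2) = lbox a1 b1 1 2" by (rule hmap_lbox[OF fphi]) (use FF in "auto intro!: phic")
 have img3: "disc_image (hmap phi) (lbox a2' b2' 1 2) = lbox a2 b2 1 2" by (rule hmap_lbox[OF fphi]) (use FF in "auto intro!: phic")
 have h1: "hmap phi ` stripes p' k 0 1 = stripes p k 0 1" by (rule hmap_stripes[OF fphi]) (use FF in "auto simp: phi1")
 have h2: "hmap phi ` stripes q' l 2 3 = stripes q l 2 3" by (rule hmap_stripes[OF fphi]) (use FF in "auto simp: phi2")
 have h3: "hmap phi ` stripes s' m 0 1 = stripes s m 0 1" by (rule hmap_stripes[OF fphi]) (use FF in "auto simp: phi1")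
 have h4: "hmap phi ` stripes t' n 2 3 = stripes t n 2 3" by (rule hmap_stripes[OF fphi]) (use FF in "auto simp: phi2")
 define G where "G = (%c d. pl [(0, e0), (1, c), (2, d), (3, e3)])"
 define G0 where "G0 = pl [(0, e0), (3, e3)]"
 have G0: "G0 0 = e0" "G0 3 = e3" "G0 (3/2) = (e0 + e3) / 2" unfolding G0_def using o by (auto simp: field_simps)
 have G: "G c d 0 = e0" "G c d 1 = c" "G c d 2 = d" "G c d 3 = e3" "G c d (3/2) = (c + d) / 2"
  if "e0 < c" "c < d" "d < e3" for c d unfolding G_def using that by (auto simp: field_simps)
 have hG: "line_homeo (G c d)" if "e0 < c" "c < d" "d < e3" for c d unfolding G_def using that by (intro line_homeo_pl) auto
 have hG0: "line_homeo G0" unfolding G0_def using o by (intro line_homeo_pl) auto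
 define G1 G2 where "G1 = G c1 d1" and "G2 = G c2 d2"
 note GG = G[OF o(6-8), folded G1_def] G[OF o(9-11), folded G2_def]
 define psi where "psi = interpolate A G0 [(a1, G1), (b1, G1), (a2, G2)]"
 have fpsi: "fibre_family psi" unfolding psi_def using o by (intro fibre_interpolate_homeo) (auto simp: G1_def G2_def intro!: hG hG0)
 have psiA: "psi A = G0" unfolding psi_def using o by (intro interpolate_le) auto
 have psi1: "psi x y = v" if "a1 <= x" "x <= b1" "G1 y = v" for x y v
  using interpolate_skip[of A "(a1, G1)" "[(b1, G1), (a2, G2)]" x G0] that o interpolate_here[of x "(b1, G1)" G1 y v a1 "[(a2, G2)]"]
  by (simp add: psi_def del: interpolate.simps)
 have psi2: "psi x = G2" if "a2 <= x" for x
  using interpolate_skip[of A "(a1, G1)" "[(b1, G1), (a2, G2)]" x G0] that o interpolate_skip[of a1 "(b1, G1)" "[(a2, G2)]" x G1]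
   interpolate_skip[of b1 "(a2, G2)" "[]" x G1] by (simp add: psi_def del: interpolate.simps(2))
 have psic: "psi x y = v" if "G0 y = v" "G1 y = v" "G2 y = v" for x y v unfolding psi_def using that by (intro interpolate_const) auto
 have v1: "disc_image (vmap psi) (lbox A B 0 3) = lbox A B e0 e3" by (rule vmap_lbox[OF fpsi]) (use G0 GG in "auto intro!: psic simp: psiA")
 have v2: "disc_image (vmap psi) (lbox a1 b1 1 2) = lbox a1 b1 c1 d1"
 proof (rule vmap_lbox[OF fpsi])
  show "psi a1 ((1 + 2) / 2) = (c1 + d1) / 2" by (rule psi1) (use GG o in auto)
  fix x assume "a1 <= x" "x <= b1"
  thus "psi x 1 = c1 & psi x 2 = d1" using GG by (auto intro!: psi1)
 qed
 have v3: "disc_image (vmap psi) (lbox a2 b2 1 2) = lbox a2 b2 c2 d2" by (rule vmap_lbox[OF fpsi]) (use GG o in "auto simp: psi2")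
 have w1: "vmap psi ` stripes p k 0 1 = stripes p k e0 c1"
 proof (rule vmap_stripes[OF fpsi])
  fix i assume "i \<in> {1..k}"
  from spread_bounds[OF o(12) this] GG show "psi (p i) 0 = e0 & psi (p i) 1 = c1" by (auto intro!: psi1)
 qed simp
 have w2: "vmap psi ` stripes q l 2 3 = stripes q l d1 e3"
 proof (rule vmap_stripes[OF fpsi])
  fix i assume "i \<in> {1..l}"
  from spread_bounds[OF o(13) this] GG show "psi (q i) 2 = d1 & psi (q i) 3 = e3" by (auto intro!: psi1)
 qed simp
 have w3: "vmap psi ` stripes s m 0 1 = stripes s m e0 c2"
 proof (rule vmap_stripes[OF fpsi])
  fix i assume "i \<in> {1..m}"
  from spread_bounds[OF o(14) this] GG show "psi (s i) 0 = e0 & psi (s i) 1 = c2" by (auto simp: psi2)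
 qed simp
 have w4: "vmap psi ` stripes t n 2 3 = stripes t n d2 e3"
 proof (rule vmap_stripes[OF fpsi])
  fix i assume "i \<in> {1..n}"
  from spread_bounds[OF o(15) this] GG show "psi (t i) 2 = d2 & psi (t i) 3 = e3" by (auto simp: psi2)
 qed simp
 define h where "h = vmap psi \<circ> hmap phi"
 have dh: "disc_image h D = disc_image (vmap psi) (disc_image (hmap phi) D)" for D by (simp add: h_def disc_image_def image_comp)
 have hS: "h ` S = vmap psi ` hmap phi ` S" for S by (simp add: h_def image_comp)
 have "tangle_image h (row k l m n p' q' s' t' A' B' a1' b1' a2' b2' 0 1 2 1 2 3) = row k l m n p q s t A B a1 b1 a2 b2 e0 c1 d1 c2 d2 e3"
  unfolding tangle_image_def row_simps by (simp only: image_insert image_empty dh img1 img2 img3 v1 v2 v3 image_Un hS h1 h2 h3 h4 w1 w2 w3 w4 row_def)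
 moreover have "isotopic_id h" unfolding h_def using fphi fpsi by (intro isotopic_id_compose isotopic_id_hmap isotopic_id_vmap)
 moreover have "disc_image h (lbox a1' b1' 1 2) = lbox a1 b1 c1 d1" "disc_image h (lbox a2' b2' 1 2) = lbox a2 b2 c2 d2" by (simp_all only: dh img2 img3 v2 v3)
 ultimately show ?thesis using that by blast
qed

lemma (in planar_alg) val_row: assumes "val (row k l m n p' q' s' t' A' B' a1' b1' a2' b2' 0 1 2 1 2 3) f x"
  and ok: "row_ok k l m n p q s t A B a1 b1 a2 b2 e0 c1 d1 c2 d2 e3" and ok': "row_ok k l m n p' q' s' t' A' B' a1' b1' a2' b2' 0 1 2 1 2 3"
  and f: "g (lbox a1 b1 c1 d1) = f (lbox a1' b1' 1 2)" "g (lbox a2 b2 c2 d2) = f (lbox a2' b2' 1 2)"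
 shows "val (row k l m n p q s t A B a1 b1 a2 b2 e0 c1 d1 c2 d2 e3) g x"
proof -
 let ?T1 = "row k l m n p' q' s' t' A' B' a1' b1' a2' b2' 0 1 2 1 2 3"
 obtain h where h: "isotopic_id h" "tangle_image h ?T1 = row k l m n p q s t A B a1 b1 a2 b2 e0 c1 d1 c2 d2 e3"
  "disc_image h (lbox a1' b1' 1 2) = lbox a1 b1 c1 d1" "disc_image h (lbox a2' b2' 1 2) = lbox a2 b2 c2 d2" using row_isotopy[OF ok ok'] .
 have "g (disc_image h D) = f D" if "D \<in> inner ?T1" for D using that f h(3,4) by auto
 from val_iso[OF assms(1) h(1) this] show ?thesis by (simp only: h(2))
qed

text \<open>A box with \<open>k\<close> points at the bottom and \<open>l\<close> points at the top, and a further strand to its right, which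
  carries a box.\<close>

definition beside_tangle :: "nat => nat => tangle" where
 "beside_tangle k l = row k l 1 1 real real (%_. real (k + l) + 2) (%_. real (k + l) + 2) 0 (real (k + l) + 3)
   (1/4) (real (k + l) + 3/2) (real (k + l) + 7/4) (real (k + l) + 9/4) 0 1 2 1 2 3"

definition beside :: "'a planar_algebra => nat => nat => 'a => 'a => 'a" where
 "beside \<P> k l y x = act \<P> (beside_tangle k l) (%B. if B = lbox (1/4) (real (k + l) + 3/2) 1 2 then y else x)"

abbreviation (in planar_alg) "bes \<equiv> beside \<P>"

lemma beside_row_ok: "row_ok k l 1 1 real real (%_. real (k + l) + 2) (%_. real (k + l) + 2) 0 (real (k + l) + 3)
   (1/4) (real (k + l) + 3/2) (real (k + l) + 7/4) (real (k + l) + 9/4) 0 1 2 1 2 3" by (auto simp: row_ok_def spread_def)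

lemma (in planar_alg) val_beside: assumes ok: "row_ok k l 1 1 p q s t A B a1 b1 a2 b2 e0 c1 d1 c2 d2 e3" and ev: "even (k + l)"
  and y: "y \<in> \<B> ((k + l) div 2)" and x: "x \<in> \<B> 1" and f: "f (lbox a1 b1 c1 d1) = y" "f (lbox a2 b2 c2 d2) = x"
 shows "val (row k l 1 1 p q s t A B a1 b1 a2 b2 e0 c1 d1 c2 d2 e3) f (bes k l y x)"
proof -
 have neq: "lbox (real (k + l) + 7/4) (real (k + l) + 9/4) 1 2 ~= lbox (1/4) (real (k + l) + 3/2) 1 2" by (rule lbox_neq) simp
 have "val (beside_tangle k l) (%B. if B = lbox (1/4) (real (k + l) + 3/2) 1 2 then y else x) (bes k l y x)" unfolding beside_def
 proof (rule valI)
  show "planar_tangle (beside_tangle k l)" unfolding beside_tangle_def by (rule planar_row[OF beside_row_ok ev]) simp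
  show "labelling \<P> (beside_tangle k l) (%B. if B = lbox (1/4) (real (k + l) + 3/2) 1 2 then y else x)" using x y box_index_row(2,3)[OF beside_row_ok[of k l]] neq
   unfolding labelling_def beside_tangle_def row_simps by (auto simp del: of_nat_add)
 qed
 from val_row[OF this[unfolded beside_tangle_def] ok beside_row_ok, of f] show ?thesis using f neq by simp
qed

lemma juxt_tangle_row: "juxt_tangle k l = row k k l l real real (%i. real (k + 1 + i)) (%i. real (k + 1 + i)) 0 (real (k + l) + 2)
   (1/4) (real k + 3/4) (real k + 5/4) (real (k + l) + 7/4) 0 1 2 1 2 3"
proof -
 have "{k + 2..k + l + 1} = (%i. k + 1 + i) ` {1..l}"
 proof (intro set_eqI iffI)
  fix x assume "x \<in> {k + 2..k + l + 1}"
  thus "x \<in> (%i. k + 1 + i) ` {1..l}" by (intro image_eqI[of _ _ "x - (k + 1)"]) auto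
 qed auto
 hence "real ` ({1..k} Un {k + 2..k + l + 1}) = real ` {1..k} Un (%i. real (k + 1 + i)) ` {1..l}" by (simp only: image_Un image_image)
 thus ?thesis unfolding juxt_tangle_def row_def juxt_left_def juxt_right_def stripes_def
  by (simp only: UN_Un UN_Un_distrib image_image UN_extend_simps(10)[symmetric]) (auto simp: algebra_simps)
qed

lemma juxt_row_ok: "row_ok k k l l real real (%i. real (k + 1 + i)) (%i. real (k + 1 + i)) 0 (real (k + l) + 2)
   (1/4) (real k + 3/4) (real k + 5/4) (real (k + l) + 7/4) 0 1 2 1 2 3" by (auto simp: row_ok_def spread_def)

lemma (in planar_alg) val_tensor: assumes ok: "row_ok k k l l p q s t A B a1 b1 a2 b2 e0 c1 d1 c2 d2 e3" and y: "y \<in> \<B> k" and x: "x \<in> \<B> l"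
  and f: "f (lbox a1 b1 c1 d1) = y" "f (lbox a2 b2 c2 d2) = x" shows "val (row k k l l p q s t A B a1 b1 a2 b2 e0 c1 d1 c2 d2 e3) f (ten k l y x)"
proof -
 have neq: "lbox (real k + 5/4) (real (k + l) + 7/4) 1 2 ~= lbox (1/4) (real k + 3/4) 1 2" by (rule lbox_neq) simp
 have "val (juxt_tangle k l) (%B. if B = juxt_left k l then y else x) (ten k l y x)" unfolding tensor_def
 proof (rule valI)
  show "planar_tangle (juxt_tangle k l)" unfolding juxt_tangle_row by (rule planar_row[OF juxt_row_ok]) simp_all
  show "labelling \<P> (juxt_tangle k l) (%B. if B = juxt_left k l then y else x)" using x y box_index_row(2,3)[OF juxt_row_ok[of k l]] neq
   unfolding labelling_def juxt_tangle_row row_simps by (auto simp: juxt_left_def simp del: of_nat_add)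
 qed
 from val_row[OF this[unfolded juxt_tangle_row] ok juxt_row_ok, of f] show ?thesis using f neq by (simp add: juxt_left_def)
qed

subsection \<open>Parallel strands, and a single turned box\<close>

lemma fibre_family_const: "line_homeo F ==> fibre_family (%_. F)"
proof -
 assume "line_homeo F"
 hence "fibre_family (interpolate 0 F [])" by (intro fibre_interpolate_homeo) auto
 moreover have "interpolate 0 F [] = (%_. F)" by (simp add: fun_eq_iff)
 ultimately show ?thesis by simp
qed

definition straight where "straight k p A B c d = Tangle (lbox A B c d) {} (stripes p k c d)"

lemma straight_simps [simp]: "outer (straight k p A B c d) = lbox A B c d" "inner (straight k p A B c d) = {}" "strings (straight k p A B c d) = stripes p k c d"
 by (simp_all add: straight_def)

lemma boundary_points_straight: assumes "spread p k A B" "c < d" shows "boundary_points (straight k p A B c d) (lbox A B c d) = points p k c Un points p k d"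
 using stripes_frontier(3)[OF assms refl refl] by (simp add: boundary_points_def)

lemma planar_straight: assumes "spread p k A B" "A < B" "c < d" shows "planar_tangle (straight k p A B c d)"
proof (rule planar_tangle_vertical)
 let ?V = "(%i. (p i, c, d)) ` {1..k}"
 show "is_disc (outer (straight k p A B c d))" using assms by (simp add: is_disc_lbox)
 show "finite ?V" "strings (straight k p A B c d) = (\<Union>(x, c, d)\<in>?V. vline x c d)" by (auto simp: stripes_def)
 fix x c' d' assume "(x, c', d') \<in> ?V"
 hence "c' = c" "d' = d" "A < x" "x < B" using assms(1) by (auto simp: spread_def)
 thus "open_strand (straight k p A B c d) (vline x c' d')"
  using assms(3) by (intro open_strand_vline) (auto simp: exterior_region_def interior_rect_iff box_frontiers_def boxes_def frontier_rect_iff)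
next
 fix B' assume B': "B' \<in> boxes (straight k p A B c d)"
 hence b: "B' = lbox A B c d" by (simp add: boxes_def)
 show "star B' \<notin> strings (straight k p A B c d)" using assms b by (auto simp: stripes_iff spread_def)
 show "even (card (boundary_points (straight k p A B c d) B'))"
  using card_points2[OF assms(1,1), of c d] assms(3) by (simp add: b boundary_points_straight[OF assms(1,3)])
qed auto

lemma (in planar_alg) val_straight: assumes s: "spread p k A B" and "A < B" "c < d" shows "val (straight k p A B c d) f (str k)"
proof -
 have eq: "strands_tangle k = straight k real 0 (real k + 1) 0 1" by (simp add: strands_tangle_def straight_def stripes_def)
 have s': "spread real k 0 (real k + 1)" by (rule spread_real) auto
 have v: "val (strands_tangle k) (%_. undefined) (str k)" unfolding strands_def using planar_straight[OF s'] by (intro valI) (simp_all add: eq labelling_def)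
 let ?T1 = "spread_nodes ([] @ [(0, A)]) real p k ((real k + 1, B) # [])"
 define F where "F = pl ?T1"
 have n: "nodes ?T1" by (rule nodes_spread[OF s' s]) (use assms in auto)
 have F: "F 0 = A" "F (real k + 1) = B" "i \<in> {1..k} ==> F (real i) = p i" for i using pl_spread_node[OF n] unfolding F_def by auto
 define G where "G = pl [(0, c), (1, d)]"
 have G: "G 0 = c" "G 1 = d" "G (1/2) = (c + d) / 2" unfolding G_def using assms by (auto simp: field_simps)
 have fphi: "fibre_family (%_. F)" unfolding F_def by (rule fibre_family_const[OF line_homeo_pl[OF n]])
 have fpsi: "fibre_family (%_. G)" unfolding G_def by (rule fibre_family_const[OF line_homeo_pl]) (use assms in simp)
 define h where "h = vmap (%_. G) \<circ> hmap (%_. F)"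
 have dh: "disc_image h D = disc_image (vmap (%_. G)) (disc_image (hmap (%_. F)) D)" for D by (simp add: h_def disc_image_def image_comp)
 have hS: "h ` S = vmap (%_. G) ` hmap (%_. F) ` S" for S by (simp add: h_def image_comp)
 have "disc_image (hmap (%_. F)) (lbox 0 (real k + 1) 0 1) = lbox A B 0 1" by (rule hmap_lbox[OF fphi]) (use F in auto)
 moreover have "disc_image (vmap (%_. G)) (lbox A B 0 1) = lbox A B c d" by (rule vmap_lbox[OF fpsi]) (use G in auto)
 moreover have "hmap (%_. F) ` stripes real k 0 1 = stripes p k 0 1" by (rule hmap_stripes[OF fphi]) (use F in auto)
 moreover have "vmap (%_. G) ` stripes p k 0 1 = stripes p k c d" by (rule vmap_stripes[OF fpsi]) (use G in auto)
 ultimately have "tangle_image h (strands_tangle k) = straight k p A B c d"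
  unfolding tangle_image_def eq straight_simps by (simp only: dh hS image_empty straight_def)
 moreover have "isotopic_id h" unfolding h_def using fphi fpsi by (intro isotopic_id_compose isotopic_id_hmap isotopic_id_vmap)
 ultimately show ?thesis using val_iso[OF v, of h f] by (simp add: eq)
qed

definition turned where "turned K A B a b e0 e1 e2 e3 =
   Tangle (lbox A B e0 e3) {rbox a b e1 e2} (stripes (%_. K) 1 e0 e1 Un stripes (%_. K) 1 e2 e3)"

lemma turned_simps [simp]: "outer (turned K A B a b e0 e1 e2 e3) = lbox A B e0 e3" "inner (turned K A B a b e0 e1 e2 e3) = {rbox a b e1 e2}"
 "strings (turned K A B a b e0 e1 e2 e3) = stripes (%_. K) 1 e0 e1 Un stripes (%_. K) 1 e2 e3" by (simp_all add: turned_def)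

lemma spread_const1: "a < K ==> K < b ==> spread (%_. K) 1 a b" by (auto simp: spread_def)

lemma boundary_points_turned: assumes "A < a" "a < K" "K < b" "b < B" "e0 < e1" "e1 < e2" "e2 < e3"
 shows "boundary_points (turned K A B a b e0 e1 e2 e3) (lbox A B e0 e3) = points (%_. K) 1 e0 Un points (%_. K) 1 e3"
  "boundary_points (turned K A B a b e0 e1 e2 e3) (rbox a b e1 e2) = points (%_. K) 1 e1 Un points (%_. K) 1 e2"
proof -
 have s: "spread (%_. K) 1 A B" "spread (%_. K) 1 a b" by (rule spread_const1; use assms in linarith)+
 have e: "e1 < e3" "e0 < e2" using assms by linarith+
 show "boundary_points (turned K A B a b e0 e1 e2 e3) (lbox A B e0 e3) = points (%_. K) 1 e0 Un points (%_. K) 1 e3"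
  by (simp only: boundary_points_def turned_simps lbox_simps Int_Un_distrib2 stripes_frontier(2)[OF s(1) assms(5) refl e(1)]
    stripes_frontier(1)[OF s(1) assms(7) e(2) assms(7) refl])
 show "boundary_points (turned K A B a b e0 e1 e2 e3) (rbox a b e1 e2) = points (%_. K) 1 e1 Un points (%_. K) 1 e2"
  by (simp only: boundary_points_def turned_simps rbox_simps Int_Un_distrib2 stripes_frontier(4)[OF s(2) assms(5) refl assms(6)]
    stripes_frontier(5)[OF s(2) assms(7) refl assms(6)])
qed

lemma planar_turned: assumes o: "A < a" "a < K" "K < b" "b < B" "e0 < e1" "e1 < e2" "e2 < e3" shows "planar_tangle (turned K A B a b e0 e1 e2 e3)"
proof (rule planar_tangle_vertical)
 let ?T = "turned K A B a b e0 e1 e2 e3"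
 let ?V = "{(K, e0, e1), (K, e2, e3)}"
 have s: "spread (%_. K) 1 A B" "spread (%_. K) 1 a b" by (rule spread_const1; use assms in linarith)+
 have ext: "z \<in> exterior_region ?T \<longleftrightarrow> A < Re z & Re z < B & e0 < Im z & Im z < e3 &
   \<not> (a <= Re z & Re z <= b & e1 <= Im z & Im z <= e2)" for z by (simp add: exterior_region_def interior_rect_iff rect_iff)
 have fr: "z \<in> box_frontiers ?T \<longleftrightarrow> z \<in> frontier (rect A B e0 e3) | z \<in> frontier (rect a b e1 e2)" for z
  by (auto simp: box_frontiers_def boxes_def)
 show "is_disc (outer ?T)" using o by (auto intro: is_disc_lbox)
 show "finite ?V" "strings ?T = (\<Union>(x, c, d)\<in>?V. vline x c d)" by (auto simp: stripes_def)
 show "is_disc B'" "region B' <= interior (region (outer ?T))" if "B' \<in> inner ?T" for B'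
  using o that by (auto simp: interior_rect_iff rect_iff intro: is_disc_rbox)
 show "open_strand ?T (vline x c d)" if v: "(x, c, d) \<in> ?V" for x c d
 proof -
  consider "x = K" "c = e0" "d = e1" | "x = K" "c = e2" "d = e3" using v by auto
  thus ?thesis
  proof cases
   case 1 thus ?thesis using o by (intro open_strand_vline) (auto simp: ext fr frontier_rect_iff)
  next
   case 2 thus ?thesis using o by (intro open_strand_vline) (auto simp: ext fr frontier_rect_iff)
  qed
 qed
 fix B' assume B': "B' \<in> boxes ?T"
 show "star B' \<notin> strings ?T" using B' o by (auto simp: stripes_iff boxes_def)
 show "even (card (boundary_points ?T B'))" using B' o card_points2[OF s(1,1), of e0 e3] card_points2[OF s(2,2), of e1 e2]
  by (auto simp: boxes_def boundary_points_turned[OF o])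
qed (use assms in auto)

lemma (in planar_alg) val_turned: assumes o: "A < a" "a < K" "K < b" "b < B" "e0 < e1" "e1 < e2" "e2 < e3" and x: "x \<in> \<B> 1" and f: "f (rbox a b e1 e2) = x"
 shows "val (turned K A B a b e0 e1 e2 e3) f (rot x)"
proof -
 let ?T1 = "turned 1 0 3 (1/2) (5/2) 0 1 2 3"
 have eq: "cable_tangle 1 (rotated_box 1) = ?T1" by (simp add: cable_tangle_def turned_def rotated_box_def stripes_def)
 have o': "0 < (1/2::real)" "1/2 < (1::real)" "1 < (5/2::real)" "5/2 < (3::real)" "0 < (1::real)" "1 < (2::real)" "2 < (3::real)" by simp_all
 have s: "spread (%_. 1) 1 (1/2) (5/2)" by (rule spread_const1) auto
 have v: "val ?T1 (%_. x) (rot x)" unfolding rotation_def eq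
 proof (rule valI)
  show "planar_tangle ?T1" by (rule planar_turned[OF o'])
  show "labelling \<P> ?T1 (%_. x)" using x card_points2[OF s s, of 1 2] by (simp add: labelling_def box_index_def boundary_points_turned(2)[OF o'])
 qed
 define F where "F = pl [(0, A), (1/2, a), (1, K), (5/2, b), (3, B)]"
 have nF: "nodes [(0, A), (1/2, a), (1, K), (5/2, b), (3, B)]" using o by auto
 have F: "F 0 = A" "F (1/2) = a" "F 1 = K" "F (5/2) = b" "F 3 = B"
  using pl_node[OF nF, of "(0, A)"] pl_node[OF nF, of "(1/2, a)"] pl_node[OF nF, of "(1, K)"] pl_node[OF nF, of "(5/2, b)"] pl_node[OF nF, of "(3, B)"]
  by (simp_all add: F_def del: pl.simps)
 define G0 where "G0 = pl [(0, e0), (3, e3)]"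
 define G1 where "G1 = pl [(0, e0), (1, e1), (2, e2), (3, e3)]"
 have G0: "G0 0 = e0" "G0 3 = e3" "G0 (3/2) = (e0 + e3) / 2" unfolding G0_def using o by (auto simp: field_simps)
 have G1: "G1 0 = e0" "G1 1 = e1" "G1 2 = e2" "G1 3 = e3" "G1 (3/2) = (e1 + e2) / 2" unfolding G1_def using o by (auto simp: field_simps)
 have fphi: "fibre_family (%_. F)" unfolding F_def by (rule fibre_family_const[OF line_homeo_pl[OF nF]])
 define psi where "psi = interpolate A G0 [(a, G1)]"
 have "line_homeo G0" "line_homeo G1" unfolding G0_def G1_def using o by (auto intro!: line_homeo_pl)
 hence fpsi: "fibre_family psi" unfolding psi_def using o by (intro fibre_interpolate_homeo) auto
 have psiA: "psi A = G0" unfolding psi_def using o by (intro interpolate_le) auto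
 have psi1: "psi x = G1" if "a <= x" for x using interpolate_skip[of A "(a, G1)" "[]" x G0] that o by (simp add: psi_def)
 have psic: "psi x y = v" if "G0 y = v" "G1 y = v" for x y v unfolding psi_def using that by (intro interpolate_const) auto
 define h where "h = vmap psi \<circ> hmap (%_. F)"
 let ?T2 = "hmap (%_. F)"
 have dh: "disc_image h D = disc_image (vmap psi) (disc_image ?T2 D)" for D by (simp add: h_def disc_image_def image_comp)
 have hS: "h ` S = vmap psi ` hmap (%_. F) ` S" for S by (simp add: h_def image_comp)
 have 1: "disc_image ?T2 (lbox 0 3 0 3) = lbox A B 0 3" by (rule hmap_lbox[OF fphi]) (use F in auto)
 have 2: "disc_image (vmap psi) (lbox A B 0 3) = lbox A B e0 e3" by (rule vmap_lbox[OF fpsi]) (use G0 G1 in "auto intro!: psic simp: psiA")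
 have 3: "disc_image ?T2 (rbox (1/2) (5/2) 1 2) = rbox a b 1 2" by (rule hmap_rbox[OF fphi]) (use F in auto)
 have 4: "disc_image (vmap psi) (rbox a b 1 2) = rbox a b e1 e2" by (rule vmap_rbox[OF fpsi]) (use G1 o in "auto simp: psi1")
 have 5: "hmap (%_. F) ` stripes (%_. 1) 1 c d = stripes (%_. K) 1 c d" if "c <= d" for c d by (rule hmap_stripes[OF fphi]) (use F that in auto)
 have 6: "vmap psi ` stripes (%_. K) 1 0 1 = stripes (%_. K) 1 e0 e1" "vmap psi ` stripes (%_. K) 1 2 3 = stripes (%_. K) 1 e2 e3"
  by (rule vmap_stripes[OF fpsi]; use G1 o in "auto simp: psi1")+
 have img: "tangle_image h ?T1 = turned K A B a b e0 e1 e2 e3" unfolding tangle_image_def turned_simps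
  by (simp add: dh hS 1 2 3 4 5 6 image_Un turned_def del: One_nat_def)
 have "isotopic_id h" unfolding h_def using fphi fpsi by (intro isotopic_id_compose isotopic_id_hmap isotopic_id_vmap)
 moreover have "f (disc_image h D) = x" if "D \<in> inner ?T1" for D using that f by (simp add: dh 3 4)
 ultimately have "val (tangle_image h ?T1) f (rot x)" by (rule val_iso[OF v])
 thus ?thesis by (simp only: img)
qed

lemma isotopic_id_half_turn: "isotopic_id (%z. c - z)"
proof (rule isotopic_idI[where H = "%t z. c / 2 + cis (pi * t) * (z - c / 2)"])
 show "continuous_on ({0..1} \<times> UNIV) (%(t, z). c / 2 + cis (pi * t) * (z - c / 2))" unfolding case_prod_unfold by (intro continuous_intros)
 show "inj (%z. c / 2 + cis (pi * t) * (z - c / 2))" for t by (rule injI) auto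
 show "surj (%z. c / 2 + cis (pi * t) * (z - c / 2))" for t
 proof -
  have "EX z. c / 2 + cis (pi * t) * (z - c / 2) = w" for w by (rule exI[of _ "c / 2 + (w - c / 2) / cis (pi * t)"]) simp
  thus ?thesis unfolding surj_def by metis
 qed
qed (auto simp: fun_eq_iff field_simps)

lemma (in planar_alg) rotation_strand: "rot wire = wire"
proof -
 let ?c = "Complex 3 3"
 have s: "spread (%_. 3/2) 1 (1/2) (5/2)" by (rule spread_const1) auto
 let ?T1 = "straight 1 (%_. 3/2) (1/2) (5/2) 1 2"
 have v: "val ?T1 f wire" for f by (rule val_straight[OF s]) auto
 have X: "wire \<in> \<B> 1" by (rule val_in[OF v]) (use card_points2[OF s s, of 1 2] in "simp add: box_index_def boundary_points_straight[OF s] del: One_nat_def")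
 define U where "U = Tangle (rbox (1/2) (5/2) 1 2) {} (stripes (%_. 3/2) 1 1 2)"
 have "(%z. ?c - z) ` rect (1/2) (5/2) 1 2 = rect (1/2) (5/2) 1 2"
 proof (intro subset_antisym subsetI)
  fix z assume "z \<in> rect (1/2) (5/2) 1 2"
  thus "z \<in> (%z. ?c - z) ` rect (1/2) (5/2) 1 2" by (intro image_eqI[of _ _ "?c - z"]) (auto simp: rect_iff)
 qed (auto simp: rect_iff)
 moreover have "(%z. ?c - z) ` stripes (%_. 3/2) 1 1 2 = stripes (%_. 3/2) 1 1 2"
 proof (intro subset_antisym subsetI)
  fix z assume "z \<in> stripes (%_. 3/2) 1 1 2"
  thus "z \<in> (%z. ?c - z) ` stripes (%_. 3/2) 1 1 2" by (intro image_eqI[of _ _ "?c - z"]) (auto simp: stripes_iff)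
 qed (auto simp: stripes_iff)
 ultimately have "tangle_image (%z. ?c - z) ?T1 = U" unfolding tangle_image_def straight_simps U_def by (simp add: disc_image_def lbox_def rbox_def complex_eq_iff)
 hence vU: "val U f wire" for f using val_iso[OF v isotopic_id_half_turn[of ?c]] by simp
 define T where "T = turned (3/2) 0 3 (1/2) (5/2) 0 1 2 3"
 have o: "0 < (1/2::real)" "1/2 < (3/2::real)" "3/2 < (5/2::real)" "5/2 < (3::real)" "0 < (1::real)" "1 < (2::real)" "2 < (3::real)" by simp_all
 have vT: "val T (%_. wire) (rot wire)" unfolding T_def by (rule val_turned[OF o X refl])
 have s3: "spread (%_. 3/2) 1 0 3" by (rule spread_const1) auto
 have bU: "boundary_points U (rbox (1/2) (5/2) 1 2) = points (%_. 3/2) 1 1 Un points (%_. 3/2) 1 2"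
  using stripes_frontier(3)[OF s, of 1 2 1 2] by (simp add: U_def boundary_points_def)
 have "val (compose_tangle T (rbox (1/2) (5/2) 1 2) U) (%_. wire) (rot wire)"
  by (rule val_insert[OF vT vU]) (auto simp: T_def U_def[symmetric] bU boundary_points_turned[OF o], simp_all add: U_def)
 moreover have "compose_tangle T (rbox (1/2) (5/2) 1 2) U = straight 1 (%_. 3/2) 0 3 0 3" by (auto simp: compose_tangle_def T_def U_def straight_def stripes_iff)
 ultimately show ?thesis using val_unique val_straight[OF s3] by fastforce
qed

section \<open>Sliding a strand around the tip of a box\<close>

text \<open>Polar coordinates on the half plane to the right of \<open>x0\<close>: the radius is the maximum norm, the angle is
  \<open>v / (u + \<bar>v\<bar>)\<close>.  The map changes the angle by \<open>beta\<close>, keeps the radius and fixes the left half plane.\<close>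

definition wedge :: "real => (real => real) => complex => complex" where
 "wedge x0 beta z = (let u = Re z - x0; v = Im z; rho = max u \<bar>v\<bar>; s = beta (v / (u + \<bar>v\<bar>)); m = max (1 - \<bar>s\<bar>) \<bar>s\<bar> in
   if u <= 0 then z else Complex (x0 + rho * ((1 - \<bar>s\<bar>) / m)) (rho * (s / m)))"

definition angle_map :: "(real => real) => bool" where "angle_map beta \<longleftrightarrow> line_homeo beta & beta (- 1) = - 1 & beta 1 = 1"

lemma wedge_left: "Re z <= x0 ==> wedge x0 beta z = z" by (simp add: wedge_def Let_def)

lemma polar_point:
 fixes rho s :: real assumes "0 < rho" "\<bar>s\<bar> < 1"
 defines "m \<equiv> max (1 - \<bar>s\<bar>) \<bar>s\<bar>"
 shows "0 < rho * ((1 - \<bar>s\<bar>) / m)" "max (rho * ((1 - \<bar>s\<bar>) / m)) \<bar>rho * (s / m)\<bar> = rho"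
  "(rho * (s / m)) / (rho * ((1 - \<bar>s\<bar>) / m) + \<bar>rho * (s / m)\<bar>) = s"
proof -
 have m: "0 < m" using assms(2) by (auto simp: m_def)
 show "0 < rho * ((1 - \<bar>s\<bar>) / m)" using assms m by simp
 have a: "\<bar>rho * (s / m)\<bar> = rho * (\<bar>s\<bar> / m)" using assms m by (simp add: abs_mult)
 have "max (rho * ((1 - \<bar>s\<bar>) / m)) (rho * (\<bar>s\<bar> / m)) = rho * (max (1 - \<bar>s\<bar>) \<bar>s\<bar> / m)"
  using assms(1) m by (auto simp: max_def divide_simps mult_le_cancel_left_pos)
 also have "\<dots> = rho" using m by (simp add: m_def)
 finally show "max (rho * ((1 - \<bar>s\<bar>) / m)) \<bar>rho * (s / m)\<bar> = rho" by (simp only: a)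
 have "rho * ((1 - \<bar>s\<bar>) / m) + \<bar>rho * (s / m)\<bar> = rho / m" unfolding a using m by (simp add: field_simps)
 thus "(rho * (s / m)) / (rho * ((1 - \<bar>s\<bar>) / m) + \<bar>rho * (s / m)\<bar>) = s" using assms(1) m by simp
qed

lemma polar_coordinates:
 fixes u v :: real assumes "0 < u"
 defines "s \<equiv> v / (u + \<bar>v\<bar>)" and "rho \<equiv> max u \<bar>v\<bar>"
 shows "\<bar>s\<bar> < 1" "0 < rho" "rho * ((1 - \<bar>s\<bar>) / max (1 - \<bar>s\<bar>) \<bar>s\<bar>) = u" "rho * (s / max (1 - \<bar>s\<bar>) \<bar>s\<bar>) = v"
proof -
 have d: "0 < u + \<bar>v\<bar>" using assms by linarith
 have as: "\<bar>s\<bar> = \<bar>v\<bar> / (u + \<bar>v\<bar>)" using d by (simp add: s_def)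
 have bs: "1 - \<bar>s\<bar> = u / (u + \<bar>v\<bar>)" using d by (simp add: as field_simps)
 have m: "max (1 - \<bar>s\<bar>) \<bar>s\<bar> = rho / (u + \<bar>v\<bar>)" unfolding bs as rho_def using d by (auto simp: max_def divide_simps)
 show rho: "0 < rho" using assms by (simp add: rho_def)
 show "\<bar>s\<bar> < 1" using d assms by (simp add: as)
 show "rho * ((1 - \<bar>s\<bar>) / max (1 - \<bar>s\<bar>) \<bar>s\<bar>) = u" unfolding m unfolding bs using rho d by simp
 show "rho * (s / max (1 - \<bar>s\<bar>) \<bar>s\<bar>) = v" unfolding m using rho d by (simp add: s_def)
qed

lemma wedge_eq:
 fixes beta :: "real => real" assumes "x0 < Re z"
 defines "s \<equiv> beta (Im z / (Re z - x0 + \<bar>Im z\<bar>))"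
 shows "wedge x0 beta z = Complex (x0 + max (Re z - x0) \<bar>Im z\<bar> * ((1 - \<bar>s\<bar>) / max (1 - \<bar>s\<bar>) \<bar>s\<bar>))
  (max (Re z - x0) \<bar>Im z\<bar> * (s / max (1 - \<bar>s\<bar>) \<bar>s\<bar>))" using assms(1) by (simp add: wedge_def Let_def s_def)

lemma wedge_right: assumes "x0 < Re z" "ALL s. \<bar>s\<bar> < 1 --> \<bar>beta s\<bar> < 1"
 shows "x0 < Re (wedge x0 beta z)" "max (Re (wedge x0 beta z) - x0) \<bar>Im (wedge x0 beta z)\<bar> = max (Re z - x0) \<bar>Im z\<bar>"
  "Im (wedge x0 beta z) / (Re (wedge x0 beta z) - x0 + \<bar>Im (wedge x0 beta z)\<bar>) = beta (Im z / (Re z - x0 + \<bar>Im z\<bar>))"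
proof -
 have u: "0 < Re z - x0" using assms by simp
 note p = polar_coordinates[OF u, of "Im z"]
 note q = polar_point[OF p(2) assms(2)[rule_format, OF p(1)]]
 show "x0 < Re (wedge x0 beta z)" unfolding wedge_eq[OF assms(1)] complex.sel using q(1) by linarith
 show "max (Re (wedge x0 beta z) - x0) \<bar>Im (wedge x0 beta z)\<bar> = max (Re z - x0) \<bar>Im z\<bar>"
  unfolding wedge_eq[OF assms(1)] complex.sel add_diff_cancel_left' by (rule q(2))
 show "Im (wedge x0 beta z) / (Re (wedge x0 beta z) - x0 + \<bar>Im (wedge x0 beta z)\<bar>) = beta (Im z / (Re z - x0 + \<bar>Im z\<bar>))"
  unfolding wedge_eq[OF assms(1)] complex.sel add_diff_cancel_left' by (rule q(3))
qed

lemma wedge_identity: assumes "ALL s. \<bar>s\<bar> < 1 --> beta s = s" shows "wedge x0 beta z = z"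
proof (cases "Re z <= x0")
 case True thus ?thesis by (simp add: wedge_left)
next
 case False
 hence u: "x0 < Re z" "0 < Re z - x0" by simp_all
 note p = polar_coordinates[OF u(2), of "Im z"]
 show ?thesis unfolding wedge_eq[OF u(1)] assms[rule_format, OF p(1)] p(3,4) by simp
qed

lemma wedge_inverse: assumes beta: "ALL s. \<bar>s\<bar> < 1 --> \<bar>beta s\<bar> < 1" "ALL s. \<bar>s\<bar> < 1 --> gamma (beta s) = s"
 shows "wedge x0 gamma (wedge x0 beta z) = z"
proof (cases "Re z <= x0")
 case True thus ?thesis by (simp add: wedge_left)
next
 case False
 hence u: "x0 < Re z" "0 < Re z - x0" by simp_all
 note w = wedge_right[OF u(1) beta(1)]
 note p = polar_coordinates[OF u(2), of "Im z"]
 show ?thesis unfolding wedge_eq[OF w(1)] w(2,3) beta(2)[rule_format, OF p(1)] p(3,4) by simp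
qed

lemma angle_map_interpolate: assumes "angle_map beta" "0 <= t" "t <= 1" shows "angle_map (%s. (1 - t) * s + t * beta s)"
proof -
 have b: "continuous_on UNIV beta" "strict_mono beta" "surj beta" using assms(1) by (simp_all add: angle_map_def line_homeo_def)
 have i: "strict_mono (%x::real. x)" "surj (%x::real. x)" "continuous_on UNIV (%x::real. x)" by (auto simp: strict_mono_def surj_def)
 have "strict_mono (%s. (1 - t) * s + t * beta s)" by (rule convex_combination_strict_mono[OF i(1) b(2) assms(2,3)])
 moreover have "surj (%s. (1 - t) * s + t * beta s)"
  by (rule convex_combination_surj[OF strict_mono_mono[OF i(1)] strict_mono_mono[OF b(2)] assms(2,3) i(3) b(1) i(2) b(3)])
 moreover have "continuous_on UNIV (%s. (1 - t) * s + t * beta s)" by (intro continuous_on_add continuous_on_mult continuous_on_const continuous_on_id b(1))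
 ultimately show ?thesis using assms(1) by (simp add: angle_map_def line_homeo_def)
qed

lemma angle_map_bound: assumes "angle_map beta"
 shows "\<bar>s\<bar> < 1 \<longleftrightarrow> \<bar>beta s\<bar> < 1" "\<bar>s\<bar> <= 1 ==> \<bar>beta s\<bar> <= 1"
proof -
 have m: "beta a < beta b \<longleftrightarrow> a < b" "beta a <= beta b \<longleftrightarrow> a <= b" for a b
  using assms by (auto simp: angle_map_def line_homeo_def strict_mono_less strict_mono_less_eq)
 have e: "beta (- 1) = - 1" "beta 1 = 1" using assms by (simp_all add: angle_map_def)
 show "\<bar>s\<bar> < 1 \<longleftrightarrow> \<bar>beta s\<bar> < 1" using m(1)[of "-1" s] m(1)[of s 1] e by (auto simp: abs_less_iff)
 show "\<bar>s\<bar> <= 1 ==> \<bar>beta s\<bar> <= 1" using m(2)[of "-1" s] m(2)[of s 1] e by (auto simp: abs_le_iff)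
qed

lemma continuous_wedge: assumes beta: "angle_map beta" shows "continuous_on ({0..1} \<times> UNIV) (%p. wedge x0 (%s. (1 - fst p) * s + fst p * beta s) (snd p))"
proof -
 define u v rho \<sigma> s m where "u = (%p::real \<times> complex. Re (snd p) - x0)" and "v = (%p::real \<times> complex. Im (snd p))"
  and "rho = (%p. max (u p) \<bar>v p\<bar>)" and "\<sigma> = (%p. v p / (u p + \<bar>v p\<bar>))"
  and "s = (%p. (1 - fst p) * \<sigma> p + fst p * beta (\<sigma> p))" and "m = (%p. max (1 - \<bar>s p\<bar>) \<bar>s p\<bar>)"
 define F where "F = (%p. Complex (x0 + rho p * ((1 - \<bar>s p\<bar>) / m p)) (rho p * (s p / m p)))"
 define A where "A = {p \<in> {0..1} \<times> (UNIV :: complex set). 0 <= u p}"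
 have \<sigma>1: "\<bar>\<sigma> p\<bar> <= 1" if "p \<in> A" for p using that by (auto simp: A_def \<sigma>_def divide_le_eq)
 have s1: "\<bar>s p\<bar> <= 1" if "p \<in> A" for p using angle_map_bound(2)[OF angle_map_interpolate[OF beta] \<sigma>1[OF that]] that by (auto simp: s_def A_def)
 have m1: "1/2 <= m p" for p by (auto simp: m_def max_def)
 have tu: "(u \<longlongrightarrow> u p) (at p within A)" "(v \<longlongrightarrow> v p) (at p within A)" for p unfolding u_def v_def by (intro tendsto_intros)+
 have trho: "(rho \<longlongrightarrow> rho p) (at p within A)" for p unfolding rho_def by (intro tendsto_intros tu)
 have cF: "(F \<longlongrightarrow> F p) (at p within A)" if p: "p \<in> A" for p
 proof (cases "rho p = 0")
  case True
  have b: "\<bar>(1 - \<bar>s q\<bar>) / m q\<bar> <= 1" "\<bar>s q / m q\<bar> <= 1" if "q \<in> A" for q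
   using s1[OF that] m1[of q] by (auto simp: m_def divide_le_eq)
  have "((%q. rho q * f q) \<longlongrightarrow> 0) (at p within A)" if f: "!!q. q \<in> A ==> \<bar>f q\<bar> <= 1" for f :: "real \<times> complex => real"
  proof (rule Lim_null_comparison[where g = "%q. \<bar>rho q\<bar>"])
   show "\<forall>\<^sub>F q in at p within A. norm (rho q * f q) <= \<bar>rho q\<bar>" unfolding eventually_at_filter
    by (rule always_eventually) (use f in "auto simp: abs_mult mult_left_le")
   show "((%q. \<bar>rho q\<bar>) \<longlongrightarrow> 0) (at p within A)" using tendsto_rabs[OF trho[of p]] True by simp
  qed
  from this[OF b(1)] this[OF b(2)] have "(F \<longlongrightarrow> Complex (x0 + 0) 0) (at p within A)" unfolding F_def by (intro tendsto_intros)
  thus ?thesis using True by (simp add: F_def)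
 next
  case False
  hence d: "u p + \<bar>v p\<bar> ~= 0" using p by (auto simp: rho_def A_def)
  have t\<sigma>: "(\<sigma> \<longlongrightarrow> \<sigma> p) (at p within A)" unfolding \<sigma>_def by (intro tendsto_intros tu d)
  have "isCont beta (\<sigma> p)" using beta by (simp add: angle_map_def line_homeo_def continuous_on_eq_continuous_at)
  hence "((%q. beta (\<sigma> q)) \<longlongrightarrow> beta (\<sigma> p)) (at p within A)" using t\<sigma> isCont_tendsto_compose by blast
  hence ts: "(s \<longlongrightarrow> s p) (at p within A)" unfolding s_def by (intro tendsto_intros t\<sigma>)
  have tm: "(m \<longlongrightarrow> m p) (at p within A)" unfolding m_def by (intro tendsto_intros ts)
  have "m p ~= 0" using m1[of p] by auto
  thus ?thesis unfolding F_def by (intro tendsto_intros trho ts tm)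
 qed
 have "continuous_on ({0..1} \<times> UNIV) (%p. if u p <= 0 then snd p else F p)"
 proof (rule continuous_on_cases_le)
  show "continuous_on {p \<in> {0..1} \<times> UNIV. u p <= 0} snd" by (intro continuous_intros)
  show "continuous_on {p \<in> {0..1} \<times> UNIV. 0 <= u p} F" using cF unfolding A_def continuous_on_def by blast
  show "continuous_on ({0..1} \<times> UNIV) u" unfolding u_def by (intro continuous_intros)
  fix p :: "real \<times> complex" assume p: "p \<in> {0..1} \<times> UNIV" "u p = 0"
  show "snd p = F p"
  proof (cases "v p = 0")
   case True
   hence "F p = Complex x0 0" using p(2) by (simp add: F_def rho_def)
   thus ?thesis using True p(2) by (simp add: u_def v_def complex_eq_iff)
  next
   case False
   hence "\<sigma> p = sgn (v p)" using p(2) by (simp add: \<sigma>_def sgn_if abs_if)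
   hence "s p = sgn (v p)" using beta False by (auto simp: s_def sgn_if angle_map_def algebra_simps)
   hence "\<bar>s p\<bar> = 1" "rho p * s p = v p" using False p(2) by (auto simp: rho_def sgn_if)
   hence "F p = Complex x0 (v p)" by (simp add: F_def m_def)
   thus ?thesis using p(2) by (simp add: u_def v_def complex_eq_iff)
  qed
 qed
 moreover have "(if u p <= 0 then snd p else F p) = wedge x0 (%s. (1 - fst p) * s + fst p * beta s) (snd p)" for p
  by (simp add: wedge_def Let_def u_def v_def F_def rho_def m_def s_def \<sigma>_def)
 ultimately show ?thesis by simp
qed

lemma angle_map_inverse: assumes "angle_map beta"
 shows "EX gamma. (ALL s. beta (gamma s) = s) & (ALL s. gamma (beta s) = s) & (ALL s. \<bar>s\<bar> < 1 --> \<bar>gamma s\<bar> < 1)"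
proof -
 have b: "inj beta" "surj beta" using assms by (auto simp: angle_map_def line_homeo_def intro: strict_mono_imp_inj_on)
 have 1: "beta (inv beta s) = s" "inv beta (beta s) = s" for s using b by (auto simp: surj_f_inv_f)
 have 2: "\<bar>s\<bar> < 1 ==> \<bar>inv beta s\<bar> < 1" for s using angle_map_bound(1)[OF assms, of "inv beta s"] 1(1) by simp
 show ?thesis by (rule exI[of _ "inv beta"]) (simp add: 1 2)
qed

lemma wedge_bij: assumes "angle_map beta" shows "inj (wedge x0 beta)" "surj (wedge x0 beta)"
proof -
 obtain gamma where g: "ALL s. beta (gamma s) = s" "ALL s. gamma (beta s) = s" "ALL s. \<bar>s\<bar> < 1 --> \<bar>gamma s\<bar> < 1"
  using angle_map_inverse[OF assms] by blast
 have b: "ALL s. \<bar>s\<bar> < 1 --> \<bar>beta s\<bar> < 1" using angle_map_bound(1)[OF assms] by simp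
 have "wedge x0 gamma (wedge x0 beta z) = z" for z by (rule wedge_inverse) (simp_all add: b g)
 thus "inj (wedge x0 beta)" by (metis injI)
 have "wedge x0 beta (wedge x0 gamma z) = z" for z by (rule wedge_inverse) (simp_all add: b g)
 thus "surj (wedge x0 beta)" by (metis surjI)
qed

lemma isotopic_id_wedge: assumes "angle_map beta" shows "isotopic_id (wedge x0 beta)"
proof (rule isotopic_idI[where H = "%t. wedge x0 (%s. (1 - t) * s + t * beta s)"])
 show "continuous_on ({0..1} \<times> UNIV) (%(t, z). wedge x0 (%s. (1 - t) * s + t * beta s) z)" using continuous_wedge[OF assms] by (simp add: case_prod_unfold)
 show "wedge x0 (%s. (1 - 0) * s + 0 * beta s) z = z" for z by (rule wedge_identity) simp
 fix t :: real assume "t \<in> {0..1}"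
 hence "angle_map (%s. (1 - t) * s + t * beta s)" using angle_map_interpolate[OF assms] by simp
 thus "inj (wedge x0 (%s. (1 - t) * s + t * beta s))" "surj (wedge x0 (%s. (1 - t) * s + t * beta s))" by (rule wedge_bij)+
qed simp

lemma wedge_rect: assumes beta: "angle_map beta" and "a <= x0" "0 < r" shows "wedge x0 beta ` rect a (x0 + r) (- r) r = rect a (x0 + r) (- r) r"
proof -
 have b: "ALL s. \<bar>s\<bar> < 1 --> \<bar>beta s\<bar> < 1" using angle_map_bound(1)[OF beta] by simp
 have iff: "wedge x0 beta z \<in> rect a (x0 + r) (- r) r \<longleftrightarrow> z \<in> rect a (x0 + r) (- r) r" for z
 proof (cases "Re z <= x0")
  case True thus ?thesis by (simp add: wedge_left)
 next
  case False
  have R: "w \<in> rect a (x0 + r) (- r) r \<longleftrightarrow> max (Re w - x0) \<bar>Im w\<bar> <= r" if "x0 < Re w" for w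
   using that assms(2) by (auto simp: rect_iff)
  show ?thesis using False R[of z] R[of "wedge x0 beta z"] wedge_right[of x0 z beta, OF _ b] by auto
 qed
 show ?thesis
 proof (intro subset_antisym subsetI)
  fix z assume z: "z \<in> rect a (x0 + r) (- r) r"
  obtain w where "z = wedge x0 beta w" using wedge_bij(2)[OF beta, of x0] by (metis surjD)
  thus "z \<in> wedge x0 beta ` rect a (x0 + r) (- r) r" using iff z by blast
 qed (use iff in auto)
qed

lemma wedge_fix: "(!!z. z \<in> S ==> Re z <= x0) ==> wedge x0 beta ` S = S" by (simp add: wedge_left image_def)

definition sector :: "real => real => real => real => real => complex set" where
 "sector x0 l1 l2 c d = {z. c <= Im z & Im z <= d & l1 * \<bar>Im z\<bar> <= Re z - x0 & Re z - x0 <= l2 * \<bar>Im z\<bar>}"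

lemma wedge_up: assumes "0 < v" "0 < t" "t <= 1" "0 < mu" "mu <= 1" "beta (1 / (1 + t)) = - (1 / (1 + mu))"
 shows "wedge x0 beta (Complex (x0 + t * v) v) = Complex (x0 + mu * v) (- v)"
proof -
 have 0: "0 < t * v" using assms by simp
 have 1: "v / (t * v + \<bar>v\<bar>) = 1 / (1 + t)"
 proof -
  have "t * v + \<bar>v\<bar> = (1 + t) * v" using assms(1) by (simp add: algebra_simps)
  thus ?thesis using assms by simp
 qed
 have 2: "max (t * v) \<bar>v\<bar> = v" using assms by (simp add: max_def)
 have 3: "1 - \<bar>- (1 / (1 + mu))\<bar> = mu / (1 + mu)" using assms by (simp add: field_simps)
 have 4: "max (mu / (1 + mu)) \<bar>- (1 / (1 + mu))\<bar> = 1 / (1 + mu)" using assms by (simp add: max_def divide_simps)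
 have 5: "v * ((mu / (1 + mu)) / (1 / (1 + mu))) = mu * v" "v * (- (1 / (1 + mu)) / (1 / (1 + mu))) = - v" using assms by (simp_all add: field_simps)
 show ?thesis using 0 by (simp only: wedge_def Let_def complex.sel add_diff_cancel_left' 1 2 assms(6) 3 4 5 not_le[symmetric] if_False)
qed

lemma wedge_sector: assumes beta: "angle_map beta" and c: "0 < c" and l: "0 < l1" "l1 <= l2" "l2 <= 1" and m: "0 < m2" "m2 <= m1" "m1 <= 1"
  and e: "beta (1 / (1 + l1)) = - (1 / (1 + m1))" "beta (1 / (1 + l2)) = - (1 / (1 + m2))" shows "wedge x0 beta ` sector x0 l1 l2 c d = sector x0 m2 m1 (- d) (- c)"
proof -
 have le: "beta a <= beta b \<longleftrightarrow> a <= b" for a b using beta by (auto simp: angle_map_def line_homeo_def strict_mono_less_eq)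
 have inv: "1 / (1 + a) <= 1 / (1 + b) \<longleftrightarrow> b <= a" if "0 < a" "0 < b" for a b :: real using that by (simp add: divide_simps)
 show ?thesis
 proof (intro subset_antisym subsetI)
  fix z assume "z \<in> wedge x0 beta ` sector x0 l1 l2 c d"
  then obtain w where w: "w \<in> sector x0 l1 l2 c d" "z = wedge x0 beta w" by auto
  define v where "v = Im w"
  define t where "t = (Re w - x0) / v"
  have v: "0 < v" "c <= v" "v <= d" using w(1) c by (auto simp: sector_def v_def)
  have lam: "l1 <= t" "t <= l2" using w(1) v by (auto simp: sector_def v_def t_def le_divide_eq divide_le_eq)
  have pos: "0 < t" "0 < l1" "0 < l2" using lam l by linarith+
  have s: "- (1 / (1 + m2)) <= beta (1 / (1 + t))" "beta (1 / (1 + t)) <= - (1 / (1 + m1))" unfolding e[symmetric] le using inv pos lam by auto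
  have s0: "beta (1 / (1 + t)) < 0"
  proof -
   have "0 < 1 / (1 + m1)" using m by simp
   thus ?thesis using s(2) by linarith
  qed
  define mu where "mu = - 1 / beta (1 / (1 + t)) - 1"
  have b: "beta (1 / (1 + t)) = - (1 / (1 + mu))" using s0 by (simp add: mu_def)
  have mu: "m2 <= mu" "mu <= m1"
  proof -
   have "- beta (1 / (1 + t)) * (1 + m2) <= 1" "1 <= - beta (1 / (1 + t)) * (1 + m1)" using s m by (simp_all add: field_simps)
   thus "m2 <= mu" "mu <= m1" unfolding mu_def using s0 by (simp_all add: field_simps)
  qed
  have "w = Complex (x0 + t * v) v" using v by (simp add: complex_eq_iff t_def v_def)
  hence "z = Complex (x0 + mu * v) (- v)" using wedge_up[where ?x0.0 = x0 and beta = beta and v = v and t = t and mu = mu] b w(2) v(1) pos(1) lam mu l m by simp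
  thus "z \<in> sector x0 m2 m1 (- d) (- c)" using v mu by (simp add: sector_def)
 next
  fix z assume z: "z \<in> sector x0 m2 m1 (- d) (- c)"
  define v where "v = - Im z"
  define mu where "mu = (Re z - x0) / v"
  have v: "0 < v" "c <= v" "v <= d" using z c by (auto simp: sector_def v_def)
  have av: "\<bar>Im z\<bar> = v" using v by (simp add: v_def)
  have mu: "m2 <= mu" "mu <= m1" using z v av by (auto simp: sector_def mu_def le_divide_eq divide_le_eq)
  have pos: "0 < mu" "0 < m1" "0 < m2" using mu m by linarith+
  obtain s where s: "beta s = - (1 / (1 + mu))" using beta unfolding angle_map_def line_homeo_def by (metis surjD)
  have "beta (1 / (1 + l2)) <= beta s" "beta s <= beta (1 / (1 + l1))" unfolding s e using inv pos mu by auto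
  hence sb: "1 / (1 + l2) <= s" "s <= 1 / (1 + l1)" by (simp_all add: le)
  have "0 < 1 / (1 + l2)" using l by simp
  hence s0: "0 < s" using sb by linarith
  define t where "t = 1 / s - 1"
  have sl: "s = 1 / (1 + t)" using s0 by (simp add: t_def)
  have lam: "l1 <= t" "t <= l2"
  proof -
   have "s * (1 + l1) <= 1" "1 <= s * (1 + l2)" using sb l by (simp_all add: field_simps)
   thus "l1 <= t" "t <= l2" unfolding t_def using s0 by (simp_all add: field_simps)
  qed
  have "wedge x0 beta (Complex (x0 + t * v) v) = Complex (x0 + mu * v) (- v)"
   using wedge_up[where ?x0.0 = x0 and beta = beta and v = v and t = t and mu = mu] s[unfolded sl] v(1) pos(1) lam mu l m by simp
  also have "\<dots> = z" using v by (simp add: complex_eq_iff mu_def v_def)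
  finally have "z = wedge x0 beta (Complex (x0 + t * v) v)" ..
  moreover have "Complex (x0 + t * v) v \<in> sector x0 l1 l2 c d" using v lam by (simp add: sector_def)
  ultimately show "z \<in> wedge x0 beta ` sector x0 l1 l2 c d" by (rule image_eqI)
 qed
qed

subsection \<open>Fanning out a vertical strand\<close>

definition fan_radius :: "real => real" where "fan_radius y = max 1 (min 4 \<bar>y\<bar>)"

definition fan_nodes :: "real => ((real => real) \<times> (real => real)) list" where "fan_nodes x0 = [(%_. x0, %_. x0), (%_. x0 + 1/20, %y. x0 + fan_radius y / 20),
   (%_. x0 + 1/10, %y. x0 + fan_radius y / 10), (%_. x0 + 3/20, %y. x0 + 3 * fan_radius y / 20), (%_. x0 + 1, %_. x0 + 1)]"

definition fan :: "real => real => real => real" where "fan x0 y = pl (map (%n. (fst n y, snd n y)) (fan_nodes x0))"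

lemma fan_radius_bounds: "1 <= fan_radius y" "fan_radius y <= 4" by (auto simp: fan_radius_def)

lemma nodes_fan: "nodes (map (%n. (fst n y, snd n y)) (fan_nodes x0))" using fan_radius_bounds[of y] by (simp add: fan_nodes_def)

lemma fibre_family_fan: "fibre_family (fan x0)" unfolding fan_def
proof (rule fibre_family_pl[OF _ nodes_fan])
 have "continuous_on UNIV fan_radius" unfolding fan_radius_def by (intro continuous_intros)
 thus "\<forall>n\<in>set (fan_nodes x0). continuous_on UNIV (fst n) & continuous_on UNIV (snd n)" by (auto simp: fan_nodes_def intro!: continuous_intros)
qed

lemma fan_values: "x <= x0 ==> fan x0 y x = x" "x0 + 1 <= x ==> fan x0 y x = x"
  "fan x0 y (x0 + 1/20) = x0 + fan_radius y / 20" "fan x0 y (x0 + 1/10) = x0 + fan_radius y / 10" "fan x0 y (x0 + 3/20) = x0 + 3 * fan_radius y / 20"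
proof -
 note n = nodes_fan[of y x0, unfolded fan_nodes_def list.map fst_conv snd_conv]
 note N = pl_node[OF n]
 show "x <= x0 ==> fan x0 y x = x" using pl_left[OF n, of x] by (simp add: fan_def fan_nodes_def del: pl.simps)
 have n4: "nodes [(x0 + 3/20, x0 + 3 * fan_radius y / 20), (x0 + 1, x0 + 1)]" using fan_radius_bounds[of y] by simp
 show "fan x0 y x = x" if "x0 + 1 <= x"
 proof -
  have "fan x0 y x = pl [(x0 + 1, x0 + 1)] x" unfolding fan_def fan_nodes_def list.map fst_conv snd_conv
   using that pl_skip[OF n, of x] pl_skip[OF nodes_tl[OF n], of x] pl_skip[OF nodes_tl[OF nodes_tl[OF n]], of x] pl_skip[OF n4, of x] by (simp del: pl.simps)
  thus ?thesis using that by simp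
 qed
 show "fan x0 y (x0 + 1/20) = x0 + fan_radius y / 20" "fan x0 y (x0 + 1/10) = x0 + fan_radius y / 10" "fan x0 y (x0 + 3/20) = x0 + 3 * fan_radius y / 20"
  using N[of "(x0 + 1/20, x0 + fan_radius y / 20)"] N[of "(x0 + 1/10, x0 + fan_radius y / 10)"] N[of "(x0 + 3/20, x0 + 3 * fan_radius y / 20)"]
  by (simp_all add: fan_def fan_nodes_def del: pl.simps)
qed

lemma hmap_rect_sides: assumes f: "fibre_family phi" shows "hmap phi ` rect a b c d = {z. c <= Im z & Im z <= d & phi (Im z) a <= Re z & Re z <= phi (Im z) b}"
proof -
 have m: "phi y s <= phi y t \<longleftrightarrow> s <= t" for y s t using f by (auto simp: fibre_family_def strict_mono_less_eq)
 show ?thesis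
 proof (intro subset_antisym subsetI)
  fix z assume z: "z \<in> {z. c <= Im z & Im z <= d & phi (Im z) a <= Re z & Re z <= phi (Im z) b}"
  obtain x where x: "phi (Im z) x = Re z" using f unfolding fibre_family_def by (metis surjD)
  hence "Complex x (Im z) \<in> rect a b c d" using z m[of "Im z" a x] m[of "Im z" x b] by (auto simp: rect_iff)
  thus "z \<in> hmap phi ` rect a b c d" using x by (intro image_eqI[of _ _ "Complex x (Im z)"]) (auto simp: hmap_def complex_eq_iff)
 qed (auto simp: rect_iff hmap_def m)
qed

lemma fan_lbox: "a <= x0 ==> b <= x0 | x0 + 1 <= b ==> c <= d ==> disc_image (hmap (fan x0)) (lbox a b c d) = lbox a b c d"
 by (rule hmap_lbox[OF fibre_family_fan]) (auto simp: fan_values)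

lemma fan_fix: "(!!z. z \<in> S ==> Re z <= x0) ==> hmap (fan x0) ` S = S"
proof -
 assume *: "!!z. z \<in> S ==> Re z <= x0"
 have "hmap (fan x0) z = z" if "z \<in> S" for z using *[OF that] by (simp add: hmap_def fan_values complex_eq_iff)
 thus ?thesis by simp
qed

lemma fan_vline: "1 <= c & d <= 4 | - 4 <= c & d <= - 1 ==> c <= d ==>
  hmap (fan x0) ` vline (x0 + 1/10) c d = sector x0 (1/10) (1/10) c d" unfolding vline_rect hmap_rect_sides[OF fibre_family_fan]
 by (auto simp: fan_values sector_def fan_radius_def)

lemma fan_small_box: "disc_image (hmap (fan x0)) (lbox (x0 + 1/20) (x0 + 3/20) 2 3) = Disc (sector x0 (1/20) (3/20) 2 3) (Complex (x0 + 1/8) (5/2))"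
  "disc_image (hmap (fan x0)) (rbox (x0 + 1/20) (x0 + 3/20) (-3) (-2)) = Disc (sector x0 (1/20) (3/20) (-3) (-2)) (Complex (x0 + 3/8) (-5/2))"
proof -
 have "hmap (fan x0) ` rect (x0 + 1/20) (x0 + 3/20) c d = sector x0 (1/20) (3/20) c d"
  if "1 <= c & d <= 4 | - 4 <= c & d <= - 1" for c d unfolding hmap_rect_sides[OF fibre_family_fan] using that by (auto simp: fan_values sector_def fan_radius_def)
 thus "disc_image (hmap (fan x0)) (lbox (x0 + 1/20) (x0 + 3/20) 2 3) = Disc (sector x0 (1/20) (3/20) 2 3) (Complex (x0 + 1/8) (5/2))"
  "disc_image (hmap (fan x0)) (rbox (x0 + 1/20) (x0 + 3/20) (-3) (-2)) = Disc (sector x0 (1/20) (3/20) (-3) (-2)) (Complex (x0 + 3/8) (-5/2))"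
  by (simp_all add: lbox_def rbox_def disc_image_def hmap_def fan_values fan_radius_def)
qed

definition flip_angle :: "real => real" where "flip_angle = pl [(-1, -1), (20/23, -20/21), (10/11, -10/11), (20/21, -20/23), (1, 1)]"

lemma flip_angle_values: "flip_angle (20/23) = -20/21" "flip_angle (10/11) = -10/11" "flip_angle (20/21) = -20/23" "flip_angle (-1) = -1" "flip_angle 1 = 1"
proof -
 have n: "nodes [(-1, -1), (20/23, -20/21), (10/11, -10/11), (20/21, -20/23), (1, 1)]" by simp
 note N = pl_node[OF n]
 show "flip_angle (20/23) = -20/21" "flip_angle (10/11) = -10/11" "flip_angle (20/21) = -20/23" "flip_angle (-1) = -1" "flip_angle 1 = 1"
  using N[of "(20/23, -20/21)"] N[of "(10/11, -10/11)"] N[of "(20/21, -20/23)"] N[of "(-1, -1)"] N[of "(1, 1)"] by (simp_all add: flip_angle_def del: pl.simps)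
qed

lemma angle_map_flip: "angle_map flip_angle" unfolding angle_map_def using flip_angle_values by (auto simp: flip_angle_def intro!: line_homeo_pl)

definition tip_above :: "real => complex set => tangle" where
 "tip_above x0 S = Tangle (lbox 0 (x0 + 4) (-4) 4) {lbox (1/2) (x0 + 1) (-1) 1, lbox (1/2) x0 2 3, lbox (x0 + 1/20) (x0 + 3/20) 2 3}
   (S Un vline (x0 + 1/10) 1 2 Un vline (x0 + 1/10) 3 4)"

definition tip_below :: "real => complex set => tangle" where
 "tip_below x0 S = Tangle (lbox 0 (x0 + 4) (-4) 4) {lbox (1/2) (x0 + 1) (-1) 1, lbox (1/2) x0 2 3, rbox (x0 + 1/20) (x0 + 3/20) (-3) (-2)}
   (S Un vline (x0 + 1/10) (-4) (-3) Un vline (x0 + 1/10) (-2) (-1))"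

text \<open>Fanning out turns the moving strand and its box into sectors of a half plane in both pictures, and a change of angle
takes one to the other.  The left side of the box becomes its right side on the way, whence the two kinds of boxes.\<close>

lemma (in planar_alg) tip_slide: assumes x0: "1/2 < x0" and S: "!!z. z \<in> S ==> Re z <= x0" and v1: "val (tip_above x0 S) f x" and v2: "val (tip_below x0 S) g y"
  and fg: "f (lbox (1/2) (x0 + 1) (-1) 1) = g (lbox (1/2) (x0 + 1) (-1) 1)" "f (lbox (1/2) x0 2 3) = g (lbox (1/2) x0 2 3)"
   "f (lbox (x0 + 1/20) (x0 + 3/20) 2 3) = g (rbox (x0 + 1/20) (x0 + 3/20) (-3) (-2))" shows "x = y"
proof -
 define N where "N = hmap (fan x0)"
 define W where "W = wedge x0 flip_angle"
 define G Y R where "G = lbox (1/2) (x0 + 1) (-1) 1" and "Y = lbox (1/2) x0 2 3" and "R = Disc (sector x0 (1/20) (3/20) (-3) (-2)) (Complex (x0 + 3/8) (-5/2))"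
 let ?T1 = "lbox 0 (x0 + 4) (-4) 4"
 define M where "M = Tangle ?T1 {G, Y, R} (S Un sector x0 (1/10) (1/10) (-4) (-3) Un sector x0 (1/10) (1/10) (-2) (-1))"
 have sS: "N ` S = S" "W ` S = S" unfolding N_def W_def by (intro fan_fix wedge_fix S; assumption)+
 have e1: "flip_angle (1 / (1 + 1/10)) = - (1 / (1 + 1/10))" "flip_angle (1 / (1 + 1/20)) = - (1 / (1 + 3/20))" "flip_angle (1 / (1 + 3/20)) = - (1 / (1 + 1/20))"
  using flip_angle_values by simp_all
 have sec: "W ` sector x0 (1/10) (1/10) 1 2 = sector x0 (1/10) (1/10) (-2) (-1)" "W ` sector x0 (1/10) (1/10) 3 4 = sector x0 (1/10) (1/10) (-4) (-3)"
  "W ` sector x0 (1/20) (3/20) 2 3 = sector x0 (1/20) (3/20) (-3) (-2)"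
  unfolding W_def by (rule wedge_sector[OF angle_map_flip _ _ _ _ _ _ _ e1(1,1)] wedge_sector[OF angle_map_flip _ _ _ _ _ _ _ e1(2,3)]; simp)+
 have star: "W (Complex (x0 + 1/8) (5/2)) = Complex (x0 + 3/8) (-5/2)"
  using wedge_up[where ?x0.0 = x0 and beta = flip_angle and v = "5/2" and t = "1/20" and mu = "3/20"] e1(2) by (simp add: W_def)
 have w0: "disc_image W ?T1 = lbox 0 (x0 + 4) (-4) 4" using wedge_rect[OF angle_map_flip, of 0 x0 4] x0 by (simp add: W_def lbox_def disc_image_def wedge_left)
 have w1: "disc_image W G = G" using wedge_rect[OF angle_map_flip, of "1/2" x0 1] x0 by (simp add: W_def G_def lbox_def disc_image_def wedge_left)
 have w2: "disc_image W Y = Y" using x0 by (simp add: W_def Y_def lbox_def disc_image_def wedge_left wedge_fix rect_iff)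
 have w3: "disc_image W (Disc (sector x0 (1/20) (3/20) 2 3) (Complex (x0 + 1/8) (5/2))) = R" by (simp add: disc_image_def R_def sec star)
 have n0: "disc_image N ?T1 = lbox 0 (x0 + 4) (-4) 4" "disc_image N G = G" "disc_image N Y = Y" unfolding N_def G_def Y_def using x0 by (simp_all add: fan_lbox)
 have nl: "N ` vline (x0 + 1/10) 1 2 = sector x0 (1/10) (1/10) 1 2" "N ` vline (x0 + 1/10) 3 4 = sector x0 (1/10) (1/10) 3 4"
  "N ` vline (x0 + 1/10) (-4) (-3) = sector x0 (1/10) (1/10) (-4) (-3)" "N ` vline (x0 + 1/10) (-2) (-1) = sector x0 (1/10) (1/10) (-2) (-1)"
  unfolding N_def by (simp_all add: fan_vline)
 note small = fan_small_box[of x0, folded N_def]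
 have nR: "disc_image N (rbox (x0 + 1/20) (x0 + 3/20) (-3) (-2)) = R" by (simp only: small R_def)
 have iN: "isotopic_id N" unfolding N_def by (rule isotopic_id_hmap[OF fibre_family_fan])
 have iW: "isotopic_id (W \<circ> N)" unfolding W_def by (rule isotopic_id_compose[OF iN isotopic_id_wedge[OF angle_map_flip]])
 have dWN: "disc_image (W \<circ> N) D = disc_image W (disc_image N D)" for D by (simp add: disc_image_def image_comp)
 have neq: "G ~= Y" "G ~= R" "Y ~= R" using x0 by (auto simp: G_def Y_def R_def lbox_def)
 define F where "F = (%D. if D = G then g G else if D = Y then g Y else g (rbox (x0 + 1/20) (x0 + 3/20) (-3) (-2)))"
 have img1: "tangle_image (W \<circ> N) (tip_above x0 S) = M"
  unfolding tangle_image_def tip_above_def tangle.sel image_insert image_empty dWN n0 G_def[symmetric] Y_def[symmetric] small w0 w1 w2 w3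
   image_comp[symmetric] image_Un sS nl sec M_def by (simp only: Un_ac)
 have img2: "tangle_image N (tip_below x0 S) = M"
  unfolding tangle_image_def tip_below_def tangle.sel image_insert image_empty n0 G_def[symmetric] Y_def[symmetric] small
   image_Un sS nl M_def R_def by simp
 have "val (tangle_image (W \<circ> N) (tip_above x0 S)) F x"
 proof (rule val_iso[OF v1 iW])
  fix D assume "D \<in> inner (tip_above x0 S)"
  then consider "D = G" | "D = Y" | "D = lbox (x0 + 1/20) (x0 + 3/20) 2 3" unfolding tip_above_def G_def Y_def by auto
  thus "F (disc_image (W \<circ> N) D) = f D" by cases (simp_all add: dWN n0 w1 w2 small w3 F_def neq neq[symmetric] fg[folded G_def Y_def])
 qed
 moreover have "val (tangle_image N (tip_below x0 S)) F y"
 proof (rule val_iso[OF v2 iN])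
  fix D assume "D \<in> inner (tip_below x0 S)"
  then consider "D = G" | "D = Y" | "D = rbox (x0 + 1/20) (x0 + 3/20) (-3) (-2)" unfolding tip_below_def G_def Y_def by auto
  thus "F (disc_image N D) = g D" by cases (simp_all add: n0 nR F_def neq neq[symmetric])
 qed
 ultimately show "x = y" unfolding img1 img2 by (rule val_unique) simp
qed

section \<open>Diagrammatic identities\<close>

lemma lbox_eq_False [simp]: "a ~= a' | c + d ~= c' + d' ==> (lbox a b c d = lbox a' b' c' d') = False"
 "a ~= b' | c + d ~= c' + d' ==> (lbox a b c d = rbox a' b' c' d') = False" "b ~= a' | c + d ~= c' + d' ==> (rbox a b c d = lbox a' b' c' d') = False"
 by (auto simp: lbox_def rbox_def)

definition joined :: "(nat => real) => nat => (nat => real) => nat => real" where "joined p k q i = (if i <= k then p i else q (i - k))"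

lemma joined_image: "(\<Union>i\<in>{1..k + l}. g (joined p k q i)) = (\<Union>i\<in>{1..k}. g (p i)) Un (\<Union>i\<in>{1..l}. g (q i))"
proof -
 have u: "{1..k + l} = {1..k} Un (%i. k + i) ` {1..l}"
 proof (intro set_eqI iffI)
  fix i assume i: "i \<in> {1..k + l}"
  show "i \<in> {1..k} Un (%i. k + i) ` {1..l}"
  proof (cases "i <= k")
   case False
   hence "i = k + (i - k)" "i - k \<in> {1..l}" using i by auto
   thus ?thesis by blast
  qed (use i in auto)
 qed auto
 have "(\<Union>i\<in>{1..k}. g (joined p k q i)) = (\<Union>i\<in>{1..k}. g (p i))" by (simp add: joined_def)
 moreover have "(\<Union>i\<in>(%i. k + i) ` {1..l}. g (joined p k q i)) = (\<Union>i\<in>{1..l}. g (q i))"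
  unfolding image_image by (rule SUP_cong) (auto simp: joined_def)
 ultimately show ?thesis unfolding u by (simp only: UN_Un)
qed

lemma stripes_joined: "stripes (joined p k q) (k + l) c d = stripes p k c d Un stripes q l c d" unfolding stripes_def by (rule joined_image)

lemma points_joined: "points (joined p k q) (k + l) c = points p k c Un points q l c"
 using joined_image[of "%x. {Complex x c}" p k q l] unfolding points_def by (simp only: UNION_singleton_eq_range)

lemma spread_joined: assumes p: "spread p k a m" and q: "spread q l m b" and "a <= m" "m <= b" shows "spread (joined p k q) (k + l) a b" unfolding spread_def
proof (intro conjI ballI impI)
 fix i assume i: "i \<in> {1..k + l}"
 have "a < joined p k q i & joined p k q i < b"
 proof (cases "i <= k")
  case True
  hence "i \<in> {1..k}" using i by auto
  thus ?thesis using spread_bounds[OF p, of i] assms(4) True by (simp add: joined_def)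
 next
  case False
  hence "i - k \<in> {1..l}" using i by auto
  thus ?thesis using spread_bounds[OF q, of "i - k"] assms(3) False by (simp add: joined_def)
 qed
 thus "a < joined p k q i" "joined p k q i < b" by auto
next
 fix i j assume ij: "i \<in> {1..k + l}" "j \<in> {1..k + l}" "i < j"
 consider "j <= k" | "i <= k" "\<not> j <= k" | "\<not> i <= k" by linarith
 thus "joined p k q i < joined p k q j"
 proof cases
  case 1
  hence "i \<in> {1..k}" "j \<in> {1..k}" "i <= k" using ij by auto
  thus ?thesis using p ij 1 by (auto simp: spread_def joined_def)
 next
  case 2
  hence "i \<in> {1..k}" "j - k \<in> {1..l}" using ij by auto
  hence "p i < m" "m < q (j - k)" using spread_bounds[OF p, of i] spread_bounds[OF q, of "j - k"] by simp_all
  thus ?thesis using 2 by (simp add: joined_def)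
 next
  case 3
  hence "i - k \<in> {1..l}" "j - k \<in> {1..l}" "i - k < j - k" "\<not> j <= k" using ij by auto
  thus ?thesis using q 3 by (auto simp: spread_def joined_def)
 qed
qed

lemma tangle_eqI: "B = B' ==> I = I' ==> S = S' ==> Tangle B I S = Tangle B' I' S'" by simp

lemma stripes_one: "stripes p (Suc 0) c d = vline (p 1) c d" by (simp add: stripes_def)

context planar_alg begin

text \<open>Evaluation together with the boundary points of the outer box, as needed for gluing.\<close>

definition valb :: "tangle => (disc => 'a) => 'a => complex set => bool" where "valb T f x b \<longleftrightarrow> val T f x & boundary_points T (outer T) = b"

lemma valbI: "val T f x ==> boundary_points T (outer T) = b ==> valb T f x b" by (simp add: valb_def)

lemma outer_notin_inner: "planar_tangle T ==> B \<in> inner T ==> outer T ~= B"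
proof
 assume *: "planar_tangle T" "B \<in> inner T" "outer T = B"
 have "star B \<in> frontier (region B)" using planar_tangleD(3)[OF *(1,2)] by (simp add: is_disc_def)
 moreover have "region B <= interior (region B)" using planar_tangleD(5)[OF *(1,2)] *(3) by simp
 moreover have "frontier (region B) <= region B" by (rule frontier_region_subset[OF planar_tangleD(3)[OF *(1,2)]])
 ultimately show False unfolding frontier_def by blast
qed

lemma glue1: assumes T: "valb T (F(B := v)) x b" and U: "valb U F v b'" and B: "B \<in> inner T" "outer U = B" "boundary_points T B = b'"
  and M: "Tangle (outer T) ((inner T - {B}) Un inner U) (strings T Un strings U) = M" shows "valb M F x b"
proof -
 have vT: "val T (F(B := v)) x" and vU: "val U F v" and bU: "boundary_points U B = boundary_points T B" and bT: "boundary_points T (outer T) = b"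
  using T U B by (simp_all add: valb_def)
 have pT: "planar_tangle T" and pU: "planar_tangle U" using vT vU by (simp_all add: val_def)
 have "val (compose_tangle T B U) F x" by (rule val_insert[OF vT _ B(1,2) bU, of F]) (use vU in simp_all)
 moreover have "composable T B U" using pT pU B bU by (simp add: composable_def)
 hence "boundary_points (compose_tangle T B U) (outer T) = b"
  using boundary_points_compose(1)[of T B U "outer T"] outer_notin_inner[OF pT B(1)] bT by (simp add: boxes_def)
 ultimately show ?thesis by (simp add: valb_def compose_tangle_def M[symmetric])
qed

text \<open>The two boxes are filled one after the other; the second box is none of the inputs of the first filling, since regions
of different boxes are disjoint.\<close>

lemma glue2: assumes T: "valb T (F(B1 := v1, B2 := v2)) x b" and U1: "valb U1 F v1 b1" and U2: "valb U2 F v2 b2"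
  and B: "inner T = {B1, B2}" "B1 ~= B2" "outer U1 = B1" "outer U2 = B2" "boundary_points T B1 = b1" "boundary_points T B2 = b2"
  and M: "Tangle (outer T) (inner U1 Un inner U2) (strings T Un strings U1 Un strings U2) = M" shows "valb M F x b"
proof -
 have vT: "val T (F(B1 := v1, B2 := v2)) x" and vU: "val U1 F v1" "val U2 F v2"
  and bU: "boundary_points U1 B1 = boundary_points T B1" "boundary_points U2 B2 = boundary_points T B2" and bT: "boundary_points T (outer T) = b"
  using T U1 U2 B by (simp_all add: valb_def)
 have pT: "planar_tangle T" and pU1: "planar_tangle U1" and pU2: "planar_tangle U2" using vT vU by (simp_all add: val_def)
 have in': "B1 \<in> inner T" "B2 \<in> inner T" using B by simp_all
 have c: "composable T B1 U1" using pT pU1 B bU in' by (simp add: composable_def)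
 have dis: "region B2 Int region B1 = {}" using planar_tangleD(6)[OF pT in'(2,1)] B(2) by simp
 have n: "B2 \<notin> inner U1"
 proof
  assume a: "B2 \<in> inner U1"
  have "region B2 <= region B1" using compose_geometry(5)[OF c a] interior_subset by blast
  moreover have "star B2 \<in> region B2" using planar_tangleD(3)[OF pT in'(2)] frontier_region_subset by (auto simp: is_disc_def)
  ultimately show False using dis by blast
 qed
 define V where "V = compose_tangle T B1 U1"
 have vV: "val V (F(B2 := v2)) x" unfolding V_def by (rule val_insert[OF vT _ in'(1) B(3) bU(1)]) (use n B(2) in "auto intro: val_cong[OF vU(1)]")
 have iV: "inner V = {B2} Un inner U1" using B by (auto simp: V_def)
 have bV: "boundary_points V B2 = boundary_points T B2" unfolding V_def using boundary_points_compose(1)[OF c, of B2] B by (simp add: boxes_def)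
 have bVo: "boundary_points V (outer V) = b"
  unfolding V_def using boundary_points_compose(1)[OF c, of "outer T"] outer_notin_inner[OF pT in'(1)] bT by (simp add: boxes_def)
 have "valb (Tangle (outer V) ((inner V - {B2}) Un inner U2) (strings V Un strings U2)) F x b"
  by (rule glue1[of V F B2 v2 x b U2 b2, OF _ _ _ _ _ refl]) (use vV bVo U2 iV B bV in "auto simp: valb_def")
 moreover have "inner V - {B2} = inner U1" using iV n by auto
 ultimately show ?thesis by (simp add: V_def M[symmetric])
qed

lemma valb_unique: "valb T F x b ==> valb T F y b' ==> x = y" using val_unique[of T F x F y] by (simp add: valb_def)

text \<open>A box either stays an input, labelled by \<open>F\<close>, or is the outer box of a picture drawn inside of it.  Treating both
alike allows nested pictures to be evaluated from the inside to the outside: the sets of input boxes, of strings and of boundary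
points are computed by the rules \<open>drawn_column\<close>, \<open>drawn_tensor\<close> and so on, and two readings of one picture
are compared by \<open>drawn_unique\<close>.\<close>

definition drawn :: "(disc => 'a) => disc => 'a => disc set => complex set => complex set => bool" where
 "drawn F B x I S b \<longleftrightarrow> F B = x & I = {B} & S = {} | valb (Tangle B I S) F x b"

lemma drawn_box: "F B = x ==> drawn F B x {B} {} b" by (simp add: drawn_def)

lemma drawn_valb: "val T F x ==> outer T = B ==> boundary_points T B = b ==> drawn F B x (inner T) (strings T) b" by (cases T) (simp add: drawn_def valb_def)

lemma drawn_val: "drawn F B x I S b ==> outer T = B ==> inner T = I ==> strings T = S ==> B \<notin> I ==> val T F x" by (cases T) (auto simp: drawn_def valb_def)

lemma drawn_unique: assumes "drawn F B x I S b" "drawn F B y J R c" and e: "I = J" "S = R" shows "x = y"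
proof -
 have "B \<notin> I'" if "valb (Tangle B I' S') F z d" for I' S' z d using outer_notin_inner[of "Tangle B I' S'" B] that by (auto simp: valb_def val_def)
 thus ?thesis using assms valb_unique unfolding drawn_def by blast
qed

lemma drawn_one: assumes T: "val T (F(B := v)) x" and B: "inner T = {B}" and D: "drawn F B v I S (boundary_points T B)"
 shows "drawn F (outer T) x I (strings T Un S) (boundary_points T (outer T))"
proof (cases "F B = v & I = {B} & S = {}")
 case True
 hence "F(B := v) = F" by auto
 thus ?thesis using T B True by (cases T) (simp add: drawn_def valb_def)
next
 case False
 hence U: "valb (Tangle B I S) F v (boundary_points T B)" using D unfolding drawn_def by blast
 show ?thesis unfolding drawn_def by (rule disjI2, rule glue1[OF valbI[OF T refl] U]) (simp_all add: B)
qed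

lemma drawn_two: assumes T: "val T (F(B1 := v1, B2 := v2)) x" and B: "inner T = {B1, B2}" "B1 ~= B2"
  and D: "drawn F B1 v1 I1 S1 (boundary_points T B1)" "drawn F B2 v2 I2 S2 (boundary_points T B2)"
 shows "drawn F (outer T) x (I1 Un I2) (strings T Un S1 Un S2) (boundary_points T (outer T))"
proof -
 let ?P1 = "F B1 = v1 & I1 = {B1} & S1 = {}" and ?P2 = "F B2 = v2 & I2 = {B2} & S2 = {}"
 let ?T1 = "boundary_points T B2"
 have U: "?P1 | valb (Tangle B1 I1 S1) F v1 (boundary_points T B1)" "?P2 | valb (Tangle B2 I2 S2) F v2 ?T1" using D by (simp_all add: drawn_def)
 have M: "valb (Tangle (outer T) (I1 Un I2) (strings T Un S1 Un S2)) F x (boundary_points T (outer T))"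
 proof (cases ?P1)
  case p1: True
  hence F: "F(B1 := v1) = F" by auto
  show ?thesis
  proof (cases ?P2)
   case True
   hence "F(B2 := v2) = F" by auto
   thus ?thesis using T F B p1 True by (cases T) (simp add: valb_def insert_commute)
  next
   case False
   hence U2: "valb (Tangle B2 I2 S2) F v2 ?T1" using U by blast
   show ?thesis by (rule glue1[OF valbI[OF T[unfolded F] refl] U2]) (use B p1 in auto)
  qed
 next
  case False
  hence U1: "valb (Tangle B1 I1 S1) F v1 (boundary_points T B1)" using U by blast
  show ?thesis
  proof (cases ?P2)
   case True
   hence F: "F(B1 := v1, B2 := v2) = F(B1 := v1)" using B by (auto simp: fun_eq_iff)
   show ?thesis by (rule glue1[OF valbI[OF T[unfolded F] refl] U1]) (use B True in auto)
  next
   case False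
   hence U2: "valb (Tangle B2 I2 S2) F v2 ?T1" using U by blast
   show ?thesis by (rule glue2[OF valbI[OF T refl] U1 U2]) (use B in auto)
  qed
 qed
 thus ?thesis by (simp add: drawn_def)
qed

lemma drawn_column: assumes ok: "column_ok k l m p q r A B a1 b1 a2 b2 e0 e1 e2 e3 e4 e5" "even (k + l)" "even (l + m)"
  "x \<in> \<B> ((k + l) div 2)" "y \<in> \<B> ((l + m) div 2)" and D: "drawn F (lbox a1 b1 e1 e2) x I S b" "b = points p k e1 Un points q l e2"
   "drawn F (lbox a2 b2 e3 e4) y J R c" "c = points q l e3 Un points r m e4" shows "drawn F (lbox A B e0 e5) (stk k l m y x) (I Un J)
  (stripes p k e0 e1 Un stripes q l e2 e3 Un stripes r m e4 e5 Un S Un R) (points p k e0 Un points r m e5)"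
proof -
 let ?T = "column k l m p q r A B a1 b1 a2 b2 e0 e1 e2 e3 e4 e5" and ?L = "lbox a1 b1 e1 e2" and ?U = "lbox a2 b2 e3 e4"
 have n: "?L ~= ?U" using ok(1) by (intro lbox_neq) (auto simp: column_ok_def)
 note bp = boundary_points_column[OF ok(1)]
 have "val ?T (F(?L := x, ?U := y)) (stk k l m y x)" by (rule val_column[OF ok]) (use n in simp_all)
 thus ?thesis using drawn_two[of ?T F ?L x ?U y "stk k l m y x" I S J R] n D by (simp add: bp)
qed

lemma drawn_row: assumes ok: "row_ok k l m n p q s t A B a1 b1 a2 b2 e0 c1 d1 c2 d2 e3"
  and v: "!!f. f (lbox a1 b1 c1 d1) = y ==> f (lbox a2 b2 c2 d2) = x ==> val (row k l m n p q s t A B a1 b1 a2 b2 e0 c1 d1 c2 d2 e3) f z"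
  and D: "drawn F (lbox a1 b1 c1 d1) y I S b" "b = points p k c1 Un points q l d1" "drawn F (lbox a2 b2 c2 d2) x J R c" "c = points s m c2 Un points t n d2"
 shows "drawn F (lbox A B e0 e3) z (I Un J) (stripes p k e0 c1 Un stripes q l d1 e3 Un stripes s m e0 c2 Un stripes t n d2 e3 Un S Un R)
  (points p k e0 Un points q l e3 Un points s m e0 Un points t n e3)"
proof -
 let ?T = "row k l m n p q s t A B a1 b1 a2 b2 e0 c1 d1 c2 d2 e3" and ?L = "lbox a1 b1 c1 d1" and ?U = "lbox a2 b2 c2 d2"
 have n: "?L ~= ?U" using ok by (intro lbox_neq) (auto simp: row_ok_def)
 note bp = boundary_points_row[OF ok]
 have "val ?T (F(?L := y, ?U := x)) z" by (rule v) (use n in simp_all)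
 thus ?thesis using drawn_two[of ?T F ?L y ?U x z I S J R] n D by (simp add: bp)
qed

lemma drawn_beside: assumes "row_ok k l 1 1 p q s t A B a1 b1 a2 b2 e0 c1 d1 c2 d2 e3" "even (k + l)" "y \<in> \<B> ((k + l) div 2)" "x \<in> \<B> 1"
  "drawn F (lbox a1 b1 c1 d1) y I S b" "b = points p k c1 Un points q l d1" "drawn F (lbox a2 b2 c2 d2) x J R c" "c = points s 1 c2 Un points t 1 d2"
 shows "drawn F (lbox A B e0 e3) (bes k l y x) (I Un J) (stripes p k e0 c1 Un stripes q l d1 e3 Un stripes s 1 e0 c2 Un stripes t 1 d2 e3 Un S Un R)
  (points p k e0 Un points q l e3 Un points s 1 e0 Un points t 1 e3)" by (rule drawn_row[OF assms(1) val_beside[OF assms(1-4)] assms(5-)])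

lemma drawn_tensor: assumes "row_ok k k l l p q s t A B a1 b1 a2 b2 e0 c1 d1 c2 d2 e3" "y \<in> \<B> k" "x \<in> \<B> l"
  "drawn F (lbox a1 b1 c1 d1) y I S b" "b = points p k c1 Un points q k d1" "drawn F (lbox a2 b2 c2 d2) x J R c" "c = points s l c2 Un points t l d2"
 shows "drawn F (lbox A B e0 e3) (ten k l y x) (I Un J) (stripes p k e0 c1 Un stripes q k d1 e3 Un stripes s l e0 c2 Un stripes t l d2 e3 Un S Un R)
  (points p k e0 Un points q k e3 Un points s l e0 Un points t l e3)" by (rule drawn_row[OF assms(1) val_tensor[OF assms(1-3)] assms(4-)])

lemma drawn_straight: assumes "spread p k A B" "A < B" "c < d" shows "drawn F (lbox A B c d) (str k) {} (stripes p k c d) (points p k c Un points p k d)"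
 using drawn_valb[OF val_straight[OF assms] refl refl, of F] by (simp add: boundary_points_straight[OF assms(1,3)])

lemma drawn_turned: assumes "A < a" "a < K" "K < b" "b < B" "e0 < e1" "e1 < e2" "e2 < e3" "x \<in> \<B> 1" "F (rbox a b e1 e2) = x"
 shows "drawn F (lbox A B e0 e3) (rot x) {rbox a b e1 e2} (stripes (%_. K) 1 e0 e1 Un stripes (%_. K) 1 e2 e3) (points (%_. K) 1 e0 Un points (%_. K) 1 e3)"
 using drawn_valb[OF val_turned[where f = F, OF assms] refl refl] by (simp add: boundary_points_turned[OF assms(1-7)])

lemma cable_stripes: "cable_tangle k (identity_box k) =
  Tangle (lbox 0 (real k + 2) 0 3) {lbox (1/2) (real k + 3/2) 1 2} (stripes real k 0 1 Un stripes real k 2 3)"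
 by (auto simp: cable_tangle_def identity_box_def stripes_def)

lemma drawn_cable: assumes "drawn (%_. f) (lbox 0 (real k + 2) 0 3) x {lbox (1/2) (real k + 3/2) 1 2} (stripes real k 0 1 Un stripes real k 2 3) b" "f \<in> \<B> k"
 shows "x = f" using drawn_val[OF assms(1), of "cable_tangle k (identity_box k)"] act_cable[OF assms(2)] by (simp add: val_def cable_stripes)

subsection \<open>Box spaces and linearity\<close>

lemma stack_in: assumes "even (k + l)" "even (l + m)" "x \<in> \<B> ((k + l) div 2)" "y \<in> \<B> ((l + m) div 2)" shows "stk k l m y x \<in> \<B> ((k + m) div 2)"
proof (rule val_in[OF val_column[where f = "%B. if B = stack_upper k l m then y else x", OF stack_column_ok assms]])
 show "box_index (column k l m real real real 0 (real (k + l + m) + 2) (1/2) (real (k + l + m) + 3/2)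
   (1/2) (real (k + l + m) + 3/2) 0 1 2 3 4 5) (outer (column k l m real real real 0 (real (k + l + m) + 2) (1/2) (real (k + l + m) + 3/2)
   (1/2) (real (k + l + m) + 3/2) 0 1 2 3 4 5)) = (k + m) div 2" using box_index_column(1)[OF stack_column_ok[of k l m]] by (simp only: column_simps)
qed (use stack_boxes_neq[of k l m] in "simp_all add: stack_upper_def stack_lower_def")

lemma beside_in: assumes "even (k + l)" "y \<in> \<B> ((k + l) div 2)" "x \<in> \<B> 1" shows "bes k l y x \<in> \<B> ((k + l) div 2 + 1)"
proof -
 let ?f = "%B. if B = lbox (1/4) (real (k + l) + 3/2) 1 2 then y else x"
 have "lbox (real (k + l) + 7/4) (real (k + l) + 9/4) 1 2 ~= lbox (1/4) (real (k + l) + 3/2) 1 2" by (rule lbox_neq) simp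
 hence "val (beside_tangle k l) ?f (bes k l y x)" unfolding beside_tangle_def by (intro val_beside[OF beside_row_ok assms]) simp_all
 moreover have "box_index (beside_tangle k l) (outer (beside_tangle k l)) = (k + l) div 2 + 1"
  using box_index_row(1)[OF beside_row_ok[of k l]] assms(1) by (simp add: beside_tangle_def del: of_nat_add)
 ultimately show ?thesis by (rule val_in)
qed

lemma strands_in: "str k \<in> \<B> k"
proof -
 have s: "spread real k 0 (real k + 1)" by (rule spread_real) auto
 let ?T1 = "straight k real 0 (real k + 1) 0 1"
 have "val ?T1 (%_. 0) (str k)" by (rule val_straight[OF s]) auto
 moreover have "box_index ?T1 (outer ?T1) = k" using card_points2[OF s s, of 0 1] by (simp add: box_index_def boundary_points_straight[OF s])
 ultimately show ?thesis by (rule val_in)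
qed

lemma rotation_in: "x \<in> \<B> 1 ==> rot x \<in> \<B> 1"
proof -
 assume x: "x \<in> \<B> 1"
 have o: "0 < (1/2::real)" "1/2 < (1::real)" "1 < (3/2::real)" "3/2 < (2::real)" "0 < (1::real)" "1 < (2::real)" "2 < (3::real)" by simp_all
 have s: "spread (%_. 1) 1 0 2" by (rule spread_const1) auto
 let ?T1 = "turned 1 0 2 (1/2) (3/2) 0 1 2 3"
 have "val ?T1 (%_. x) (rot x)" by (rule val_turned[OF o x refl])
 moreover have "box_index ?T1 (outer ?T1) = 1" using card_points2[OF s s, of 0 3] by (simp add: box_index_def boundary_points_turned[OF o] del: One_nat_def)
 ultimately show ?thesis by (rule val_in)
qed

lemma box_closed: "x \<in> \<B> k ==> y \<in> \<B> k ==> x + y \<in> \<B> k" "x \<in> \<B> k ==> scl c x \<in> \<B> k" "0 \<in> \<B> k"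
 "x \<in> \<B> k ==> y \<in> \<B> k ==> x - y \<in> \<B> k" using subspace_box[of k] by (auto intro: subspace_add subspace_scale subspace_0 subspace_diff)

lemma stack_label: assumes "even (k + l)" "even (l + m)" "x \<in> \<B> ((k + l) div 2)" "y \<in> \<B> ((l + m) div 2)"
 shows "planar_tangle (stack_tangle k l m)" "labelling \<P> (stack_tangle k l m) (%B. if B = stack_upper k l m then y else x)"
  "stack_upper k l m \<in> inner (stack_tangle k l m)" "stack_lower k l m \<in> inner (stack_tangle k l m)"
  "box_index (stack_tangle k l m) (stack_upper k l m) = (l + m) div 2" "box_index (stack_tangle k l m) (stack_lower k l m) = (k + l) div 2"
proof -
 show "planar_tangle (stack_tangle k l m)" unfolding stack_tangle_column by (rule planar_column[OF stack_column_ok assms(1,2)])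
 show "stack_upper k l m \<in> inner (stack_tangle k l m)" "stack_lower k l m \<in> inner (stack_tangle k l m)" by (simp_all add: stack_tangle_def)
 show i: "box_index (stack_tangle k l m) (stack_upper k l m) = (l + m) div 2" "box_index (stack_tangle k l m) (stack_lower k l m) = (k + l) div 2"
  using box_index_column(2,3)[OF stack_column_ok[of k l m]] unfolding stack_tangle_column stack_upper_def stack_lower_def by simp_all
 show "labelling \<P> (stack_tangle k l m) (%B. if B = stack_upper k l m then y else x)"
  using assms(3,4) i stack_boxes_neq[of k l m] by (auto simp: labelling_def stack_tangle_def)
qed

lemma stack_linear: assumes "even (k + l)" "even (l + m)" "x \<in> \<B> ((k + l) div 2)" "y \<in> \<B> ((l + m) div 2)"
 shows "x' \<in> \<B> ((k + l) div 2) ==> stk k l m y (x + x') = stk k l m y x + stk k l m y x'"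
  "y' \<in> \<B> ((l + m) div 2) ==> stk k l m (y + y') x = stk k l m y x + stk k l m y' x" "stk k l m y (scl c x) = scl c (stk k l m y x)"
  "stk k l m (scl c y) x = scl c (stk k l m y x)"
proof -
 note L = stack_label[OF assms]
 let ?f = "%B. if B = stack_upper k l m then y else x"
 have up: "act \<P> (stack_tangle k l m) (?f(stack_upper k l m := z)) = stk k l m z x" if "z \<in> \<B> ((l + m) div 2)" for z
  unfolding stack_def by (intro arg_cong[of _ _ "act \<P> (stack_tangle k l m)"]) auto
 have lo: "act \<P> (stack_tangle k l m) (?f(stack_lower k l m := z)) = stk k l m y z" if "z \<in> \<B> ((k + l) div 2)" for z unfolding stack_def
 proof (rule act_cong[OF L(1), symmetric])
  show "labelling \<P> (stack_tangle k l m) (%B. if B = stack_upper k l m then y else z)" by (rule stack_label(2)[OF assms(1,2) that assms(4)])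
 qed (use stack_boxes_neq[of k l m] in "auto simp: stack_tangle_def")
 show "stk k l m y (x + x') = stk k l m y x + stk k l m y x'" if "x' \<in> \<B> ((k + l) div 2)"
  using act_add[OF L(1,2,4), unfolded L(6), OF assms(3) that] lo[OF assms(3)] lo[OF that] lo[OF box_closed(1)[OF assms(3) that]] by simp
 show "stk k l m (y + y') x = stk k l m y x + stk k l m y' x" if "y' \<in> \<B> ((l + m) div 2)"
  using act_add[OF L(1,2,3), unfolded L(5), OF assms(4) that] up[OF assms(4)] up[OF that] up[OF box_closed(1)[OF assms(4) that]] by simp
 show "stk k l m y (scl c x) = scl c (stk k l m y x)"
  using act_scale[OF L(1,2,4), unfolded L(6), OF assms(3)] lo[OF assms(3)] lo[OF box_closed(2)[OF assms(3)]] by simp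
 show "stk k l m (scl c y) x = scl c (stk k l m y x)"
  using act_scale[OF L(1,2,3), unfolded L(5), OF assms(4)] up[OF assms(4)] up[OF box_closed(2)[OF assms(4)]] by simp
qed

lemma beside_linear: assumes "even (k + l)" "y \<in> \<B> ((k + l) div 2)" "x \<in> \<B> 1"
 shows "x' \<in> \<B> 1 ==> bes k l y (x + x') = bes k l y x + bes k l y x'" "bes k l y (scl c x) = scl c (bes k l y x)"
  "y' \<in> \<B> ((k + l) div 2) ==> bes k l (y + y') x = bes k l y x + bes k l y' x" "bes k l (scl c y) x = scl c (bes k l y x)"
proof -
 define U L where "U = lbox (1/4) (real (k + l) + 3/2) 1 2" and "L = lbox (real (k + l) + 7/4) (real (k + l) + 9/4) 1 2"
 have neq: "L ~= U" unfolding U_def L_def by (rule lbox_neq) simp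
 have inn: "inner (beside_tangle k l) = {U, L}" by (simp add: beside_tangle_def U_def L_def)
 have p: "planar_tangle (beside_tangle k l)" unfolding beside_tangle_def by (rule planar_row[OF beside_row_ok assms(1)]) simp
 have i: "box_index (beside_tangle k l) U = (k + l) div 2" "box_index (beside_tangle k l) L = 1"
  using box_index_row(2,3)[OF beside_row_ok[of k l]] unfolding beside_tangle_def U_def L_def by simp_all
 have lab: "labelling \<P> (beside_tangle k l) (%B. if B = U then y else x)"
  if "y \<in> \<B> ((k + l) div 2)" "x \<in> \<B> 1" for x y using that neq i by (auto simp: labelling_def inn)
 have def': "bes k l y x = act \<P> (beside_tangle k l) (%B. if B = U then y else x)" for x y by (simp add: beside_def U_def)
 let ?f = "%B. if B = U then y else x"
 have up: "act \<P> (beside_tangle k l) (?f(U := z)) = bes k l z x" for z unfolding def' by (intro arg_cong[of _ _ "act \<P> (beside_tangle k l)"]) auto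
 have lo: "act \<P> (beside_tangle k l) (?f(L := z)) = bes k l y z" if "z \<in> \<B> 1" for z
  unfolding def' by (rule act_cong[OF p lab[OF assms(2) that], symmetric]) (use neq in "auto simp: inn")
 have in': "U \<in> inner (beside_tangle k l)" "L \<in> inner (beside_tangle k l)" by (simp_all add: inn)
 show "bes k l y (x + x') = bes k l y x + bes k l y x'" if "x' \<in> \<B> 1"
  using act_add[OF p lab[OF assms(2,3)] in'(2), unfolded i, OF assms(3) that] lo[OF assms(3)] lo[OF that] lo[OF box_closed(1)[OF assms(3) that]] by simp
 show "bes k l y (scl c x) = scl c (bes k l y x)"
  using act_scale[OF p lab[OF assms(2,3)] in'(2), unfolded i, OF assms(3)] lo[OF assms(3)] lo[OF box_closed(2)[OF assms(3)]] by simp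
 show "bes k l (y + y') x = bes k l y x + bes k l y' x" if "y' \<in> \<B> ((k + l) div 2)"
  using act_add[OF p lab[OF assms(2,3)] in'(1), unfolded i, OF assms(2) that] up by simp
 show "bes k l (scl c y) x = scl c (bes k l y x)" using act_scale[OF p lab[OF assms(2,3)] in'(1), unfolded i, OF assms(2)] up by simp
qed

lemma beside_tensor: "y \<in> \<B> k ==> x \<in> \<B> 1 ==> bes k k y x = ten k 1 y x"
proof -
 assume xy: "y \<in> \<B> k" "x \<in> \<B> 1"
 let ?f = "%B. if B = lbox (1/4) (real (k + k) + 3/2) 1 2 then y else x"
 have n: "lbox (real (k + k) + 7/4) (real (k + k) + 9/4) 1 2 ~= lbox (1/4) (real (k + k) + 3/2) 1 2" by (rule lbox_neq) simp
 have "val (beside_tangle k k) ?f (bes k k y x)" unfolding beside_tangle_def by (rule val_beside[OF beside_row_ok]) (use xy n in simp_all)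
 moreover have "val (beside_tangle k k) ?f (ten k 1 y x)" unfolding beside_tangle_def by (rule val_tensor[OF beside_row_ok]) (use xy n in simp_all)
 ultimately show ?thesis using val_unique by blast
qed

subsection \<open>Associativity and unit\<close>

lemma stack_assoc: assumes ev: "even (k + l)" "even (l + m)" "even (m + n)"
  and f: "f \<in> \<B> ((k + l) div 2)" and g: "g \<in> \<B> ((l + m) div 2)" and h: "h \<in> \<B> ((m + n) div 2)"
 shows "stk k m n h (stk k l m g f) = stk k l n (stk l m n h g) f"
proof -
 define N where "N = real (k + l + m + n)"
 have N: "real k <= N" "real l <= N" "real m <= N" "real n <= N" "0 <= N" by (simp_all add: N_def)
 let ?f = "lbox (1/2) (N + 1) 1 2" let ?g = "lbox (1/2) (N + 1) 3 4" let ?h = "lbox (1/2) (N + 1) 5 6"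
 define F where "F = (%_. undefined)(?f := f, ?g := g, ?h := h)"
 have F: "F ?f = f" "F ?g = g" "F ?h = h" by (simp_all add: F_def)
 note box = drawn_box[of F]
 have spl: "stripes real k 0 1 = stripes real k 0 (1/2) Un stripes real k (1/2) 1" "stripes real l 2 3 = stripes real l 2 (5/2) Un stripes real l (5/2) 3"
  "stripes real m 4 5 = stripes real m 4 (9/2) Un stripes real m (9/2) 5" "stripes real n 6 7 = stripes real n 6 (13/2) Un stripes real n (13/2) 7"
  by (simp_all add: stripes_join)
 have s: "spread real j (1/4) (N + 2)" "spread real j (1/2) (N + 1)" if "real j <= N" for j using that by (auto intro!: spread_real)
 have ev': "even (k + m)" "even (l + n)" using ev by presburger+
 have ok: "column_ok k l m real real real (1/4) (N + 2) (1/2) (N + 1) (1/2) (N + 1) (1/2) 1 2 3 4 (9/2)"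
  "column_ok k m n real real real 0 (N + 3) (1/4) (N + 2) (1/2) (N + 1) 0 (1/2) (9/2) 5 6 7"
  "column_ok l m n real real real (1/4) (N + 2) (1/2) (N + 1) (1/2) (N + 1) (5/2) 3 4 5 6 (13/2)"
  "column_ok k l n real real real 0 (N + 3) (1/2) (N + 1) (1/4) (N + 2) 0 1 2 (5/2) (13/2) 7" using N s by (simp_all add: column_ok_def)
 note 1 = drawn_column[OF ok(2) ev'(1) ev(3) stack_in[OF ev(1,2) f g] h
  drawn_column[OF ok(1) ev(1,2) f g box[OF F(1)] refl box[OF F(2)] refl] refl box[OF F(3)] refl]
 note 2 = drawn_column[OF ok(4) ev(1) ev'(2) f stack_in[OF ev(2,3) g h] box[OF F(1)] refl
  drawn_column[OF ok(3) ev(2,3) g h box[OF F(2)] refl box[OF F(3)] refl] refl]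
 show ?thesis by (rule drawn_unique[OF 1 2]; (simp only: spl)?; blast)
qed

text \<open>The identity strands are drawn into the upper box; what is left is the tangle that acts as the identity.\<close>

lemma stack_unit: assumes f: "f \<in> \<B> k" shows "cmp k (str k) f = f"
proof -
 let ?b = "real k + 3/2"
 have s: "spread real k (1/2) ?b" by (rule spread_real) auto
 have ok: "column_ok k k k real real real 0 (real k + 2) (1/2) ?b (1/2) ?b 0 1 2 (9/4) (11/4) 3" using s by (simp add: column_ok_def)
 have sp: "stripes real k 2 3 = stripes real k 2 (9/4) Un stripes real k (9/4) (11/4) Un stripes real k (11/4) 3" by (simp add: stripes_join)
 have "drawn (%_. f) (lbox 0 (real k + 2) 0 3) (cmp k (str k) f) ({lbox (1/2) ?b 1 2} Un {})
   (stripes real k 0 1 Un stripes real k 2 (9/4) Un stripes real k (11/4) 3 Un {} Un stripes real k (9/4) (11/4)) (points real k 0 Un points real k 3)"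
  by (rule drawn_column[OF ok _ _ _ _ drawn_box refl drawn_straight[OF s] refl]) (use f strands_in in simp_all)
 thus ?thesis by (intro drawn_cable[OF _ f]) (simp add: sp Un_ac)
qed

text \<open>The two ways of reading a two by two array of boxes.\<close>

lemma interchange: assumes p: "p \<in> \<B> k" and q: "q \<in> \<B> k" and a: "a \<in> \<B> 1" and b: "b \<in> \<B> 1"
 shows "cmp (k + 1) (ten k 1 p a) (ten k 1 q b) = ten k 1 (cmp k p q) (cmp 1 a b)"
proof -
 let ?n = "real k"
 let ?K = "%_::nat. ?n + 3"
 let ?P = "joined real k ?K"
 let ?D = "lbox (1/2) (?n + 1) 1 2" let ?E = "lbox (1/2) (?n + 1) 3 4"
 let ?G = "lbox (?n + 5/2) (?n + 7/2) 1 2" let ?H = "lbox (?n + 5/2) (?n + 7/2) 3 4"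
 define F where "F = (%_. undefined)(?D := q, ?E := p, ?G := b, ?H := a)"
 have F: "F ?D = q" "F ?E = p" "F ?G = b" "F ?H = a" by (simp_all add: F_def)
 note box = drawn_box[of F]
 have sp: "stripes r j 0 1 = stripes r j 0 (1/2) Un stripes r j (1/2) 1" "stripes r j 2 3 = stripes r j 2 (9/4) Un stripes r j (9/4) (11/4) Un stripes r j (11/4) 3"
  "stripes r j 4 5 = stripes r j 4 (9/2) Un stripes r j (9/2) 5" for r j by (simp_all add: stripes_join)
 have sK: "spread ?K 1 (?n + 5/2) (?n + 7/2)" "spread ?K 1 (?n + 1) (?n + 4)" "spread ?K 1 (?n + 9/4) (?n + 15/4)" by (rule spread_const1; simp)+
 have s: "spread real k (1/2) (?n + 1)" "spread real k (1/8) (?n + 1)" "spread real k (1/4) (?n + 3/2)" by (auto intro: spread_real)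
 have sP: "spread ?P (k + 1) (1/8) (?n + 4)" by (rule spread_joined[OF s(2) sK(2)]) auto
 have okT: "column_ok (k+1) (k+1) (k+1) ?P ?P ?P 0 (?n + 5) (1/8) (?n + 4) (1/8) (?n + 4) 0 (1/2) (9/4) (11/4) (9/2) 5" using sP by (simp add: column_ok_def)
 have okr: "row_ok k k 1 1 real real ?K ?K (1/8) (?n + 4) (1/2) (?n + 1) (?n + 5/2) (?n + 7/2) (1/2) 1 2 1 2 (9/4)"
  "row_ok k k 1 1 real real ?K ?K (1/8) (?n + 4) (1/2) (?n + 1) (?n + 5/2) (?n + 7/2) (11/4) 3 4 3 4 (9/2)"
  "row_ok k k 1 1 real real ?K ?K 0 (?n + 5) (1/4) (?n + 3/2) (?n + 9/4) (?n + 15/4) 0 (1/2) (9/2) (1/2) (9/2) 5" using s sK by (simp_all add: row_ok_def)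
 have okc: "column_ok k k k real real real (1/4) (?n + 3/2) (1/2) (?n + 1) (1/2) (?n + 1) (1/2) 1 2 3 4 (9/2)"
  "column_ok 1 1 1 ?K ?K ?K (?n + 9/4) (?n + 15/4) (?n + 5/2) (?n + 7/2) (?n + 5/2) (?n + 7/2) (1/2) 1 2 3 4 (9/2)" using s sK by (simp_all add: column_ok_def)
 have in1: "ten k 1 p' a' \<in> \<B> ((k + 1 + (k + 1)) div 2)" if "p' \<in> \<B> k" "a' \<in> \<B> 1" for p' a'
  using beside_in[of k k p' a'] beside_tensor[of p' k a'] that by simp
 have h: "x \<in> \<B> ((j + j) div 2)" "even (j + j)" if "x \<in> \<B> j" for x j using that by simp_all
 have pq: "cmp k p q \<in> \<B> k" using stack_in[of k k k q p] p q by simp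
 have ab: "cmp 1 a b \<in> \<B> 1" using stack_in[of 1 1 1 b a] a b by simp
 have e: "even (k + 1 + (k + 1))" by simp
 have bp: "points real k c Un points real k d Un points ?K 1 c Un points ?K 1 d = points ?P (k + 1) c Un points ?P (k + 1) d" for c d
  unfolding points_joined by blast
 note 1 = drawn_column[OF okT e e in1[OF q b] in1[OF p a]
  drawn_tensor[OF okr(1) q b box[OF F(1)] refl box[OF F(3)] refl] bp drawn_tensor[OF okr(2) p a box[OF F(2)] refl box[OF F(4)] refl] bp]
 note 2 = drawn_tensor[OF okr(3) pq ab
  drawn_column[OF okc(1) h(2)[OF p] h(2)[OF p] h(1)[OF q] h(1)[OF p] box[OF F(1)] refl box[OF F(2)] refl] refl
  drawn_column[OF okc(2) h(2)[OF a] h(2)[OF a] h(1)[OF b] h(1)[OF a] box[OF F(3)] refl box[OF F(4)] refl] refl]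
 show ?thesis by (rule drawn_unique[OF 1 2]; (simp only: sp stripes_joined)?; blast)
qed

end

context planar_alg begin

lemma tensor_in: "p \<in> \<B> k ==> a \<in> \<B> 1 ==> ten k 1 p a \<in> \<B> (k + 1)" using beside_in[of k k p a] beside_tensor[of p k a] by simp

lemma tensor_strands: "ten k 1 (str k) wire = str (k + 1)"
proof -
 let ?n = "real k"
 let ?K = "%_::nat. ?n + 3"
 let ?P = "joined real k ?K"
 have sK: "spread ?K 1 (?n + 5/2) (?n + 7/2)" "spread ?K 1 (?n + 1) (?n + 5)" by (rule spread_const1; simp)+
 have s: "spread real k (1/2) (?n + 1)" "spread real k 0 (?n + 1)" by (auto intro: spread_real)
 have sP: "spread ?P (k + 1) 0 (?n + 5)" by (rule spread_joined[OF s(2) sK(2)]) auto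
 have ok: "row_ok k k 1 1 real real ?K ?K 0 (?n + 5) (1/2) (?n + 1) (?n + 5/2) (?n + 7/2) 0 1 2 1 2 3" using s sK by (simp add: row_ok_def)
 have sp: "stripes r j 0 3 = stripes r j 0 1 Un stripes r j 1 2 Un stripes r j 2 3" for r j by (simp add: stripes_join)
 have "drawn F (lbox 0 (?n + 5) 0 3) (str (k + 1)) {} (stripes ?P (k + 1) 0 3) (points ?P (k + 1) 0 Un points ?P (k + 1) 3)" for F
  by (rule drawn_straight[OF sP]) auto
 note 2 = this
 show ?thesis by (rule drawn_unique[OF drawn_tensor[OF ok strands_in strands_in drawn_straight[OF s(1)] refl drawn_straight[OF sK(1)] refl] 2];
   (simp; fail)?; (simp only: sp stripes_joined)?; blast)
qed

lemma tensor_empty_left: assumes a: "a \<in> \<B> 1" shows "ten 0 1 (str 0) a = a"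
proof -
 have s0: "spread r 0 c d" for r c d by (simp add: spread_def)
 have s1: "spread real 1 (1/2) (5/2)" by (rule spread_real) auto
 have ok: "row_ok 0 0 1 1 real real real real 0 3 (1/8) (1/4) (1/2) (5/2) 0 1 2 1 2 3" using s0 s1 by (simp add: row_ok_def)
 have "drawn (%_. a) (lbox 0 3 0 3) (ten 0 1 (str 0) a) ({} Un {lbox (1/2) (5/2) 1 2})
   (stripes real 0 0 1 Un stripes real 0 2 3 Un stripes real 1 0 1 Un stripes real 1 2 3 Un stripes real 0 1 2 Un {})
   (points real 0 0 Un points real 0 3 Un points real 1 0 Un points real 1 3)"
  by (rule drawn_tensor[OF ok strands_in a drawn_straight[OF s0] refl drawn_box refl]) auto
 thus ?thesis by (intro drawn_cable[OF _ a]) (simp del: One_nat_def)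
qed

lemma tensor_empty_right: assumes a: "a \<in> \<B> k" shows "ten k 0 a (str 0) = a"
proof -
 let ?n = "real k"
 have s0: "spread r 0 c d" for r c d by (simp add: spread_def)
 have s1: "spread real k (1/2) (?n + 3/2)" by (rule spread_real) auto
 have ok: "row_ok k k 0 0 real real real real 0 (?n + 2) (1/2) (?n + 3/2) (?n + 7/4) (?n + 15/8) 0 1 2 1 2 3" using s0 s1 by (simp add: row_ok_def)
 have "drawn (%_. a) (lbox 0 (?n + 2) 0 3) (ten k 0 a (str 0)) ({lbox (1/2) (?n + 3/2) 1 2} Un {})
   (stripes real k 0 1 Un stripes real k 2 3 Un stripes real 0 0 1 Un stripes real 0 2 3 Un {} Un stripes real 0 1 2)
   (points real k 0 Un points real k 3 Un points real 0 0 Un points real 0 3)"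
  by (rule drawn_tensor[OF ok a strands_in drawn_box refl drawn_straight[OF s0] refl]) auto
 thus ?thesis by (intro drawn_cable[OF _ a]) simp
qed

lemma tensor_general_in: assumes "p \<in> \<B> k" "a \<in> \<B> l" shows "ten k l p a \<in> \<B> (k + l)"
proof -
 have n: "lbox (real k + 5/4) (real (k + l) + 7/4) 1 2 ~= lbox (1/4) (real k + 3/4) 1 2" by simp
 have "val (juxt_tangle k l) (%B. if B = lbox (1/4) (real k + 3/4) 1 2 then p else a) (ten k l p a)"
  unfolding juxt_tangle_row by (rule val_tensor[OF juxt_row_ok assms]) (use n in simp_all)
 moreover have "box_index (juxt_tangle k l) (outer (juxt_tangle k l)) = k + l"
  using box_index_row(1)[OF juxt_row_ok[of k l]] by (simp add: juxt_tangle_row del: of_nat_add)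
 ultimately show ?thesis by (rule val_in)
qed

lemma points_row: "points p k c Un points q l d Un points s m c Un points t n d = points (joined p k s) (k + m) c Un points (joined q l t) (l + n) d"
 unfolding points_joined by blast

lemma tensor_assoc: assumes p: "p \<in> \<B> k" and b: "b \<in> \<B> l" and a: "a \<in> \<B> m" shows "ten (k + l) m (ten k l p b) a = ten k (l + m) p (ten l m b a)"
proof -
 let ?k = "real k" and ?l = "real l" and ?m = "real m"
 let ?Q = "%i::nat. ?k + 2 + real i"
 let ?R = "%i::nat. ?k + ?l + 4 + real i"
 let ?D = "lbox (1/2) (?k + 1) 1 2" and ?E = "lbox (?k + 5/2) (?k + ?l + 3) 1 2" and ?G = "lbox (?k + ?l + 9/2) (?k + ?l + ?m + 5) 1 2"
 define F where "F = (%_. undefined)(?D := p, ?E := b, ?G := a)"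
 have F: "F ?D = p" "F ?E = b" "F ?G = a" by (simp_all add: F_def)
 note box = drawn_box[of F]
 have sk: "spread real k (1/2) (?k + 1)" "spread real k (1/4) (?k + 2)" by (auto intro: spread_real)
 have sl: "spread ?Q l (?k + 5/2) (?k + ?l + 3)" "spread ?Q l (?k + 2) (?k + ?l + 7/2)" by (auto simp: spread_def)
 have sm: "spread ?R m (?k + ?l + 9/2) (?k + ?l + ?m + 5)" "spread ?R m (?k + ?l + 7/2) (?k + ?l + ?m + 11/2)" by (auto simp: spread_def)
 have sP: "spread (joined real k ?Q) (k + l) (1/4) (?k + ?l + 7/2)" by (rule spread_joined[OF sk(2) sl(2)]) auto
 have sP': "spread (joined ?Q l ?R) (l + m) (?k + 2) (?k + ?l + ?m + 11/2)" by (rule spread_joined[OF sl(2) sm(2)]) auto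
 have sp: "stripes r j 0 1 = stripes r j 0 (1/2) Un stripes r j (1/2) 1" "stripes r j 2 3 = stripes r j 2 (5/2) Un stripes r j (5/2) 3" for r j
  by (simp_all add: stripes_join)
 have ok: "row_ok (k + l) (k + l) m m (joined real k ?Q) (joined real k ?Q) ?R ?R 0 (?k + ?l + ?m + 6) (1/4) (?k + ?l + 7/2)
   (?k + ?l + 9/2) (?k + ?l + ?m + 5) 0 (1/2) (5/2) 1 2 3"
  "row_ok k k l l real real ?Q ?Q (1/4) (?k + ?l + 7/2) (1/2) (?k + 1) (?k + 5/2) (?k + ?l + 3) (1/2) 1 2 1 2 (5/2)"
  "row_ok k k (l + m) (l + m) real real (joined ?Q l ?R) (joined ?Q l ?R) 0 (?k + ?l + ?m + 6) (1/2) (?k + 1) (?k + 2) (?k + ?l + ?m + 11/2) 0 1 2 (1/2) (5/2) 3"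
  "row_ok l l m m ?Q ?Q ?R ?R (?k + 2) (?k + ?l + ?m + 11/2) (?k + 5/2) (?k + ?l + 3) (?k + ?l + 9/2) (?k + ?l + ?m + 5) (1/2) 1 2 1 2 (5/2)"
  using sP sP' sk sl sm by (simp_all add: row_ok_def)
 note 1 = drawn_tensor[OF ok(1) tensor_general_in[OF p b] a drawn_tensor[OF ok(2) p b box[OF F(1)] refl box[OF F(2)] refl]
  points_row box[OF F(3)] refl]
 note 2 = drawn_tensor[OF ok(3) p tensor_general_in[OF b a] box[OF F(1)] refl
  drawn_tensor[OF ok(4) b a box[OF F(2)] refl box[OF F(3)] refl] points_row]
 show ?thesis by (rule drawn_unique[OF 1 2]; (simp only: stripes_joined sp[of real k] sp[of ?Q l] sp[of ?R m])?; blast)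
qed

text \<open>Sliding a box along a bent strand: on the way round the bend it is turned upside down.\<close>

lemma beside_bend: assumes ev: "even (k + (l + 1))" "even (l + l')"
  and g: "g \<in> \<B> ((k + (l + 1)) div 2)" and y: "y \<in> \<B> ((l + l') div 2)" and a: "a \<in> \<B> 1" shows "stk k (l + 1) (l' + 1) (bes l l' y a) g =
  stk (k + 1) (k + 1) l' (stk (k + 1) l l' y g) (ten k 1 (str k) (rot a))"
proof -
 define x where "x = real k + real l + real l' + 1"
 have x: "real k + 1 <= x" "real l + 1 <= x" "real l' + 1 <= x" "1 <= x" by (simp_all add: x_def)
 let ?K = "%_::nat. x + 1/10" let ?J = "%j. joined real j ?K"
 let ?G = "lbox (1/2) (x + 1) (-1) 1" and ?Y = "lbox (1/2) x 2 3" and ?R = "lbox (x + 1/20) (x + 3/20) 2 3" and ?R' = "rbox (x + 1/20) (x + 3/20) (-3) (-2)"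
 define F where "F = (%_. undefined)(?G := g, ?Y := y, ?R := a)"
 have F: "F ?G = g" "F ?Y = y" "F ?R = a" using x by (simp_all add: F_def)
 define F' where "F' = (%_. undefined)(?G := g, ?Y := y, ?R' := a)"
 have F': "F' ?G = g" "F' ?Y = y" "F' ?R' = a" using x by (simp_all add: F'_def)
 note box = drawn_box[of F] and box' = drawn_box[of F']
 define S where "S = stripes real k (-4) (-1) Un stripes real l 1 2 Un stripes real l' 3 4"
 have sr: "spread real j (1/2) x" "spread real j (1/2) (x + 1)" "spread real j (1/4) (x + 3)" if "real j + 1 <= x" for j using that by (auto intro!: spread_real)
 have sK: "spread ?K 1 x (x + 1)" "spread ?K 1 (x + 1/20) (x + 3/20)" "spread ?K 1 x (x + 3)" "spread ?K 1 (x + 1/40) (x + 1/5)" by (rule spread_const1; simp)+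
 have sJ: "spread (?J j) (j + 1) (1/2) (x + 1)" "spread (?J j) (j + 1) (1/4) (x + 3)" if "real j + 1 <= x" for j
  using spread_joined[OF sr(1)[OF that] sK(1)] spread_joined[OF spread_mono[OF sr(1)[OF that], of "1/4" x] sK(3)] x by auto
 have st: "vline (x + 1/10) c d = stripes ?K 1 c d" for c d by (simp add: stripes_one)
 have ev': "even (l + 1 + (l' + 1))" "even (k + 1 + l)" "even (k + 1 + l')" "even (k + 1 + (k + 1))" using ev by presburger+
 have ya: "bes l l' y a \<in> \<B> ((l + 1 + (l' + 1)) div 2)" using beside_in[OF ev(2) y a] by simp
 have g': "g \<in> \<B> ((k + 1 + l) div 2)" using g by (simp add: ac_simps)
 have ok: "column_ok k (l + 1) (l' + 1) real (?J l) (?J l') 0 (x + 4) (1/2) (x + 1) (1/4) (x + 3) (-4) (-1) 1 (3/2) (7/2) 4"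
  "column_ok (k + 1) (k + 1) l' (?J k) (?J k) real 0 (x + 4) (1/4) (x + 3) (1/4) (x + 3) (-4) (-7/2) (-3/2) (-5/4) (15/4) 4"
  "column_ok (k + 1) l l' (?J k) real real (1/4) (x + 3) (1/2) (x + 1) (1/2) x (-5/4) (-1) 1 2 3 (15/4)" using sJ sr x by (simp_all add: column_ok_def)
 have okr: "row_ok l l' 1 1 real real ?K ?K (1/4) (x + 3) (1/2) x (x + 1/20) (x + 3/20) (3/2) 2 3 2 3 (7/2)"
  "row_ok k k 1 1 real real ?K ?K (1/4) (x + 3) (1/2) x (x + 1/40) (x + 1/5) (-7/2) (-3) (-2) (-13/4) (-7/4) (-3/2)" using sr sK x by (simp_all add: row_ok_def)
 have ra: "rot a \<in> \<B> 1" by (rule rotation_in[OF a])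
 have sa: "stk (k + 1) l l' y g \<in> \<B> ((k + 1 + l') div 2)" by (rule stack_in[OF ev'(2) ev(2) g' y])
 have ta: "ten k 1 (str k) (rot a) \<in> \<B> ((k + 1 + (k + 1)) div 2)" using tensor_in[OF strands_in ra] by simp
 have o: "x + 1/40 < x + 1/20" "x + 1/20 < x + 1/10" "x + 1/10 < x + 3/20" "x + 3/20 < x + 1/5"
  "-13/4 < (-3::real)" "-3 < (-2::real)" "-2 < (-7/4::real)" "1/2 < x" using x by simp_all
 note 1 = drawn_column[OF ok(1) ev(1) ev'(1) g ya box[OF F(1)] refl
  drawn_beside[OF okr(1) ev(2) y a box[OF F(2)] refl box[OF F(3)] refl] points_row]
 note 2 = drawn_column[OF ok(2) ev'(4,3) ta sa
  drawn_tensor[OF okr(2) strands_in ra drawn_straight[OF sr(1)[OF x(1)] o(8,6)] refl drawn_turned[where F = F', OF o(1-7) a F'(3)] refl] points_row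
  drawn_column[OF ok(3) ev'(2) ev(2) g' y box'[OF F'(1)] refl box'[OF F'(2)] refl] refl]
 have sp: "stripes r j 1 2 = stripes r j 1 (3/2) Un stripes r j (3/2) 2" "stripes r j 3 4 = stripes r j 3 (7/2) Un stripes r j (7/2) 4"
  "stripes r j 3 (15/4) = stripes r j 3 (7/2) Un stripes r j (7/2) (15/4)" "stripes r j (7/2) 4 = stripes r j (7/2) (15/4) Un stripes r j (15/4) 4"
  "stripes r j (-4) (-1) = stripes r j (-4) (-7/2) Un stripes r j (-7/2) (-3) Un stripes r j (-3) (-2) Un stripes r j (-2) (-3/2) Un stripes r j (-3/2) (-5/4) Un stripes r j (-5/4) (-1)"
  "stripes r j (-4) (-3) = stripes r j (-4) (-7/2) Un stripes r j (-7/2) (-13/4) Un stripes r j (-13/4) (-3)"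
  "stripes r j (-2) (-1) = stripes r j (-2) (-7/4) Un stripes r j (-7/4) (-3/2) Un stripes r j (-3/2) (-5/4) Un stripes r j (-5/4) (-1)" for r j
  by (simp_all add: stripes_join)
 note T = tip_above_def tip_below_def tangle.sel
 show ?thesis
 proof (rule tip_slide[of x S])
  show "Re z <= x" if "z \<in> S" for z using that x by (auto simp: S_def stripes_iff)
  show "val (tip_above x S) F (stk k (l + 1) (l' + 1) (bes l l' y a) g)"
   by (rule drawn_val[OF 1]; (simp only: T S_def st sp stripes_joined)?; (blast | (use x in simp)))
  show "val (tip_below x S) F' (stk (k + 1) (k + 1) l' (stk (k + 1) l l' y g) (ten k 1 (str k) (rot a)))"
   by (rule drawn_val[OF 2]; (simp only: T S_def st sp stripes_joined)?; (blast | (use x in simp)))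
 qed (use o(8) in "simp_all add: F F'")
qed

end

section \<open>Adjoints\<close>

lemma cnj_rect: "cnj ` rect a b c d = rect a b (- d) (- c)"
proof (intro subset_antisym subsetI)
 fix z assume "z \<in> rect a b (- d) (- c)"
 thus "z \<in> cnj ` rect a b c d" by (intro image_eqI[of _ _ "cnj z"]) (auto simp: rect_iff)
qed (auto simp: rect_iff)

lemma cnj_middle: "cnj (Complex a ((c + d) / 2)) = Complex a ((- d + - c) / 2)"
proof -
 have "- (c + d) = - d + - c" by simp
 thus ?thesis by (simp only: complex_cnj minus_divide_left)
qed

lemma cnj_lbox: "disc_image cnj (lbox a b c d) = lbox a b (- d) (- c)" unfolding disc_image_def lbox_def disc.sel cnj_rect cnj_middle by (rule refl)

lemma cnj_rbox: "disc_image cnj (rbox a b c d) = rbox a b (- d) (- c)" unfolding disc_image_def rbox_def disc.sel cnj_rect cnj_middle by (rule refl)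

lemma cnj_vline: "cnj ` vline x c d = vline x (- d) (- c)"
proof (intro subset_antisym subsetI)
 fix z assume "z \<in> vline x (- d) (- c)"
 thus "z \<in> cnj ` vline x c d" by (intro image_eqI[of _ _ "cnj z"]) (auto simp: vline_iff)
qed (auto simp: vline_iff)

lemma cnj_hline: "cnj ` hline a b y = hline a b (- y)"
proof (intro subset_antisym subsetI)
 fix z assume "z \<in> hline a b (- y)"
 thus "z \<in> cnj ` hline a b y" by (intro image_eqI[of _ _ "cnj z"]) (auto simp: hline_iff)
qed (auto simp: hline_iff)

lemma cnj_stripes: "cnj ` stripes p k c d = stripes p k (- d) (- c)" by (simp add: stripes_def image_UN cnj_vline)

lemma homeomorphism_cnj: "homeomorphism UNIV UNIV cnj cnj" by (auto simp: homeomorphism_def surj_def intro!: continuous_intros exI[of _ "cnj _"])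

locale subfactor_alg = planar_alg + assumes spa: "unshaded_subfactor_planar_algebra \<P>"
begin

lemma adjoint_structure: "adjoint_structure \<P>" using spa unfolding unshaded_subfactor_planar_algebra_def by (elim conjE)

lemma adj_in: "f \<in> \<B> k ==> adj \<P> k f \<in> \<B> k" and adj_adj: "f \<in> \<B> k ==> adj \<P> k (adj \<P> k f) = f"
 using adjoint_structure unfolding adjoint_structure_def by (elim conjE, simp)+

lemma adj_add: "f \<in> \<B> k ==> g \<in> \<B> k ==> adj \<P> k (f + g) = adj \<P> k f + adj \<P> k g"
 and adj_scale: "f \<in> \<B> k ==> adj \<P> k (scl c f) = scl (cnj c) (adj \<P> k f)" using adjoint_structure unfolding adjoint_structure_def by (elim conjE, simp)+

lemma adj_act: "planar_tangle T ==> labelling \<P> T f ==> adj \<P> (box_index T (outer T)) (act \<P> T f) =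
  act \<P> (tangle_image cnj T) (%B. adj \<P> (box_index (tangle_image cnj T) B) (f (disc_image cnj B)))"
 using adjoint_structure unfolding adjoint_structure_def by (elim conjE) simp

lemma disc_image_cnj_cnj: "disc_image cnj (disc_image cnj B) = B" by (simp add: disc_image_def image_image)

lemma val_adj: assumes v: "val T f x" and n: "box_index T (outer T) = n" and g: "!!B. B \<in> inner T ==> g (disc_image cnj B) = adj \<P> (box_index T B) (f B)"
 shows "val (tangle_image cnj T) g (adj \<P> n x)"
proof -
 have T: "planar_tangle T" "labelling \<P> T f" "act \<P> T f = x" using v by (simp_all add: val_def)
 let ?T1 = "tangle_image cnj T"
 define F where "F = (%B. adj \<P> (box_index ?T1 B) (f (disc_image cnj B)))"
 have i: "box_index ?T1 (disc_image cnj B) = box_index T B" for B by (rule box_index_image[OF homeomorphism_cnj])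
 have F: "F (disc_image cnj B) = adj \<P> (box_index T B) (f B)" for B by (simp add: F_def i disc_image_cnj_cnj)
 have "labelling \<P> ?T1 F" unfolding labelling_def
 proof
  fix B assume "B \<in> inner ?T1"
  then obtain B' where B': "B' \<in> inner T" "B = disc_image cnj B'" by auto
  hence "f B' \<in> \<B> (box_index T B')" using T(2) by (simp add: labelling_def)
  thus "F B \<in> \<B> (box_index ?T1 B)" unfolding B'(2) F i by (rule adj_in)
 qed
 hence "val ?T1 F (adj \<P> n x)" using adj_act[OF T(1,2)] planar_tangle_image[OF homeomorphism_cnj T(1)] T(3) n by (simp add: val_def F_def)
 thus ?thesis by (rule val_cong) (auto simp: F g)
qed

lemma adj_stack: assumes ev: "even (k + l)" "even (l + m)" and x: "x \<in> \<B> ((k + l) div 2)" and y: "y \<in> \<B> ((l + m) div 2)"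
 shows "adj \<P> ((k + m) div 2) (stk k l m y x) = stk m l k (adj \<P> ((k + l) div 2) x) (adj \<P> ((l + m) div 2) y)"
proof -
 define N where "N = real (k + l + m)"
 have s: "spread real k (1/2) (N + 3/2)" "spread real l (1/2) (N + 3/2)" "spread real m (1/2) (N + 3/2)" by (auto simp: N_def intro!: spread_real)
 let ?T = "column k l m real real real 0 (N + 2) (1/2) (N + 3/2) (1/2) (N + 3/2) 0 1 2 3 4 5"
 let ?U = "column m l k real real real 0 (N + 2) (1/2) (N + 3/2) (1/2) (N + 3/2) (-5) (-4) (-3) (-2) (-1) 0"
 define D where "D = lbox (1/2) (N + 3/2) 1 2"
 define E where "E = lbox (1/2) (N + 3/2) 3 4"
 define D' where "D' = lbox (1/2) (N + 3/2) (-2) (-1)"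
 define E' where "E' = lbox (1/2) (N + 3/2) (-4) (-3)"
 have neq: "D ~= E" "D' ~= E'" by (simp_all add: D_def E_def D'_def E'_def)
 have okT: "column_ok k l m real real real 0 (N + 2) (1/2) (N + 3/2) (1/2) (N + 3/2) 0 1 2 3 4 5" using s by (simp add: column_ok_def N_def)
 have okU: "column_ok m l k real real real 0 (N + 2) (1/2) (N + 3/2) (1/2) (N + 3/2) (-5) (-4) (-3) (-2) (-1) 0" using s by (simp add: column_ok_def N_def)
 define f where "f = (%_. undefined)(D := x, E := y)"
 define g where "g = (%_. undefined)(D' := adj \<P> ((k + l) div 2) x, E' := adj \<P> ((l + m) div 2) y)"
 have f: "f D = x" "f E = y" "g D' = adj \<P> ((k + l) div 2) x" "g E' = adj \<P> ((l + m) div 2) y" using neq by (simp_all add: f_def g_def)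
 have T: "val ?T f (stk k l m y x)" by (rule val_column[where f = f, OF okT ev x y]) (use f in "simp_all add: D_def E_def")
 have img: "tangle_image cnj ?T = ?U" unfolding column_def tangle_image_def tangle.sel image_insert image_empty image_Un cnj_lbox cnj_stripes
  by (rule tangle_eqI) (simp, simp add: insert_commute, simp add: Un_ac)
 have c: "disc_image cnj D = D'" "disc_image cnj E = E'" by (simp_all add: D_def D'_def E_def E'_def cnj_lbox)
 have "val (tangle_image cnj ?T) g (adj \<P> ((k + m) div 2) (stk k l m y x))"
 proof (rule val_adj[OF T])
  show "box_index ?T (outer ?T) = (k + m) div 2" by (simp only: column_simps box_index_column[OF okT])
  fix B assume "B \<in> inner ?T"
  then consider "B = D" | "B = E" by (auto simp: D_def E_def)
  thus "g (disc_image cnj B) = adj \<P> (box_index ?T B) (f B)" using box_index_column(2,3)[OF okT] by cases (simp_all add: c f, simp_all add: D_def E_def)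
 qed
 moreover have "val ?U g (stk m l k (adj \<P> ((k + l) div 2) x) (adj \<P> ((l + m) div 2) y))"
 proof (rule val_column[where f = g, OF okU])
  show "adj \<P> ((l + m) div 2) y \<in> \<B> ((m + l) div 2)" "adj \<P> ((k + l) div 2) x \<in> \<B> ((l + k) div 2)"
   using adj_in[OF x] adj_in[OF y] by (simp_all add: add.commute)
 qed (use ev f in "simp_all add: D'_def E'_def add.commute")
 ultimately show ?thesis unfolding img by (rule val_unique) simp
qed

lemma adj_beside: assumes ev: "even (k + l)" and y: "y \<in> \<B> ((k + l) div 2)" and x: "x \<in> \<B> 1"
 shows "adj \<P> ((k + l) div 2 + 1) (bes k l y x) = bes l k (adj \<P> ((k + l) div 2) y) (adj \<P> 1 x)"
proof -
 define N where "N = real (k + l)"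
 have s: "spread real k (1/2) (N + 1)" "spread real l (1/2) (N + 1)" "spread (%_. N + 5/2) 1 (N + 2) (N + 3)" by (auto simp: N_def spread_def)
 let ?p = "%_::nat. N + 5/2"
 let ?T = "row k l 1 1 real real ?p ?p 0 (N + 4) (1/2) (N + 1) (N + 2) (N + 3) 0 1 2 1 2 3"
 let ?U = "row l k 1 1 real real ?p ?p 0 (N + 4) (1/2) (N + 1) (N + 2) (N + 3) (-3) (-2) (-1) (-2) (-1) 0"
 define D where "D = lbox (1/2) (N + 1) 1 2"
 define E where "E = lbox (N + 2) (N + 3) 1 2"
 define D' where "D' = lbox (1/2) (N + 1) (-2) (-1)"
 define E' where "E' = lbox (N + 2) (N + 3) (-2) (-1)"
 have n: "0 <= N" by (simp add: N_def)
 have neq: "D ~= E" "D' ~= E'" using n by (simp_all add: D_def E_def D'_def E'_def)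
 have okT: "row_ok k l 1 1 real real ?p ?p 0 (N + 4) (1/2) (N + 1) (N + 2) (N + 3) 0 1 2 1 2 3" using s n by (simp add: row_ok_def)
 have okU: "row_ok l k 1 1 real real ?p ?p 0 (N + 4) (1/2) (N + 1) (N + 2) (N + 3) (-3) (-2) (-1) (-2) (-1) 0" using s n by (simp add: row_ok_def)
 define f where "f = (%_. undefined)(D := y, E := x)"
 define g where "g = (%_. undefined)(D' := adj \<P> ((k + l) div 2) y, E' := adj \<P> 1 x)"
 have f: "f D = y" "f E = x" "g D' = adj \<P> ((k + l) div 2) y" "g E' = adj \<P> 1 x" using neq by (simp_all add: f_def g_def)
 have T: "val ?T f (bes k l y x)" by (rule val_beside[OF okT ev y x]) (use f in "simp_all add: D_def E_def")
 have img: "tangle_image cnj ?T = ?U" unfolding row_def tangle_image_def tangle.sel image_insert image_empty image_Un cnj_lbox cnj_stripes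
  by (rule tangle_eqI) (simp, simp, simp add: Un_ac)
 have c: "disc_image cnj D = D'" "disc_image cnj E = E'" by (simp_all add: D_def D'_def E_def E'_def cnj_lbox)
 have "val (tangle_image cnj ?T) g (adj \<P> ((k + l) div 2 + 1) (bes k l y x))"
 proof (rule val_adj[OF T])
  show "box_index ?T (outer ?T) = (k + l) div 2 + 1" using ev by (simp only: row_simps box_index_row[OF okT])
  fix B assume "B \<in> inner ?T"
  then consider "B = D" | "B = E" by (auto simp: D_def E_def)
  thus "g (disc_image cnj B) = adj \<P> (box_index ?T B) (f B)" using box_index_row(2,3)[OF okT] by cases (simp_all add: c f, simp_all add: D_def E_def)
 qed
 moreover have "val ?U g (bes l k (adj \<P> ((k + l) div 2) y) (adj \<P> 1 x))"
 proof (rule val_beside[OF okU])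
  show "adj \<P> ((k + l) div 2) y \<in> \<B> ((l + k) div 2)" using adj_in[OF y] by (simp add: add.commute)
 qed (use ev f adj_in[OF x] in "simp_all add: D'_def E'_def add.commute")
 ultimately show ?thesis unfolding img by (rule val_unique) simp
qed

lemma adj_tensor: "p \<in> \<B> k ==> a \<in> \<B> 1 ==> adj \<P> (k + 1) (ten k 1 p a) = ten k 1 (adj \<P> k p) (adj \<P> 1 a)"
 using adj_beside[of k k p a] beside_tensor[of p k a] beside_tensor[of "adj \<P> k p" k "adj \<P> 1 a"] adj_in[of p k] adj_in[of a 1] by simp

lemma adj_strands: "adj \<P> k (str k) = str k"
proof -
 have s: "spread real k 0 (real k + 1)" by (rule spread_real) auto
 let ?T = "straight k real 0 (real k + 1) 0 1"
 have T: "val ?T (%_. 0) (str k)" by (rule val_straight[OF s]) auto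
 let ?T1 = "straight k real 0 (real k + 1) (-1) 0"
 have "box_index ?T (outer ?T) = k" using card_points2[OF s s, of 0 1] by (simp add: box_index_def boundary_points_straight[OF s])
 hence "val (tangle_image cnj ?T) (%_. 0) (adj \<P> k (str k))" by (rule val_adj[OF T]) simp
 moreover have "tangle_image cnj ?T = ?T1" by (simp add: straight_def tangle_image_def cnj_lbox cnj_stripes)
 moreover have "val ?T1 (%_. 0) (str k)" by (rule val_straight[OF s]) auto
 ultimately show ?thesis using val_unique by fastforce
qed

lemma adj_rotation: assumes x: "x \<in> \<B> 1" shows "adj \<P> 1 (rot x) = rot (adj \<P> 1 x)"
proof -
 have o: "0 < (1/2::real)" "1/2 < (1::real)" "1 < (3/2::real)" "3/2 < (2::real)" "0 < (1::real)" "1 < (2::real)" "2 < (3::real)" by simp_all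
 have o': "0 < (1/2::real)" "1/2 < (1::real)" "1 < (3/2::real)" "3/2 < (2::real)" "-3 < (-2::real)" "-2 < (-1::real)" "-1 < (0::real)" by simp_all
 let ?T = "turned 1 0 2 (1/2) (3/2) 0 1 2 3"
 have s: "spread (%_. 1) 1 0 2" "spread (%_. 1) 1 (1/2) (3/2)" by (rule spread_const1; simp)+
 have T: "val ?T (%_. x) (rot x)" by (rule val_turned[OF o x refl])
 have i: "box_index ?T (outer ?T) = 1" "box_index ?T (rbox (1/2) (3/2) 1 2) = 1"
  using card_points2[OF s(1,1), of 0 3] card_points2[OF s(2,2), of 1 2] by (simp_all add: box_index_def boundary_points_turned[OF o] del: One_nat_def)
 let ?T1 = "turned 1 0 2 (1/2) (3/2) (-3) (-2) (-1) 0"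
 have "val (tangle_image cnj ?T) (%_. adj \<P> 1 x) (adj \<P> 1 (rot x))" by (rule val_adj[OF T i(1)]) (use i(2) in "simp del: One_nat_def")
 moreover have "tangle_image cnj ?T = ?T1" by (simp add: turned_def tangle_image_def cnj_lbox cnj_rbox cnj_stripes image_Un Un_ac del: One_nat_def)
 moreover have "val ?T1 (%_. adj \<P> 1 x) (rot (adj \<P> 1 x))" by (rule val_turned[OF o' adj_in[OF x] refl])
 ultimately show ?thesis using val_unique by fastforce
qed

end

section \<open>Caps and cups\<close>

definition tilt_nodes :: "real => ((real => real) \<times> (real => real)) list" where
 "tilt_nodes x0 = [(%_. x0 - 1/2, %_. x0 - 1/2), (%_. x0, %v. x0 + max 0 (min 4 v) / 10), (%_. x0 + 1, %_. x0 + 1)]"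

definition unfold_nodes :: "real => ((real => real) \<times> (real => real)) list" where
 "unfold_nodes x0 = [(%_. x0, %_. x0), (%v. x0 + max (1/10) (min 4 (- v) / 10), %_. x0 + 2/5), (%_. x0 + 1, %_. x0 + 1)]"

definition level_nodes :: "real => ((real => real) \<times> (real => real)) list" where
 "level_nodes x0 = [(%_. -4, %_. -4), (%x. - max 0 (min 1 ((x - x0) * (5/2))), %_. 0), (%_. 4, %_. 4)]"

definition fibre_map :: "((real => real) \<times> (real => real)) list => real => real => real" where "fibre_map ns y = pl (map (%n. (fst n y, snd n y)) ns)"

lemma fibre_cap: "fibre_family (fibre_map (tilt_nodes x0))" "fibre_family (fibre_map (unfold_nodes x0))" "fibre_family (fibre_map (level_nodes x0))"
proof -
 have "nodes (map (%n. (fst n y, snd n y)) (tilt_nodes x0))" for y by (simp add: tilt_nodes_def max_def min_def)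
 thus "fibre_family (fibre_map (tilt_nodes x0))" unfolding fibre_map_def by (rule fibre_family_pl[rotated]) (auto simp: tilt_nodes_def intro!: continuous_intros)
 have "nodes (map (%n. (fst n y, snd n y)) (unfold_nodes x0))" for y by (simp add: unfold_nodes_def max_def min_def)
 thus "fibre_family (fibre_map (unfold_nodes x0))" unfolding fibre_map_def by (rule fibre_family_pl[rotated]) (auto simp: unfold_nodes_def intro!: continuous_intros)
 have "nodes (map (%n. (fst n y, snd n y)) (level_nodes x0))" for y by (simp add: level_nodes_def max_def min_def)
 thus "fibre_family (fibre_map (level_nodes x0))" unfolding fibre_map_def by (rule fibre_family_pl[rotated]) (auto simp: level_nodes_def intro!: continuous_intros)
qed

lemma pl3: assumes "a < b" "b < c" "a' < b'" "b' < c'" shows "x <= a ==> pl [(a, a'), (b, b'), (c, c')] x = a' + (x - a)" "pl [(a, a'), (b, b'), (c, c')] b = b'"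
  "c <= x ==> pl [(a, a'), (b, b'), (c, c')] x = c' + (x - c)" "a <= x ==> x <= b ==> pl [(a, a'), (b, b'), (c, c')] x = a' + (b' - a') / (b - a) * (x - a)"
  "pl [(a, a'), (b, b'), (c, c')] a = a'" "pl [(a, a'), (b, b'), (c, c')] c = c'"
proof -
 have n: "nodes [(a, a'), (b, b'), (c, c')]" using assms by simp
 have n': "nodes [(b, b'), (c, c')]" using assms by simp
 show "x <= a ==> pl [(a, a'), (b, b'), (c, c')] x = a' + (x - a)" using pl_left[OF n, of x] by simp
 show "pl [(a, a'), (b, b'), (c, c')] b = b'" "pl [(a, a'), (b, b'), (c, c')] a = a'" "pl [(a, a'), (b, b'), (c, c')] c = c'"
  using pl_node[OF n, of "(b, b')"] pl_node[OF n, of "(a, a')"] pl_node[OF n, of "(c, c')"] by (simp_all del: pl.simps)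
 show "a <= x ==> x <= b ==> pl [(a, a'), (b, b'), (c, c')] x = a' + (b' - a') / (b - a) * (x - a)" using pl_between[OF n, of x] by (simp del: pl.simps)
 show "c <= x ==> pl [(a, a'), (b, b'), (c, c')] x = c' + (x - c)"
  using pl_skip[OF n, of x] pl_skip[OF n', of x] pl_right[of "(c, c')" x] assms by (simp del: pl.simps)
qed

lemma fibre_tilt: "x <= x0 - 1/2 | x0 + 1 <= x ==> fibre_map (tilt_nodes x0) v x = x" "fibre_map (tilt_nodes x0) v x0 = x0 + max 0 (min 4 v) / 10"
proof -
 have o: "x0 - 1/2 < x0" "x0 < x0 + 1" "x0 - 1/2 < x0 + max 0 (min 4 v) / 10" "x0 + max 0 (min 4 v) / 10 < x0 + 1" by auto
 show "x <= x0 - 1/2 | x0 + 1 <= x ==> fibre_map (tilt_nodes x0) v x = x" "fibre_map (tilt_nodes x0) v x0 = x0 + max 0 (min 4 v) / 10"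
  using pl3(1,3)[OF o, of x] pl3(2)[OF o] by (auto simp: fibre_map_def tilt_nodes_def simp del: pl.simps)
qed

lemma fibre_unfold: "x <= x0 | x0 + 1 <= x ==> fibre_map (unfold_nodes x0) v x = x"
 "1 <= t ==> t <= 4 ==> fibre_map (unfold_nodes x0) (- t) (x0 + t / 10) = x0 + 2/5"
 "0 <= t ==> t <= 1 ==> fibre_map (unfold_nodes x0) (- t) (x0 + t / 10) = x0 + 2/5 * t"
proof -
 have o: "x0 < x0 + max (1/10) (min 4 (- v) / 10)" "x0 + max (1/10) (min 4 (- v) / 10) < x0 + 1" "x0 < x0 + 2/5" "x0 + 2/5 < x0 + 1" for v
  by (auto simp: max_def min_def)
 show "x <= x0 | x0 + 1 <= x ==> fibre_map (unfold_nodes x0) v x = x"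
  using pl3(1,3)[OF o(1)[of v] o(2)[of v] o(3,4), of x] by (auto simp: fibre_map_def unfold_nodes_def simp del: pl.simps)
 show "fibre_map (unfold_nodes x0) (- t) (x0 + t / 10) = x0 + 2/5" if "1 <= t" "t <= 4"
 proof -
  have "max (1/10) (min 4 (- (- t)) / 10) = t / 10" using that by (simp add: max_def min_def)
  thus ?thesis using pl3(2)[OF o(1)[of "- t"] o(2)[of "- t"] o(3,4)] by (simp add: fibre_map_def unfold_nodes_def del: pl.simps)
 qed
 show "fibre_map (unfold_nodes x0) (- t) (x0 + t / 10) = x0 + 2/5 * t" if "0 <= t" "t <= 1"
 proof -
  have "max (1/10) (min 4 (- (- t)) / 10) = 1 / 10" using that by (simp add: max_def min_def)
  thus ?thesis using pl3(4)[OF o(1)[of "- t"] o(2)[of "- t"] o(3,4), of "x0 + t / 10"] that by (simp add: fibre_map_def unfold_nodes_def del: pl.simps)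
 qed
qed

lemma fibre_level: "x <= x0 ==> fibre_map (level_nodes x0) x 0 = 0" "fibre_map (level_nodes x0) x (-4) = -4" "fibre_map (level_nodes x0) x 4 = 4"
 "0 <= t ==> t <= 1 ==> fibre_map (level_nodes x0) (x0 + 2 * t / 5) (- t) = 0"
proof -
 have o: "(-4::real) < - max 0 (min 1 ((x - x0) * (5/2)))" "- max 0 (min 1 ((x - x0) * (5/2))) < (4::real)" "(-4::real) < 0" "(0::real) < 4" for x
  by (auto simp: max_def min_def)
 show "fibre_map (level_nodes x0) x (-4) = -4" "fibre_map (level_nodes x0) x 4 = 4"
  using pl3(5,6)[OF o(1)[of x] o(2)[of x] o(3,4)] by (simp_all add: fibre_map_def level_nodes_def del: pl.simps)
 show "x <= x0 ==> fibre_map (level_nodes x0) x 0 = 0"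
  using pl3(2)[OF o(1)[of x] o(2)[of x] o(3,4)] by (simp add: fibre_map_def level_nodes_def mult_nonpos_nonneg max_def min_def split: if_splits del: pl.simps)
 show "fibre_map (level_nodes x0) (x0 + 2 * t / 5) (- t) = 0" if "0 <= t" "t <= 1"
  using pl3(2)[OF o(1)[of "x0 + 2 * t / 5"] o(2)[of "x0 + 2 * t / 5"] o(3,4)] that by (simp add: fibre_map_def level_nodes_def del: pl.simps)
qed

definition cap where "cap k p x y A B c e = Tangle (lbox A B c e) {}
   (stripes p k c e Un vline x c ((c + e) / 2) Un hline x y ((c + e) / 2) Un vline y c ((c + e) / 2))"

definition cup where "cup k p x y A B c e = Tangle (lbox A B c e) {}
   (stripes p k c e Un vline x ((c + e) / 2) e Un hline x y ((c + e) / 2) Un vline y ((c + e) / 2) e)"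

text \<open>A straight strand to the right of the others is tilted, bent downwards by a change of angle around a point, and
straightened to a rectangular cap.\<close>

lemma (in planar_alg) val_cap_base:
 fixes k :: nat
 defines "x0 \<equiv> real k + 1" shows "val (cap k real x0 (x0 + 2/5) 0 (x0 + 4) (-4) 4) f (str (k + 1))"
proof -
 let ?P = "joined real k (%_. x0)"
 have k: "0 <= real k" by simp
 have s1: "spread real k 0 (x0 - 1/4)" by (rule spread_real) (auto simp: x0_def)
 have s2: "spread (%_. x0) 1 (x0 - 1/4) (x0 + 4)" by (rule spread_const1) auto
 let ?T1 = "straight (k + 1) ?P 0 (x0 + 4) (-4) 4"
 have "spread ?P (k + 1) 0 (x0 + 4)" by (rule spread_joined[OF s1 s2]) (use k in "auto simp: x0_def")
 hence v: "val ?T1 f (str (k + 1))" by (rule val_straight) (use k in "auto simp: x0_def")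
 define L where "L = stripes real k (-4) 4"
 have L: "z \<in> L ==> Re z <= x0 - 1" for z by (auto simp: L_def stripes_iff x0_def)
 define t1 where "t1 = hmap (fibre_map (tilt_nodes x0))"
 define t2 where "t2 = wedge x0 flip_angle"
 define t3 where "t3 = hmap (fibre_map (unfold_nodes x0))"
 define t4 where "t4 = vmap (fibre_map (level_nodes x0))"
 have fixL: "t1 ` L = L" "t2 ` L = L" "t3 ` L = L"
 proof -
  have "t1 z = z" "t2 z = z" "t3 z = z" if "z \<in> L" for z using L[OF that] by (simp_all add: t1_def t2_def t3_def hmap_def fibre_tilt fibre_unfold wedge_left)
  thus "t1 ` L = L" "t2 ` L = L" "t3 ` L = L" by (simp_all add: image_def)
 qed
 have fixL4: "t4 ` L = L" unfolding t4_def L_def by (rule vmap_stripes[OF fibre_cap(3)]) (simp_all add: fibre_level)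
 let ?T2 = "lbox 0 (x0 + 4) (-4) 4"
 have box: "disc_image t1 ?T2 = lbox 0 (x0 + 4) (-4) 4" "disc_image t3 ?T2 = lbox 0 (x0 + 4) (-4) 4"
  unfolding t1_def t3_def by (rule hmap_lbox[OF fibre_cap(1)] hmap_lbox[OF fibre_cap(2)]; use k in "simp add: fibre_tilt fibre_unfold x0_def")+
 have box2: "disc_image t2 ?T2 = lbox 0 (x0 + 4) (-4) 4"
  using wedge_rect[OF angle_map_flip, of 0 x0 4] k by (simp add: disc_image_def lbox_def t2_def wedge_left x0_def)
 have box4: "disc_image t4 ?T2 = lbox 0 (x0 + 4) (-4) 4" unfolding t4_def by (rule vmap_lbox[OF fibre_cap(3)]) (use k in "simp_all add: fibre_level x0_def")
 define V where "V = vline x0 (-4) 0"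
 define R where "R = (%t. Complex (x0 + t / 10) t) ` {0..4::real}"
 define R' where "R' = (%t. Complex (x0 + t / 10) (- t)) ` {0..4::real}"
 have V: "V = (%t. Complex x0 (- t)) ` {0..4::real}"
 proof (intro subset_antisym subsetI)
  fix z assume "z \<in> V" thus "z \<in> (%t. Complex x0 (- t)) ` {0..4::real}" by (intro image_eqI[of _ _ "- Im z"]) (auto simp: V_def vline_iff complex_eq_iff)
 qed (auto simp: V_def vline_iff)
 have "vline x0 (-4) 4 = V Un (%t. Complex x0 t) ` {0..4::real}"
 proof (intro subset_antisym subsetI)
  fix z assume z: "z \<in> vline x0 (-4) 4"
  show "z \<in> V Un (%t. Complex x0 t) ` {0..4::real}"
  proof (cases "Im z <= 0")
   case True thus ?thesis using z by (auto simp: V_def vline_iff)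
  next
   case False
   hence "z \<in> (%t. Complex x0 t) ` {0..4::real}" using z by (intro image_eqI[of _ _ "Im z"]) (auto simp: vline_iff complex_eq_iff)
   thus ?thesis by simp
  qed
 qed (auto simp: V_def vline_iff)
 moreover have "t1 ` V = V" unfolding V image_image by (rule image_cong) (auto simp: t1_def hmap_def fibre_tilt)
 moreover have "t1 ` (%t. Complex x0 t) ` {0..4::real} = R" unfolding image_image R_def by (rule image_cong) (auto simp: t1_def hmap_def fibre_tilt)
 ultimately have s1: "t1 ` vline x0 (-4) 4 = V Un R" by (simp add: image_Un)
 have "t2 ` V = V" unfolding t2_def by (rule wedge_fix) (auto simp: V_def vline_iff)
 moreover have "t2 ` R = R'" unfolding R_def R'_def image_image
 proof (rule image_cong)
  fix t :: real assume t: "t \<in> {0..4}"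
  show "t2 (Complex (x0 + t / 10) t) = Complex (x0 + t / 10) (- t)"
  proof (cases "t = 0")
   case False
   thus ?thesis using t wedge_up[of t "1/10" "1/10" flip_angle x0] flip_angle_values(2) by (simp add: t2_def)
  qed (simp add: t2_def wedge_left)
 qed simp
 ultimately have s2: "t2 ` (V Un R) = V Un R'" by (simp add: image_Un)
 define I where "I = (%t. Complex (x0 + 2/5 * t) (- t)) ` {0..1::real}"
 have "{0..4} = {0..1} Un {1..4::real}" by auto
 hence "t3 ` R' = (%t. t3 (Complex (x0 + t / 10) (- t))) ` {0..1} Un (%t. t3 (Complex (x0 + t / 10) (- t))) ` {1..4}" by (simp only: R'_def image_image image_Un)
 also have "(%t. t3 (Complex (x0 + t / 10) (- t))) ` {0..1} = I" unfolding I_def by (rule image_cong) (auto simp: t3_def hmap_def fibre_unfold)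
 also have "(%t. t3 (Complex (x0 + t / 10) (- t))) ` {1..4} = (%t. Complex (x0 + 2/5) (- t)) ` {1..4}" by (rule image_cong) (auto simp: t3_def hmap_def fibre_unfold)
 also have "(%t. Complex (x0 + 2/5) (- t)) ` {1..4} = vline (x0 + 2/5) (-4) (-1)"
 proof (intro subset_antisym subsetI)
  fix z assume "z \<in> vline (x0 + 2/5) (-4) (-1)" thus "z \<in> (%t. Complex (x0 + 2/5) (- t)) ` {1..4}"
   by (intro image_eqI[of _ _ "- Im z"]) (auto simp: vline_iff complex_eq_iff)
 qed (auto simp: vline_iff)
 finally have "t3 ` R' = I Un vline (x0 + 2/5) (-4) (-1)" .
 moreover have "t3 ` V = V" unfolding V image_image by (rule image_cong) (auto simp: t3_def hmap_def fibre_unfold)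
 ultimately have s3: "t3 ` (V Un R') = V Un (I Un vline (x0 + 2/5) (-4) (-1))" by (simp add: image_Un)
 have "t4 ` V = V" unfolding t4_def V_def by (rule vmap_vline[OF fibre_cap(3)]) (auto simp: fibre_level)
 moreover have "t4 ` I = hline x0 (x0 + 2/5) 0"
 proof -
  have "t4 ` I = (%t. Complex (x0 + 2/5 * t) 0) ` {0..1}" unfolding I_def image_image by (rule image_cong) (auto simp: t4_def vmap_def fibre_level)
  also have "\<dots> = hline x0 (x0 + 2/5) 0"
  proof (intro subset_antisym subsetI)
   fix z assume "z \<in> hline x0 (x0 + 2/5) 0" thus "z \<in> (%t. Complex (x0 + 2/5 * t) 0) ` {0..1}"
    by (intro image_eqI[of _ _ "(Re z - x0) * (5/2)"]) (auto simp: hline_iff complex_eq_iff field_simps)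
  qed (auto simp: hline_iff)
  finally show ?thesis .
 qed
 moreover have "t4 ` vline (x0 + 2/5) (-4) (-1) = vline (x0 + 2/5) (-4) 0"
  unfolding t4_def by (rule vmap_vline[OF fibre_cap(3)]) (use fibre_level(4)[of 1 x0] in "auto simp: fibre_level")
 ultimately have s4: "t4 ` (V Un (I Un vline (x0 + 2/5) (-4) (-1))) = V Un (hline x0 (x0 + 2/5) 0 Un vline (x0 + 2/5) (-4) 0)" by (simp add: image_Un)
 define t where "t = t4 \<circ> t3 \<circ> t2 \<circ> t1"
 have ti: "t ` S = t4 ` t3 ` t2 ` t1 ` S" for S by (simp add: t_def image_comp)
 have td: "disc_image t D = disc_image t4 (disc_image t3 (disc_image t2 (disc_image t1 D)))" for D by (simp add: disc_image_def ti, simp add: t_def)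
 have st: "stripes ?P (k + 1) (-4) 4 = L Un vline x0 (-4) 4" unfolding stripes_joined L_def by (simp add: stripes_one)
 have img: "tangle_image t ?T1 = cap k real x0 (x0 + 2/5) 0 (x0 + 4) (-4) 4" unfolding tangle_image_def straight_simps td box box2 box4 cap_def ti st
  unfolding image_Un[of t1] fixL s1 image_Un[of t2 L] s2 image_Un[of t3 L] s3 image_Un[of t4 L] fixL4 s4 by (simp add: L_def V_def Un_ac)
 have "isotopic_id t" unfolding t_def t1_def t2_def t3_def t4_def
  by (intro isotopic_id_compose isotopic_id_hmap isotopic_id_vmap isotopic_id_wedge fibre_cap angle_map_flip)
 hence "val (tangle_image t ?T1) f (str (k + 1))" by (rule val_iso[OF v]) simp
 thus ?thesis unfolding img .
qed

lemma (in planar_alg) val_cap: assumes p: "spread p k A x" and o: "A < x" "x < y" "y < B" "c < e" shows "val (cap k p x y A B c e) f (str (k + 1))"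
proof -
 define x0 where "x0 = real k + 1"
 define m where "m = (c + e) / 2"
 have m: "c < m" "m < e" using o by (auto simp: m_def field_simps)
 have s: "spread real k 0 x0" by (rule spread_real) (auto simp: x0_def)
 define F where "F = pl (spread_nodes ([] @ [(0, A)]) real p k ((x0, x) # [(x0 + 2/5, y), (x0 + 4, B)]))"
 have n: "nodes (spread_nodes ([] @ [(0, A)]) real p k ((x0, x) # [(x0 + 2/5, y), (x0 + 4, B)]))" by (rule nodes_spread[OF s p]) (use o in "auto simp: x0_def")
 have F: "F 0 = A" "F x0 = x" "F (x0 + 2/5) = y" "F (x0 + 4) = B" "i \<in> {1..k} ==> F (real i) = p i" for i using pl_spread_node[OF n] unfolding F_def by auto
 define G where "G = pl [(-4, c), (0, m), (4, e)]"
 have G: "G (-4) = c" "G 0 = m" "G 4 = e" using pl3(2,5,6)[of "-4" 0 4 c m e] m by (simp_all add: G_def del: pl.simps)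
 have fF: "fibre_family (%_. F)" unfolding F_def by (rule fibre_family_const[OF line_homeo_pl[OF n]])
 have fG: "fibre_family (%_. G)" unfolding G_def by (rule fibre_family_const[OF line_homeo_pl]) (use m in simp)
 define t where "t = vmap (%_. G) \<circ> hmap (%_. F)"
 have ti: "t ` S = vmap (%_. G) ` hmap (%_. F) ` S" for S by (simp add: t_def image_comp)
 have td: "disc_image t D = disc_image (vmap (%_. G)) (disc_image (hmap (%_. F)) D)" for D by (simp add: disc_image_def ti, simp add: t_def)
 have 1: "disc_image t (lbox 0 (x0 + 4) (-4) 4) = lbox A B c e"
  unfolding td using hmap_lbox[OF fF, of "-4" 4 0 A "x0 + 4" B] vmap_lbox[OF fG, of A B "-4" c 4 e] F G by (simp add: m_def)
 have 2: "t ` stripes real k (-4) 4 = stripes p k c e"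
  unfolding ti using hmap_stripes[OF fF, where k=k and c="-4" and d=4 and p=real and p'=p] vmap_stripes[OF fG, where k=k and p=p and c="-4" and c'=c and d=4 and d'=e] F G by simp
 have 3: "t ` vline a (-4) 0 = vline (F a) c m" for a
  unfolding ti using hmap_vline[OF fF, of "-4" 0 a "F a"] vmap_vline[OF fG, where x="F a" and c="-4" and c'=c and d=0 and d'=m] G by simp
 have 4: "t ` hline x0 (x0 + 2/5) 0 = hline x y m"
  unfolding ti hline_rect[OF less_imp_le[OF o(2)]] using hmap_rect[OF fF, of 0 0 x0 x "x0 + 2/5" y] vmap_rect[OF fG, of x y 0 m 0 m] F G by (simp add: hline_rect)
 have img: "tangle_image t (cap k real x0 (x0 + 2/5) 0 (x0 + 4) (-4) 4) = cap k p x y A B c e" unfolding tangle_image_def cap_def tangle.sel 1 image_empty image_Un 2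
  by (simp add: 3 4 F m_def[symmetric])
 have "isotopic_id t" unfolding t_def using fF fG by (intro isotopic_id_compose isotopic_id_hmap isotopic_id_vmap)
 thus ?thesis using val_iso[OF val_cap_base[of k f, folded x0_def], of t f] by (simp add: img) (simp add: cap_def)
qed

lemma boundary_points_cap: assumes p: "spread p k A x" and o: "A < x" "x < y" "y < B" "c < e"
 shows "boundary_points (cap k p x y A B c e) (lbox A B c e) = points p k c Un points p k e Un {Complex x c, Complex y c}"
  "boundary_points (cup k p x y A B c e) (lbox A B c e) = points p k c Un points p k e Un {Complex x e, Complex y e}"
proof -
 define m where "m = (c + e) / 2"
 have m: "c < m" "m < e" using o by (auto simp: m_def field_simps)
 have s: "spread p k A B" by (rule spread_mono[OF p]) (use o in auto)
 have v: "vline z c m Int frontier (rect A B c e) = {Complex z c}" "vline z m e Int frontier (rect A B c e) = {Complex z e}" if "A < z" "z < B" for z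
  using that m by (auto simp: vline_iff frontier_rect_iff complex_eq_iff)
 have h: "hline x y m Int frontier (rect A B c e) = {}" using o m by (auto simp: hline_iff frontier_rect_iff)
 have z: "A < y" "x < B" using o by auto
 show "boundary_points (cap k p x y A B c e) (lbox A B c e) = points p k c Un points p k e Un {Complex x c, Complex y c}"
  unfolding boundary_points_def cap_def tangle.sel lbox_simps Int_Un_distrib2 m_def[symmetric] stripes_frontier(3)[OF s o(4) refl refl]
   v(1)[OF o(1) z(2)] v(1)[OF z(1) o(3)] h by blast
 show "boundary_points (cup k p x y A B c e) (lbox A B c e) = points p k c Un points p k e Un {Complex x e, Complex y e}"
  unfolding boundary_points_def cup_def tangle.sel lbox_simps Int_Un_distrib2 m_def[symmetric] stripes_frontier(3)[OF s o(4) refl refl]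
   v(2)[OF o(1) z(2)] v(2)[OF z(1) o(3)] h by blast
qed

lemma (in planar_alg) drawn_cap: assumes "spread p k A x" "A < x" "x < y" "y < B" "c < e"
 shows "drawn F (lbox A B c e) (str (k + 1)) {} (stripes p k c e Un vline x c ((c + e) / 2) Un hline x y ((c + e) / 2) Un vline y c ((c + e) / 2))
  (points p k c Un points p k e Un {Complex x c, Complex y c})"
 using drawn_valb[OF val_cap[OF assms] _ boundary_points_cap(1)[OF assms], of F] by (simp add: cap_def)

text \<open>A cup is the mirror image of a cap, and parallel strands are self-adjoint.\<close>

lemma (in subfactor_alg) drawn_cup: assumes "spread p k A x" "A < x" "x < y" "y < B" "c < e"
 shows "drawn F (lbox A B c e) (str (k + 1)) {} (stripes p k c e Un vline x ((c + e) / 2) e Un hline x y ((c + e) / 2) Un vline y ((c + e) / 2) e)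
  (points p k c Un points p k e Un {Complex x e, Complex y e})"
proof -
 let ?T = "cap k p x y A B (- e) (- c)"
 have ec: "- e < - c" using assms by simp
 have s: "spread p k A B" by (rule spread_mono[OF assms(1)]) (use assms in auto)
 have T: "val ?T F (str (k + 1))" by (rule val_cap[OF assms(1-4) ec])
 have "str (k + 1) \<in> \<B> (box_index ?T (outer ?T))" by (rule val_in[OF T refl])
 have b: "boundary_points ?T (outer ?T) = points p k (- e) Un points p k (- c) Un {Complex x (- e), Complex y (- e)}"
  using boundary_points_cap(1)[OF assms(1-4) ec] by (simp add: cap_def)
 let ?T1 = "points p k (- e) Un points p k (- c)"
 have "card (points p k (- e) Un points p k (- c) Un {Complex x (- e), Complex y (- e)}) = (k + k) + 2"
 proof (subst card_Un_disjoint)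
  show "?T1 Int {Complex x (- e), Complex y (- e)} = {}" using assms by (auto simp: points_iff spread_def)
  show "card ?T1 + card {Complex x (- e), Complex y (- e)} = (k + k) + 2" using card_points2[OF assms(1,1), of "- e" "- c"] assms by (simp add: complex_eq_iff)
 qed auto
 hence i: "box_index ?T (outer ?T) = k + 1" by (simp add: box_index_def b)
 have "val (tangle_image cnj ?T) F (adj \<P> (k + 1) (str (k + 1)))" by (rule val_adj[OF T i]) (simp add: cap_def)
 moreover have "tangle_image cnj ?T = cup k p x y A B c e"
 proof -
  have "- (- e + - c) = c + e" by simp
  hence m: "- ((- e + - c) / 2) = (c + e) / 2" by (simp only: minus_divide_left)
  show ?thesis by (simp only: tangle_image_def cap_def cup_def tangle.sel image_empty cnj_lbox cnj_stripes image_Un cnj_vline cnj_hline m minus_minus)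
 qed
 ultimately have "val (cup k p x y A B c e) F (str (k + 1))" by (simp add: adj_strands)
 thus ?thesis using drawn_valb[OF _ _ boundary_points_cap(2)[OF assms], of F] by (simp add: cup_def)
qed

section \<open>Traces\<close>

definition product_map :: "(real => real) => (real => real) => complex => complex" where "product_map F G = vmap (%_. G) \<circ> hmap (%_. F)"

lemma product_map: assumes F: "line_homeo F" and G: "line_homeo G" shows "isotopic_id (product_map F G)"
  "c <= d ==> product_map F G ` vline x c d = vline (F x) (G c) (G d)" "a <= b ==> product_map F G ` hline a b y = hline (F a) (F b) (G y)"
  "c <= d ==> G ((c + d) / 2) = (G c + G d) / 2 ==> disc_image (product_map F G) (lbox a b c d) = lbox (F a) (F b) (G c) (G d)"
proof -
 note f = fibre_family_const[OF F] fibre_family_const[OF G]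
 have m: "F a <= F b" if "a <= b" for a b using F that by (auto simp: line_homeo_def strict_mono_less_eq)
 have i: "product_map F G ` S = vmap (%_. G) ` hmap (%_. F) ` S" for S by (simp add: product_map_def image_comp)
 have di: "disc_image (product_map F G) D = disc_image (vmap (%_. G)) (disc_image (hmap (%_. F)) D)" for D by (simp add: product_map_def disc_image_def image_comp)
 show "isotopic_id (product_map F G)" unfolding product_map_def by (intro isotopic_id_compose isotopic_id_hmap isotopic_id_vmap f)
 show "product_map F G ` vline x c d = vline (F x) (G c) (G d)" if cd: "c <= d" unfolding i hmap_vline[OF f(1) refl cd] by (rule vmap_vline[OF f(2) refl refl cd])
 show "product_map F G ` hline a b y = hline (F a) (F b) (G y)" if "a <= b" unfolding i hline_rect[OF that] hline_rect[OF m[OF that]]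
  using hmap_rect[OF f(1), of y y a "F a" b "F b"] vmap_rect[OF f(2), where a="F a" and b="F b" and c=y and d=y and c'="G y" and d'="G y"] by simp
 show "c <= d ==> G ((c + d) / 2) = (G c + G d) / 2 ==> disc_image (product_map F G) (lbox a b c d) = lbox (F a) (F b) (G c) (G d)"
  unfolding di using hmap_lbox[OF f(1), of c d a "F a" b "F b"] vmap_lbox[OF f(2), where a="F a" and b="F b" and c=c and d=d and c'="G c" and d'="G d"] by simp
qed

definition bend :: "real => real => real => real => complex set" where
 "bend x y d u = vline x d u Un hline x y u Un vline y (- u) u Un hline x y (- u) Un vline x (- u) (- d)"

lemma bend_iff: "0 <= d ==> d <= u ==> x <= y ==> z \<in> bend x y d u \<longleftrightarrow>
  (Re z = x & d <= \<bar>Im z\<bar> & \<bar>Im z\<bar> <= u) | (x <= Re z & Re z <= y & \<bar>Im z\<bar> = u) | (Re z = y & \<bar>Im z\<bar> <= u)"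
 by (auto simp: bend_def vline_iff hline_iff)

lemma arc_between_segment: "a ~= b ==> arc_between (closed_segment a b) a b" unfolding arc_between_def by (intro exI[of _ "linepath a b"]) (simp add: arc_linepath)

lemma arc_bend: assumes "0 < d" "d < u" "x < y" shows "arc_between (bend x y d u) (Complex x d) (Complex x (- d))"
proof -
 have 1: "arc_between (vline x d u) (Complex x d) (Complex x u)" "arc_between (hline x y u) (Complex x u) (Complex y u)"
  "arc_between (vline y (- u) u) (Complex y u) (Complex y (- u))" "arc_between (hline x y (- u)) (Complex y (- u)) (Complex x (- u))"
  "arc_between (vline x (- u) (- d)) (Complex x (- u)) (Complex x (- d))"
  using assms by (auto simp: vline_def hline_def intro!: arc_between_segment arc_between_sym[OF arc_between_segment, of "Complex y (- u)"]
   arc_between_sym[OF arc_between_segment, of "Complex x (- u)" "Complex y (- u)"])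
 have "arc_between (vline x d u Un hline x y u) (Complex x d) (Complex y u)"
  by (rule arc_between_join[OF 1(1,2)]) (use assms in "auto simp: vline_iff hline_iff complex_eq_iff")
 hence "arc_between (vline x d u Un hline x y u Un vline y (- u) u) (Complex x d) (Complex y (- u))"
  by (rule arc_between_join[OF _ 1(3)]) (use assms in "auto simp: vline_iff hline_iff complex_eq_iff")
 hence "arc_between (vline x d u Un hline x y u Un vline y (- u) u Un hline x y (- u)) (Complex x d) (Complex x (- u))"
  by (rule arc_between_join[OF _ 1(4)]) (use assms in "auto simp: vline_iff hline_iff complex_eq_iff")
 thus ?thesis unfolding bend_def by (rule arc_between_join[OF _ 1(5)]) (use assms in "auto simp: vline_iff hline_iff complex_eq_iff")
qed

definition bends :: "nat => (nat => real) => real => real => real => complex set" where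
 "bends k p rho omega d = (\<Union>i\<in>{1..k}. bend (p i) (rho - real i) d (omega - real i))"

definition trace_closure where "trace_closure k p rho omega A B a b d e = Tangle (lbox A B (- e) e) {lbox a b (- d) d} (bends k p rho omega d)"

lemma trace_closure_simps [simp]:
 "outer (trace_closure k p rho omega A B a b d e) = lbox A B (- e) e" "inner (trace_closure k p rho omega A B a b d e) = {lbox a b (- d) d}"
 "strings (trace_closure k p rho omega A B a b d e) = bends k p rho omega d" by (simp_all add: trace_closure_def)

definition closure_ok where "closure_ok k p rho omega A B a b d e \<longleftrightarrow> A < a & a < b & b < B & 0 < d & d < e & spread p k a b &
   b < rho - real k & rho - 1 < B & d < omega - real k & omega - 1 < e"

lemma bends_extend: assumes "d' <= d" "d < omega - real k" shows "bends k p rho omega d Un stripes p k d' d Un stripes p k (- d) (- d') = bends k p rho omega d'"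
proof -
 have "bend (p i) (rho - real i) d (omega - real i) Un vline (p i) d' d Un vline (p i) (- d) (- d') = bend (p i) (rho - real i) d' (omega - real i)"
  if "i \<in> {1..k}" for i
 proof -
  have "real i <= real k" using that by simp
  hence "d <= omega - real i" using assms(2) by linarith
  hence "vline (p i) d' (omega - real i) = vline (p i) d' d Un vline (p i) d (omega - real i)"
   "vline (p i) (- (omega - real i)) (- d') = vline (p i) (- (omega - real i)) (- d) Un vline (p i) (- d) (- d')" using assms(1) by (simp_all add: vline_join)
  thus ?thesis unfolding bend_def by blast
 qed
 thus ?thesis unfolding bends_def stripes_def UN_Un_distrib[symmetric] by (intro SUP_cong refl)
qed

lemma bends_joined: "bends (k + 1) (joined p k (%_. x)) rho omega d = bends k p rho omega d Un bend x (rho - (real k + 1)) d (omega - (real k + 1))"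
proof -
 have "{1..k + 1} = insert (k + 1) {1..k}" by auto
 moreover have "(\<Union>i\<in>{1..k}. bend (joined p k (%_. x) i) (rho - real i) d (omega - real i)) = (\<Union>i\<in>{1..k}. bend (p i) (rho - real i) d (omega - real i))"
  by (rule SUP_cong) (auto simp: joined_def)
 moreover have "joined p k (%_. x) (k + 1) = x" "real (k + 1) = real k + 1" by (simp_all add: joined_def)
 ultimately show ?thesis by (simp only: bends_def UN_insert Un_commute)
qed

lemma closure_pairs: assumes ok: "closure_ok k p rho omega A B a b d e" and i: "i \<in> {1..k}"
 shows "a < p i" "p i < b" "b < rho - real i" "rho - real i < B" "d < omega - real i" "omega - real i < e"
proof -
 have "1 <= real i" "real i <= real k" using i by auto
 thus "b < rho - real i" "rho - real i < B" "d < omega - real i" "omega - real i < e" using ok unfolding closure_ok_def by linarith+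
 show "a < p i" "p i < b" using ok spread_bounds[of p k a b i] i by (auto simp: closure_ok_def)
qed

lemma bends_iff: assumes ok: "closure_ok k p rho omega A B a b d e" and i: "i \<in> {1..k}"
 shows "z \<in> bend (p i) (rho - real i) d (omega - real i) \<longleftrightarrow> (Re z = p i & d <= \<bar>Im z\<bar> & \<bar>Im z\<bar> <= omega - real i) |
   (p i <= Re z & Re z <= rho - real i & \<bar>Im z\<bar> = omega - real i) | (Re z = rho - real i & \<bar>Im z\<bar> <= omega - real i)"
 using closure_pairs[OF assms] ok by (intro bend_iff) (auto simp: closure_ok_def)

lemma boundary_points_closure: assumes ok: "closure_ok k p rho omega A B a b d e"
 shows "boundary_points (trace_closure k p rho omega A B a b d e) (lbox A B (- e) e) = {}"
  "boundary_points (trace_closure k p rho omega A B a b d e) (lbox a b (- d) d) = points p k (- d) Un points p k d"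
proof -
 have o: "A < a" "a < b" "b < B" "0 < d" "d < e" using ok by (simp_all add: closure_ok_def)
 let ?T2 = "trace_closure k p rho omega A B a b d e"
 have "z \<notin> frontier (rect A B (- e) e)" if z: "z \<in> bends k p rho omega d" for z
 proof -
  obtain i where i: "i \<in> {1..k}" "z \<in> bend (p i) (rho - real i) d (omega - real i)" using z unfolding bends_def by blast
  have "p i <= Re z & Re z <= rho - real i & \<bar>Im z\<bar> <= omega - real i" using i(2) closure_pairs[OF ok i(1)] unfolding bends_iff[OF ok i(1)] by auto
  thus ?thesis using closure_pairs[OF ok i(1)] o unfolding frontier_rect_iff by auto
 qed
 thus "boundary_points ?T2 (lbox A B (- e) e) = {}" by (auto simp: boundary_points_def)
 let ?T1 = "rect a b (- d) d"
 have *: "z \<in> bends k p rho omega d & z \<in> frontier ?T1 \<longleftrightarrow> (\<exists>i\<in>{1..k}. Re z = p i & \<bar>Im z\<bar> = d)" for z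
 proof
  assume z: "z \<in> bends k p rho omega d & z \<in> frontier ?T1"
  obtain i where i: "i \<in> {1..k}" "z \<in> bend (p i) (rho - real i) d (omega - real i)" using z unfolding bends_def by blast
  have "a <= Re z" "Re z <= b" "\<bar>Im z\<bar> <= d" using z unfolding frontier_rect_iff by auto
  hence "Re z = p i & \<bar>Im z\<bar> = d" using i(2) closure_pairs[OF ok i(1)] unfolding bends_iff[OF ok i(1)] by auto
  thus "\<exists>i\<in>{1..k}. Re z = p i & \<bar>Im z\<bar> = d" using i(1) by blast
 next
  assume "\<exists>i\<in>{1..k}. Re z = p i & \<bar>Im z\<bar> = d"
  then obtain i where i: "i \<in> {1..k}" "Re z = p i" "\<bar>Im z\<bar> = d" by blast
  have "z \<in> bend (p i) (rho - real i) d (omega - real i)" using closure_pairs[OF ok i(1)] i unfolding bends_iff[OF ok i(1)] by auto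
  moreover have "z \<in> frontier ?T1" using closure_pairs[OF ok i(1)] i o unfolding frontier_rect_iff by auto
  ultimately show "z \<in> bends k p rho omega d & z \<in> frontier ?T1" using i(1) unfolding bends_def by blast
 qed
 have "z \<in> points p k (- d) Un points p k d \<longleftrightarrow> (\<exists>i\<in>{1..k}. Re z = p i & \<bar>Im z\<bar> = d)" for z
  using o(4) by (auto simp: points_iff)
 thus "boundary_points ?T2 (lbox a b (- d) d) = points p k (- d) Un points p k d"
  unfolding boundary_points_def trace_closure_simps lbox_simps by (intro set_eqI) (simp only: Int_iff *)
qed

lemma planar_closure: assumes ok: "closure_ok k p rho omega A B a b d e" shows "planar_tangle (trace_closure k p rho omega A B a b d e)"
proof -
 let ?T = "trace_closure k p rho omega A B a b d e"
 let ?b = "%i. bend (p i) (rho - real i) d (omega - real i)"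
 define C where "C = ?b ` {1..k}"
 define E where "E = points p k (- d) Un points p k d"
 have o: "A < a" "a < b" "b < B" "0 < d" "d < e" "spread p k a b" using ok by (simp_all add: closure_ok_def)
 have E: "z \<in> E \<longleftrightarrow> (\<exists>i\<in>{1..k}. Re z = p i & \<bar>Im z\<bar> = d)" for z using o by (auto simp: E_def points_iff)
 have dis: "?b i Int ?b j = {}" if ij: "i \<in> {1..k}" "j \<in> {1..k}" "i < j" for i j
 proof -
  have lt: "p i < p j" using o(6) ij by (auto simp: spread_def)
  have "real i < real j" using ij by simp
  hence n: "rho - real j < rho - real i" "omega - real j < omega - real i" by auto
  have False if z: "z \<in> ?b i" "z \<in> ?b j" for z
  proof -
   have "p j <= Re z" "Re z <= rho - real j" "\<bar>Im z\<bar> <= omega - real j" using z(2) closure_pairs[OF ok ij(2)] unfolding bends_iff[OF ok ij(2)] by auto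
   thus False using z(1) lt n unfolding bends_iff[OF ok ij(1)] by auto
  qed
  thus ?thesis by blast
 qed
 have S: "strand_system C E {}" unfolding strand_system_def
 proof (intro conjI ballI impI)
  fix c assume "c \<in> C"
  then obtain i where i: "i \<in> {1..k}" "c = ?b i" by (auto simp: C_def)
  note P = closure_pairs[OF ok i(1)]
  have "arc_between c (Complex (p i) d) (Complex (p i) (- d))" unfolding i(2) by (rule arc_bend) (use P o in auto)
  moreover have "c Int E = {Complex (p i) d, Complex (p i) (- d)}"
  proof (intro set_eqI iffI)
   fix z assume z: "z \<in> c Int E"
   hence "z \<in> E" by simp
   then obtain j where j: "j \<in> {1..k}" "Re z = p j" "\<bar>Im z\<bar> = d" unfolding E by blast
   hence "Re z = p i" using z P closure_pairs[OF ok j(1)] unfolding i(2) bends_iff[OF ok i(1)] Int_iff by auto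
   thus "z \<in> {Complex (p i) d, Complex (p i) (- d)}" using j(3) by (auto simp: complex_eq_iff)
  next
   fix z assume "z \<in> {Complex (p i) d, Complex (p i) (- d)}"
   hence "Re z = p i" "\<bar>Im z\<bar> = d" using o by auto
   thus "z \<in> c Int E" using P i(1) unfolding i(2) Int_iff E bends_iff[OF ok i(1)] by auto
  qed
  ultimately show "(EX p q. arc_between c p q & c Int E = {p, q}) | simple_loop c & c Int E = {}" by blast
 next
  fix c c' assume c: "c \<in> C" "c' \<in> C" "c ~= c'"
  obtain i where i: "i \<in> {1..k}" "c = ?b i" using c(1) unfolding C_def by blast
  obtain j where j: "j \<in> {1..k}" "c' = ?b j" using c(2) unfolding C_def by blast
  note ij = i(1) j(1) i(2) j(2)
  have "i ~= j" using c(3) ij by blast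
  hence "i < j | j < i" by linarith
  thus "c Int c' <= {}" using dis[OF ij(1,2)] dis[OF ij(2,1)] unfolding ij(3,4) by blast
 qed (auto simp: C_def)
 show ?thesis
 proof (rule planar_tangleI[OF _ _ _ _ S])
  show "is_disc (outer ?T)" using o by (auto intro!: is_disc_lbox)
  show "strings ?T = \<Union> C" by (simp add: C_def bends_def)
  show "is_disc D & region D <= interior (region (outer ?T))" if "D \<in> inner ?T" for D
   using that o by (auto simp: interior_rect_iff rect_iff intro!: is_disc_lbox)
  show "strings ?T - (E - {}) <= exterior_region ?T"
  proof
   fix z assume z: "z \<in> strings ?T - (E - {})"
   then obtain i where i: "i \<in> {1..k}" "z \<in> ?b i" by (auto simp: bends_def)
   have n: "\<not> (Re z = p i & \<bar>Im z\<bar> = d)" using z i(1) E by blast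
   have "p i <= Re z" "Re z <= rho - real i" "\<bar>Im z\<bar> <= omega - real i" "b < Re z | d < \<bar>Im z\<bar>"
    using i(2) n closure_pairs[OF ok i(1)] unfolding bends_iff[OF ok i(1)] by auto
   thus "z \<in> exterior_region ?T" using closure_pairs[OF ok i(1)] o by (auto simp: exterior_region_def interior_rect_iff rect_iff)
  qed
  show "E - {} <= box_frontiers ?T" using boundary_points_closure(2)[OF ok] by (auto simp: E_def box_frontiers_def boxes_def boundary_points_def)
  fix D assume D: "D \<in> boxes ?T"
  have "z \<in> strings ?T ==> a < Re z" for z
  proof -
   assume "z \<in> strings ?T"
   then obtain i where i: "i \<in> {1..k}" "z \<in> ?b i" by (auto simp: bends_def)
   thus "a < Re z" using closure_pairs[OF ok i(1)] unfolding bends_iff[OF ok i(1)] by auto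
  qed
  moreover have "Re (star D) <= a" using D o by (auto simp: boxes_def)
  ultimately have "star D \<notin> strings ?T" by (meson not_le)
  moreover have "even (card (boundary_points ?T D))" using D boundary_points_closure[OF ok] card_points2[OF o(6,6), of "- d" d] o by (auto simp: boxes_def)
  ultimately show "star D \<notin> strings ?T & even (card (boundary_points ?T D))" ..
 qed auto
qed

lemma right_trace_tangle_closure: "right_trace_tangle k = trace_closure k real (2 * real k + 2) (real k + 2) 0 (2 * real k + 2) (1/4) (real k + 3/4) 1 (real k + 2)"
proof -
 have "closing_strand a b j = bend a b 1 (1 + j)" for a b j by (auto simp: closing_strand_def bend_def vline_iff hline_iff)
 hence "(\<Union>j\<in>{1..k}. closing_strand (real k + 1 - real j) (real k + 1 + real j) (real j)) =
   (\<Union>j\<in>{1..k}. bend (real k + 1 - real j) (real k + 1 + real j) 1 (1 + real j))" by simp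
 also have "\<dots> = (\<Union>i\<in>{1..k}. bend (real i) (2 * real k + 2 - real i) 1 (real k + 2 - real i))"
 proof -
  have r: "(%j. k + 1 - j) ` {1..k} = {1..k}"
  proof (intro set_eqI iffI)
   fix i assume "i \<in> {1..k}"
   thus "i \<in> (%j. k + 1 - j) ` {1..k}" by (intro image_eqI[of _ _ "k + 1 - i"]) auto
  qed auto
  have "(\<Union>i\<in>(%j. k + 1 - j) ` {1..k}. bend (real i) (2 * real k + 2 - real i) 1 (real k + 2 - real i)) =
   (\<Union>j\<in>{1..k}. bend (real k + 1 - real j) (real k + 1 + real j) 1 (1 + real j))"
   unfolding image_image by (rule SUP_cong) (auto simp: of_nat_diff algebra_simps)
  thus ?thesis unfolding r by simp
 qed
 finally show ?thesis by (simp add: right_trace_tangle_def trace_closure_def right_trace_box_def bends_def)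
qed

lemma right_trace_closure_ok: "closure_ok k real (2 * real k + 2) (real k + 2) 0 (2 * real k + 2) (1/4) (real k + 3/4) 1 (real k + 2)"
 by (auto simp: closure_ok_def spread_def)

context planar_alg begin

lemma val_right_trace: assumes x: "x \<in> \<B> k" shows "val (right_trace_tangle k) (%_. x) (rtr k x)" unfolding right_trace_def
proof (rule valI)
 show "planar_tangle (right_trace_tangle k)" unfolding right_trace_tangle_closure by (rule planar_closure[OF right_trace_closure_ok])
 have s: "spread real k (1/4) (real k + 3/4)" by (auto simp: spread_def)
 show "labelling \<P> (right_trace_tangle k) (%_. x)" using x card_points2[OF s s, of "-1" 1] boundary_points_closure(2)[OF right_trace_closure_ok[of k]]
  by (simp add: labelling_def right_trace_tangle_closure box_index_def)
qed

text \<open>All closures with nested bends are isotopic: the horizontal and vertical positions are adjusted one after the other by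
piecewise linear maps.\<close>

lemma val_closure: assumes ok: "closure_ok k p rho omega A B a b d e" and x: "x \<in> \<B> k" and f: "f (lbox a b (- d) d) = x"
 shows "val (trace_closure k p rho omega A B a b d e) f (rtr k x)"
proof -
 have o: "A < a" "a < b" "b < B" "0 < d" "d < e" "spread p k a b" using ok by (simp_all add: closure_ok_def)
 let ?k = "real k"
 let ?s = "%i. ?k + 1 + real i" let ?q = "%i. rho - ?k - 1 + real i"
 define R where "R = map (%i. (?s i, ?q i)) [1..<Suc k] @ [(2 * ?k + 2, B)]"
 have q: "real i <= ?k" "1 <= real i" if "i \<in> {1..k}" for i using that by auto
 have flip: "k + 1 - i \<in> {1..k}" "real (k + 1 - i) = ?k + 1 - real i" if "i \<in> {1..k}" for i using that by (auto simp: of_nat_diff)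
 have "spread ?q k b B" unfolding spread_def
 proof (intro conjI ballI impI)
  fix i assume i: "i \<in> {1..k}"
  show "b < ?q i" using closure_pairs(3)[OF ok flip(1)[OF i]] unfolding flip(2)[OF i] by simp
  show "?q i < B" using closure_pairs(4)[OF ok flip(1)[OF i]] unfolding flip(2)[OF i] by simp
 qed auto
 hence "nodes (spread_nodes ([] @ [(?k + 3/4, b)]) ?s ?q k ((2 * ?k + 2, B) # []))" by (intro nodes_spread) (use o in "auto simp: spread_def")
 moreover have "spread_nodes ([] @ [(?k + 3/4, b)]) ?s ?q k ((2 * ?k + 2, B) # []) = (?k + 3/4, b) # R" by (simp add: spread_nodes_def R_def del: upt_Suc)
 ultimately have nR: "nodes ((?k + 3/4, b) # R)" by simp
 have R: "i \<in> {1..k} ==> (?s i, ?q i) \<in> set R" "(2 * ?k + 2, B) \<in> set R" for i by (auto simp: R_def simp del: upt_Suc)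
 let ?T1 = "spread_nodes ([(0, A)] @ [(1/4, a)]) real p k ((?k + 3/4, b) # R)"
 define F where "F = pl ?T1"
 have nF: "nodes ?T1" by (rule nodes_spread[OF _ o(6) _ o(2) _ nR]) (use o in "auto simp: spread_def")
 have F: "F 0 = A" "F (1/4) = a" "F (?k + 3/4) = b" "F (2 * ?k + 2) = B" "i \<in> {1..k} ==> F (real i) = p i"
  "i \<in> {1..k} ==> F (2 * ?k + 2 - real i) = rho - real i" for i
 proof -
  show "F 0 = A" "F (1/4) = a" "F (?k + 3/4) = b" "F (2 * ?k + 2) = B" "i \<in> {1..k} ==> F (real i) = p i" unfolding F_def using pl_spread_node[OF nF] R by auto
  assume i: "i \<in> {1..k}"
  have "(?s (k + 1 - i), ?q (k + 1 - i)) \<in> set R" by (rule R) (use i in auto)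
  hence "F (?s (k + 1 - i)) = ?q (k + 1 - i)" unfolding F_def by (intro pl_spread_node(2)[OF nF]) simp
  moreover have "?k + 1 + (?k + 1 - real i) = 2 * ?k + 2 - real i" "rho - ?k - 1 + (?k + 1 - real i) = rho - real i" by simp_all
  ultimately show "F (2 * ?k + 2 - real i) = rho - real i" by (simp only: flip(2)[OF i])
 qed
 let ?s2 = "%i. 1 + real i" let ?q2 = "%i. omega - ?k - 1 + real i"
 define R2 where "R2 = map (%i. (?s2 i, ?q2 i)) [1..<Suc k] @ [(?k + 2, e)]"
 have "spread ?q2 k d e" unfolding spread_def
 proof (intro conjI ballI impI)
  fix i assume i: "i \<in> {1..k}"
  show "d < ?q2 i" using closure_pairs(5)[OF ok flip(1)[OF i]] unfolding flip(2)[OF i] by simp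
  show "?q2 i < e" using closure_pairs(6)[OF ok flip(1)[OF i]] unfolding flip(2)[OF i] by simp
 qed auto
 hence "nodes (spread_nodes ([] @ [(1, d)]) ?s2 ?q2 k ((?k + 2, e) # []))" by (intro nodes_spread) (use o in "auto simp: spread_def")
 moreover have "spread_nodes ([] @ [(1, d)]) ?s2 ?q2 k ((?k + 2, e) # []) = (1, d) # R2" by (simp add: spread_nodes_def R2_def del: upt_Suc)
 ultimately have nR2: "nodes ((-1, -d) # (0, 0) # (1, d) # R2)" using o by simp
 have R2: "i \<in> {1..k} ==> (?s2 i, ?q2 i) \<in> set R2" "(?k + 2, e) \<in> set R2" for i by (auto simp: R2_def simp del: upt_Suc)
 define N where "N = spread_nodes ([] @ [(- (?k + 2), - e)]) (%i. real i - (?k + 2)) (%i. real i - omega) k ((-1, -d) # (0, 0) # (1, d) # R2)"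
 have s3: "spread (%i. real i - omega) k (- e) (- d)" unfolding spread_def
 proof (intro conjI ballI impI)
  fix i assume i: "i \<in> {1..k}"
  show "- e < real i - omega" "real i - omega < - d" using closure_pairs(5,6)[OF ok i] by simp_all
 qed auto
 have nG: "nodes N" unfolding N_def by (rule nodes_spread[OF _ s3 _ _ _ nR2]) (use o in "auto simp: spread_def")
 define G where "G = pl N"
 have G: "G (- (?k + 2)) = - e" "G (-1) = - d" "G 0 = 0" "G 1 = d" "G (?k + 2) = e" "i \<in> {1..k} ==> G (real i - (?k + 2)) = real i - omega"
  "i \<in> {1..k} ==> G (?k + 2 - real i) = omega - real i" for i
 proof -
  show "G (- (?k + 2)) = - e" "G (-1) = - d" "G 0 = 0" "G 1 = d" "G (?k + 2) = e"
   unfolding G_def N_def by (rule pl_spread_node(2)[OF nG[unfolded N_def]]; use R2 in simp)+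
  show "i \<in> {1..k} ==> G (real i - (?k + 2)) = real i - omega" unfolding G_def N_def using pl_spread_node(1)[OF nG[unfolded N_def]] by blast
  assume i: "i \<in> {1..k}"
  have "(?s2 (k + 1 - i), ?q2 (k + 1 - i)) \<in> set R2" by (rule R2) (use i in auto)
  hence "G (?s2 (k + 1 - i)) = ?q2 (k + 1 - i)" unfolding G_def N_def by (intro pl_spread_node(2)[OF nG[unfolded N_def]]) simp
  moreover have "1 + (?k + 1 - real i) = ?k + 2 - real i" "omega - ?k - 1 + (?k + 1 - real i) = omega - real i" by simp_all
  ultimately show "G (?k + 2 - real i) = omega - real i" by (simp only: flip(2)[OF i])
 qed
 have lF: "line_homeo F" and lG: "line_homeo G" unfolding F_def G_def by (rule line_homeo_pl[OF nF] line_homeo_pl[OF nG])+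
 note t = product_map[OF lF lG]
 define h where "h = product_map F G"
 have 1: "disc_image h (lbox 0 (2 * ?k + 2) (- (?k + 2)) (?k + 2)) = lbox A B (- e) e"
  unfolding h_def using t(4)[of "- (?k + 2)" "?k + 2" 0 "2 * ?k + 2"] F G by simp
 have 2: "disc_image h (lbox (1/4) (?k + 3/4) (-1) 1) = lbox a b (- d) d" unfolding h_def using t(4)[of "-1" 1 "1/4" "?k + 3/4"] F G by simp
 have 3: "h ` bend (real i) (2 * ?k + 2 - real i) 1 (?k + 2 - real i) = bend (p i) (rho - real i) d (omega - real i)" if i: "i \<in> {1..k}" for i
 proof -
  note Gi = G(6,7)[OF i] note Fi = F(5,6)[OF i]
  have n: "- (?k + 2 - real i) = real i - (?k + 2)" "- (omega - real i) = real i - omega" by simp_all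
  have l: "1 <= ?k + 2 - real i" "real i <= 2 * ?k + 2 - real i" "real i - (?k + 2) <= ?k + 2 - real i" "real i - (?k + 2) <= - 1" using q[OF i] by linarith+
  show ?thesis unfolding bend_def n image_Un h_def t(2)[OF l(1)] t(2)[OF l(3)] t(2)[OF l(4)] t(3)[OF l(2)] Gi Fi G ..
 qed
 have 4: "h ` bends k real (2 * ?k + 2) (?k + 2) 1 = bends k p rho omega d" unfolding bends_def image_UN by (intro SUP_cong refl 3)
 have img: "tangle_image h (right_trace_tangle k) = trace_closure k p rho omega A B a b d e"
  unfolding right_trace_tangle_closure tangle_image_def trace_closure_simps image_insert image_empty 1 2 4 by (simp add: trace_closure_def)
 have "val (tangle_image h (right_trace_tangle k)) f (rtr k x)"
  by (rule val_iso[OF val_right_trace[OF x]]) (use t(1) f 2 in "simp_all add: right_trace_tangle_closure h_def")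
 thus ?thesis unfolding img .
qed

lemma drawn_closure: assumes ok: "closure_ok k p rho omega A B a b d e" "x \<in> \<B> k"
  and D: "drawn F (lbox a b (- d) d) x I S c" "c = points p k (- d) Un points p k d" shows "drawn F (lbox A B (- e) e) (rtr k x) I (bends k p rho omega d Un S) {}"
proof -
 let ?T = "trace_closure k p rho omega A B a b d e" and ?B = "lbox a b (- d) d"
 have "val ?T (F(?B := x)) (rtr k x)" by (rule val_closure[OF ok]) simp
 thus ?thesis using drawn_one[of ?T F ?B x "rtr k x" I S] D by (simp add: boundary_points_closure[OF ok(1)])
qed

lemma right_trace_in: "x \<in> \<B> k ==> rtr k x \<in> \<B> 0" by (rule val_in[OF val_right_trace])
  (simp_all only: right_trace_tangle_closure box_index_def trace_closure_simps boundary_points_closure(1)[OF right_trace_closure_ok], simp)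

lemma right_trace_linear: assumes x: "x \<in> \<B> k" shows "y \<in> \<B> k ==> rtr k (x + y) = rtr k x + rtr k y" "rtr k (scl c x) = scl c (rtr k x)"
proof -
 let ?T = "right_trace_tangle k" and ?B = "lbox (1/4) (real k + 3/4) (-1) 1"
 have T: "planar_tangle ?T" "labelling \<P> ?T (%_. x)" using val_right_trace[OF x] by (simp_all add: val_def)
 have inn: "inner ?T = {?B}" by (simp add: right_trace_tangle_closure)
 have i: "box_index ?T ?B = k"
  using card_points2[of real k "1/4" "real k + 3/4" real k "1/4" "real k + 3/4" "-1" 1] boundary_points_closure(2)[OF right_trace_closure_ok[of k]]
  by (simp add: right_trace_tangle_closure box_index_def spread_def)
 have e: "act \<P> ?T ((%_. x)(?B := z)) = rtr k z" if "z \<in> \<B> k" for z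
  unfolding right_trace_def by (rule act_cong[OF T(1)]) (use that i in "auto simp: inn labelling_def")
 show "rtr k (x + y) = rtr k x + rtr k y" if y: "y \<in> \<B> k" using act_add[OF T, of ?B x y] e[OF x] e[OF y] e[OF box_closed(1)[OF x y]] x y by (simp add: inn i)
 show "rtr k (scl c x) = scl c (rtr k x)" using act_scale[OF T, of ?B x c] e[OF x] e[OF box_closed(2)[OF x]] x by (simp add: inn i)
qed

lemma right_trace_0: assumes x: "x \<in> \<B> 0" shows "rtr 0 x = x"
proof -
 let ?D = "lbox (1/4) (3/4) (-1) 1"
 have s: "spread r 0 c d" for r c d by (simp add: spread_def)
 have ok: "column_ok 0 0 0 real real real 0 2 (1/4) (3/4) (1/4) (3/4) (-2) (-1) 1 (5/4) (3/2) 2" by (simp add: column_ok_def s)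
 have D: "drawn (%_. x) (lbox 0 2 (-2) 2) (cmp 0 (str 0) x) ({?D} Un {})
  (stripes real 0 (-2) (-1) Un stripes real 0 1 (5/4) Un stripes real 0 (3/2) 2 Un {} Un stripes real 0 (5/4) (3/2)) (points real 0 (-2) Un points real 0 2)"
  by (rule drawn_column[OF ok _ _ _ _ drawn_box refl drawn_straight[OF s] refl]) (use x strands_in[of 0] in simp_all)
 have "val (right_trace_tangle 0) (%_. x) (cmp 0 (str 0) x)" by (rule drawn_val[OF D]) (simp_all add: right_trace_tangle_def right_trace_box_def)
 hence "rtr 0 x = cmp 0 (str 0) x" using val_right_trace[OF x] val_unique by blast
 thus ?thesis by (simp add: stack_unit[OF x])
qed

end

lemma stripes_const: "stripes (%_. x) 1 c d = vline x c d" by (simp add: stripes_def)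

lemma points_const: "points (%_. x) 1 c = {Complex x c}" by (simp add: points_def)

lemma bends_const: "bends 1 (%_. x) rho omega d = bend x (rho - 1) d (omega - 1)" by (simp add: bends_def)

lemma stripes_two: "stripes (joined (%_. x) 1 (%_. y)) 2 c d = vline x c d Un vline y c d"
 using stripes_joined[of "%_. x" 1 "%_. y" 1 c d] by (simp only: one_add_one stripes_const)

lemma points_two: "points (joined (%_. x) 1 (%_. y)) 2 c = {Complex x c, Complex y c}"
 using points_joined[of "%_. x" 1 "%_. y" 1 c] by (simp only: one_add_one points_const) blast

text \<open>The innermost of the closing strands is a cup below and a cap above the box, joined to its right.\<close>

lemma (in subfactor_alg) trace_bend: assumes z: "z \<in> \<B> (k + 1)" shows "rtr (k + 1) z = rtr k (stk k (k + 2) k (str (k + 1))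
   (stk k (k + 2) (k + 2) (ten (k + 1) 1 z wire) (str (k + 1))))"
proof -
 let ?n = "real k"
 define kappa where "kappa = ?n + 1"
 define K where "K = ?n + 3"
 let ?P = "joined real k (%_. kappa)"
 let ?Q = "joined ?P (k + 1) (%_. K)"
 have n: "0 <= ?n" by simp
 have k2: "k + 2 = (k + 1) + 1" by simp
 have S1: "stripes ?P (k + 1) c d = stripes real k c d Un vline kappa c d" for c d by (simp only: stripes_joined stripes_const)
 have S2: "stripes ?Q (k + 2) c d = stripes real k c d Un vline kappa c d Un vline K c d" for c d unfolding k2 by (simp only: stripes_joined stripes_const)
 have P: "points ?P (k + 1) c = points real k c Un {Complex kappa c}" "points ?Q (k + 2) c = points real k c Un {Complex kappa c, Complex K c}" for c
  unfolding k2 by (simp_all only: points_joined points_const Un_assoc insert_is_Un[symmetric])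
 have s: "spread real k a b" if "a < 1" "?n + 1/4 <= b" for a b using that by (intro spread_real) auto
 have sP: "spread ?P (k + 1) a b" if "a <= 1/2" "?n + 5/4 <= b" for a b
  by (rule spread_joined[where m = "?n + 1/2"]) (use that n in "auto simp: kappa_def intro!: s spread_const1[simplified]")
 have sQ: "spread ?Q (k + 2) a b" if ab: "a <= 1/2" "?n + 13/4 <= b" for a b
  unfolding k2 by (rule spread_joined[where m = "?n + 3/2", OF sP spread_const1]) (use ab n in "auto simp: K_def")
 have bp: "points ?P (k + 1) c Un points ?P (k + 1) d Un points (%_. K) 1 c Un points (%_. K) 1 d = points ?Q (k + 2) c Un points ?Q (k + 2) d"
  "points real k c Un points real k d Un {Complex kappa d, Complex K d} = points real k c Un points ?Q (k + 2) d"
  "points real k c Un points real k d Un {Complex kappa c, Complex K c} = points ?Q (k + 2) c Un points real k d" for c d unfolding P points_const by blast+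
 have tz: "ten (k + 1) 1 z wire \<in> \<B> (k + 2)" using tensor_in[OF z strands_in] by simp
 let ?y = "stk k (k + 2) (k + 2) (ten (k + 1) 1 z wire) (str (k + 1))"
 have i: "str (k + 1) \<in> \<B> ((k + (k + 2)) div 2)" "str (k + 1) \<in> \<B> ((k + 2 + k) div 2)"
  "ten (k + 1) 1 z wire \<in> \<B> ((k + 2 + (k + 2)) div 2)" "even (k + (k + 2))" "even (k + 2 + (k + 2))" "even (k + 2 + k)"
  using strands_in[of "k + 1"] tz by simp_all
 have y: "?y \<in> \<B> ((k + (k + 2)) div 2)" by (rule stack_in[OF i(4,5,1,3)])
 have yy: "stk k (k + 2) k (str (k + 1)) ?y \<in> \<B> k" using stack_in[OF i(4,6) y i(2)] by simp
 have okR: "row_ok (k + 1) (k + 1) 1 1 ?P ?P (%_. K) (%_. K) (7/16) (?n + 13/4) (1/2) (?n + 3/2) (?n + 5/2) (?n + 25/8) (-(3/2)) (-(1/2)) (1/2) (-1) 1 (9/8)"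
  unfolding row_ok_def by (intro conjI sP spread_const1) (use n in "auto simp: K_def")
 have sX: "spread (%_. K) 1 (?n + 5/2) (?n + 25/8)" by (rule spread_const1) (auto simp: K_def)
 have ok: "column_ok k (k + 2) (k + 2) real ?Q ?Q (3/8) (?n + 27/8) (7/16) (?n + 13/4) (7/16) (?n + 13/4) (-(5/2)) (-(19/8)) (-(13/8)) (-(3/2)) (9/8) (5/4)"
  "column_ok k (k + 2) k real ?Q real (1/4) (?n + 7/2) (3/8) (?n + 27/8) (3/8) (?n + 27/8) (-(11/4)) (-(5/2)) (5/4) (3/2) (5/2) (11/4)"
  unfolding column_ok_def by (intro conjI s sQ; use n in simp)+
 let ?r = "2 * ?n + 4" let ?w = "?n + 3"
 have okE: "closure_ok k real ?r ?w 0 ?r (1/4) (?n + 7/2) (11/4) ?w" unfolding closure_ok_def by (intro conjI s) (use n in auto)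
 have okE': "closure_ok (k + 1) ?P ?r ?w 0 ?r (1/2) (?n + 3/2) (1/2) ?w" unfolding closure_ok_def by (intro conjI sP) (use n in auto)
 have c: "spread real k (7/16) kappa" "spread real k (3/8) kappa" "7/16 < kappa" "3/8 < kappa" "kappa < K" "K < ?n + 13/4" "K < ?n + 27/8"
  "?n + 5/2 < ?n + 25/8" "-1 < (1::real)" "-(19/8) < (-(13/8)::real)" "3/2 < (5/2::real)" using n by (auto simp: kappa_def K_def intro!: s)
 note 1 = drawn_closure[OF okE' z drawn_box[of "%_. z", OF refl] refl]
 note 2 = drawn_closure[OF okE yy drawn_column[OF ok(2) i(4,6) y i(2)
  drawn_column[OF ok(1) i(4,5,1,3) drawn_cup[OF c(1,3,5,6,10)] bp(2)
   drawn_tensor[OF okR z strands_in drawn_box[of "%_. z", OF refl] refl drawn_straight[OF sX c(8,9)] refl] bp(1)] refl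
  drawn_cap[OF c(2,4,5,7,11)] bp(3)] refl]
 have m: "(-(19/8) + -(13/8)) / 2 = (-2::real)" "(3/2 + 5/2) / 2 = (2::real)" by simp_all
 have sp: "stripes real k (-(11/4)) (-(1/2)) = stripes real k (-(11/4)) (-(5/2)) Un stripes real k (-(5/2)) (-(19/8)) Un
   stripes real k (-(19/8)) (-(13/8)) Un stripes real k (-(13/8)) (-(3/2)) Un stripes real k (-(3/2)) (-(1/2))"
  "stripes real k (1/2) (11/4) = stripes real k (1/2) (9/8) Un stripes real k (9/8) (5/4) Un stripes real k (5/4) (3/2) Un stripes real k (3/2) (5/2) Un stripes real k (5/2) (11/4)"
  "vline kappa (-2) (-(1/2)) = vline kappa (-2) (-(13/8)) Un vline kappa (-(13/8)) (-(3/2)) Un vline kappa (-(3/2)) (-(1/2))"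
  "vline kappa (1/2) 2 = vline kappa (1/2) (9/8) Un vline kappa (9/8) (5/4) Un vline kappa (5/4) (3/2) Un vline kappa (3/2) 2"
  "vline K (-2) 2 = vline K (-2) (-(13/8)) Un vline K (-(13/8)) (-(3/2)) Un vline K (-(3/2)) (-1) Un vline K (-1) 1 Un
   vline K 1 (9/8) Un vline K (9/8) (5/4) Un vline K (5/4) (3/2) Un vline K (3/2) 2" by (simp_all add: vline_join stripes_join)
 have "?r - (?n + 1) = K" "?w - (?n + 1) = 2" by (simp_all add: K_def)
 hence be: "bends (k + 1) ?P ?r ?w (1/2) = bends k real ?r ?w (11/4) Un stripes real k (1/2) (11/4) Un stripes real k (-(11/4)) (-(1/2)) Un
   (vline kappa (1/2) 2 Un hline kappa K 2 Un vline K (-2) 2 Un hline kappa K (-2) Un vline kappa (-2) (-(1/2)))"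
  using bends_extend[of "1/2" "11/4" ?w k real ?r] by (simp only: bends_joined bend_def)
 show ?thesis by (rule drawn_unique[OF 1 2]; (simp only: be m S1 S2 stripes_const sp)?; blast)
qed

text \<open>The closing strand of the last factor runs inside of all others and can be closed first.\<close>

lemma (in planar_alg) trace_tensor: assumes p: "p \<in> \<B> k" and a: "a \<in> \<B> 1" shows "rtr (k + 1) (ten k 1 p a) = rtr k (ten k 0 p (rtr 1 a))"
proof -
 let ?n = "real k"
 define K where "K = ?n + 3"
 let ?P = "joined real k (%_. K)"
 let ?r = "2 * ?n + 6" let ?w = "?n + 3"
 have n: "0 <= ?n" by simp
 let ?D = "lbox (1/2) (?n + 1) (-(1/2)) (1/2)" and ?E = "lbox (?n + 5/2) (?n + 7/2) (-(1/2)) (1/2)"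
 define F where "F = (%_. undefined)(?D := p, ?E := a)"
 have F: "F ?D = p" "F ?E = a" by (simp_all add: F_def)
 note box = drawn_box[of F]
 have s: "spread real k a b" if "a < 1" "?n + 1/4 <= b" for a b using that by (intro spread_real) auto
 have sP: "spread ?P (k + 1) (1/4) (?n + 15/4)" by (rule spread_joined[where m = "?n + 1", OF s spread_const1]) (auto simp: K_def)
 have okT: "closure_ok (k + 1) ?P ?r ?w 0 ?r (1/4) (?n + 15/4) (3/4) ?w" unfolding closure_ok_def by (intro conjI sP) (use n in auto)
 have okR: "row_ok k k 1 1 real real (%_. K) (%_. K) (1/4) (?n + 15/4) (1/2) (?n + 1) (?n + 5/2) (?n + 7/2) (-(3/4)) (-(1/2)) (1/2) (-(1/2)) (1/2) (3/4)"
  unfolding row_ok_def by (intro conjI s spread_const1) (use n in "auto simp: K_def")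
 have okU: "closure_ok k real ?r ?w 0 ?r (1/4) (?n + 23/4) (11/4) ?w" unfolding closure_ok_def by (intro conjI s) (use n in auto)
 have s0: "spread real 0 c d" for c d by (simp add: spread_def)
 have okV: "row_ok k k 0 0 real real real real (1/4) (?n + 23/4) (1/2) (?n + 1) (?n + 9/4) (?n + 11/2) (-(11/4)) (-(1/2)) (1/2) (-(5/2)) (5/2) (11/4)"
  unfolding row_ok_def by (intro conjI s s0) (use n in auto)
 have okW: "closure_ok 1 (%_. K) (?n + 6) 3 (?n + 9/4) (?n + 11/2) (?n + 5/2) (?n + 7/2) (1/2) (5/2)"
  unfolding closure_ok_def by (intro conjI spread_const1) (auto simp: K_def)
 have ta: "rtr 1 a \<in> \<B> 0" by (rule right_trace_in[OF a])
 have pt: "ten k 0 p (rtr 1 a) \<in> \<B> k" using tensor_general_in[OF p ta] by simp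
 have b0: "{} = points real 0 c Un points real 0 d" "points real k c Un points real k d Un points real 0 c Un points real 0 d = points real k c Un points real k d" for c d
  by simp_all
 note 1 = drawn_closure[OF okT tensor_in[OF p a] drawn_tensor[OF okR p a box[OF F(1)] refl box[OF F(2)] refl] points_row]
 note 2 = drawn_closure[OF okU pt drawn_tensor[OF okV p ta box[OF F(1)] refl drawn_closure[OF okW a box[OF F(2)] refl] b0(1)] b0(2)]
 have ex: "bends (k + 1) ?P ?r ?w (1/2) = bends (k + 1) ?P ?r ?w (3/4) Un (stripes real k (1/2) (3/4) Un stripes (%_. K) 1 (1/2) (3/4)) Un
   (stripes real k (-(3/4)) (-(1/2)) Un stripes (%_. K) 1 (-(3/4)) (-(1/2)))" using bends_extend[of "1/2" "3/4" ?w "k + 1" ?P ?r] by (simp only: stripes_joined)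
 have "?r - (?n + 1) = ?n + 6 - 1" "?w - (?n + 1) = 3 - 1" by simp_all
 hence be: "bends (k + 1) ?P ?r ?w (1/2) = bends k real ?r ?w (11/4) Un stripes real k (1/2) (11/4) Un stripes real k (-(11/4)) (-(1/2)) Un bends 1 (%_. K) (?n + 6) 3 (1/2)"
  using bends_extend[of "1/2" "11/4" ?w k real ?r] by (simp only: bends_joined bends_const)
 note be[unfolded ex]
 thus ?thesis by (intro drawn_unique[OF 1 2]; (simp only: stripes_0)?; blast)
qed

subsection \<open>The closed loop\<close>

lemma pl_tail_diagonal: "nodes ((a, a) # ns) ==> \<forall>n\<in>set ns. snd n = fst n ==> pl_tail a a ns x = max (x - a) 0"
proof (induction ns arbitrary: a)
 case (Cons n ns)
 hence n: "snd n = fst n" "a < fst n" "nodes ((fst n, fst n) # ns)" by (cases n; simp; fail)+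
 have "pl_tail (fst n) (fst n) ns x = max (x - fst n) 0" using Cons n by simp
 thus ?case using n(1,2) by (simp add: max_def min_def)
qed simp

lemma pl_diagonal: "nodes ns ==> \<forall>n\<in>set ns. snd n = fst n ==> pl ns x = x"
proof (cases ns)
 case (Cons n r)
 assume "nodes ns" "\<forall>n\<in>set ns. snd n = fst n"
 hence "pl_tail (fst n) (fst n) r x = max (x - fst n) 0" "snd n = fst n" using pl_tail_diagonal[of "fst n" r x] Cons by (cases n; simp)+
 thus ?thesis using Cons by simp
qed simp

definition round_radius :: "real => real => real" where "round_radius r y = max r (sqrt (1 - y\<^sup>2))"

definition square_nodes :: "real => ((real => real) \<times> (real => real)) list" where
 "square_nodes r = [(%_. -2, %_. -2), (%y. - round_radius r y, %_. - r), (%y. round_radius r y, %_. r), (%_. 2, %_. 2)]"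

lemma square_map: assumes r: "0 < r" "r < 1" shows "fibre_family (fibre_map (square_nodes r))"
  "fibre_map (square_nodes r) y (-2) = -2" "fibre_map (square_nodes r) y 2 = 2"
  "\<bar>fibre_map (square_nodes r) y x\<bar> = r \<longleftrightarrow> \<bar>x\<bar> = round_radius r y"
  "\<bar>fibre_map (square_nodes r) y x\<bar> <= r \<longleftrightarrow> \<bar>x\<bar> <= round_radius r y"
  "round_radius r y = r ==> fibre_map (square_nodes r) y x = x"
proof -
 have b: "r <= round_radius r y" "round_radius r y <= 1" for y using r by (auto simp: round_radius_def intro!: real_le_lsqrt)
 have n: "nodes (map (%n. (fst n y, snd n y)) (square_nodes r))" for y using b[of y] r by (simp add: square_nodes_def)
 have "continuous_on UNIV (round_radius r)" unfolding round_radius_def by (intro continuous_intros)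
 thus f: "fibre_family (fibre_map (square_nodes r))" unfolding fibre_map_def by (intro fibre_family_pl n) (auto simp: square_nodes_def intro!: continuous_intros)
 note N = pl_node[OF n[of y], unfolded square_nodes_def list.map fst_conv snd_conv]
 have v: "fibre_map (square_nodes r) y (-2) = -2" "fibre_map (square_nodes r) y 2 = 2"
  "fibre_map (square_nodes r) y (- round_radius r y) = - r" "fibre_map (square_nodes r) y (round_radius r y) = r"
  using N[of "(-2, -2)"] N[of "(2, 2)"] N[of "(- round_radius r y, - r)"] N[of "(round_radius r y, r)"]
  by (simp_all add: fibre_map_def square_nodes_def del: pl.simps)
 thus "fibre_map (square_nodes r) y (-2) = -2" "fibre_map (square_nodes r) y 2 = 2" by simp_all
 have m: "strict_mono (fibre_map (square_nodes r) y)" using f by (simp add: fibre_family_def)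
 have le: "fibre_map (square_nodes r) y a <= fibre_map (square_nodes r) y b \<longleftrightarrow> a <= b" for a b using m by (simp add: strict_mono_less_eq)
 have eq: "fibre_map (square_nodes r) y a = fibre_map (square_nodes r) y b \<longleftrightarrow> a = b" for a b using m by (simp add: strict_mono_eq)
 show "\<bar>fibre_map (square_nodes r) y x\<bar> = r \<longleftrightarrow> \<bar>x\<bar> = round_radius r y"
  using eq[of x "round_radius r y"] eq[of x "- round_radius r y"] v(3,4) r b(1)[of y] by (auto simp: abs_if)
 show "\<bar>fibre_map (square_nodes r) y x\<bar> <= r \<longleftrightarrow> \<bar>x\<bar> <= round_radius r y"
  using le[of x "round_radius r y"] le[of "- round_radius r y" x] v(3,4) by (auto simp: abs_le_iff)
 show "fibre_map (square_nodes r) y x = x" if "round_radius r y = r" unfolding fibre_map_def by (rule pl_diagonal[OF n]) (use that in "simp add: square_nodes_def")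
qed

definition rectangle_loop :: "real => real => real => real => complex set" where "rectangle_loop a b c d = vline a c d Un vline b c d Un hline a b c Un hline a b d"

text \<open>The loop in the definition of the parameter is a round circle, while traces produce rectangles.\<close>

lemma circle_to_rectangle:
 "vmap (fibre_map (square_nodes (4/5))) ` hmap (fibre_map (square_nodes (3/5))) ` sphere 0 1 = rectangle_loop (-(3/5)) (3/5) (-(4/5)) (4/5)"
proof -
 define Q where "Q = {z. (\<bar>Re z\<bar> = 3/5 & \<bar>Im z\<bar> <= 4/5) | (\<bar>Re z\<bar> <= 3/5 & (Re z)\<^sup>2 + (Im z)\<^sup>2 = 1)}"
 have s: "z \<in> sphere 0 1 \<longleftrightarrow> (Re z)\<^sup>2 + (Im z)\<^sup>2 = 1" for z by (simp add: cmod_def)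
 have sq: "x\<^sup>2 + y\<^sup>2 = 1 \<longleftrightarrow> \<bar>x\<bar> = sqrt (1 - y\<^sup>2)" if "\<bar>y\<bar> <= 1" for x y :: real
 proof -
  have "y\<^sup>2 <= 1" using that by (simp add: abs_square_le_1)
  hence "\<bar>x\<bar> = sqrt (1 - y\<^sup>2) \<longleftrightarrow> x\<^sup>2 = 1 - y\<^sup>2" by (metis abs_ge_zero diff_ge_0_iff_ge power2_abs real_sqrt_abs real_sqrt_pow2 )
  thus ?thesis by auto
 qed
 have R: "round_radius r y = sqrt (1 - y\<^sup>2)" if "\<bar>y\<bar> <= t" "r\<^sup>2 + t\<^sup>2 = 1" "0 < r" for r y t
 proof -
  have "y\<^sup>2 <= t\<^sup>2" using that(1) by (metis abs_ge_zero power2_abs power_mono)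
  hence "r\<^sup>2 <= 1 - y\<^sup>2" using that(2) by linarith
  hence "r <= sqrt (1 - y\<^sup>2)" by (rule real_le_rsqrt)
  thus ?thesis by (simp add: round_radius_def)
 qed
 have R': "round_radius r y = r" if "t <= \<bar>y\<bar>" "r\<^sup>2 + t\<^sup>2 = 1" "0 < r" "0 < t" for r y t
 proof -
  have "t\<^sup>2 <= y\<^sup>2" using that(1,4) by (metis less_imp_le power2_abs power_mono)
  hence "1 - y\<^sup>2 <= r\<^sup>2" using that(2) by linarith
  hence "sqrt (1 - y\<^sup>2) <= r" using that(3) by (intro real_le_lsqrt) auto
  thus ?thesis by (simp add: round_radius_def)
 qed
 have num: "(3/5)\<^sup>2 + (4/5)\<^sup>2 = (1::real)" "(4/5)\<^sup>2 + (3/5)\<^sup>2 = (1::real)" by (simp_all add: power2_eq_square)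
 note h = square_map[of "3/5"] note v = square_map[of "4/5"]
 let ?T1 = "fibre_map (square_nodes (3/5))"
 have 1: "hmap ?T1 z \<in> Q \<longleftrightarrow> z \<in> sphere 0 1" for z
 proof (cases "\<bar>Im z\<bar> <= 4/5")
  case True
  define x where "x = fibre_map (square_nodes (3/5)) (Im z) (Re z)"
  have "\<bar>x\<bar> = 3/5 \<longleftrightarrow> (Re z)\<^sup>2 + (Im z)\<^sup>2 = 1"
   using h(4)[of "Im z" "Re z"] R[OF True num(1)] sq[of "Im z" "Re z"] True by (simp add: x_def)
  moreover have "\<bar>x\<bar> = 3/5" if c: "\<bar>x\<bar> <= 3/5" "x\<^sup>2 + (Im z)\<^sup>2 = 1"
  proof -
   have "(Im z)\<^sup>2 <= (4/5)\<^sup>2" using True by (metis abs_ge_zero power2_abs power_mono)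
   hence "(3/5)\<^sup>2 <= x\<^sup>2" using c(2) num(1) by linarith
   hence "3/5 <= \<bar>x\<bar>" using abs_le_square_iff[of "3/5" x] by simp
   thus ?thesis using c(1) by simp
  qed
  ultimately show ?thesis using True unfolding s by (auto simp: Q_def hmap_def x_def[symmetric])
 next
  case False
  hence r: "round_radius (3/5) (Im z) = 3/5" by (intro R'[OF _ num(1)]) auto
  have e: "hmap ?T1 z = z" using h(6)[OF _ _ r] by (simp add: hmap_def)
  have "\<bar>Re z\<bar> <= 3/5" if c: "(Re z)\<^sup>2 + (Im z)\<^sup>2 = 1"
  proof -
   have "(4/5)\<^sup>2 <= \<bar>Im z\<bar>\<^sup>2" using False by (intro power_mono) auto
   hence "(Re z)\<^sup>2 <= (3/5)\<^sup>2" using c num(1) by simp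
   thus ?thesis using abs_le_square_iff[of "Re z" "3/5"] by simp
  qed
  thus ?thesis unfolding e s using False by (auto simp: Q_def)
 qed
 define L where "L = rectangle_loop (-(3/5)) (3/5) (-(4/5)) (4/5)"
 have L: "z \<in> L \<longleftrightarrow> (\<bar>Re z\<bar> = 3/5 & \<bar>Im z\<bar> <= 4/5) | (\<bar>Re z\<bar> <= 3/5 & \<bar>Im z\<bar> = 4/5)" for z
  by (auto simp: L_def rectangle_loop_def vline_iff hline_iff)
 let ?T2 = "fibre_map (square_nodes (4/5))"
 have 2: "vmap ?T2 z \<in> L \<longleftrightarrow> z \<in> Q" for z
 proof (cases "\<bar>Re z\<bar> <= 3/5")
  case True
  define y where "y = fibre_map (square_nodes (4/5)) (Re z) (Im z)"
  have a: "\<bar>y\<bar> = 4/5 \<longleftrightarrow> (Re z)\<^sup>2 + (Im z)\<^sup>2 = 1"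
   using v(4)[of "Re z" "Im z"] R[OF True num(2)] sq[of "Re z" "Im z"] True by (simp add: y_def add.commute)
  have "\<bar>y\<bar> <= 4/5 \<longleftrightarrow> \<bar>Im z\<bar> <= 4/5" if c: "\<bar>Re z\<bar> = 3/5"
  proof -
   have r: "round_radius (4/5) (Re z) = 4/5" by (rule R'[OF _ num(2)]) (use c in auto)
   have "\<bar>y\<bar> <= 4/5 \<longleftrightarrow> \<bar>Im z\<bar> <= round_radius (4/5) (Re z)" unfolding y_def by (rule v(5)) auto
   thus ?thesis unfolding r .
  qed
  thus ?thesis using a True unfolding L by (auto simp: Q_def vmap_def y_def[symmetric])
 qed (auto simp: L Q_def vmap_def)
 have sh: "surj (hmap ?T1)" using isotopic_id_homeomorphism[OF isotopic_id_hmap[OF h(1)]] unfolding homeomorphism_def by fastforce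
 have sv: "surj (vmap ?T2)" using isotopic_id_homeomorphism[OF isotopic_id_vmap[OF v(1)]] unfolding homeomorphism_def by fastforce
 have "hmap ?T1 ` sphere 0 1 = Q"
 proof (intro subset_antisym subsetI)
  fix z assume z: "z \<in> Q"
  obtain w where "z = hmap ?T1 w" using sh by (metis surjD)
  thus "z \<in> hmap ?T1 ` sphere 0 1" using z 1 by blast
 qed (use 1 in blast)
 moreover have "vmap ?T2 ` Q = L"
 proof (intro subset_antisym subsetI)
  fix z assume z: "z \<in> L"
  obtain w where "z = vmap ?T2 w" using sv by (metis surjD)
  thus "z \<in> vmap ?T2 ` Q" using z 2 by blast
 qed (use 2 in blast)
 ultimately show ?thesis by (simp add: L_def)
qed

lemma (in planar_alg) trace_strand: "rtr 1 wire = closed_loop \<P>"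
proof -
 have ok: "closure_ok 1 (%_. 1) 4 3 0 4 (1/4) (7/4) 1 3" unfolding closure_ok_def by (intro conjI spread_const1) auto
 have s: "spread (%_. 1) 1 (1/4) (7/4)" by (rule spread_const1) auto
 have "vline 1 (-2) 2 = vline 1 (-2) (-1) Un vline 1 (-1) 1 Un vline 1 1 2" by (simp add: vline_join)
 hence l: "rectangle_loop 1 3 (-2) 2 = bends 1 (%_. 1) 4 3 1 Un stripes (%_. 1) 1 (-1) 1"
  unfolding bends_const stripes_const rectangle_loop_def by (simp add: bend_def Un_ac)
 have 1: "val (Tangle (lbox 0 4 (-3) 3) {} (rectangle_loop 1 3 (-2) 2)) (%_. undefined) (rtr 1 wire)"
  unfolding l by (rule drawn_val[OF drawn_closure[OF ok strands_in drawn_straight[OF s] refl]]) auto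
 have lp: "closed_loop \<P> = act \<P> loop_tangle (%_. undefined)" by (rule closed_loop_def)
 define F where "F = pl [(-2, 0), (-(3/5), 1), (3/5, 3), (2, 4)]"
 define G where "G = pl [(-2, -3), (-(4/5), -2), (0, 0), (4/5, 2), (2, 3)]"
 have nF: "nodes [(-2, 0), (-(3/5), 1), (3/5, 3), (2, 4::real)]" and nG: "nodes [(-2, -3), (-(4/5), -2), (0, 0), (4/5, 2), (2, 3::real)]" by simp_all
 have F: "F (-2) = 0" "F (-(3/5)) = 1" "F (3/5) = 3" "F 2 = 4"
  using pl_node[OF nF, of "(-2, 0)"] pl_node[OF nF, of "(-(3/5), 1)"] pl_node[OF nF, of "(3/5, 3)"] pl_node[OF nF, of "(2, 4)"]
  by (simp_all add: F_def del: pl.simps)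
 have G: "G (-2) = -3" "G (-(4/5)) = -2" "G 0 = 0" "G (4/5) = 2" "G 2 = 3"
  using pl_node[OF nG, of "(-2, -3)"] pl_node[OF nG, of "(-(4/5), -2)"] pl_node[OF nG, of "(0, 0)"] pl_node[OF nG, of "(4/5, 2)"] pl_node[OF nG, of "(2, 3)"]
  by (simp_all add: G_def del: pl.simps)
 have lF: "line_homeo F" and lG: "line_homeo G" unfolding F_def G_def by (rule line_homeo_pl[OF nF] line_homeo_pl[OF nG])+
 note t = product_map[OF lF lG]
 note h = square_map[of "3/5"] note v = square_map[of "4/5"]
 define hh where "hh = hmap (fibre_map (square_nodes (3/5)))"
 define vv where "vv = vmap (fibre_map (square_nodes (4/5)))"
 define g where "g = vv \<circ> hh"
 have gi: "isotopic_id g" unfolding g_def hh_def vv_def by (intro isotopic_id_compose isotopic_id_hmap isotopic_id_vmap h(1) v(1)) auto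
 have r0: "round_radius (4/5) (-2) = 4/5"
 proof -
  have "sqrt (1 - (-2)\<^sup>2) <= 0" by simp
  thus ?thesis unfolding round_radius_def by linarith
 qed
 let ?T2 = "lbox (-2) 2 (-2) 2"
 have d1: "disc_image hh ?T2 = lbox (-2) 2 (-2) 2" unfolding hh_def by (rule hmap_lbox[OF h(1)]) (use h(2,3) in auto)
 have d2: "disc_image vv ?T2 = lbox (-2) 2 (-2) 2" unfolding vv_def by (rule vmap_lbox[OF v(1)]) (use v(2,3) v(6)[OF _ _ r0] in auto)
 have dg: "disc_image g ?T2 = lbox (-2) 2 (-2) 2"
 proof -
  have "disc_image g D = disc_image vv (disc_image hh D)" for D by (simp add: g_def disc_image_def image_comp)
  thus ?thesis by (simp only: d1 d2)
 qed
 have gs: "g ` sphere 0 1 = rectangle_loop (-(3/5)) (3/5) (-(4/5)) (4/5)" using circle_to_rectangle by (simp add: g_def hh_def vv_def image_comp)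
 have rl: "product_map F G ` rectangle_loop (-(3/5)) (3/5) (-(4/5)) (4/5) = rectangle_loop 1 3 (-2) 2"
  unfolding rectangle_loop_def image_Un using t(2)[of "-(4/5)" "4/5"] t(3)[of "-(3/5)" "3/5"] F G by simp
 have db: "disc_image (product_map F G) ?T2 = lbox 0 4 (-3) 3" using t(4)[of "-2" 2 "-2" 2] F G by simp
 define m where "m = product_map F G \<circ> g"
 have mi: "isotopic_id m" unfolding m_def by (intro isotopic_id_compose t(1) gi)
 have img: "tangle_image m loop_tangle = Tangle (lbox 0 4 (-3) 3) {} (rectangle_loop 1 3 (-2) 2)"
 proof -
  have "disc_image m D = disc_image (product_map F G) (disc_image g D)" "m ` S = product_map F G ` g ` S" for D S by (simp_all add: m_def disc_image_def image_comp)
  thus ?thesis by (simp only: tangle_image_def loop_tangle_def tangle.sel dg db gs rl image_empty)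
 qed
 obtain i where i: "homeomorphism UNIV UNIV m i" using isotopic_id_homeomorphism[OF mi] .
 let ?T1 = "tangle_image m loop_tangle"
 have "planar_tangle (tangle_image i ?T1)"
 proof (rule planar_tangle_image)
  show "homeomorphism UNIV UNIV i m" using i by (simp add: homeomorphism_symD)
  show "planar_tangle ?T1" unfolding img using 1 by (simp add: val_def)
 qed
 moreover have "tangle_image i ?T1 = loop_tangle"
  using i by (simp add: tangle_image_def loop_tangle_def disc_image_def image_image homeomorphism_apply1[OF i] lbox_def)
 ultimately have "val loop_tangle (%_. undefined) (closed_loop \<P>)" unfolding lp by (intro valI) (simp_all add: labelling_def loop_tangle_def)
 hence "val ?T1 (%_. undefined) (closed_loop \<P>)" by (rule val_iso[OF _ mi]) simp
 thus ?thesis using 1 val_unique unfolding img by blast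
qed

subsection \<open>The saddle\<close>

lemma (in subfactor_alg) saddle_stack: assumes x: "x \<in> \<B> 1" and y: "y \<in> \<B> 1" shows "saddle \<P> x y = stk 2 0 2 (stk 0 2 2 (ten 1 1 x wire) wire)
   (stk 2 2 0 wire (ten 1 1 y wire))"
proof -
 let ?P = "joined (%_::nat. 1::real) 1 (%_. 2)"
 let ?one = "%_::nat. 1::real" let ?two = "%_::nat. 2::real"
 have s0: "spread r 0 c d" for r c d by (simp add: spread_def)
 have s1: "spread ?one 1 a b" if "a < 1" "1 < b" for a b using that by (rule spread_const1)
 have s2: "spread ?two 1 a b" if "a < 2" "2 < b" for a b using that by (rule spread_const1)
 have sP: "spread ?P 2 a b" if ab: "a < 1" "2 < b" for a b
 proof -
  have "spread ?P (1 + 1) a b" by (rule spread_joined[where m = "3/2", OF s1 s2]) (use ab in auto)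
  thus ?thesis by (simp only: one_add_one)
 qed
 have X: "wire \<in> \<B> 1" by (rule strands_in)
 let ?x = "lbox (3/4) (5/4) 2 3" and ?y = "lbox (3/4) (5/4) (-3) (-2)"
 define F where "F = (%B. if B = saddle_upper then x else y)"
 have F: "F ?x = x" "F ?y = y" by (simp_all add: F_def saddle_upper_def)
 note box = drawn_box[of F]
 have okr: "row_ok 1 1 1 1 ?one ?one ?two ?two (3/8) (21/8) (3/4) (5/4) (7/4) (9/4) (3/2) 2 3 2 3 (7/2)"
  "row_ok 1 1 1 1 ?one ?one ?two ?two (3/8) (21/8) (3/4) (5/4) (7/4) (9/4) (-(7/2)) (-3) (-2) (-3) (-2) (-(3/2))" unfolding row_ok_def by (intro conjI s1 s2; simp)+
 have ok: "column_ok 0 2 2 real ?P ?P (1/4) (11/4) (3/8) (21/8) (3/8) (21/8) (1/2) (3/4) (5/4) (3/2) (7/2) (15/4)"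
  "column_ok 2 2 0 ?P ?P real (1/4) (11/4) (3/8) (21/8) (3/8) (21/8) (-(15/4)) (-(7/2)) (-(3/2)) (-(5/4)) (-(3/4)) (-(1/2))"
  "column_ok 2 0 2 ?P real ?P 0 3 (1/4) (11/4) (1/4) (11/4) (-4) (-(15/4)) (-(1/2)) (1/2) (15/4) 4" unfolding column_ok_def by (intro conjI s0 sP; simp)+
 have t: "ten 1 1 x wire \<in> \<B> ((2 + 2) div 2)" "ten 1 1 y wire \<in> \<B> ((2 + 2) div 2)"
  "wire \<in> \<B> ((0 + 2) div 2)" "wire \<in> \<B> ((2 + 0) div 2)" "even (0 + 2::nat)" "even (2 + 2::nat)" "even (2 + 0::nat)"
  using tensor_in[OF x X, unfolded one_add_one] tensor_in[OF y X, unfolded one_add_one] X by ((simp del: One_nat_def; fail) | simp)+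
 have bp: "points ?one 1 c Un points ?one 1 d Un points ?two 1 c Un points ?two 1 d = points ?P 2 c Un points ?P 2 d"
  "points real 0 c Un points real 0 d Un {Complex 1 d, Complex 2 d} = points real 0 c Un points ?P 2 d"
  "points real 0 c Un points real 0 d Un {Complex 1 c, Complex 2 c} = points ?P 2 c Un points real 0 d" for c d unfolding points_two points_const by auto
 have o: "3/8 < (1::real)" "1 < (2::real)" "2 < (21/8::real)" "7/4 < (9/4::real)" "2 < (3::real)" "-3 < (-2::real)"
  "3/4 < (5/4::real)" "-(5/4) < (-(3/4)::real)" by simp_all
 have s2': "spread ?two 1 (7/4) (9/4)" by (rule s2) auto
 note D = drawn_column[OF ok(3) t(7,5) stack_in[OF t(6,7,2,4)] stack_in[OF t(5,6,3,1)]
  drawn_column[OF ok(2) t(6,7,2,4)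
   drawn_tensor[OF okr(2) y X box[OF F(2)] refl drawn_straight[OF s2' o(4,6)] refl] bp(1) drawn_cap[OF s0 o(1-3,8), unfolded add_0] bp(3)] refl
  drawn_column[OF ok(1) t(5,6,3,1) drawn_cup[OF s0 o(1-3,7), unfolded add_0] bp(2)
   drawn_tensor[OF okr(1) x X box[OF F(1)] refl drawn_straight[OF s2' o(4,5)] refl] bp(1)] refl]
 have m: "(3/4 + 5/4) / 2 = (1::real)" "(-(5/4) + -(3/4)) / 2 = (-1::real)" by simp_all
 have rv: "vline 1 4 3 = vline 1 3 (7/2) Un vline 1 (7/2) (15/4) Un vline 1 (15/4) 4" "vline 1 2 1 = vline 1 1 (5/4) Un vline 1 (5/4) (3/2) Un vline 1 (3/2) 2"
  "vline 2 1 4 = vline 2 1 (5/4) Un vline 2 (5/4) (3/2) Un vline 2 (3/2) 2 Un vline 2 2 3 Un vline 2 3 (7/2) Un vline 2 (7/2) (15/4) Un vline 2 (15/4) 4"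
  "vline 1 (-4) (-3) = vline 1 (-4) (-(15/4)) Un vline 1 (-(15/4)) (-(7/2)) Un vline 1 (-(7/2)) (-3)"
  "vline 1 (-1) (-2) = vline 1 (-2) (-(3/2)) Un vline 1 (-(3/2)) (-(5/4)) Un vline 1 (-(5/4)) (-1)"
  "vline 1 (-2) (-1) = vline 1 (-2) (-(3/2)) Un vline 1 (-(3/2)) (-(5/4)) Un vline 1 (-(5/4)) (-1)"
  "vline 2 (-1) (-4) = vline 2 (-4) (-(15/4)) Un vline 2 (-(15/4)) (-(7/2)) Un vline 2 (-(7/2)) (-3) Un vline 2 (-3) (-2) Un
   vline 2 (-2) (-(3/2)) Un vline 2 (-(3/2)) (-(5/4)) Un vline 2 (-(5/4)) (-1)" by (auto simp: vline_iff)
 have "val saddle_tangle F (stk 2 0 2 (stk 0 2 2 (ten 1 1 x wire) wire) (stk 2 2 0 wire (ten 1 1 y wire)))"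
  by (rule drawn_val[OF D]; (simp only: saddle_tangle_def saddle_upper_def saddle_lower_def tangle.sel rv stripes_two stripes_const stripes_0 m)?; (blast | simp))
 thus ?thesis unfolding val_def saddle_def F_def by simp
qed

section \<open>The category of shaped diagrams\<close>

context planar_alg begin

definition mor :: "nat => nat => 'a => bool" where "mor k l f \<longleftrightarrow> even (k + l) & f \<in> box_space \<P> ((k + l) div 2)"

lemma mor_shape: "mor k l f ==> k' + l' = k + l ==> mor k' l' f" by (simp add: mor_def)

lemma mor_square: "mor k k f \<longleftrightarrow> f \<in> \<B> k" by (simp add: mor_def)

lemma mor_stack: "mor k l f ==> mor l m g ==> mor k m (stk k l m g f)"
proof -
 assume a: "mor k l f" "mor l m g"
 hence e: "even (k + l)" "even (l + m)" by (simp_all add: mor_def)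
 hence "even (k + m)" by presburger
 thus ?thesis using stack_in[OF e] a by (simp add: mor_def)
qed

lemma mor_beside: "mor k l f ==> a \<in> \<B> 1 ==> mor (k + 1) (l + 1) (bes k l f a)" unfolding mor_def using beside_in[of k l f a] by simp

lemma mor_tensor: "f \<in> \<B> k ==> a \<in> \<B> 1 ==> mor (k + 1) (k + 1) (ten k 1 f a)" unfolding mor_square by (rule tensor_in)

lemma mor_strands: "mor k k (str k)" by (simp add: mor_square strands_in)

lemma mor_linear: "mor k l f ==> mor k l g ==> mor k l (f + g)" "mor k l f ==> mor k l (scl c f)" "even (k + l) ==> mor k l 0"
  "mor k l f ==> mor k l g ==> mor k l (f - g)" by (simp_all add: mor_def box_closed)

lemma assoc: "mor k l f ==> mor l m g ==> mor m n h ==> stk k m n h (stk k l m g f) = stk k l n (stk l m n h g) f"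
 unfolding mor_def by (elim conjE, rule stack_assoc; assumption)

lemma stack_add_right: "mor k l f ==> mor k l f' ==> mor l m g ==> stk k l m g (f + f') = stk k l m g f + stk k l m g f'"
 unfolding mor_def by (elim conjE, rule stack_linear(1); assumption)

lemma stack_add_left: "mor k l f ==> mor l m g ==> mor l m g' ==> stk k l m (g + g') f = stk k l m g f + stk k l m g' f"
 unfolding mor_def by (elim conjE, rule stack_linear(2); assumption)

lemma stack_scale_right: "mor k l f ==> mor l m g ==> stk k l m g (scl c f) = scl c (stk k l m g f)"
 unfolding mor_def by (elim conjE, rule stack_linear(3); assumption)

lemma stack_scale_left: "mor k l f ==> mor l m g ==> stk k l m (scl c g) f = scl c (stk k l m g f)"
 unfolding mor_def by (elim conjE, rule stack_linear(4); assumption)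

lemma stack_zero: "mor k l f ==> even (l + m) ==> stk k l m 0 f = 0" "mor l m g ==> even (k + l) ==> stk k l m g 0 = 0"
 using stack_scale_left[of k l f m 0 0] stack_scale_right[of k l 0 m g 0] mor_linear(3) by simp_all

lemma stack_diff_right: "mor k l f ==> mor k l f' ==> mor l m g ==> stk k l m g (f - f') = stk k l m g f - stk k l m g f'"
 using stack_add_right[of k l "f - f'" f' m g] mor_linear(4)[of k l f f'] by (simp add: eq_diff_eq)

lemma stack_diff_left: "mor k l f ==> mor l m g ==> mor l m g' ==> stk k l m (g - g') f = stk k l m g f - stk k l m g' f"
 using stack_add_left[of k l f m "g - g'" g'] mor_linear(4)[of l m g g'] by (simp add: eq_diff_eq)

lemma bend:  assumes "mor k (l + 1) g" "mor l l' y" "a \<in> \<B> 1" shows "stk k (l + 1) (l' + 1) (bes l l' y a) g =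
  stk (k + 1) (k + 1) l' (stk (k + 1) l l' y g) (ten k 1 (str k) (rot a))" using assms unfolding mor_def by (intro beside_bend) auto

lemma mor_shift: "mor k (l + 1) g ==> mor (k + 1) l g" "mor (k + 1) l g ==> mor k (l + 1) g" by (erule mor_shape, simp)+

end

context subfactor_alg begin

definition dag :: "nat => nat => 'a => 'a" where "dag k l f = adj \<P> ((k + l) div 2) f"

lemma mor_dag: "mor k l f ==> mor l k (dag k l f)" unfolding mor_def dag_def by (simp add: adj_in add.commute)

lemma dag_dag: "mor k l f ==> dag l k (dag k l f) = f" "mor k l f ==> dag k l (dag k l f) = f" unfolding mor_def dag_def by (simp_all add: adj_adj add.commute)

lemma dag_shape: "k' + l' = k + l ==> dag k' l' = dag k l" by (simp add: dag_def fun_eq_iff)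

lemma dag_stack: "mor k l f ==> mor l m g ==> dag k m (stk k l m g f) = stk m l k (dag k l f) (dag l m g)" unfolding mor_def dag_def by (intro adj_stack) auto

lemma dag_beside: "mor k l f ==> a \<in> \<B> 1 ==> dag (k + 1) (l + 1) (bes k l f a) = bes l k (dag k l f) (adj \<P> 1 a)"
proof -
 assume a: "mor k l f" "a \<in> \<B> 1"
 have "(k + 1 + (l + 1)) div 2 = (k + l) div 2 + 1" by simp
 thus ?thesis using a unfolding mor_def dag_def by (simp only: adj_beside)
qed

lemma dag_strands: "dag k k (str k) = str k" by (simp add: dag_def adj_strands)

lemma dag_linear: "mor k l f ==> mor k l g ==> dag k l (f + g) = dag k l f + dag k l g" "mor k l f ==> dag k l (scl c f) = scl (cnj c) (dag k l f)"
 unfolding mor_def dag_def by (simp_all add: adj_add adj_scale)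

lemma dag_diff: "mor k l f ==> mor k l g ==> dag k l (f - g) = dag k l f - dag k l g"
 using dag_linear(1)[of k l "f - g" g] mor_linear(4)[of k l f g] by (simp add: eq_diff_eq)

definition unital :: "nat => nat => bool" where
 "unital k l \<longleftrightarrow> (ALL f. mor k l f --> stack \<P> k l l (strands \<P> l) f = f & stack \<P> k k l f (strands \<P> k) = f)"

lemma unital_square: "unital n n" unfolding unital_def
proof (intro allI impI conjI)
 fix f assume f: "mor n n f"
 show "cmp n (str n) f = f" using f by (intro stack_unit) (simp add: mor_square)
 have "mor n n (dag n n f)" using mor_dag f by simp
 hence "cmp n (str n) (dag n n f) = dag n n f" by (intro stack_unit) (simp add: mor_square)
 hence "dag n n (cmp n (str n) (dag n n f)) = f" using dag_dag[OF f] by simp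
 thus "cmp n f (str n) = f" using dag_stack[OF mor_dag[OF f] mor_strands] dag_dag[OF f] by (simp add: dag_strands)
qed

lemma unital_bend: assumes g: "mor k (l + 1) g" shows "stk k (l + 1) (l + 1) (str (l + 1)) g = stk (k + 1) (k + 1) l (stk (k + 1) l l (str l) g) (str (k + 1))"
  "stk (k + 1) (k + 1) l g (str (k + 1)) = stk k (l + 1) (l + 1) (str (l + 1)) (stk k k (l + 1) g (str k))"
proof -
 have *: "stk k (l + 1) (l + 1) (str (l + 1)) g = stk (k + 1) (k + 1) l (stk (k + 1) l l (str l) g) (str (k + 1))"
  if g: "mor k (l + 1) g" for k l g
  using bend[OF g mor_strands strands_in] beside_tensor[OF strands_in strands_in, of l] tensor_strands[of l] tensor_strands[of k] rotation_strand by simp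
 thus "stk k (l + 1) (l + 1) (str (l + 1)) g = stk (k + 1) (k + 1) l (stk (k + 1) l l (str l) g) (str (k + 1))" using g by blast
 define h where "h = dag (k + 1) l g"
 have g': "mor (k + 1) l g" by (rule mor_shift(1)[OF g])
 have h: "mor l (k + 1) h" unfolding h_def by (rule mor_dag[OF g'])
 have h': "mor (l + 1) k h" by (rule mor_shift(1)[OF h])
 have dh: "dag l (k + 1) h = g" "dag (l + 1) k h = g" unfolding h_def using dag_dag(1)[OF g'] dag_shape[of "l + 1" k l "k + 1"] by simp_all
 have "dag l (k + 1) (stk l (k + 1) (k + 1) (str (k + 1)) h) =
   dag (l + 1) k (stk (l + 1) (l + 1) k (stk (l + 1) k k (str k) h) (str (l + 1)))" using *[OF h] dag_shape[of "l + 1" k l "k + 1"] by simp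
 thus "stk (k + 1) (k + 1) l g (str (k + 1)) = stk k (l + 1) (l + 1) (str (l + 1)) (stk k k (l + 1) g (str k))"
  unfolding dag_stack[OF h mor_strands] dag_stack[OF mor_strands mor_stack[OF h' mor_strands]] dag_stack[OF h' mor_strands] dag_strands dh .
qed

text \<open>Bending the last boundary point from the bottom to the top turns the unit laws of one shape into those of the next one.\<close>

lemma unital_step: "unital (k + 1) l \<longleftrightarrow> unital k (l + 1)"
proof
 assume u: "unital (k + 1) l"
 have 1: "stk k (l + 1) (l + 1) (str (l + 1)) g = g" if g: "mor k (l + 1) g" for g using unital_bend(1)[OF g] u mor_shift(1)[OF g] by (simp add: unital_def)
 have "stk k k (l + 1) g (str k) = g" if g: "mor k (l + 1) g" for g
  using unital_bend(2)[OF g] u mor_shift(1)[OF g] 1[OF mor_stack[OF mor_strands g]] by (simp add: unital_def)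
 thus "unital k (l + 1)" using 1 by (simp add: unital_def)
next
 assume u: "unital k (l + 1)"
 have 1: "stk (k + 1) (k + 1) l g (str (k + 1)) = g" if g: "mor (k + 1) l g" for g
  using unital_bend(2)[OF mor_shift(2)[OF g]] u mor_shift(2)[OF g] by (simp add: unital_def)
 have "stk (k + 1) l l (str l) g = g" if g: "mor (k + 1) l g" for g
  using unital_bend(1)[OF mor_shift(2)[OF g]] u mor_shift(2)[OF g] 1[OF mor_stack[OF g mor_strands]] by (simp add: unital_def)
 thus "unital (k + 1) l" using 1 by (simp add: unital_def)
qed

lemma unital_all: "even (k + l) ==> unital k l"
proof -
 assume e: "even (k + l)"
 then obtain n where n: "k + l = 2 * n" by (elim evenE)
 have 1: "j <= n ==> unital (n - j) (n + j) & unital (n + j) (n - j)" for j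
 proof (induction j)
  case (Suc j)
  hence "n - j = (n - Suc j) + 1" by simp
  thus ?case using Suc unital_step[of "n - Suc j" "n + j"] unital_step[of "n + j" "n - Suc j"] by auto
 qed (simp add: unital_square)
 show ?thesis
 proof (cases "k <= l")
  case True
  hence "n - (l - n) = k" "n + (l - n) = l" "l - n <= n" using n by arith+
  thus ?thesis using 1[of "l - n"] by simp
 next
  case False
  hence "n - (k - n) = l" "n + (k - n) = k" "k - n <= n" using n by arith+
  thus ?thesis using 1[of "k - n"] by simp
 qed
qed

lemma unit_left: "mor k l f ==> stk k l l (str l) f = f" and unit_right: "mor k l f ==> stk k k l f (str k) = f"
 using unital_all[of k l] by (auto simp: mor_def unital_def)

text \<open>For a strand next to a diagram the rule for bends has no box to turn, and just changes the shape of the other factor.\<close>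

lemma beside_strand_left: assumes g: "mor k (l + 1) g" and y: "mor l m y" shows "stk k (l + 1) (m + 1) (bes l m y wire) g = stk (k + 1) l m y g"
 using bend[OF g y strands_in] unit_right[OF mor_stack[OF mor_shift(1)[OF g] y]] tensor_strands[of k] rotation_strand by simp

lemma beside_strand_right: assumes h: "mor (l + 1) k h" and w: "mor m l w" shows "stk (m + 1) (l + 1) k h (bes m l w wire) = stk m l (k + 1) h w"
proof -
 have h': "mor l (k + 1) h" by (rule mor_shift(2)[OF h])
 have d: "dag l (k + 1) = dag (l + 1) k" "dag m (k + 1) = dag (m + 1) k" by (rule dag_shape; simp)+
 have b: "mor (m + 1) (l + 1) (bes m l w wire)" by (rule mor_beside[OF w strands_in])
 let ?T1 = "stk (m + 1) (l + 1) k h (bes m l w wire)"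
 have "stk k (l + 1) (m + 1) (bes l m (dag m l w) wire) (dag (l + 1) k h) = stk (k + 1) l m (dag m l w) (dag (l + 1) k h)"
  by (rule beside_strand_left[OF mor_dag[OF h] mor_dag[OF w]])
 moreover have "dag (m + 1) k ?T1 =
   stk k (l + 1) (m + 1) (bes l m (dag m l w) wire) (dag (l + 1) k h)" using dag_stack[OF b h] dag_beside[OF w strands_in] adj_strands[of 1] by simp
 moreover have "dag m (k + 1) (stk m l (k + 1) h w) = stk (k + 1) l m (dag m l w) (dag (l + 1) k h)" using dag_stack[OF w h'] d by simp
 ultimately have "dag (m + 1) k ?T1 = dag (m + 1) k (stk m l (k + 1) h w)" using d by simp
 thus ?thesis using dag_dag(2)[OF mor_stack[OF b h]] dag_dag(2)[OF mor_shift(1)[OF mor_stack[OF w h']]] by metis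
qed

lemma beside_strand: assumes w: "mor k l w" shows "bes k l w wire = stk (k + 2) k l w (str (k + 1))"
proof -
 have "mor (k + 1) (k + 1) (str (k + 1))" by (rule mor_strands)
 from beside_strand_left[OF this w] show ?thesis using unit_right[OF mor_beside[OF w strands_in]] by simp
qed

lemma beside_strand_stack: assumes w: "mor k l w" and v: "mor l m v"
 shows "stk (k + 1) (l + 1) (m + 1) (bes l m v wire) (bes k l w wire) = bes k m (stk k l m v w) wire"
proof -
 have s: "mor (k + 2) k (str (k + 1))" by (rule mor_shape[OF mor_strands[of "k + 1"]]) simp
 have "stk (k + 1) (l + 1) (m + 1) (bes l m v wire) (bes k l w wire) = stk (k + 1 + 1) l m v (bes k l w wire)"
  by (rule beside_strand_left[OF mor_beside[OF w strands_in] v])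
 also have "\<dots> = stk (k + 2) l m v (stk (k + 2) k l w (str (k + 1)))" using beside_strand[OF w] by simp
 also have "\<dots> = stk (k + 2) k m (stk k l m v w) (str (k + 1))" by (rule assoc[OF s w v])
 also have "\<dots> = bes k m (stk k l m v w) wire" by (rule beside_strand[OF mor_stack[OF w v], symmetric])
 finally show ?thesis .
qed

subsection \<open>Traces of composites do not depend on the shape\<close>

text \<open>The innermost closing strand on the left hand side is one of the strands between the two factors on the right hand side.\<close>

lemma trace_shift: assumes f: "mor (k + 1) l f" and g: "mor l (k + 1) g" shows "rtr (k + 1) (stk (k + 1) l (k + 1) g f) = rtr k (stk k (l + 1) k g f)"
proof -
 let ?z = "stk (k + 1) l (k + 1) g f"
 have z: "mor (k + 1) (k + 1) ?z" by (rule mor_stack[OF f g])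
 have f': "mor k (l + 1) f" by (rule mor_shift(2)[OF f])
 have u: "mor k (k + 1 + 1) (str (k + 1))" "mor (k + 1 + 1) k (str (k + 1))" by (rule mor_shape[OF mor_strands[of "k + 1"]]; simp)+
 let ?T1 = "bes l (k + 1) g wire"
 have "stk k (k + 1 + 1) (k + 1 + 1) (ten (k + 1) 1 ?z wire) (str (k + 1)) = cmp (k + 1) ?z (str (k + 1))"
  using beside_strand_left[OF u(1) z] beside_tensor[of ?z "k + 1" "wire"] z strands_in[of 1] by (simp only: mor_square)
 also have "\<dots> = ?z" by (rule unit_right[OF z])
 also have "\<dots> = stk k (l + 1) (k + 1 + 1) ?T1 f" by (rule beside_strand_left[OF f' g, symmetric])
 finally have 1: "stk k (k + 2) (k + 2) (ten (k + 1) 1 ?z wire) (str (k + 1)) =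
  stk k (l + 1) (k + 1 + 1) ?T1 f" by simp
 have "stk k (k + 1 + 1) k (str (k + 1)) (stk k (l + 1) (k + 1 + 1) ?T1 f) =
  stk k (l + 1) k (stk (l + 1) (k + 1 + 1) k (str (k + 1)) ?T1) f" by (rule assoc[OF f' mor_beside[OF g strands_in] u(2)])
 also have "stk (l + 1) (k + 1 + 1) k (str (k + 1)) ?T1 = stk l (k + 1) (k + 1) (str (k + 1)) g" by (rule beside_strand_right[OF u(2) g])
 also have "\<dots> = g" by (rule unit_left[OF g])
 finally have 2: "stk k (k + 2) k (str (k + 1)) (stk k (l + 1) (k + 1 + 1) ?T1 f) = stk k (l + 1) k g f" by simp
 show ?thesis using trace_bend[of ?z k] z unfolding mor_square 1 2 by blast
qed

lemma trace_shape: assumes f: "mor k l f" and g: "mor l k g" and e: "k' + l' = k + l" shows "rtr k' (stk k' l' k' g f) = rtr k (stk k l k g f)"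
proof -
 have *: "rtr k (stk k l k g f) = rtr (k + l) (stk (k + l) 0 (k + l) g f)"
  if "mor k l f" "mor l k g" for k l using that
 proof (induction l arbitrary: k)
  case (Suc l)
  have m: "mor (k + 1) l f" "mor l (k + 1) g" by (rule mor_shape[OF Suc.prems(1)] mor_shape[OF Suc.prems(2)]; simp)+
  have "rtr k (stk k (Suc l) k g f) = rtr (k + 1) (stk (k + 1) l (k + 1) g f)" using trace_shift[OF m] by simp
  also have "\<dots> = rtr (k + 1 + l) (stk (k + 1 + l) 0 (k + 1 + l) g f)" by (rule Suc.IH[OF m])
  finally show ?case by simp
 qed simp
 have "mor k' l' f" "mor l' k' g" by (rule mor_shape[OF f] mor_shape[OF g]; use e in simp)+
 thus ?thesis using *[OF f g] *[of k' l'] e by simp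
qed

subsection \<open>The trace functional\<close>

lemma dim_zero_space: "dim {0} = 0"
proof -
 obtain B where "B <= {0}" "independent B" "{0} <= span B" "card B = dim {0}" using basis_exists[of "{0}"] by blast
 moreover have "B = {}" using calculation(1,2) dependent_zero by blast
 ultimately show ?thesis by simp
qed

lemma dim_one_generated: assumes "subspace S" "dim S = 1" "e \<in> S" "e ~= 0" "x \<in> S" shows "EX c. x = scl c e"
proof -
 obtain B where B: "B <= S" "independent B" "S <= span B" "card B = dim S" using basis_exists[of S] by blast
 then obtain b where b: "B = {b}" using assms(2) card_1_singletonE by metis
 obtain c where c: "e = scl c b" using assms(3) B(3) b by (auto simp: span_singleton)
 obtain d where d: "x = scl d b" using assms(5) B(3) b by (auto simp: span_singleton)
 have "c ~= 0" using assms(4) c by auto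
 hence "x = scl (d / c) e" using c d by simp
 thus ?thesis ..
qed

lemma dim_closed: "dim (\<B> 0) = 1" using spa unfolding unshaded_subfactor_planar_algebra_def by (elim conjE)

lemma empty_nonzero: "str 0 ~= 0"
proof
 assume z: "str 0 = 0"
 have "x = 0" if "x \<in> \<B> 0" for x using stack_unit[OF that] stack_zero(1)[of 0 0 x 0] that z by (simp add: mor_square)
 hence "\<B> 0 = {0}" using box_closed(3)[of 0] by blast
 thus False using dim_closed dim_zero_space by simp
qed

lemma closed_scalar: "x \<in> \<B> 0 ==> x = scl (scalar_of \<P> x) (str 0)"
proof -
 assume "x \<in> \<B> 0"
 then obtain c where c: "x = scl c (str 0)" using dim_one_generated[OF subspace_box dim_closed strands_in empty_nonzero] by blast
 have "scalar_of \<P> x = c" unfolding scalar_of_def using c empty_nonzero by (intro the_equality) auto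
 thus ?thesis using c by simp
qed

lemma scalar_of_scale: "scalar_of \<P> (scl c (str 0)) = c" unfolding scalar_of_def using empty_nonzero by (intro the_equality) auto

definition tr :: "nat => 'a => complex" where "tr k f = scalar_of \<P> (right_trace \<P> k f)"

lemma tr_eq: "f \<in> \<B> k ==> rtr k f = scl (tr k f) (str 0)" unfolding tr_def by (rule closed_scalar[OF right_trace_in])

lemma tr_unique: "rtr k f = scl c (str 0) ==> tr k f = c" by (simp add: tr_def scalar_of_scale)

lemma tr_add: "f \<in> \<B> k ==> g \<in> \<B> k ==> tr k (f + g) = tr k f + tr k g" by (rule tr_unique) (simp add: right_trace_linear(1) tr_eq scale_left_distrib)

lemma tr_scale: "f \<in> \<B> k ==> tr k (scl c f) = c * tr k f" by (rule tr_unique) (simp add: right_trace_linear(2) tr_eq)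

lemma tr_diff: "f \<in> \<B> k ==> g \<in> \<B> k ==> tr k (f - g) = tr k f - tr k g" using tr_add[of "f - g" k g] box_closed(4)[of f k g] by simp

lemma tr_zero: "tr k 0 = 0" using tr_scale[of 0 k 0] box_closed(3) by simp

lemma tr_positive: assumes f: "mor k l f" "f ~= 0" shows "\<exists>t>0. tr k (stk k l k (dag k l f) f) = complex_of_real t"
proof -
 define n where "n = (k + l) div 2"
 have e: "even (k + l)" and fn: "f \<in> \<B> n" using f(1) by (simp_all add: mor_def n_def)
 have "2 * n = k + l" unfolding n_def using e by (rule dvd_mult_div_cancel)
 hence n: "n + n = k + l" "f \<in> \<B> n" using fn by simp_all
 let ?T1 = "stk k l k (dag k l f) f"
 have "rtr n (cmp n (dag k l f) f) = rtr k ?T1" by (rule trace_shape[OF f(1) mor_dag[OF f(1)] n(1)])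
 hence "box_inner \<P> n f f = tr k ?T1" by (simp add: box_inner_def mult_def tr_def dag_def n_def)
 moreover have "Im (box_inner \<P> n f f) = 0 & 0 < Re (box_inner \<P> n f f)" using spa n(2) f(2) unfolding unshaded_subfactor_planar_algebra_def by blast
 ultimately have "tr k ?T1 = complex_of_real (Re (box_inner \<P> n f f))" "0 < Re (box_inner \<P> n f f)" by (simp_all add: complex_eq_iff)
 thus ?thesis by blast
qed

lemma tr_empty: "tr 0 (str 0) = 1" by (rule tr_unique) (simp add: right_trace_0 strands_in)

lemma tensor_scale_right: assumes p: "p \<in> \<B> k" and a: "a \<in> \<B> l" shows "ten k l p (scl c a) = scl c (ten k l p a)"
proof -
 define U V where "U = juxt_left k l" and "V = juxt_right k l"
 have neq: "V ~= U" unfolding U_def V_def juxt_left_def juxt_right_def by (rule lbox_neq) simp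
 have inn: "inner (juxt_tangle k l) = {U, V}" by (simp add: juxt_tangle_def U_def V_def)
 have pl: "planar_tangle (juxt_tangle k l)" unfolding juxt_tangle_row by (rule planar_row[OF juxt_row_ok]) simp_all
 have i: "box_index (juxt_tangle k l) U = k" "box_index (juxt_tangle k l) V = l"
  using box_index_row(2,3)[OF juxt_row_ok[of k l]] unfolding juxt_tangle_row U_def V_def juxt_left_def juxt_right_def by simp_all
 have lab: "labelling \<P> (juxt_tangle k l) (%B. if B = U then p else x)" if "x \<in> \<B> l" for x using that neq i p by (auto simp: labelling_def inn)
 let ?f = "%B. if B = U then p else a"
 have lo: "act \<P> (juxt_tangle k l) (?f(V := z)) = ten k l p z" if "z \<in> \<B> l" for z
  unfolding tensor_def U_def[symmetric] by (rule act_cong[OF pl lab[OF that], symmetric]) (use neq in "auto simp: inn")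
 have V: "V \<in> inner (juxt_tangle k l)" by (simp add: inn)
 show ?thesis using act_scale[OF pl lab[OF a] V, unfolded i, OF a] lo[OF a] lo[OF box_closed(2)[OF a]] by simp
qed

lemma tr_tensor: assumes p: "p \<in> \<B> k" and a: "a \<in> \<B> 1" shows "tr (k + 1) (ten k 1 p a) = tr k p * tr 1 a"
proof (rule tr_unique)
 have "rtr (k + 1) (ten k 1 p a) = rtr k (ten k 0 p (rtr 1 a))" by (rule trace_tensor[OF p a])
 also have "\<dots> = rtr k (scl (tr 1 a) p)" using tr_eq[OF a] tensor_scale_right[OF p strands_in] tensor_empty_right[OF p] by simp
 also have "\<dots> = scl (tr k p * tr 1 a) (str 0)" using right_trace_linear(2)[OF p] tr_eq[OF p] by (simp add: mult.commute)
 finally show "rtr (k + 1) (ten k 1 p a) = scl (tr k p * tr 1 a) (str 0)" .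
qed

subsection \<open>Rotation of one strand boxes\<close>

lemma rotation_stack: assumes a: "a \<in> \<B> 1" shows "rot a = stk 0 2 2 (ten 1 1 wire a) wire"
proof -
 have g: "mor 0 (1 + 1) wire" by (rule mor_shape[OF mor_strands[of 1]]) simp
 have "stk 0 (1 + 1) (1 + 1) (bes 1 1 wire a) wire =
   stk (0 + 1) (0 + 1) 1 (stk (0 + 1) 1 1 wire wire) (ten 0 1 (str 0) (rot a))" by (rule bend[OF g mor_strands a])
 also have "\<dots> = rot a" using tensor_empty_left[OF rotation_in[OF a]] unit_left[OF mor_strands[of 1]] unit_left[of 1 1 "rot a"] rotation_in[OF a]
  by (simp add: mor_square)
 finally show ?thesis using beside_tensor[OF strands_in a] by (simp add: numeral_2_eq_2)
qed

lemma rotation_bend: assumes a: "a \<in> \<B> 1" and g: "g \<in> \<B> 1" shows "stk 0 2 2 (ten 1 1 wire a) g = cmp 1 g (rot a)"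
proof -
 have g': "mor 0 (1 + 1) g" using g by (simp add: mor_def)
 have "stk 0 (1 + 1) (1 + 1) (bes 1 1 wire a) g =
   stk (0 + 1) (0 + 1) 1 (stk (0 + 1) 1 1 wire g) (ten 0 1 (str 0) (rot a))" by (rule bend[OF g' mor_strands a])
 thus ?thesis using beside_tensor[OF strands_in a] tensor_empty_left[OF rotation_in[OF a]] unit_left[of 1 1 g] g by (simp add: mor_square numeral_2_eq_2)
qed

lemma rotation_linear: assumes a: "a \<in> \<B> 1" and b: "b \<in> \<B> 1" shows "rot (a + b) = rot a + rot b"
proof -
 have X: "wire \<in> \<B> ((1 + 1) div 2)" using strands_in[of 1] by simp
 have t: "ten 1 1 wire (a + b) = ten 1 1 wire a + ten 1 1 wire b"
  using beside_linear(1)[of 1 1 "wire" a b] beside_tensor[OF strands_in[of 1]] a b box_closed(1)[OF a b] X by simp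
 have m: "mor 2 2 (ten 1 1 wire c)" if "c \<in> \<B> 1" for c using mor_tensor[OF strands_in[of 1] that] by (simp only: one_add_one)
 have g: "mor 0 2 wire" by (rule mor_shape[OF mor_strands[of 1]]) simp
 show ?thesis unfolding rotation_stack[OF a] rotation_stack[OF b] rotation_stack[OF box_closed(1)[OF a b]] t by (rule stack_add_left[OF g m[OF a] m[OF b]])
qed

lemma rotation_mult: assumes a: "a \<in> \<B> 1" and b: "b \<in> \<B> 1" shows "rot (cmp 1 a b) = cmp 1 (rot b) (rot a)"
proof -
 have g: "mor 0 2 wire" by (rule mor_shape[OF mor_strands[of 1]]) simp
 have m: "mor 2 2 (ten 1 1 wire c)" if "c \<in> \<B> 1" for c using mor_tensor[OF strands_in[of 1] that] by (simp only: one_add_one)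
 have ab: "cmp 1 a b \<in> \<B> 1" using mor_stack[of 1 1 b 1 a] a b by (simp add: mor_square)
 have "ten 1 1 wire (cmp 1 a b) = cmp 2 (ten 1 1 wire a) (ten 1 1 wire b)"
  using interchange[OF strands_in[of 1] strands_in[of 1] a b] unit_left[OF mor_strands[of 1]] by (simp add: numeral_2_eq_2)
 hence "rot (cmp 1 a b) = stk 0 2 2 (ten 1 1 wire a) (stk 0 2 2 (ten 1 1 wire b) wire)" unfolding rotation_stack[OF ab] using assoc[OF g m[OF b] m[OF a]] by simp
 also have "\<dots> = stk 0 2 2 (ten 1 1 wire a) (rot b)" using rotation_stack[OF b] by simp
 also have "\<dots> = cmp 1 (rot b) (rot a)" by (rule rotation_bend[OF a rotation_in[OF b]])
 finally show ?thesis .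
qed

lemma rotation_injective: assumes a: "a \<in> \<B> 1" and z: "rot a = 0" shows "a = 0"
proof -
 have g: "mor 1 (0 + 1) wire" using mor_strands[of 1] by simp
 have g2: "mor 2 0 wire" by (rule mor_shape[OF mor_strands[of 1]]) simp
 have "stk 1 (0 + 1) (0 + 1) (bes 0 0 (str 0) a) wire =
  stk (1 + 1) (1 + 1) 0 (stk (1 + 1) 0 0 (str 0) wire) (ten 1 1 wire (rot a))" by (rule bend[OF g mor_strands a])
 moreover have "bes 0 0 (str 0) a = a" using beside_tensor[OF strands_in[of 0] a] tensor_empty_left[OF a] by simp
 moreover have "cmp 1 a wire = a" using unit_right[of 1 1 a] a by (simp add: mor_square)
 moreover have "ten 1 1 wire 0 = 0" using tensor_scale_right[OF strands_in[of 1] box_closed(3)[of 1], of 0] by simp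
 moreover have "stk 2 2 0 (stk 2 0 0 (str 0) wire) 0 = 0" by (rule stack_zero(2)[OF mor_stack[OF g2 mor_strands]]) simp
 ultimately show ?thesis using z by (simp add: numeral_2_eq_2)
qed

text \<open>A saddle is a cup above a cap; with the labels absorbed by bending, it is a composite through the shape without points.\<close>

lemma saddle_eq: assumes x: "x \<in> \<B> 1" and y: "y \<in> \<B> 1" shows "saddle \<P> x y = stk 2 0 2 x y"
proof -
 have g: "mor 0 (1 + 1) wire" "mor (1 + 1) 0 wire" by (rule mor_shape[OF mor_strands[of 1]]; simp)+
 have m: "mor 1 1 x" "mor 1 1 y" using x y by (simp_all add: mor_square)
 have "stk 0 2 2 (ten 1 1 x wire) wire = x" using beside_strand_left[OF g(1) m(1)] beside_tensor[OF x strands_in] unit_right[OF m(1)] by (simp add: numeral_2_eq_2)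
 moreover have "stk 2 2 0 wire (ten 1 1 y wire) = y"
  using beside_strand_right[OF g(2) m(2)] beside_tensor[OF y strands_in] unit_left[OF m(2)] by (simp add: numeral_2_eq_2)
 ultimately show ?thesis using saddle_stack[OF x y] by simp
qed

end

section \<open>Projections and the spaces between them\<close>

context subfactor_alg begin

lemma vector_space_pair: "vector_space_pair (scl) (scl)" by (rule vector_space_pair.intro[OF vs vs])

lemma dim_linear_bijection: assumes S: "subspace S" and T: "phi ` S = S'" and add: "!!x y. x \<in> S ==> y \<in> S ==> phi (x + y) = phi x + phi y"
  and scal: "!!c x. x \<in> S ==> phi (scl c x) = scl c (phi x)" and inj: "inj_on phi S" shows "dim S' = dim S"
proof -
 interpret vp: vector_space_pair "scl" "scl" by (rule vector_space_pair)
 obtain B where B: "B <= S" "independent B" "S <= span B" "card B = dim S" using basis_exists[of S] by blast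
 have sp: "span B = S" using B span_minimal[OF B(1) S] by blast
 obtain g where g: "Vector_Spaces.linear (scl) (scl) g" "\<forall>x\<in>B. g x = phi x" using vp.linear_independent_extend[OF B(2)] by blast
 have gS: "x \<in> S & g x = phi x" if x: "x \<in> span B" for x using x
 proof (induction rule: span_induct_alt)
  case base
  have "0 \<in> S" by (rule subspace_0[OF S])
  moreover have "phi 0 = 0" using scal[OF `0 \<in> S`, of 0] by simp
  ultimately show ?case using vp.linear_0[OF g(1)] by simp
 next
  case (step c x y)
  have x: "x \<in> S" using step(1) B(1) by blast
  have cx: "scl c x \<in> S" by (rule subspace_scale[OF S x])
  have "g (scl c x + y) = scl c (g x) + g y" using vp.linear_add[OF g(1)] vp.linear_scale[OF g(1)] by simp
  also have "\<dots> = phi (scl c x + y)" using g(2) step(1,2) add[OF cx] scal[OF x] by simp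
  finally show ?case using subspace_add[OF S cx] step(2) by simp
 qed
 have "inj_on g (span B)" using inj gS sp unfolding inj_on_def by metis
 hence i: "independent (g ` B)" "card (g ` B) = card B"
  using vp.linear_independent_injective_image[OF g(1) B(2)] inj_on_subset[OF _ span_superset] card_image by blast+
 have "span (g ` B) = g ` span B" by (rule vp.linear_span_image[OF g(1)])
 also have "\<dots> = phi ` S" unfolding sp using gS sp by (intro image_cong) auto
 finally have s: "span (g ` B) = S'" using T by simp
 hence "dim S' = card (g ` B)" using i by (intro dim_unique[of "g ` B"]) (auto simp: span_base)
 thus ?thesis using i B by simp
qed

definition proj :: "nat => 'a => bool" where "proj k p \<longleftrightarrow> mor k k p & stack \<P> k k k p p = p & dag k k p = p"

lemma proj_is_projection: "is_projection \<P> k p \<longleftrightarrow> proj k p" by (simp add: is_projection_def proj_def mor_square mult_def dag_def)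

definition hom :: "nat => 'a => nat => 'a => 'a => bool" where "hom k p l q f \<longleftrightarrow> mor k l f & stack \<P> k l l q f = f & stack \<P> k k l f p = f"

lemma Hom_iff: assumes p: "proj k p" and q: "proj l q" and e: "even (k + l)" shows "f \<in> Hom \<P> (k, p) (l, q) \<longleftrightarrow> hom k p l q f"
proof
 have pm: "mor k k p" "mor l l q" "cmp k p p = p" "cmp l q q = q" using p q by (simp_all add: proj_def)
 assume "f \<in> Hom \<P> (k, p) (l, q)"
 hence f: "mor k l f" "stk k l l q (stk k k l f p) = f" using e by (auto simp: Hom_def mor_def)
 have fp: "mor k l (stk k k l f p)" by (rule mor_stack[OF pm(1) f(1)])
 have 1: "stk k l l q f = f" using assoc[OF fp pm(2) pm(2)] f(2) pm(4) by simp
 have "stk k k l f p = stk k k l (stk k l l q (stk k k l f p)) p" using f(2) by simp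
 also have "\<dots> = stk k l l q (stk k k l (stk k k l f p) p)" by (rule assoc[OF pm(1) fp pm(2), symmetric])
 also have "stk k k l (stk k k l f p) p = stk k k l f p" using assoc[OF pm(1) pm(1) f(1)] pm(3) by simp
 finally show "hom k p l q f" using f 1 by (simp add: hom_def)
next
 assume "hom k p l q f"
 thus "f \<in> Hom \<P> (k, p) (l, q)" using e by (simp add: hom_def Hom_def mor_def)
qed

lemma Hom_odd: "odd (k + l) ==> Hom \<P> (k, p) (l, q) = {0}" by (auto simp: Hom_def)

lemma proj_mor: "proj k p ==> mor k k p" "proj k p ==> cmp k p p = p" "proj k p ==> dag k k p = p" "proj k p ==> p \<in> \<B> k"
 by (simp_all add: proj_def mor_square)

lemma hom_mor: "hom k p l q f ==> mor k l f" "hom k p l q f ==> stk k l l q f = f" "hom k p l q f ==> stk k k l f p = f" by (simp_all add: hom_def)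

lemma hom_comp: assumes f: "hom k p l q f" and g: "hom l q m r g" and p: "proj k p" and r: "proj m r" shows "hom k p m r (stk k l m g f)"
 using assoc[OF hom_mor(1)[OF f] hom_mor(1)[OF g] proj_mor(1)[OF r]] assoc[OF proj_mor(1)[OF p] hom_mor(1)[OF f] hom_mor(1)[OF g]]
  hom_mor[OF f] hom_mor[OF g] mor_stack[OF hom_mor(1)[OF f] hom_mor(1)[OF g]] by (simp add: hom_def)

lemma hom_dag: assumes f: "hom k p l q f" and p: "proj k p" and q: "proj l q" shows "hom l q k p (dag k l f)"
 using dag_stack[OF hom_mor(1)[OF f] proj_mor(1)[OF q]] dag_stack[OF proj_mor(1)[OF p] hom_mor(1)[OF f]]
  hom_mor[OF f] proj_mor(3)[OF p] proj_mor(3)[OF q] mor_dag[OF hom_mor(1)[OF f]] by (simp add: hom_def)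

lemma hom_proj: "proj k p ==> hom k p k p p" by (simp add: hom_def proj_def)

lemma hom_linear: assumes p: "proj k p" and q: "proj l q" and f: "hom k p l q f" shows "hom k p l q g ==> hom k p l q (f + g)" "hom k p l q (scl c f)"
proof -
 note m = proj_mor(1)[OF p] proj_mor(1)[OF q]
 show "hom k p l q (scl c f)"
  using hom_mor[OF f] mor_linear(2)[OF hom_mor(1)[OF f]] stack_scale_right[OF hom_mor(1)[OF f] m(2)] stack_scale_left[OF m(1) hom_mor(1)[OF f]]
  by (simp add: hom_def)
 assume g: "hom k p l q g"
 show "hom k p l q (f + g)" using hom_mor[OF f] hom_mor[OF g] mor_linear(1)[OF hom_mor(1)[OF f] hom_mor(1)[OF g]]
   stack_add_right[OF hom_mor(1)[OF f] hom_mor(1)[OF g] m(2)] stack_add_left[OF m(1) hom_mor(1)[OF f] hom_mor(1)[OF g]] by (simp add: hom_def)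
qed

lemma hom_zero: "even (k + l) ==> proj k p ==> proj l q ==> hom k p l q 0" using stack_zero mor_linear(3) by (simp add: hom_def proj_def)

lemma subspace_Hom: assumes p: "proj k p" and q: "proj l q" shows "subspace (Hom \<P> (k, p) (l, q))"
proof (cases "even (k + l)")
 case True
 show ?thesis unfolding subspace_def using hom_zero[OF True p q] hom_linear[OF p q] by (auto simp: Hom_iff[OF p q True])
next
 case False
 thus ?thesis by (simp add: Hom_odd subspace_0 subspace_def)
qed

subsection \<open>Isomorphism\<close>

definition iso :: "nat => 'a => nat => 'a => 'a => bool" where
 "iso k p l q u \<longleftrightarrow> proj k p & proj l q & hom k p l q u & stack \<P> k l k (dag k l u) u = p & stack \<P> l k l u (dag k l u) = q"

lemma iso_projections_iff: assumes p: "proj k p" and q: "proj l q" shows "iso_projections \<P> (k, p) (l, q) \<longleftrightarrow> (EX u. iso k p l q u)"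
proof (cases "even (k + l)")
 case True
 thus ?thesis using p q unfolding iso_projections_def iso_def prod.case dag_def Bex_def Hom_iff[OF p q True] by blast
next
 case False
 thus ?thesis by (auto simp: iso_projections_def iso_def hom_def mor_def)
qed

lemma isoD: assumes "iso k p l q u" shows "proj k p" "proj l q" "hom k p l q u" "hom l q k p (dag k l u)" "mor k l u" "mor l k (dag k l u)"
  "stk k l k (dag k l u) u = p" "stk l k l u (dag k l u) = q" "even (k + l)" using assms hom_dag[of k p l q u] by (auto simp: iso_def hom_def mor_def dest: mor_dag)

lemma iso_refl: "proj k p ==> iso k p k p p" by (simp add: iso_def hom_proj proj_def)

lemma iso_sym: "iso k p l q u ==> iso l q k p (dag k l u)"
proof -
 assume u: "iso k p l q u"
 note U = isoD[OF u]
 show "iso l q k p (dag k l u)" unfolding iso_def dag_dag(1)[OF U(5)] by (intro conjI U)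
qed

lemma iso_trans: assumes u: "iso k p l q u" and w: "iso l q m r w" shows "iso k p m r (stk k l m w u)"
proof -
 note U = isoD[OF u] note W = isoD[OF w]
 have d: "dag k m (stk k l m w u) = stk m l k (dag k l u) (dag l m w)" by (rule dag_stack[OF U(5) W(5)])
 have wu: "mor k m (stk k l m w u)" by (rule mor_stack[OF U(5) W(5)])
 let ?T1 = "stk m l k (dag k l u) (dag l m w)"
 have dd: "mor m k ?T1" by (rule mor_stack[OF W(6) U(6)])
 have "stk k m k ?T1 (stk k l m w u) = stk k l k (dag k l u) (stk k m l (dag l m w) (stk k l m w u))" by (rule assoc[OF wu W(6) U(6), symmetric])
 also have "stk k m l (dag l m w) (stk k l m w u) = stk k l l q u" using assoc[OF U(5) W(5) W(6)] W(7) by simp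
 also have "\<dots> = u" by (rule hom_mor(2)[OF U(3)])
 finally have 1: "stk k m k ?T1 (stk k l m w u) = p" using U(7) by simp
 have "stk m k m (stk k l m w u) ?T1 = stk m l m w (stk m k l u ?T1)" by (rule assoc[OF dd U(5) W(5), symmetric])
 also have "stk m k l u ?T1 = stk m l l q (dag l m w)" using assoc[OF W(6) U(6) U(5)] U(8) by simp
 also have "\<dots> = dag l m w" by (rule hom_mor(2)[OF W(4)])
 finally have 2: "stk m k m (stk k l m w u) ?T1 = r" using W(8) by simp
 show ?thesis using hom_comp[OF U(3) W(3) U(1) W(2)] U(1) W(2) 1 2 by (simp add: iso_def d)
qed

lemma proj_tensor: "proj k p ==> proj (k + 1) (ten k 1 p wire)"
 using beside_strand_stack[of k k p k p] dag_beside[of k k p "wire"] beside_tensor[of p k "wire"] mor_tensor[of p k "wire"]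
  adj_strands[of 1] strands_in[of 1] by (simp add: proj_def mor_square)

lemma iso_tensor: assumes u: "iso k p l q u" shows "iso (k + 1) (ten k 1 p wire) (l + 1) (ten l 1 q wire) (bes k l u wire)"
proof -
 note U = isoD[OF u]
 have t: "ten k 1 p wire = bes k k p wire" "ten l 1 q wire = bes l l q wire" using beside_tensor strands_in proj_mor(4)[OF U(1)] proj_mor(4)[OF U(2)] by simp_all
 have d: "dag (k + 1) (l + 1) (bes k l u wire) = bes l k (dag k l u) wire" using dag_beside[OF U(5) strands_in] adj_strands[of 1] by simp
 show ?thesis unfolding iso_def hom_def d t using proj_tensor[OF U(1), unfolded t] proj_tensor[OF U(2), unfolded t] mor_beside[OF U(5) strands_in]
   beside_strand_stack[OF U(5) proj_mor(1)[OF U(2)]] beside_strand_stack[OF proj_mor(1)[OF U(1)] U(5)] hom_mor[OF U(3)]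
   beside_strand_stack[OF U(5,6)] beside_strand_stack[OF U(6,5)] U(7,8) by simp
qed

lemma hom_dim_iso: assumes u: "iso k p k' p' u" and w: "iso l q l' q' w" shows "hom_dim \<P> (k', p') (l', q') = hom_dim \<P> (k, p) (l, q)"
proof (cases "even (k + l)")
 case True
 note U = isoD[OF u] note W = isoD[OF w]
 have e': "even (k' + l')" using U(9) W(9) True by presburger
 let ?a = "%f. stk k' l l' w (stk k' k l f (dag k k' u))"
 let ?b = "%f. stk k l' l (dag l l' w) (stk k k' l' f u)"
 have a: "hom k' p' l' q' (?a f)" if "hom k p l q f" for f by (rule hom_comp[OF hom_comp[OF U(4) that U(2) W(1)] W(3) U(2) W(2)])
 have b: "hom k p l q (?b f)" if "hom k' p' l' q' f" for f by (rule hom_comp[OF hom_comp[OF U(3) that U(1) W(2)] W(4) U(1) W(1)])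
 have ba: "?b (?a f) = f" if f: "hom k p l q f" for f
 proof -
  note m = hom_mor(1)[OF f] mor_stack[OF U(6) hom_mor(1)[OF f]]
  have "stk k k' l' (?a f) u = stk k l l' w (stk k k' l (stk k' k l f (dag k k' u)) u)" by (rule assoc[OF U(5) m(2) W(5), symmetric])
  also have "stk k k' l (stk k' k l f (dag k k' u)) u = stk k k l f p" using assoc[OF U(5) U(6) m(1)] U(7) by simp
  also have "\<dots> = f" by (rule hom_mor(3)[OF f])
  finally have "?b (?a f) = stk k l l q f" using assoc[OF m(1) W(5,6)] W(7) by simp
  thus ?thesis using hom_mor(2)[OF f] by simp
 qed
 have ab: "?a (?b f) = f" if f: "hom k' p' l' q' f" for f
 proof -
  note m = hom_mor(1)[OF f] mor_stack[OF U(5) hom_mor(1)[OF f]]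
  have "stk k' k l (?b f) (dag k k' u) = stk k' l' l (dag l l' w) (stk k' k l' (stk k k' l' f u) (dag k k' u))" by (rule assoc[OF U(6) m(2) W(6), symmetric])
  also have "stk k' k l' (stk k k' l' f u) (dag k k' u) = stk k' k' l' f p'" using assoc[OF U(6) U(5) m(1)] U(8) by simp
  also have "\<dots> = f" by (rule hom_mor(3)[OF f])
  finally have "?a (?b f) = stk k' l' l' q' f" using assoc[OF m(1) W(6,5)] W(8) by simp
  thus ?thesis using hom_mor(2)[OF f] by simp
 qed
 show ?thesis unfolding hom_dim_def
 proof (rule dim_linear_bijection[where phi = ?a])
  show "subspace (Hom \<P> (k, p) (l, q))" by (rule subspace_Hom[OF U(1) W(1)])
  note H = Hom_iff[OF U(1) W(1) True] and H' = Hom_iff[OF U(2) W(2) e']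
  show "?a ` Hom \<P> (k, p) (l, q) = Hom \<P> (k', p') (l', q')"
  proof (intro subset_antisym subsetI)
   fix f assume "f \<in> Hom \<P> (k', p') (l', q')"
   hence f: "hom k' p' l' q' f" by (simp add: H')
   show "f \<in> ?a ` Hom \<P> (k, p) (l, q)" using ab[OF f] b[OF f] by (intro image_eqI[of _ _ "?b f"]) (simp_all add: H)
  qed (use a in "auto simp: H H'")
  show "inj_on ?a (Hom \<P> (k, p) (l, q))" by (rule inj_on_inverseI[where g = ?b], rule ba) (simp add: H)
  fix f assume "f \<in> Hom \<P> (k, p) (l, q)"
  hence f: "mor k l f" by (simp add: H hom_def)
  show "?a (scl c f) = scl c (?a f)" for c using stack_scale_left[OF U(6) f] stack_scale_right[OF mor_stack[OF U(6) f] W(5)] by simp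
  fix g assume "g \<in> Hom \<P> (k, p) (l, q)"
  hence g: "mor k l g" by (simp add: H hom_def)
  show "?a (f + g) = ?a f + ?a g" using stack_add_left[OF U(6) f g] stack_add_right[OF mor_stack[OF U(6) f] mor_stack[OF U(6) g] W(5)] by simp
 qed
next
 case False
 hence "odd (k' + l')" using isoD(9)[OF u] isoD(9)[OF w] by presburger
 thus ?thesis using False by (simp add: hom_dim_def Hom_odd)
qed

subsection \<open>Minimal projections\<close>

definition minimal :: "nat => 'a => bool" where "minimal k p \<longleftrightarrow> proj k p & hom_dim \<P> (k, p) (k, p) = 1"

lemma minimal_projection_iff: "minimal_projection \<P> (k, p) \<longleftrightarrow> minimal k p" by (simp add: minimal_projection_def minimal_def proj_is_projection)

lemma minimal_proj: "minimal k p ==> proj k p" by (simp add: minimal_def)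

lemma minimal_nonzero: "minimal k p ==> p ~= 0"
proof
 assume m: "minimal k p" "p = 0"
 have p: "proj k p" by (rule minimal_proj[OF m(1)])
 have "f = 0" if "f \<in> Hom \<P> (k, p) (k, p)" for f
 proof -
  have f: "hom k p k p f" using that Hom_iff[OF p p] by simp
  show ?thesis using hom_mor(2)[OF f] stack_zero(1)[OF hom_mor(1)[OF f], of k] m(2) by simp
 qed
 moreover have "0 \<in> Hom \<P> (k, p) (k, p)" by (rule subspace_0[OF subspace_Hom[OF p p]])
 ultimately have "Hom \<P> (k, p) (k, p) = {0}" by blast
 thus False using m(1) dim_zero_space by (simp add: minimal_def hom_dim_def)
qed

lemma minimal_scalar: assumes m: "minimal k p" and f: "hom k p k p f" shows "EX c. f = scl c p"
proof (rule dim_one_generated)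
 have p: "proj k p" by (rule minimal_proj[OF m])
 show "subspace (Hom \<P> (k, p) (k, p))" by (rule subspace_Hom[OF p p])
 show "dim (Hom \<P> (k, p) (k, p)) = 1" using m by (simp add: minimal_def hom_dim_def)
 show "p \<in> Hom \<P> (k, p) (k, p)" "f \<in> Hom \<P> (k, p) (k, p)" using Hom_iff[OF p p] f hom_proj[OF p] by simp_all
qed (rule minimal_nonzero[OF m])

lemma minimal_iso: "minimal k p ==> iso k p l q u ==> minimal l q" using hom_dim_iso[of k p l q u k p l q u] isoD(2)[of k p l q u] by (simp add: minimal_def)

lemma tr_proj: "proj k p ==> p ~= 0 ==> \<exists>t>0. tr k p = complex_of_real t" using tr_positive[of k k p] by (simp add: proj_def)

lemma dag_zero: "mor k l f ==> dag k l f = 0 ==> f = 0" using dag_dag(1)[of k l f] dag_linear(2)[of k l f 0] mor_linear(2)[of k l f 0] dag_linear(2)[of l k 0 0]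
  mor_linear(3)[of l k] by (simp add: mor_def add.commute)

lemma minimal_square: assumes m: "minimal l q" and f: "hom l q k p f" and p: "proj k p" and nz: "f ~= 0"
 shows "\<exists>t>0. stk l k l (dag l k f) f = scl (complex_of_real t) q"
proof -
 have q: "proj l q" by (rule minimal_proj[OF m])
 have "hom l q l q (stk l k l (dag l k f) f)" by (rule hom_comp[OF f hom_dag[OF f q p] q q])
 then obtain c where c: "stk l k l (dag l k f) f = scl c q" using minimal_scalar[OF m] by blast
 obtain t where t: "0 < t" "tr l (stk l k l (dag l k f) f) = complex_of_real t" using tr_positive[OF hom_mor(1)[OF f] nz] by blast
 obtain s where s: "0 < s" "tr l q = complex_of_real s" using tr_proj[OF q minimal_nonzero[OF m]] by blast
 have "c * complex_of_real s = complex_of_real t" using t(2) tr_scale[OF proj_mor(4)[OF q]] s(2) unfolding c by simp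
 hence "c = complex_of_real (t / s)" using s(1) by (simp add: field_simps)
 thus ?thesis using c t(1) s(1) by (intro exI[of _ "t / s"]) simp
qed

lemma normalise: assumes f: "mor l k f" and t: "0 < t" "stk l k l (dag l k f) f = scl (complex_of_real t) q"
 defines "c \<equiv> complex_of_real (1 / sqrt t)" shows "stk l k l (dag l k (scl c f)) (scl c f) = q"
  "stk k l k (scl c f) (dag l k (scl c f)) = scl (complex_of_real (1 / t)) (stk k l k f (dag l k f))"
proof -
 have cc: "c * c = complex_of_real (1 / t)" using t(1) by (simp add: c_def flip: of_real_mult)
 hence "c * (c * complex_of_real t) = 1" using t(1) by (simp flip: mult.assoc)
 note cc = cc this
 have d: "dag l k (scl c f) = scl c (dag l k f)" using dag_linear(2)[OF f] by (simp add: c_def)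
 note m = mor_linear(2)[OF f, of c] mor_linear(2)[OF mor_dag[OF f], of c]
 show "stk l k l (dag l k (scl c f)) (scl c f) = q"
  using stack_scale_left[OF m(1) mor_dag[OF f], of c] stack_scale_right[OF f mor_dag[OF f], of c] t cc by (simp add: d flip: of_real_mult)
 show "stk k l k (scl c f) (dag l k (scl c f)) = scl (complex_of_real (1 / t)) (stk k l k f (dag l k f))"
  using stack_scale_left[OF m(2) f, of c] stack_scale_right[OF mor_dag[OF f] f, of c] cc by (simp add: d)
qed

lemma range_projection: assumes q: "proj l q" and f: "hom l q k p v" and p: "proj k p" and i: "stk l k l (dag l k v) v = q"
 defines "x \<equiv> stk k l k v (dag l k v)" shows "iso l q k x v" "cmp k p x = x" "cmp k x p = x"
proof -
 note v = hom_mor(1)[OF f] note dv = mor_dag[OF v]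
 have x: "mor k k x" unfolding x_def by (rule mor_stack[OF dv v])
 have dx: "dag k k x = x" unfolding x_def using dag_stack[OF dv v] dag_dag(1)[OF v] by simp
 have xv: "stk l k k x v = v" unfolding x_def using assoc[OF v dv v] i hom_mor(3)[OF f] by simp
 have "cmp k x x = stk k l k (stk l k k x v) (dag l k v)" unfolding x_def[symmetric] using assoc[OF dv v x] by (simp add: x_def)
 hence xx: "cmp k x x = x" using xv by (simp add: x_def)
 have px: "proj k x" using x dx xx by (simp add: proj_def)
 show "iso l q k x v" unfolding iso_def using q px i hom_mor[OF f] xv by (simp add: hom_def x_def)
 show 1: "cmp k p x = x" unfolding x_def using assoc[OF dv v proj_mor(1)[OF p]] hom_mor(2)[OF f] by simp
 have "dag k k (cmp k p x) = cmp k x p" using dag_stack[OF x proj_mor(1)[OF p]] dx proj_mor(3)[OF p] by simp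
 thus "cmp k x p = x" using 1 dx by simp
qed

lemma minimal_subprojection: assumes m: "minimal l q" and p: "proj k p" and h: "hom k p l q h" "h ~= 0"
 shows "EX x v. iso l q k x v & hom l q k p v & cmp k p x = x & cmp k x p = x"
proof -
 have q: "proj l q" by (rule minimal_proj[OF m])
 have f: "hom l q k p (dag k l h)" by (rule hom_dag[OF h(1) p q])
 have nz: "dag k l h ~= 0" using dag_zero[OF hom_mor(1)[OF h(1)]] h(2) by blast
 obtain t where t: "0 < t" "stk l k l (dag l k (dag k l h)) (dag k l h) = scl (complex_of_real t) q" using minimal_square[OF m f p nz] by blast
 define v where "v = scl (complex_of_real (1 / sqrt t)) (dag k l h)"
 have v: "hom l q k p v" unfolding v_def by (rule hom_linear(2)[OF q p f])
 have "stk l k l (dag l k v) v = q" unfolding v_def by (rule normalise(1)[OF hom_mor(1)[OF f] t])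
 thus ?thesis using range_projection[OF q v p] v by blast
qed

lemma minimal_hom_iso: assumes m: "minimal k p" "minimal l q" and h: "hom k p l q h" "h ~= 0" shows "EX u. iso k p l q u"
proof -
 have p: "proj k p" and q: "proj l q" using m by (simp_all add: minimal_def)
 obtain x v where v: "iso l q k x v" "hom l q k p v" "cmp k p x = x" "cmp k x p = x" using minimal_subprojection[OF m(2) p h] by blast
 note V = isoD[OF v(1)]
 have "hom k p k p x" using v(3,4) proj_mor(1)[OF V(2)] by (simp add: hom_def)
 then obtain c where c: "x = scl c p" using minimal_scalar[OF m(1)] by blast
 have "cmp k x x = scl (c * c) p"
  using stack_scale_left[OF mor_linear(2)[OF proj_mor(1)[OF p]] proj_mor(1)[OF p], of c c] stack_scale_right[OF proj_mor(1)[OF p] proj_mor(1)[OF p], of c] proj_mor(2)[OF p]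
  by (simp add: c)
 hence "scl (c * c) p = scl c p" using proj_mor(2)[OF V(2)] c by simp
 hence "c * c = c" using minimal_nonzero[OF m(1)] by simp
 moreover have "c ~= 0"
 proof
  assume "c = 0"
  hence "x = 0" using c by simp
  moreover have "x ~= 0" by (rule minimal_nonzero[OF minimal_iso[OF m(2) v(1)]])
  ultimately show False by simp
 qed
 ultimately have "x = p" using c by simp
 thus ?thesis using iso_sym[OF v(1)] by blast
qed

lemma minimal_empty: "minimal 0 (str 0)"
proof -
 have p: "proj 0 (str 0)" using unit_left[OF mor_strands[of 0]] mor_strands[of 0] dag_strands[of 0] by (simp add: proj_def)
 have "Hom \<P> (0, str 0) (0, str 0) = \<B> 0" using unit_left[of 0 0] unit_right[of 0 0] by (intro set_eqI) (simp add: Hom_iff[OF p p] hom_def mor_square, blast)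
 thus ?thesis using p dim_closed by (simp add: minimal_def hom_dim_def)
qed

subsection \<open>Vertices and edges of the principal graph\<close>

lemma iso_class_iff: "minimal k p ==> (l, q) \<in> iso_class \<P> (k, p) \<longleftrightarrow> minimal l q & (EX u. iso k p l q u)"
 unfolding iso_class_def using iso_projections_iff[of k p l q] by (auto simp: minimal_projection_iff minimal_def)

lemma vertex_minimal: "C \<in> pg_vertices \<P> ==> (k, p) \<in> C ==> minimal k p" unfolding pg_vertices_def iso_class_def using minimal_projection_iff by auto

lemma vertex_iso: assumes "C \<in> pg_vertices \<P>" "(k, p) \<in> C" "(l, q) \<in> C" shows "EX u. iso k p l q u"
proof -
 obtain m r where z: "minimal m r" "C = iso_class \<P> (m, r)" using assms(1) unfolding pg_vertices_def by (auto simp: minimal_projection_iff)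
 obtain u w where "iso m r k p u" "iso m r l q w" using assms(2,3) unfolding z(2) iso_class_iff[OF z(1)] by blast
 thus ?thesis using iso_trans[OF iso_sym] by blast
qed

lemma vertex_class: assumes "C \<in> pg_vertices \<P>" "(k, p) \<in> C" shows "iso_class \<P> (k, p) = C"
proof -
 have m: "minimal k p" by (rule vertex_minimal[OF assms])
 obtain l q where z: "minimal l q" "C = iso_class \<P> (l, q)" using assms(1) unfolding pg_vertices_def by (auto simp: minimal_projection_iff)
 obtain u where u: "iso l q k p u" using assms(2) unfolding z(2) iso_class_iff[OF z(1)] by blast
 show ?thesis
 proof (intro set_eqI)
  fix y :: "nat \<times> 'a"
  obtain n r where y: "y = (n, r)" by (cases y)
  show "y \<in> iso_class \<P> (k, p) \<longleftrightarrow> y \<in> C"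
   unfolding y z(2) iso_class_iff[OF z(1)] iso_class_iff[OF m] using iso_trans[OF u] iso_trans[OF iso_sym[OF u]] by blast
 qed
qed

lemma class_vertex: "minimal k p ==> iso_class \<P> (k, p) \<in> pg_vertices \<P>" "minimal k p ==> (k, p) \<in> iso_class \<P> (k, p)"
 using iso_refl[of k p] by (auto simp: pg_vertices_def minimal_projection_iff iso_class_iff minimal_def)

lemma vertex_member: "C \<in> pg_vertices \<P> ==> (k, p) \<in> C ==> iso k p l q u ==> (l, q) \<in> C"
 using vertex_class[of C k p] vertex_minimal[of C k p] iso_class_iff[of k p l q] minimal_iso[of k p l q u] by blast

lemma vertex_nonempty: "C \<in> pg_vertices \<P> ==> EX k p. (k, p) \<in> C" unfolding pg_vertices_def using class_vertex(2) by (force simp: minimal_projection_iff)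

lemma pg_edges_eq: assumes C: "C \<in> pg_vertices \<P>" "(k, p) \<in> C" and D: "D \<in> pg_vertices \<P>" "(l, q) \<in> D"
 shows "pg_edges \<P> C D = hom_dim \<P> (k + 1, ten k 1 p wire) (l, q)"
proof -
 have "hom_dim \<P> (tensor_X \<P> x) y = hom_dim \<P> (k + 1, ten k 1 p wire) (l, q)" if xy: "x \<in> C" "y \<in> D" for x y
 proof -
  obtain k' p' l' q' where e: "x = (k', p')" "y = (l', q')" by (cases x, cases y) auto
  obtain u w where u: "iso k p k' p' u" and w: "iso l q l' q' w" using vertex_iso[OF C(1,2)] vertex_iso[OF D(1,2)] xy e by blast
  show ?thesis unfolding e tensor_X_def prod.case by (rule hom_dim_iso[OF iso_tensor[OF u] w])
 qed
 hence "(%(x, y). hom_dim \<P> (tensor_X \<P> x) y) ` (C \<times> D) = {hom_dim \<P> (k + 1, ten k 1 p wire) (l, q)}" using C(2) D(2) by force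
 thus ?thesis unfolding pg_edges_def by simp
qed

end

section \<open>Positive concave functions on the integers\<close>

text \<open>A negative increment would persist by concavity, and the function would become negative.\<close>

lemma concave_increasing:
 fixes a :: "nat => real" assumes pos: "!!n. 0 < a n" and con: "!!n. a n + a (n + 2) <= 2 * a (n + 1)" shows "a n <= a (n + 1)"
proof (rule ccontr)
 assume "\<not> a n <= a (n + 1)"
 define e where "e = a n - a (n + 1)"
 have e: "0 < e" using `\<not> a n <= a (n + 1)` by (simp add: e_def)
 have s: "a (n + j) - a (n + j + 1) \<ge> e" for j
 proof (induction j)
  case (Suc j)
  thus ?case using con[of "n + j"] by (simp add: add.assoc)
 qed (simp add: e_def)
 have "a (n + j) <= a n - real j * e" for j
 proof (induction j)
  case (Suc j)
  thus ?case using s[of j] by (simp add: algebra_simps)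
 qed simp
 moreover obtain j where "a n < real j * e" using reals_Archimedean3[OF e] by blast
 ultimately show False using pos[of "n + j"] by (smt (verit))
qed

text \<open>Both halves are increasing when read outwards, while concavity at 0 allows no increase on both sides.\<close>

lemma concave_two_sided:
 fixes a b :: "nat => real" assumes a: "!!n. 0 < a n" "!!n. a n + a (n + 2) <= 2 * a (n + 1)" and b: "!!n. 0 < b n" "!!n. b n + b (n + 2) <= 2 * b (n + 1)"
  and z: "a 0 = 1" "b 0 = 1" "a 1 + b 1 <= 2" shows "a n = 1"
proof -
 have "a 0 <= a 1" "b 0 <= b 1" using concave_increasing[of a 0] concave_increasing[of b 0] a b by simp_all
 hence 1: "a 1 = 1" using z by simp
 have "a n = 1 & a (n + 1) = 1"
 proof (induction n)
  case (Suc n)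
  have "a (n + 1) <= a (n + 2)" using concave_increasing[of a "n + 1"] a by simp
  thus ?case using Suc a(2)[of n] by simp
 qed (use z 1 in simp)
 thus ?thesis ..
qed

section \<open>Walking along the principal graph\<close>

context subfactor_alg begin

lemma proj_diff: assumes q: "proj k q" and r: "proj k r" and qr: "cmp k q r = r" "cmp k r q = r" shows "proj k (q - r)"
proof -
 note Q = proj_mor[OF q] note R = proj_mor[OF r]
 have m: "mor k k (q - r)" by (rule mor_linear(4)[OF Q(1) R(1)])
 have "cmp k (q - r) (q - r) = q - r"
  using stack_diff_left[OF m Q(1) R(1)] stack_diff_right[OF Q(1) R(1) Q(1)] stack_diff_right[OF Q(1) R(1) R(1)] Q(2) R(2) qr by simp
 thus ?thesis using m dag_diff[OF Q(1) R(1)] Q(3) R(3) by (simp add: proj_def)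
qed

lemma proj_trace_nonneg: assumes p: "proj k p" shows "\<exists>t\<ge>0. tr k p = complex_of_real t" "tr k p = 0 ==> p = 0"
proof -
 show "tr k p = 0 ==> p = 0" using tr_proj[OF p] by auto
 show "\<exists>t\<ge>0. tr k p = complex_of_real t"
 proof (cases "p = 0")
  case True thus ?thesis by (auto simp: tr_zero intro: exI[of _ 0])
 next
  case False thus ?thesis using tr_proj[OF p] less_imp_le by blast
 qed
qed

lemma minimal_orthogonal: assumes "minimal k p" "minimal l q" "\<nexists>u. iso k p l q u" "hom k p l q h" shows "h = 0"
 using minimal_hom_iso[OF assms(1,2,4)] assms(3) by blast

definition chain :: "(nat => 'a) => bool" where "chain x \<longleftrightarrow> x 0 = strands \<P> 0 & (ALL n. minimal n (x n)) &
   (ALL n. stack \<P> (n + 1) (n + 1) (n + 1) (tensor \<P> n 1 (x n) (strands \<P> 1)) (x (n + 1)) = x (n + 1)) &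
   (ALL n. stack \<P> (n + 1) (n + 1) (n + 1) (x (n + 1)) (tensor \<P> n 1 (x n) (strands \<P> 1)) = x (n + 1)) &
   (ALL n. \<nexists>u. iso n (x n) (n + 2) (x (n + 2)) u)"

lemma chainD: assumes "chain x"
 shows "x 0 = str 0" "minimal n (x n)" "proj n (x n)" "mor n n (x n)" "cmp n (x n) (x n) = x n" "dag n n (x n) = x n" "x n \<in> \<B> n"
   "cmp (n + 1) (ten n 1 (x n) wire) (x (n + 1)) = x (n + 1)" "cmp (n + 1) (x (n + 1)) (ten n 1 (x n) wire) = x (n + 1)"
   "\<nexists>u. iso n (x n) (n + 2) (x (n + 2)) u"
proof -
 show m: "minimal n (x n)" using assms by (simp add: chain_def)
 note p = minimal_proj[OF m]
 show "proj n (x n)" by (rule p)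
 show "mor n n (x n)" "cmp n (x n) (x n) = x n" "dag n n (x n) = x n" "x n \<in> \<B> n" by (rule proj_mor[OF p])+
qed (use assms in "simp_all only: chain_def", blast+)

text \<open>The element \<open>x (n + 1)\<close> is read as a map from \<open>x n\<close> to \<open>x (n + 1) \<otimes> X\<close> by bending one strand.\<close>

lemma chain_fold:
 fixes n :: nat assumes c: "chain x"
 defines "q \<equiv> ten (n + 1) 1 (x (n + 1)) wire" and "f \<equiv> x (n + 1)"
 shows "proj (n + 2) q" "hom n (x n) (n + 2) q f" "dag n (n + 2) f = f" "mor n (n + 2) f" "mor (n + 2) n f"
proof -
 note C = chainD[OF c]
 show "proj (n + 2) q" unfolding q_def using proj_tensor[OF C(3)[of "n + 1"]] by simp
 have d: "dag n (n + 2) = dag (n + 1) (n + 1)" by (rule dag_shape) simp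
 thus "dag n (n + 2) f = f" unfolding f_def using C(6)[of "n + 1"] by simp
 have m: "mor n (n + 1 + 1) f" "mor (n + 1 + 1) n f" unfolding f_def by (rule mor_shape[OF C(4)[of "n + 1"]]; simp)+
 thus "mor n (n + 2) f" "mor (n + 2) n f" by simp_all
 have 1: "stk n (n + 1 + 1) (n + 1 + 1) q f = f"
  using beside_strand_left[OF m(1) C(4)[of "n + 1"]] beside_tensor[OF C(7)[of "n + 1"] strands_in] C(5)[of "n + 1"] by (simp add: q_def f_def)
 have 2: "stk n n (n + 1 + 1) f (x n) = f"
  using beside_strand_right[OF C(4)[of "n + 1"] C(4)[of n]] beside_tensor[OF C(7)[of n] strands_in] C(9)[of n] by (simp add: f_def)
 show "hom n (x n) (n + 2) q f" using 1 2 m by (simp add: hom_def)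
qed

lemma chain_trace: "chain x ==> \<exists>t>0. tr n (x n) = complex_of_real t"
proof -
 assume c: "chain x"
 show ?thesis by (rule tr_proj[OF chainD(3)[OF c] minimal_nonzero[OF chainD(2)[OF c]]])
qed

text \<open>By minimality of \<open>x n\<close>, the bent element is a multiple of an isometry.  Its range has the trace of \<open>x n\<close>, and the multiple is
determined by comparing the two shapes of the same composite.\<close>

lemma chain_return:
 fixes n :: nat assumes c: "chain x"
 defines "q \<equiv> ten (n + 1) 1 (x (n + 1)) wire" and "f \<equiv> x (n + 1)"
 obtains t where "0 < t" "stk n (n + 2) n f f = scl (complex_of_real t) (x n)" "tr (n + 1) (x (n + 1)) = complex_of_real t * tr n (x n)"
  "tr (n + 2) (returned n f t) = tr n (x n)" "proj (n + 2) (returned n f t)" "cmp (n + 2) q (returned n f t) = returned n f t"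
  "cmp (n + 2) (returned n f t) q = returned n f t"
proof -
 note C = chainD[OF c] note D = chain_fold[OF c, of n, folded q_def f_def]
 have nz: "f ~= 0" unfolding f_def by (rule minimal_nonzero[OF C(2)])
 obtain t where t: "0 < t" "stk n (n + 2) n (dag n (n + 2) f) f = scl (complex_of_real t) (x n)" using minimal_square[OF C(2) D(2) D(1) nz] by blast
 define r where "r = returned n f t"
 define v where "v = scl (complex_of_real (1 / sqrt t)) f"
 have v: "hom n (x n) (n + 2) q v" unfolding v_def by (rule hom_linear(2)[OF C(3) D(1) D(2)])
 have vv: "stk n (n + 2) n (dag n (n + 2) v) v = x n" "stk (n + 2) n (n + 2) v (dag n (n + 2) v) = r" using normalise[OF D(4) t] D(3) by (simp_all only: v_def r_def)
 note R = range_projection[OF C(3) v D(1) vv(1), unfolded vv(2)]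
 have ff: "mor (n + 2) (n + 2) (stk (n + 2) n (n + 2) f f)" by (rule mor_stack[OF D(5,4)])
 have s: "tr (n + 1) f = tr (n + 1) (cmp (n + 1) f f)" using C(5)[of "n + 1"] by (simp add: f_def)
 have t1: "tr n (stk n (n + 2) n f f) = tr (n + 1) f" using trace_shape[OF D(4,5), of "n + 1" "n + 1"] by (subst s) (simp add: tr_def)
 have t2: "tr (n + 2) (stk (n + 2) n (n + 2) f f) = tr (n + 1) f" using trace_shape[OF D(5,4), of "n + 1" "n + 1"] by (subst s) (simp add: tr_def)
 have e: "tr (n + 1) f = complex_of_real t * tr n (x n)" using t1 t(2) tr_scale[OF C(7)] D(3) by simp
 have "tr (n + 2) r = tr n (x n)" unfolding r_def using tr_scale[of "stk (n + 2) n (n + 2) f f" "n + 2"] ff t2 e t(1) by (simp add: mor_square)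
 thus thesis using that[of t] t D(3) e isoD(2)[OF R(1)] R(2,3) by (simp add: r_def f_def)
qed

lemma chain_orthogonal:
 fixes n :: nat assumes c: "chain x"
 defines "f \<equiv> x (n + 1)" shows "cmp (n + 2) (x (n + 2)) (scl s (stk (n + 2) n (n + 2) f f)) = 0"
proof -
 note C = chainD[OF c] note D = chain_fold[OF c, of n, folded f_def]
 have "hom n (x n) (n + 2) (x (n + 2)) (stk n (n + 2) (n + 2) (x (n + 2)) f)"
  using assoc[OF D(4) C(4)[of "n + 2"] C(4)[of "n + 2"]] assoc[OF C(4)[of n] D(4) C(4)[of "n + 2"]] mor_stack[OF D(4) C(4)[of "n + 2"]] hom_mor(3)[OF D(2)] C(5)[of "n + 2"]
  by (simp add: hom_def)
 hence z: "stk n (n + 2) (n + 2) (x (n + 2)) f = 0" by (rule minimal_orthogonal[OF C(2) C(2) C(10)])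
 have "cmp (n + 2) (x (n + 2)) (stk (n + 2) n (n + 2) f f) = 0" using assoc[OF D(5) D(4) C(4)[of "n + 2"]] z stack_zero(1)[OF D(5), of "n + 2"] by simp
 thus ?thesis using stack_scale_right[OF mor_stack[OF D(5,4)] C(4)[of "n + 2"]] by simp
qed

lemma chain_remainder:
 fixes n :: nat assumes c: "chain x" and X: "tr 1 wire = 2"
 defines "q \<equiv> ten (n + 1) 1 (x (n + 1)) wire" and "f \<equiv> x (n + 1)"
 obtains t where "0 < t" "tr (n + 1) (x (n + 1)) = complex_of_real t * tr n (x n)" "proj (n + 2) (returned n f t)" "cmp (n + 2) q (returned n f t) = returned n f t"
  "tr (n + 2) (returned n f t) = tr n (x n)" "proj (n + 2) (q - returned n f t - x (n + 2))"
  "tr (n + 2) (q - returned n f t - x (n + 2)) = 2 * tr (n + 1) (x (n + 1)) - tr n (x n) - tr (n + 2) (x (n + 2))"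
proof -
 note C = chainD[OF c]
 obtain t where t: "0 < t" "tr (n + 1) (x (n + 1)) = complex_of_real t * tr n (x n)" "tr (n + 2) (returned n f t) = tr n (x n)" "proj (n + 2) (returned n f t)"
  "cmp (n + 2) q (returned n f t) = returned n f t" "cmp (n + 2) (returned n f t) q = returned n f t" using chain_return[OF c, of n] unfolding q_def f_def by blast
 define r where "r = returned n f t"
 note T = t(3-6)[folded r_def]
 have q: "proj (n + 2) q" unfolding q_def by (rule chain_fold(1)[OF c])
 note Q = proj_mor[OF q] note R = proj_mor[OF T(2)] note Y = C(3-7)[of "n + 2"]
 have xr: "cmp (n + 2) (x (n + 2)) r = 0" unfolding r_def f_def by (rule chain_orthogonal[OF c])
 have "cmp (n + 2) r (x (n + 2)) = dag (n + 2) (n + 2) (cmp (n + 2) (x (n + 2)) r)" using dag_stack[OF R(1) Y(2)] R(3) Y(4) by simp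
 also have "\<dots> = 0" unfolding xr using dag_linear(2)[OF R(1), of 0] by simp
 finally have rx: "cmp (n + 2) r (x (n + 2)) = 0" .
 have qx: "cmp (n + 2) q (x (n + 2)) = x (n + 2)" "cmp (n + 2) (x (n + 2)) q = x (n + 2)" using C(8,9)[of "n + 1"] by (simp_all add: q_def)
 have p1: "proj (n + 2) (q - r)" by (rule proj_diff[OF q T(2,3,4)])
 have p2: "proj (n + 2) (q - r - x (n + 2))"
  by (rule proj_diff[OF p1 Y(1)]) (use stack_diff_left[OF Y(2) Q(1) R(1)] stack_diff_right[OF Q(1) R(1) Y(2)] qx xr rx in simp_all)
 have tq: "tr (n + 2) q = 2 * tr (n + 1) (x (n + 1))" using tr_tensor[OF C(7)[of "n + 1"] strands_in] X by (simp add: q_def mult.commute)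
 have "tr (n + 2) (q - r - x (n + 2)) = 2 * tr (n + 1) (x (n + 1)) - tr n (x n) - tr (n + 2) (x (n + 2))"
  using tr_diff[OF proj_mor(4)[OF p1] Y(5)] tr_diff[OF Q(4) R(4)] tq T(1) by simp
 thus thesis using that[of t] t(1,2) T(1,2,3) p2 by (simp only: r_def)
qed

lemma chain_concave: assumes c: "chain x" and X: "tr 1 wire = 2"
 shows "0 < Re (tr n (x n))" "Im (tr n (x n)) = 0" "Re (tr n (x n)) + Re (tr (n + 2) (x (n + 2))) <= 2 * Re (tr (n + 1) (x (n + 1)))"
proof -
 show "0 < Re (tr n (x n))" "Im (tr n (x n)) = 0" using chain_trace[OF c, of n] by auto
 obtain e where e: "proj (n + 2) e" "tr (n + 2) e = 2 * tr (n + 1) (x (n + 1)) - tr n (x n) - tr (n + 2) (x (n + 2))" using chain_remainder[OF c X, of n] by metis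
 then obtain t where "0 <= t" "tr (n + 2) e = complex_of_real t" using proj_trace_nonneg(1)[OF e(1)] by blast
 hence "complex_of_real t = 2 * tr (n + 1) (x (n + 1)) - tr n (x n) - tr (n + 2) (x (n + 2))" "0 <= t" using e(2) by simp_all
 hence "t = 2 * Re (tr (n + 1) (x (n + 1))) - Re (tr n (x n)) - Re (tr (n + 2) (x (n + 2)))" by (simp add: complex_eq_iff)
 thus "Re (tr n (x n)) + Re (tr (n + 2) (x (n + 2))) <= 2 * Re (tr (n + 1) (x (n + 1)))" using `0 <= t` by simp
qed

lemma chain_split:
 fixes n :: nat assumes c: "chain x" and X: "tr 1 wire = 2" and one: "!!n. tr n (x n) = 1"
 defines "r \<equiv> stk (n + 2) n (n + 2) (x (n + 1)) (x (n + 1))" shows "proj (n + 2) r" "tr (n + 2) r = 1" "ten (n + 1) 1 (x (n + 1)) wire = r + x (n + 2)"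
  "cmp (n + 2) (ten (n + 1) 1 (x (n + 1)) wire) r = r"
proof -
 obtain t where t: "0 < t" "tr (n + 1) (x (n + 1)) = complex_of_real t * tr n (x n)" "proj (n + 2) (scl (complex_of_real (1 / t)) r)"
  "cmp (n + 2) (ten (n + 1) 1 (x (n + 1)) wire) (scl (complex_of_real (1 / t)) r) = scl (complex_of_real (1 / t)) r"
  "tr (n + 2) (scl (complex_of_real (1 / t)) r) = tr n (x n)" "proj (n + 2) (ten (n + 1) 1 (x (n + 1)) wire - scl (complex_of_real (1 / t)) r - x (n + 2))"
  "tr (n + 2) (ten (n + 1) 1 (x (n + 1)) wire - scl (complex_of_real (1 / t)) r - x (n + 2)) = 2 * tr (n + 1) (x (n + 1)) - tr n (x n) - tr (n + 2) (x (n + 2))"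
  using chain_remainder[OF c X, of n] unfolding r_def by metis
 have "complex_of_real t = 1" using t(2) one by simp
 hence 1: "t = 1" by simp
 show "proj (n + 2) r" "tr (n + 2) r = 1" "cmp (n + 2) (ten (n + 1) 1 (x (n + 1)) wire) r = r" using t(3,4,5) one unfolding 1 by simp_all
 have "ten (n + 1) 1 (x (n + 1)) wire - r - x (n + 2) = 0" using proj_trace_nonneg(2)[OF t(6)] t(7) one unfolding 1 by simp
 thus "ten (n + 1) 1 (x (n + 1)) wire = r + x (n + 2)" by (simp add: algebra_simps)
qed

text \<open>Sliding \<open>S\<close> around the bend in \<open>r\<close> multiplies the last letter \<open>R\<close> by the rotation of \<open>S\<close>, which gives 0.
So \<open>r\<close> lies below \<open>x (n + 1)\<close> followed by the rotation of \<open>R\<close>, and both have trace 1.\<close>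

lemma chain_letter: assumes c: "chain x" and X: "tr 1 wire = 2" and one: "!!n. tr n (x n) = 1" and R: "R \<in> \<B> 1" "x (n + 1) = ten n 1 (x n) R"
  and rot: "proj 1 (rot R)" "tr 1 (rot R) = 1" and S: "S \<in> \<B> 1" "wire = rot R + S" "cmp 1 R (rot S) = 0"
 shows "stk (n + 2) n (n + 2) (x (n + 1)) (x (n + 1)) = ten (n + 1) 1 (x (n + 1)) (rot R)" "x (n + 2) = ten (n + 1) 1 (x (n + 1)) S"
proof -
 note C = chainD[OF c] note D = chain_fold[OF c, of n] note E = chain_split[OF c X one, of n]
 define f where "f = x (n + 1)"
 define q where "q = ten (n + 1) 1 f wire"
 define r where "r = stk (n + 2) n (n + 2) f f"
 define A where "A = ten (n + 1) 1 (str (n + 1)) S"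
 define s where "s = ten (n + 1) 1 f (rot R)"
 note D = D[folded f_def, folded q_def] note E = E[folded f_def, folded q_def r_def]
 have fm: "mor (n + 1) (n + 1) f" "f \<in> \<B> (n + 1)" "proj (n + 1) f" unfolding f_def by (rule C)+
 have A: "mor (n + 2) (n + 2) A" unfolding A_def using mor_tensor[OF strands_in[of "n + 1"] S(1)] by simp
 have rS: "rot S \<in> \<B> 1" by (rule rotation_in[OF S(1)])
 have "stk n (n + 1 + 1) (n + 1 + 1) (bes (n + 1) (n + 1) (str (n + 1)) S) f =
   cmp (n + 1) (cmp (n + 1) (str (n + 1)) f) (ten n 1 (str n) (rot S))" by (rule bend[OF mor_shift(2)[OF fm(1)] mor_strands S(1)])
 also have "cmp (n + 1) (str (n + 1)) f = ten n 1 (x n) R" using unit_left[OF fm(1)] R(2) by (simp add: f_def)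
 also have "cmp (n + 1) (ten n 1 (x n) R) (ten n 1 (str n) (rot S)) = ten n 1 (cmp n (x n) (str n)) (cmp 1 R (rot S))"
  by (rule interchange[OF C(7) strands_in R(1) rS])
 also have "\<dots> = 0" unfolding S(3) unit_right[OF C(4)[of n]] using tensor_scale_right[OF C(7)[of n] box_closed(3)[of 1], of 0] by simp
 finally have Af: "stk n (n + 2) (n + 2) A f = 0" using beside_tensor[OF strands_in S(1), of "n + 1"] by (simp add: A_def)
 have rm: "mor (n + 2) (n + 2) r" unfolding r_def by (rule mor_stack[OF D(5,4)])
 have Ar: "cmp (n + 2) A r = 0" unfolding r_def using assoc[OF D(5) D(4) A] Af stack_zero(1)[OF D(5), of "n + 2"] by simp
 have qm: "mor (n + 2) (n + 2) q" by (rule proj_mor(1)[OF D(1)])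
 have sm: "mor (n + 2) (n + 2) s" unfolding s_def using mor_tensor[OF fm(2) proj_mor(4)[OF rot(1)]] by simp
 have fS: "mor (n + 2) (n + 2) (ten (n + 1) 1 f S)" using mor_tensor[OF fm(2) S(1)] by simp
 have "ten (n + 1) 1 f S = cmp (n + 2) q A" using interchange[OF fm(2) strands_in[of "n + 1"] strands_in[of 1] S(1)] unit_right[OF fm(1)] unit_left[of 1 1 S] S(1)
  by (simp add: q_def A_def mor_square)
 hence fSr: "cmp (n + 2) (ten (n + 1) 1 f S) r = 0" using assoc[OF rm A qm] Ar stack_zero(2)[OF qm, of "n + 2"] by simp
 have qs: "q = s + ten (n + 1) 1 f S"
  unfolding q_def s_def S(2) using beside_linear(1)[of "n + 1" "n + 1" f "rot R" S] beside_tensor[OF fm(2)] fm(2) S(1) proj_mor(4)[OF rot(1)]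
   box_closed(1)[OF proj_mor(4)[OF rot(1)] S(1)] by simp
 have sr: "cmp (n + 2) s r = r" using E(4) stack_add_left[OF rm sm fS] fSr unfolding qs by simp
 have ps: "proj (n + 2) s"
 proof -
  have "cmp (n + 2) s s = s"
   using interchange[OF fm(2) fm(2) proj_mor(4)[OF rot(1)] proj_mor(4)[OF rot(1)]] proj_mor(2)[OF rot(1)] proj_mor(2)[OF fm(3)] by (simp add: s_def)
  moreover have "dag (n + 2) (n + 2) s = s"
   using adj_tensor[OF fm(2) proj_mor(4)[OF rot(1)]] proj_mor(3)[OF rot(1)] proj_mor(3)[OF fm(3)] by (simp add: s_def dag_def)
  ultimately show ?thesis using sm by (simp add: proj_def)
 qed
 have rs: "cmp (n + 2) r s = r" using dag_stack[OF rm sm] sr proj_mor(3)[OF ps] proj_mor(3)[OF E(1)] by simp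
 have "tr (n + 2) s = 1" using tr_tensor[OF fm(2) proj_mor(4)[OF rot(1)]] rot(2) one[of "n + 1"] by (simp add: s_def f_def)
 hence "tr (n + 2) (s - r) = 0" using tr_diff[OF proj_mor(4)[OF ps] proj_mor(4)[OF E(1)]] E(2) by simp
 hence "s - r = 0" by (rule proj_trace_nonneg(2)[OF proj_diff[OF ps E(1) sr rs]])
 hence eq: "r = s" by simp
 show "stk (n + 2) n (n + 2) (x (n + 1)) (x (n + 1)) = ten (n + 1) 1 (x (n + 1)) (rot R)" using eq by (simp only: r_def s_def f_def)
 have "s + ten (n + 1) 1 f S = r + x (n + 2)" using E(3) qs by simp
 thus "x (n + 2) = ten (n + 1) 1 (x (n + 1)) S" using eq by (simp add: f_def)
qed

lemma chain_word: assumes c: "chain x" and X: "tr 1 wire = 2" and one: "!!n. tr n (x n) = 1" and R: "!!n. R n \<in> \<B> 1" "x 1 = R 0"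
  and rot: "!!n. proj 1 (rot (R n))" "!!n. tr 1 (rot (R n)) = 1" and S: "!!n. wire = rot (R n) + R (n + 1)" "!!n. cmp 1 (R n) (rot (R (n + 1))) = 0"
 shows "x (n + 1) = ten n 1 (x n) (R n)"
proof (induction n)
 case 0
 show ?case using tensor_empty_left[OF R(1)[of 0]] R(2) chainD(1)[OF c] by simp
next
 case (Suc n)
 show ?case using chain_letter(2)[OF c X one R(1)[of n] Suc rot(1)[of n] rot(2)[of n] R(1)[of "n + 1"] S(1)[of n] S(2)[of n]] by simp
qed

end

context subfactor_alg begin

lemma path_vertex: assumes "bi_infinite_path (pg_vertices \<P>) (pg_edges \<P>) v"
 shows "v i \<in> pg_vertices \<P>" "v i = v j \<longleftrightarrow> i = j" "pg_edges \<P> (v i) (v j) = (if \<bar>i - j\<bar> = 1 then 1 else 0)"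
 using assms unfolding bi_infinite_path_def bij_betw_def inj_on_def by auto

lemma extend_vertex: assumes path: "bi_infinite_path (pg_vertices \<P>) (pg_edges \<P>) v" and m: "(k, p) \<in> v i" and ij: "\<bar>i - j\<bar> = 1"
 shows "EX x. (k + 1, x) \<in> v j & cmp (k + 1) (ten k 1 p wire) x = x &
   cmp (k + 1) x (ten k 1 p wire) = x"
proof -
 note V = path_vertex[OF path]
 let ?q = "ten k 1 p wire"
 obtain l r where r: "(l, r) \<in> v j" using vertex_nonempty[OF V(1)] by blast
 have p: "proj k p" and mr: "minimal l r" using vertex_minimal[OF V(1) m] vertex_minimal[OF V(1) r] by (simp_all add: minimal_def)
 have q: "proj (k + 1) ?q" by (rule proj_tensor[OF p])
 have d: "dim (Hom \<P> (k + 1, ?q) (l, r)) = 1" using pg_edges_eq[OF V(1) m V(1) r] V(3)[of i j] ij by (simp add: hom_dim_def)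
 have "Hom \<P> (k + 1, ?q) (l, r) ~= {0}"
 proof
  assume "Hom \<P> (k + 1, ?q) (l, r) = {0}"
  thus False using d dim_zero_space by simp
 qed
 moreover have "0 \<in> Hom \<P> (k + 1, ?q) (l, r)" by (rule subspace_0[OF subspace_Hom[OF q minimal_proj[OF mr]]])
 ultimately obtain h where h: "h \<in> Hom \<P> (k + 1, ?q) (l, r)" "h ~= 0" by blast
 have e: "even (k + 1 + l)" using h Hom_odd[of "k + 1" l ?q r] by blast
 have hh: "hom (k + 1) ?q l r h" using h(1) unfolding Hom_iff[OF q minimal_proj[OF mr] e] .
 obtain x w where x: "iso l r (k + 1) x w" "cmp (k + 1) ?q x = x" "cmp (k + 1) x ?q = x" using minimal_subprojection[OF mr q hh h(2)] by blast
 thus ?thesis using vertex_member[OF V(1) r x(1)] by blast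
qed

text \<open>Neighbours of a vertex in the graph occur below its product with a strand.  Representatives are chosen one after the other, each
replaced by an isomorphic projection below the product with the previous one.\<close>

lemma chain_from_path:
 fixes s :: int assumes path: "bi_infinite_path (pg_vertices \<P>) (pg_edges \<P>) v" and v0: "(0, str 0) \<in> v 0" and s: "s = 1 | s = - 1"
 shows "EX x. chain x & (ALL n. (n, x n) \<in> v (s * int n))"
proof -
 note V = path_vertex[OF path]
 define Q where "Q = (%n x y. cmp (n + 1) (ten n 1 x wire) y = y &
   cmp (n + 1) y (ten n 1 x wire) = y)"
 have "EX f. ALL n. ((n, f n) \<in> v (s * int n) & (n = 0 --> f n = str 0)) & Q n (f n) (f (Suc n))"
 proof (rule dependent_nat_choice)
  show "EX x. (0, x) \<in> v (s * int 0) & (0 = 0 --> x = str 0)" for z :: nat using v0 by simp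
  fix x n assume "(n, x) \<in> v (s * int n) & (n = 0 --> x = str 0)"
  hence x: "(n, x) \<in> v (s * int n)" ..
  have "\<bar>s * int n - s * int (Suc n)\<bar> = 1" using s by auto
  from extend_vertex[OF path x this] show "EX y. ((Suc n, y) \<in> v (s * int (Suc n)) & (Suc n = 0 --> y = str 0)) & Q n x y" by (simp add: Q_def)
 qed
 then obtain x where x: "!!n. (n, x n) \<in> v (s * int n)" "x 0 = str 0" "!!n. Q n (x n) (x (Suc n))" by auto
 have m: "minimal n (x n)" for n by (rule vertex_minimal[OF V(1) x(1)])
 have "\<nexists>u. iso n (x n) (n + 2) (x (n + 2)) u" for n
 proof
  assume "EX u. iso n (x n) (n + 2) (x (n + 2)) u"
  hence "(n + 2, x (n + 2)) \<in> v (s * int n)" using vertex_member[OF V(1) x(1)] by blast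
  hence "v (s * int n) = v (s * int (n + 2))" using vertex_class[OF V(1)] x(1)[of "n + 2"] by metis
  thus False using s unfolding V(2) by auto
 qed
 hence "chain x" using x(2,3) m by (simp add: chain_def Q_def)
 thus ?thesis using x(1) by blast
qed

lemma alternating_tensor_in: "P \<in> \<B> 1 ==> Q \<in> \<B> 1 ==> alternating_tensor \<P> P Q n \<in> \<B> n"
 by (induction n arbitrary: P Q) (use strands_in tensor_general_in[of _ 1] in "force+")

lemma alternating_tensor_append: assumes "P \<in> \<B> 1" "Q \<in> \<B> 1"
 shows "alternating_tensor \<P> P Q (Suc n) = ten n 1 (alternating_tensor \<P> P Q n) (if even n then P else Q)" using assms
proof (induction n arbitrary: P Q)
 case 0
 thus ?case using tensor_empty_left[of P] tensor_empty_right[of P 1] by simp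
next
 case (Suc n)
 let ?R = "if even n then Q else P"
 have R: "?R \<in> \<B> 1" using Suc.prems by simp
 have "alternating_tensor \<P> P Q (Suc (Suc n)) = ten 1 (n + 1) P (ten n 1 (alternating_tensor \<P> Q P n) ?R)" using Suc.IH[OF Suc.prems(2,1)] by simp
 also have "\<dots> = ten (1 + n) 1 (ten 1 n P (alternating_tensor \<P> Q P n)) ?R"
  by (rule tensor_assoc[OF Suc.prems(1) alternating_tensor_in[OF Suc.prems(2,1)] R, symmetric])
 finally show ?case by simp
qed

text \<open>As \<open>P\<close> and \<open>Q\<close> are minimal and inequivalent with sum 1, they are orthogonal and span the first box space.  A self-adjoint
idempotent in it is 0, \<open>P\<close>, \<open>Q\<close> or 1, and the rotation of \<open>P\<close> is neither 0 nor 1 since rotation is injective and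
preserves 1.\<close>

lemma rotation_cases: assumes P: "minimal 1 P" and Q: "minimal 1 Q" and PQ: "\<nexists>u. iso 1 P 1 Q u" and X: "wire = P + Q"
 shows "rot P = P | rot P = Q" "proj 1 (rot P)" "cmp 1 P Q = 0" "cmp 1 Q P = 0"
proof -
 have p: "proj 1 P" and q: "proj 1 Q" using P Q by (simp_all add: minimal_def)
 note p = p proj_mor[OF p] note q = q proj_mor[OF q]
 have QP: "\<nexists>u. iso 1 Q 1 P u" using PQ iso_sym by blast
 have h: "hom 1 e 1 f (cmp 1 f (cmp 1 a e))" if e: "proj 1 e" and f: "proj 1 f" and a: "a \<in> \<B> 1" for a e f
 proof -
  have am: "mor 1 1 a" using a by (simp add: mor_square)
  note E = proj_mor[OF e] note F = proj_mor[OF f]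
  have ae: "mor 1 1 (cmp 1 a e)" by (rule mor_stack[OF E(1) am])
  show ?thesis unfolding hom_def using mor_stack[OF ae F(1)] assoc[OF ae F(1) F(1)] assoc[OF E(1) ae F(1)] assoc[OF E(1) E(1) am] E(2) F(2) by simp
 qed
 note hm = hom_mor[OF hom_proj[OF p(1)]] hom_mor[OF hom_proj[OF q(1)]]
 have z: "cmp 1 P (cmp 1 a Q) = 0" "cmp 1 Q (cmp 1 a P) = 0" if a: "a \<in> \<B> 1" for a
  using minimal_orthogonal[OF Q P QP h[OF q(1) p(1) a]] minimal_orthogonal[OF P Q PQ h[OF p(1) q(1) a]] by simp_all
 have X1: "wire \<in> \<B> 1" by (rule strands_in)
 show PQ0: "cmp 1 P Q = 0" "cmp 1 Q P = 0" using z[OF X1] unit_left[OF q(2)] unit_left[OF p(2)] by simp_all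
 define a where "a = rot P"
 have a: "a \<in> \<B> 1" "mor 1 1 a" unfolding a_def using rotation_in[OF p(5)] by (simp_all add: mor_square)
 have aa: "cmp 1 a a = a" unfolding a_def using rotation_mult[OF p(5) p(5)] p(3) by simp
 have da: "dag 1 1 a = a" unfolding a_def using adj_rotation[OF p(5)] p(4) by (simp add: dag_def)
 have "proj 1 a" unfolding proj_def using a(2) aa da by (intro conjI)
 thus "proj 1 (rot P)" unfolding a_def .
 obtain \<alpha> beta where ab: "cmp 1 P (cmp 1 a P) = scl \<alpha> P" "cmp 1 Q (cmp 1 a Q) = scl beta Q"
  using minimal_scalar[OF P h[OF p(1) p(1) a(1)]] minimal_scalar[OF Q h[OF q(1) q(1) a(1)]] by blast
 have aP: "mor 1 1 (cmp 1 a P)" "mor 1 1 (cmp 1 a Q)" by (rule mor_stack[OF p(2) a(2)] mor_stack[OF q(2) a(2)])+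
 have "a = cmp 1 wire (cmp 1 a wire)" using unit_right[OF a(2)] unit_left[OF a(2)] by simp
 also have "cmp 1 a wire = cmp 1 a P + cmp 1 a Q" unfolding X by (rule stack_add_right[OF p(2) q(2) a(2)])
 also have "cmp 1 wire (cmp 1 a P + cmp 1 a Q) = scl \<alpha> P + scl beta Q"
  unfolding X stack_add_left[OF mor_linear(1)[OF aP] p(2) q(2)] stack_add_right[OF aP p(2)] stack_add_right[OF aP q(2)] ab z[OF a(1)] by simp
 finally have dec: "a = scl \<alpha> P + scl beta Q" .
 have Pa: "cmp 1 a P = scl \<alpha> P" "cmp 1 a Q = scl beta Q"
  unfolding dec stack_add_left[OF p(2) mor_linear(2)[OF p(2)] mor_linear(2)[OF q(2)]] stack_add_left[OF q(2) mor_linear(2)[OF p(2)] mor_linear(2)[OF q(2)]]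
   stack_scale_left[OF p(2) p(2)] stack_scale_left[OF p(2) q(2)] stack_scale_left[OF q(2) p(2)] stack_scale_left[OF q(2) q(2)] PQ0 p(3) q(3) by simp_all
 have "scl (\<alpha> * \<alpha>) P = scl \<alpha> P" "scl (beta * beta) Q = scl beta Q"
  using assoc[OF p(2) a(2) a(2)] assoc[OF q(2) a(2) a(2)] stack_scale_right[OF p(2) a(2), of \<alpha>] stack_scale_right[OF q(2) a(2), of beta] aa Pa by simp_all
 hence "\<alpha> * \<alpha> = \<alpha>" "beta * beta = beta" using minimal_nonzero[OF P] minimal_nonzero[OF Q] by simp_all
 hence c: "\<alpha> = 0 | \<alpha> = 1" "beta = 0 | beta = 1" by auto
 have "a ~= 0" using rotation_injective[OF p(5)] minimal_nonzero[OF P] by (auto simp: a_def)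
 moreover have "a ~= P + Q"
 proof
  assume "a = P + Q"
  hence "rot Q = 0" using rotation_linear[OF p(5) q(5)] rotation_strand by (simp add: X[symmetric] a_def del: X)
  thus False using rotation_injective[OF q(5)] minimal_nonzero[OF Q] by blast
 qed
 ultimately have "a = P | a = Q" using c dec by auto
 thus "rot P = P | rot P = Q" unfolding a_def .
qed

lemma hom_product: assumes "proj k p" "proj k q" shows "hom k q k p (cmp k p q)"
proof -
 note P = proj_mor[OF assms(1)] note Q = proj_mor[OF assms(2)]
 show ?thesis unfolding hom_def using mor_stack[OF Q(1) P(1)] assoc[OF Q(1) P(1) P(1)] assoc[OF Q(1) Q(1) P(1), symmetric] P(2) Q(2) by simp
qed

text \<open>The elements \<open>x 1\<close> and \<open>y 1\<close> are orthogonal projections below the strand, so their traces add up to at most 2, which is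
concavity at the vertex of the empty diagram.\<close>

lemma two_chains: assumes x: "chain x" and y: "chain y" and ne: "\<nexists>u. iso 1 (x 1) 1 (y 1) u" and X: "tr 1 wire = 2"
 shows "tr n (x n) = 1" "tr n (y n) = 1" "wire = x 1 + y 1"
proof -
 note C = chainD[OF x] note D = chainD[OF y]
 have m: "mor 1 1 wire" by (rule mor_strands)
 have sp: "proj 1 wire" using unit_left[OF m] m dag_strands[of 1] by (simp add: proj_def)
 have "hom 1 (y 1) 1 (x 1) (cmp 1 (x 1) (y 1))" by (rule hom_product[OF C(3) D(3)])
 hence xy: "cmp 1 (x 1) (y 1) = 0" using minimal_orthogonal[OF D(2) C(2)] ne iso_sym by blast
 have "hom 1 (x 1) 1 (y 1) (cmp 1 (y 1) (x 1))" by (rule hom_product[OF D(3) C(3)])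
 hence yx: "cmp 1 (y 1) (x 1) = 0" using minimal_orthogonal[OF C(2) D(2)] ne by blast
 have p1: "proj 1 (wire - x 1)" by (rule proj_diff[OF sp C(3)]) (rule unit_left[OF C(4)] unit_right[OF C(4)])+
 have p2: "proj 1 (wire - x 1 - y 1)"
  by (rule proj_diff[OF p1 D(3)]) (use stack_diff_left[OF D(4) m C(4)] stack_diff_right[OF m C(4) D(4)] unit_left[OF D(4)[of 1]] unit_right[OF D(4)[of 1]] xy yx in simp_all)
 have t: "tr 1 (wire - x 1 - y 1) = 2 - tr 1 (x 1) - tr 1 (y 1)" using tr_diff[OF proj_mor(4)[OF p1] D(7)] tr_diff[OF strands_in C(7)] X by simp
 note A = chain_concave[OF x X] note B = chain_concave[OF y X]
 obtain e where "0 <= e" "tr 1 (wire - x 1 - y 1) = complex_of_real e" using proj_trace_nonneg(1)[OF p2] by blast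
 hence "2 - tr 1 (x 1) - tr 1 (y 1) = complex_of_real e" "0 <= e" using t by simp_all
 hence le: "Re (tr 1 (x 1)) + Re (tr 1 (y 1)) <= 2" by (simp add: complex_eq_iff)
 have z: "Re (tr 0 (x 0)) = 1" "Re (tr 0 (y 0)) = 1" using C(1) D(1) tr_empty by simp_all
 have "Re (tr n (x n)) = 1" for n by (rule concave_two_sided[of "%n. Re (tr n (x n))" "%n. Re (tr n (y n))"]) (use A B z le in auto)
 thus 1: "tr n (x n) = 1" for n using A(2) by (simp add: complex_eq_iff)
 have "Re (tr n (y n)) = 1" for n by (rule concave_two_sided[of "%n. Re (tr n (y n))" "%n. Re (tr n (x n))"]) (use A B z le in auto)
 thus 2: "tr n (y n) = 1" for n using B(2) by (simp add: complex_eq_iff)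
 have "wire - x 1 - y 1 = 0" by (rule proj_trace_nonneg(2)[OF p2]) (simp only: t 1 2, simp)
 thus "wire = x 1 + y 1" by (simp add: algebra_simps)
qed

lemma closed_trace: "x \<in> \<B> k ==> tr k x = 1 ==> rtr k x = str 0" using tr_eq[of x k] by simp

theorem classification: assumes path: "bi_infinite_path (pg_vertices \<P>) (pg_edges \<P>) v" and v0: "(0, str 0) \<in> v 0" and X: "tr 1 wire = 2"
 shows "(\<exists>P \<in> \<B> 1. arrow_relations \<P> P &
      bi_infinite_path (pg_vertices \<P>) (pg_edges \<P>) (two_sided_vertices \<P> (tensor_power \<P> P) (tensor_power \<P> (rot P)))) |
     (\<exists>P \<in> \<B> 1. \<exists>Q \<in> \<B> 1. color_relations \<P> P Q &
      bi_infinite_path (pg_vertices \<P>) (pg_edges \<P>) (two_sided_vertices \<P> (alternating_tensor \<P> P Q) (alternating_tensor \<P> Q P)))"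
proof -
 note V = path_vertex[OF path]
 obtain x where x: "chain x" "!!n. (n, x n) \<in> v (int n)" using chain_from_path[OF path v0, of 1] by auto
 obtain y where y: "chain y" "!!n. (n, y n) \<in> v (- int n)" using chain_from_path[OF path v0, of "- 1"] by auto
 note C = chainD[OF x(1)] note D = chainD[OF y(1)]
 define P Q where "P = x 1" and "Q = y 1"
 have x1: "x (Suc 0) = P" and y1: "y (Suc 0) = Q" by (simp_all add: P_def Q_def)
 have ne: "\<nexists>u. iso 1 (x 1) 1 (y 1) u"
 proof
  assume "EX u. iso 1 (x 1) 1 (y 1) u"
  hence "(1, y 1) \<in> v 1" using vertex_member[OF V(1), of 1 "x 1" 1 1 "y 1"] x(2)[of 1] by auto
  hence "v 1 = v (- 1)" using vertex_class[OF V(1)] y(2)[of 1] by (metis of_nat_1)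
  thus False unfolding V(2) by simp
 qed
 hence ne': "\<nexists>u. iso 1 Q 1 P u" unfolding P_def Q_def using iso_sym by blast
 have ne: "\<nexists>u. iso 1 P 1 Q u" using ne by (simp add: P_def Q_def)
 note T = two_chains[OF x(1) y(1) ne[unfolded P_def Q_def] X]
 have XPQ: "wire = P + Q" "wire = Q + P" using T(3) by (simp_all add: P_def Q_def add.commute)
 have mP: "minimal 1 P" "P \<in> \<B> 1" "proj 1 P" "tr 1 P = 1" unfolding P_def using C(2,3,7)[of 1] T(1)[of 1] by simp_all
 have mQ: "minimal 1 Q" "Q \<in> \<B> 1" "proj 1 Q" "tr 1 Q = 1" unfolding Q_def using D(2,3,7)[of 1] T(2)[of 1] by simp_all
 note RP = rotation_cases[OF mP(1) mQ(1) ne XPQ(1)] note RQ = rotation_cases[OF mQ(1) mP(1) ne' XPQ(2)]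
 have rsum: "rot P + rot Q = P + Q" using rotation_linear[OF mP(2) mQ(2)] rotation_strand XPQ(1) by metis
 have trs: "rtr 1 P = str 0" "rtr 1 Q = str 0" using closed_trace mP(2,4) mQ(2,4) by blast+
 have two: "two_sided_vertices \<P> a b = v" if ab: "!!n. a n = x n" "!!n. b n = y n" for a b
 proof
  fix i :: int
  show "two_sided_vertices \<P> a b i = v i"
  proof (cases "0 <= i")
   case True
   hence "(nat i, x (nat i)) \<in> v i" using x(2)[of "nat i"] by simp
   thus ?thesis using vertex_class[OF V(1)] True by (simp add: two_sided_vertices_def ab)
  next
   case False
   hence "(nat (- i), y (nat (- i))) \<in> v i" using y(2)[of "nat (- i)"] by simp
   thus ?thesis using vertex_class[OF V(1)] False by (simp add: two_sided_vertices_def ab)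
  qed
 qed
 from RP(1) show ?thesis
 proof
  assume r: "rot P = Q"
  hence r': "rot Q = P" using rsum by (simp add: add.commute)
  have wx: "x (n + 1) = ten n 1 (x n) P" for n by (rule chain_word[OF x(1) X T(1), of "%_. P"]) (use mP mQ RP RQ XPQ r in "simp_all add: x1")
  have wy: "y (n + 1) = ten n 1 (y n) Q" for n by (rule chain_word[OF y(1) X T(2), of "%_. Q"]) (use mP mQ RP RQ XPQ r' in "simp_all add: y1")
  have "tensor_power \<P> P n = x n" for n by (induction n) (use wx C(1) in simp_all)
  moreover have "tensor_power \<P> Q n = y n" for n by (induction n) (use wy D(1) in simp_all)
  ultimately have ts: "two_sided_vertices \<P> (tensor_power \<P> P) (tensor_power \<P> (rot P)) = v" unfolding r by (intro two)
  have "saddle \<P> P P = ten 1 1 P Q" using saddle_eq[OF mP(2,2)] chain_letter(1)[OF x(1) X T(1) mP(2) wx[of 0], of P] r RP mQ mP XPQ r'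
   by (simp add: x1 numeral_2_eq_2)
  moreover have "saddle \<P> Q Q = ten 1 1 Q P" using saddle_eq[OF mQ(2,2)] chain_letter(1)[OF y(1) X T(2) mQ(2) wy[of 0], of Q] r' RQ mP mQ XPQ r
   by (simp add: y1 numeral_2_eq_2)
  ultimately have "arrow_relations \<P> P" using trs XPQ(1) RP(3,4) by (simp only: arrow_relations_def Let_def r mult_def)
  thus ?thesis using path mP(2) by (intro disjI1 bexI[of _ P] conjI) (simp_all only: ts)
 next
  assume r: "rot P = P"
  hence r': "rot Q = Q" using rsum by simp
  define R where "R = (%n::nat. if even n then P else Q)"
  define S where "S = (%n::nat. if even n then Q else P)"
  have wx: "x (n + 1) = ten n 1 (x n) (R n)" for n by (rule chain_word[OF x(1) X T(1), of R]) (use mP mQ RP RQ XPQ r r' in "auto simp: x1 R_def")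
  have wy: "y (n + 1) = ten n 1 (y n) (S n)" for n by (rule chain_word[OF y(1) X T(2), of S]) (use mP mQ RP RQ XPQ r r' in "auto simp: y1 S_def")
  have "alternating_tensor \<P> P Q n = x n" for n
   by (induction n) (use wx C(1) alternating_tensor_append[OF mP(2) mQ(2)] in "simp_all add: R_def del: alternating_tensor.simps(2)")
  moreover have "alternating_tensor \<P> Q P n = y n" for n
   by (induction n) (use wy D(1) alternating_tensor_append[OF mQ(2) mP(2)] in "simp_all add: S_def del: alternating_tensor.simps(2)")
  ultimately have ts: "two_sided_vertices \<P> (alternating_tensor \<P> P Q) (alternating_tensor \<P> Q P) = v" by (intro two)
  have "saddle \<P> P P = ten 1 1 P P" using saddle_eq[OF mP(2,2)] chain_letter(1)[OF x(1) X T(1) mP(2), of 0 Q] wx[of 0] r RP mQ mP XPQ r'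
   by (simp add: x1 R_def numeral_2_eq_2)
  moreover have "saddle \<P> Q Q = ten 1 1 Q Q" using saddle_eq[OF mQ(2,2)] chain_letter(1)[OF y(1) X T(2) mQ(2), of 0 P] wy[of 0] r' RQ mP mQ XPQ r
   by (simp add: y1 S_def numeral_2_eq_2)
  ultimately have "color_relations \<P> P Q" using trs XPQ(1) RP(3,4) r r' by (simp only: color_relations_def mult_def)
  thus ?thesis using path mP(2) mQ(2) by (intro disjI2 bexI[of _ P] bexI[of _ Q] conjI) (simp_all only: ts)
 qed
qed

end

theorem mainTheorem19:
  fixes \<P> :: "'a::ab_group_add planar_algebra"
  assumes "unshaded_subfactor_planar_algebra \<P>"
    and "has_index \<P> 4"
    and "principal_graph_A_tilde_infinity \<P>"
  shows "(\<exists>P \<in> box_space \<P> 1.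
            arrow_relations \<P> P \<and>
            bi_infinite_path (pg_vertices \<P>) (pg_edges \<P>)
              (two_sided_vertices \<P> (tensor_power \<P> P) (tensor_power \<P> (rotation \<P> 1 P)))) \<or>
         (\<exists>P \<in> box_space \<P> 1. \<exists>Q \<in> box_space \<P> 1.
            color_relations \<P> P Q \<and>
            bi_infinite_path (pg_vertices \<P>) (pg_edges \<P>)
              (two_sided_vertices \<P> (alternating_tensor \<P> P Q) (alternating_tensor \<P> Q P)))"
proof -
  have "unshaded_planar_algebra \<P>" using assms(1) unfolding unshaded_subfactor_planar_algebra_def by (elim conjE)
  then interpret subfactor_alg \<P> by (intro subfactor_alg.intro planar_alg.intro subfactor_alg_axioms.intro assms(1))
  obtain \<delta> :: real where d: "\<delta> > 0" "closed_loop \<P> = scale \<P> (complex_of_real \<delta>) (strands \<P> 0)" "4 = \<delta>\<^sup>2"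
    using assms(2) unfolding has_index_def by blast
  have "\<delta>\<^sup>2 = 2\<^sup>2" using d(3) by simp
  then have "\<delta> = 2" by (rule power2_eq_imp_eq) (use d(1) in auto)
  then have X: "tr 1 (strands \<P> 1) = 2" using d(2) trace_strand by (intro tr_unique) simp
  obtain v where v: "bi_infinite_path (pg_vertices \<P>) (pg_edges \<P>) v"
    using assms(3) unfolding principal_graph_A_tilde_infinity_def by blast
  then have "range v = pg_vertices \<P>" by (simp add: bi_infinite_path_def bij_betw_def)
  then obtain c where c: "v c = iso_class \<P> (0, strands \<P> 0)" using class_vertex(1)[OF minimal_empty] by (metis rangeE)
  define w where "w = (\<lambda>i. v (i + c))"
  have "bij_betw (\<lambda>i. i + c) UNIV (UNIV :: int set)" by (rule bij_betw_byWitness[where f' = "\<lambda>i. i - c"]) auto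
  then have "bij_betw w UNIV (pg_vertices \<P>)" unfolding w_def
    using bij_betw_trans[of "\<lambda>i. i + c" UNIV UNIV v] v by (simp add: bi_infinite_path_def o_def)
  then have w: "bi_infinite_path (pg_vertices \<P>) (pg_edges \<P>) w"
    using v unfolding bi_infinite_path_def w_def by simp
  have "(0, strands \<P> 0) \<in> w 0" using class_vertex(2)[OF minimal_empty] c by (simp add: w_def)
  then show ?thesis by (rule classification[OF w _ X])
qed

end
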